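(* For any mergeable MSD problem whose feasibility can be validated separately on each cluster, with validation time $f(n)$, a $(1+\epsilon)$-approximate solution on an $n$-point metric space of doubling dimension $d$ with $k$ clusters can be computed in time $\left(\frac{1}{\epsilon}\right)^{O(kd)}f(n)+2^{O(d)}n\log n+O(k)f(n)$. In particular, Fair MSD (e.g. MSD where every cluster must be $b$-balanced) can be $(1+\epsilon)$-approximated in time $\left(\frac{1}{\epsilon}\right)^{O(kd)}n+2^{O(d)}n\log n+O(kn)$.
   Context: MSD: partition a finite metric space $(X,d)$ into at most $k$ disjoint clusters minimizing $\sum_i\operatorname{diam}(C_i)$, $\operatorname{diam}(C)=\max_{x,y\in C}d(x,y)$. A constrained clustering problem is mergeable if for every feasible solution, merging any two clusters yields a feasible solution; feasibility of a solution can be checked in time $f(n)$, and (standing assumption for this approximation result) the validation is applied to each cluster separately. A $(1+\epsilon)$-approximate solution is feasible with cost at most $(1+\epsilon)$ times the optimum feasible cost. Balanced example: given colors $X_1,X_2$ partitioning $X$ and $b\in[0,1]$, a cluster $C$ is $b$-balanced if $\min\{|C\cap X_2|/|C\cap X_1|,|C\cap X_1|/|C\cap X_2|\}\ge b$; this is mergeable and checkable in $O(n)$ time. The doubling dimension of $X$ is the smallest $m>0$ such that every ball of radius $r$ can be covered by at most $2^m$ balls of radius $r/2$. *)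

theory Defs
  imports "HOL-Analysis.Analysis" "HOL-Library.Disjoint_Sets"
begin

section \<open>Instances, clusterings and their cost\<close>

text \<open>
  The points of an \<open>n\<close>-point space are numbered \<open>0, \<dots>, n - 1\<close>, which is how an algorithm refers
  to them.  \<open>idata\<close> and \<open>rdata\<close> carry the problem-specific part of the input (colours, balance
  parameters, ...).
\<close>

record inst =
  npts :: nat
  dst :: "nat \<Rightarrow> nat \<Rightarrow> real"
  nclus :: nat
  idata :: "nat \<Rightarrow> int"
  rdata :: "nat \<Rightarrow> real"

definition points :: "inst \<Rightarrow> nat set" where
  "points I = {..<npts I}"

definition wf_inst :: "inst \<Rightarrow> bool" where
  "wf_inst I \<longleftrightarrow> npts I \<ge> 1 \<and> nclus I \<ge> 1 \<and> Metric_space (points I) (dst I)"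

definition diam :: "('a \<Rightarrow> 'a \<Rightarrow> real) \<Rightarrow> 'a set \<Rightarrow> real" where
  "diam d C = Max {d x y | x y. x \<in> C \<and> y \<in> C}"

definition clustering :: "inst \<Rightarrow> nat set set \<Rightarrow> bool" where
  "clustering I P \<longleftrightarrow> partition_on (points I) P \<and> card P \<le> nclus I"

definition cost :: "inst \<Rightarrow> nat set set \<Rightarrow> real" where
  "cost I P = (\<Sum>C\<in>P. diam (dst I) C)"

text \<open>
  An infimum rather than a minimum only matters for one-point spaces, where every \<open>m > 0\<close>
  qualifies; their dimension is \<open>0\<close> here.
\<close>

definition doubling_dim :: "'a set \<Rightarrow> ('a \<Rightarrow> 'a \<Rightarrow> real) \<Rightarrow> real" where
  "doubling_dim M d = Inf {m. m > 0 \<and>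
     (\<forall>x\<in>M. \<forall>r>0. \<exists>S. S \<subseteq> M \<and> finite S \<and> real (card S) \<le> 2 powr m \<and>
        Metric_space.mcball M d x r \<subseteq> (\<Union>y\<in>S. Metric_space.mcball M d y (r / 2)))}"

section \<open>Constrained problems\<close>

text \<open>
  A constrained problem is a set \<open>\<I>\<close> of admissible instances together with a constraint
  \<open>F I P\<close> on the clusterings \<open>P\<close> of an instance \<open>I\<close>.
\<close>

definition feasible :: "(inst \<Rightarrow> nat set set \<Rightarrow> bool) \<Rightarrow> inst \<Rightarrow> nat set set \<Rightarrow> bool" where
  "feasible F I P \<longleftrightarrow> clustering I P \<and> F I P"

definition mergeable :: "inst set \<Rightarrow> (inst \<Rightarrow> nat set set \<Rightarrow> bool) \<Rightarrow> bool" where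
  "mergeable \<I> F \<longleftrightarrow> (\<forall>I\<in>\<I>. \<forall>P. feasible F I P \<longrightarrow>
     (\<forall>C\<in>P. \<forall>D\<in>P. C \<noteq> D \<longrightarrow> feasible F I (insert (C \<union> D) (P - {C, D}))))"

definition clusterwise ::
    "inst set \<Rightarrow> (inst \<Rightarrow> nat set set \<Rightarrow> bool) \<Rightarrow> (inst \<Rightarrow> nat set \<Rightarrow> bool) \<Rightarrow> bool" where
  "clusterwise \<I> F ok \<longleftrightarrow> (\<forall>I\<in>\<I>. \<forall>P. clustering I P \<longrightarrow> (F I P \<longleftrightarrow> (\<forall>C\<in>P. ok I C)))"

definition approx_solution ::
    "(inst \<Rightarrow> nat set set \<Rightarrow> bool) \<Rightarrow> inst \<Rightarrow> real \<Rightarrow> nat set set \<Rightarrow> bool" where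
  "approx_solution F I \<epsilon> P \<longleftrightarrow>
     feasible F I P \<and> (\<forall>Q. feasible F I Q \<longrightarrow> cost I P \<le> (1 + \<epsilon>) * cost I Q)"

section \<open>The machine model: a real RAM\<close>

text \<open>
  Programs are structured commands over two kinds of memory cells, integers and reals, organised
  as arrays indexed by integers; a scalar variable is the cell 0 of an array.  The input is
  read-only.  Every evaluated operator and every executed statement costs one step.  As usual for
  real RAMs, there is no rounding of reals to integers, no real constants other than integers,
  and integers (used as indices and counters) are only added, subtracted and compared, so that
  unit cost is reasonable.
\<close>

datatype iexp =
    IConst int
  | IGet nat iexp              \<comment> \<open>cell of an integer array\<close>
  | IData iexp                 \<comment> \<open>input\<close>
  | IPlus iexp iexp
  | IMinus iexp iexp

datatype rexp =
    ROfInt iexp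
  | RGet nat iexp              \<comment> \<open>cell of a real array\<close>
  | RData iexp                 \<comment> \<open>input\<close>
  | RDist iexp iexp            \<comment> \<open>input\<close>
  | RPlus rexp rexp
  | RMinus rexp rexp
  | RTimes rexp rexp
  | RDivide rexp rexp

datatype bexp =
    ILess iexp iexp
  | RLess rexp rexp
  | BNot bexp
  | BAnd bexp bexp

datatype com =
    Skip
  | ISet nat iexp iexp         \<comment> \<open>array, index, value\<close>
  | RSet nat iexp rexp         \<comment> \<open>array, index, value\<close>
  | Seq com com
  | Cond bexp com com
  | Loop bexp com
  | Call nat nat               \<comment> \<open>\<open>Call x a\<close>: validate the cluster held in array \<open>a\<close>, answer in \<open>x\<close>\<close>

record state =
  ints :: "nat \<Rightarrow> int \<Rightarrow> int"
  reals :: "nat \<Rightarrow> int \<Rightarrow> real"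

primrec ival :: "inst \<Rightarrow> state \<Rightarrow> iexp \<Rightarrow> int" where
  "ival I s (IConst c) = c"
| "ival I s (IGet a e) = ints s a (ival I s e)"
| "ival I s (IData e) = idata I (nat (ival I s e))"
| "ival I s (IPlus e1 e2) = ival I s e1 + ival I s e2"
| "ival I s (IMinus e1 e2) = ival I s e1 - ival I s e2"

primrec rval :: "inst \<Rightarrow> state \<Rightarrow> rexp \<Rightarrow> real" where
  "rval I s (ROfInt e) = of_int (ival I s e)"
| "rval I s (RGet a e) = reals s a (ival I s e)"
| "rval I s (RData e) = rdata I (nat (ival I s e))"
| "rval I s (RDist e1 e2) = dst I (nat (ival I s e1)) (nat (ival I s e2))"
| "rval I s (RPlus e1 e2) = rval I s e1 + rval I s e2"
| "rval I s (RMinus e1 e2) = rval I s e1 - rval I s e2"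
| "rval I s (RTimes e1 e2) = rval I s e1 * rval I s e2"
| "rval I s (RDivide e1 e2) = rval I s e1 / rval I s e2"

primrec bval :: "inst \<Rightarrow> state \<Rightarrow> bexp \<Rightarrow> bool" where
  "bval I s (ILess e1 e2) \<longleftrightarrow> ival I s e1 < ival I s e2"
| "bval I s (RLess e1 e2) \<longleftrightarrow> rval I s e1 < rval I s e2"
| "bval I s (BNot b) \<longleftrightarrow> \<not> bval I s b"
| "bval I s (BAnd b1 b2) \<longleftrightarrow> bval I s b1 \<and> bval I s b2"

primrec icost :: "iexp \<Rightarrow> nat" where
  "icost (IConst c) = 1"
| "icost (IGet a e) = 1 + icost e"
| "icost (IData e) = 1 + icost e"
| "icost (IPlus e1 e2) = 1 + icost e1 + icost e2"
| "icost (IMinus e1 e2) = 1 + icost e1 + icost e2"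

primrec rcost :: "rexp \<Rightarrow> nat" where
  "rcost (ROfInt e) = 1 + icost e"
| "rcost (RGet a e) = 1 + icost e"
| "rcost (RData e) = 1 + icost e"
| "rcost (RDist e1 e2) = 1 + icost e1 + icost e2"
| "rcost (RPlus e1 e2) = 1 + rcost e1 + rcost e2"
| "rcost (RMinus e1 e2) = 1 + rcost e1 + rcost e2"
| "rcost (RTimes e1 e2) = 1 + rcost e1 + rcost e2"
| "rcost (RDivide e1 e2) = 1 + rcost e1 + rcost e2"

primrec bcost :: "bexp \<Rightarrow> nat" where
  "bcost (ILess e1 e2) = 1 + icost e1 + icost e2"
| "bcost (RLess e1 e2) = 1 + rcost e1 + rcost e2"
| "bcost (BNot b) = 1 + bcost b"
| "bcost (BAnd b1 b2) = 1 + bcost b1 + bcost b2"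

definition iupd :: "nat \<Rightarrow> int \<Rightarrow> int \<Rightarrow> state \<Rightarrow> state" where
  "iupd a i v s = s\<lparr>ints := (ints s)(a := (ints s a)(i := v))\<rparr>"

definition rupd :: "nat \<Rightarrow> int \<Rightarrow> real \<Rightarrow> state \<Rightarrow> state" where
  "rupd a i v s = s\<lparr>reals := (reals s)(a := (reals s a)(i := v))\<rparr>"

definition marked :: "inst \<Rightarrow> state \<Rightarrow> nat \<Rightarrow> nat set" where
  "marked I s a = {i \<in> points I. ints s a (int i) \<noteq> 0}"

text \<open>
  \<open>exec K I c s t s'\<close>: on input \<open>I\<close>, command \<open>c\<close> started in \<open>s\<close> stops in \<open>s'\<close> after \<open>t\<close> steps.
  \<open>K C t v\<close> says that the called procedure answers \<open>v\<close> on the cluster \<open>C\<close> after \<open>t\<close> steps.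
\<close>

inductive exec ::
    "(nat set \<Rightarrow> nat \<Rightarrow> int \<Rightarrow> bool) \<Rightarrow> inst \<Rightarrow> com \<Rightarrow> state \<Rightarrow> nat \<Rightarrow> state \<Rightarrow> bool"
  for K :: "nat set \<Rightarrow> nat \<Rightarrow> int \<Rightarrow> bool" and I :: inst where
  Skip: "exec K I Skip s 1 s"
| ISet: "exec K I (ISet a e1 e2) s (1 + icost e1 + icost e2)
          (iupd a (ival I s e1) (ival I s e2) s)"
| RSet: "exec K I (RSet a e1 e2) s (1 + icost e1 + rcost e2)
          (rupd a (ival I s e1) (rval I s e2) s)"
| Seq: "exec K I c1 s t1 s1 \<Longrightarrow> exec K I c2 s1 t2 s2 \<Longrightarrow> exec K I (Seq c1 c2) s (t1 + t2) s2"
| CondT: "bval I s b \<Longrightarrow> exec K I c1 s t s1 \<Longrightarrow> exec K I (Cond b c1 c2) s (1 + bcost b + t) s1"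
| CondF: "\<not> bval I s b \<Longrightarrow> exec K I c2 s t s1 \<Longrightarrow> exec K I (Cond b c1 c2) s (1 + bcost b + t) s1"
| LoopF: "\<not> bval I s b \<Longrightarrow> exec K I (Loop b c) s (1 + bcost b) s"
| LoopT: "bval I s b \<Longrightarrow> exec K I c s t1 s1 \<Longrightarrow> exec K I (Loop b c) s1 t2 s2 \<Longrightarrow>
          exec K I (Loop b c) s (1 + bcost b + t1 + t2) s2"
| Call: "K (marked I s a) t v \<Longrightarrow> exec K I (Call x a) s (1 + t) (iupd x 0 v s)"

lemma exec_deterministic:
  assumes "exec K I c s t s'" "exec K I c s u s''"
    and "\<And>C t v t' v'. K C t v \<Longrightarrow> K C t' v' \<Longrightarrow> t = t' \<and> v = v'"
  shows "t = u \<and> s' = s''"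
  using assms(1,2)
proof (induction arbitrary: u s'' rule: exec.induct)
  case (Seq c1 s t1 s1 c2 t2 s2)
  from Seq.prems show ?case by (cases rule: exec.cases) (use Seq.IH in blast)+
next
  case (LoopT s b c t1 s1 t2 s2)
  from LoopT.prems show ?case
    by (cases rule: exec.cases) (use LoopT.IH LoopT.hyps in blast)+
next
  case (Call s a t v x)
  from Call.prems show ?case
    by (cases rule: exec.cases) (use Call.hyps assms(3) in blast)+
qed (erule exec.cases; fastforce)+

text \<open>
  A procedure is itself a program (without calls), run on a fresh memory; besides the read-only
  input it receives \<open>n\<close> and \<open>k\<close> in integer array 0 and the 0/1 vector of the cluster in integer
  array 1.  Passing these \<open>n\<close> entries is charged, so validating a cluster takes at least \<open>n\<close>
  steps.
\<close>

definition proc_init :: "inst \<Rightarrow> nat set \<Rightarrow> state" where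
  "proc_init I C = \<lparr>
     ints = (\<lambda>_ _. 0)(0 := (\<lambda>_. 0)(0 := int (npts I), 1 := int (nclus I)),
                      1 := (\<lambda>i. if i \<ge> 0 \<and> nat i \<in> C then 1 else 0)),
     reals = (\<lambda>_ _. 0)\<rparr>"

definition proc_answers :: "com \<Rightarrow> inst \<Rightarrow> nat set \<Rightarrow> nat \<Rightarrow> int \<Rightarrow> bool" where
  "proc_answers V I C t v \<longleftrightarrow>
     (\<exists>t' s. exec (\<lambda>_ _ _. False) I V (proc_init I C) t' s \<and> t = npts I + t' \<and> v = ints s 0 0)"

definition validates ::
    "com \<Rightarrow> inst set \<Rightarrow> (inst \<Rightarrow> nat set \<Rightarrow> bool) \<Rightarrow> (nat \<Rightarrow> nat) \<Rightarrow> bool" where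
  "validates V \<I> ok f \<longleftrightarrow> (\<forall>I\<in>\<I>. \<forall>C. C \<noteq> {} \<and> C \<subseteq> points I \<longrightarrow>
     (\<exists>t v. proc_answers V I C t v \<and> t \<le> f (npts I) \<and> (v \<noteq> 0 \<longleftrightarrow> ok I C)))"

text \<open>
  The main program receives \<open>n\<close>, \<open>k\<close> in integer array 0 and \<open>\<epsilon>\<close> in real array 0, and leaves in
  integer array 1 a label for each point; the clusters are the classes of equally labelled points.
\<close>

definition main_init :: "inst \<Rightarrow> real \<Rightarrow> state" where
  "main_init I \<epsilon> = \<lparr>
     ints = (\<lambda>_ _. 0)(0 := (\<lambda>_. 0)(0 := int (npts I), 1 := int (nclus I))),
     reals = (\<lambda>_ _. 0)(0 := (\<lambda>_. 0)(0 := \<epsilon>))\<rparr>"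

definition output_clustering :: "inst \<Rightarrow> state \<Rightarrow> nat set set" where
  "output_clustering I s =
     (\<lambda>i. {j \<in> points I. ints s 1 (int j) = ints s 1 (int i)}) ` points I"

text \<open>
  The time bound is required of every instance; an approximate solution exists, and is required,
  only if the instance has a feasible solution.
\<close>

definition approximates_within ::
    "com \<Rightarrow> com \<Rightarrow> (inst \<Rightarrow> nat set set \<Rightarrow> bool) \<Rightarrow> inst \<Rightarrow> real \<Rightarrow> real \<Rightarrow> bool" where
  "approximates_within A V F I \<epsilon> T \<longleftrightarrow>
     (\<exists>t s. exec (proc_answers V I) I A (main_init I \<epsilon>) t s \<and> real t \<le> T \<and>
        ((\<exists>Q. feasible F I Q) \<longrightarrow> approx_solution F I \<epsilon> (output_clustering I s)))"

definition time_bound :: "real \<Rightarrow> real \<Rightarrow> inst \<Rightarrow> real \<Rightarrow> real" where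
  "time_bound c \<epsilon> I v =
     (let n = real (npts I); k = real (nclus I); d = doubling_dim (points I) (dst I)
      in (1 / \<epsilon>) powr (c * k * d) * v + 2 powr (c * d) * n * log 2 n + c * k * v)"

section \<open>Fair MSD\<close>

text \<open>
  \<open>idata\<close> is the colouring with colours 1 and 2, and \<open>rdata 0\<close> is \<open>b\<close>.  If \<open>C\<close> misses a colour,
  then one of the two ratios is 0 (and the other one infinite), so \<open>C\<close> is balanced only for
  \<open>b = 0\<close>; \<open>x / 0 = 0\<close> gives the same.
\<close>

definition colour_class :: "inst \<Rightarrow> int \<Rightarrow> nat set" where
  "colour_class I c = {i \<in> points I. idata I i = c}"

definition balanced :: "inst \<Rightarrow> nat set \<Rightarrow> bool" where
  "balanced I C \<longleftrightarrow>
     (let c1 = real (card (C \<inter> colour_class I 1)); c2 = real (card (C \<inter> colour_class I 2))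
      in min (c2 / c1) (c1 / c2) \<ge> rdata I 0)"

definition fair_insts :: "inst set" where
  "fair_insts = {I. wf_inst I \<and> (\<forall>i\<in>points I. idata I i \<in> {1, 2}) \<and> 0 \<le> rdata I 0 \<and> rdata I 0 \<le> 1}"

definition fair :: "inst \<Rightarrow> nat set set \<Rightarrow> bool" where
  "fair I P \<longleftrightarrow> (\<forall>C\<in>P. balanced I C)"

end

theory Submission
 imports Defs
begin

section \<open>Structured real-RAM programs: total correctness, and running time read off the
  syntax\<close>

section \<open>A structured fragment of the machine language\<close>

text \<open>The problem is solved by exhaustive guessing. Let \<open>th = 2^q\<close> be about
  \<open>1000/\<epsilon>\<close> and let \<open>g\<close> be about twice the doubling dimension
  \<open>d\<close>. A fixed deterministic decoder turns every bit string of length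
  \<open>B = 100*k*g*q\<close> into a labelling of the points. The program decodes all
  \<open>2^B\<close> strings, validates every class, estimates its diameter, and keeps the cheapest
  valid labelling. A round takes \<open>2^O(B)\<close> times \<open>n + f n\<close> steps, and
  \<open>2^B\<close> is \<open>(1/\<epsilon>)^O(k*d)\<close>. It remains to see that some string
  leads to a good labelling.

  The target. For a feasible \<open>Q\<close>, let \<open>cost Q <= E <= 5*cost Q\<close>; such an
  \<open>E\<close> is found among few candidates built from greedy centres
  (\<open>scale_exists\<close>). Put \<open>dl = E/(k*th)\<close> and let \<open>P\<close> minimise
  the sum of \<open>diam C + 6*dl\<close> over all feasible clusterings. By mergeability every
  coarsening of \<open>P\<close> is feasible (\<open>merge_feasible\<close>), so minimality says
  that uniting a family \<open>A\<close> never pays. After rounding diameters up to multiples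
  \<open>DD C\<close> of \<open>dl\<close> this still yields that \<open>sum DD A\<close> is at most
  the diameter of the union of \<open>A\<close>, and that two clusters always contain points at
  distance at least \<open>DD C + DD C' + 4*dl\<close> (\<open>target_guide\<close>). Consequently
  only a constant number of clusters of size at least \<open>R\<close> meet a ball of radius
  \<open>O(R)\<close>, whatever the dimension (\<open>card_meeting\<close>). This keeps the advice
  short.

  Decoding. \<open>P\<close> itself need not be recovered: a coarsening of nearly the same cost is
  just as good. Clusters are discovered one after the other; the least uncovered point serves as a
  centre, and the rounded diameter is read from the advice. Any other point is named by a walk from
  a known centre through finer and finer greedy nets, \<open>g\<close> bits per halving. For a
  discovered cluster the advice names the nearby clusters that are not smaller by a factor
  \<open>th\<close>, a marker for each much smaller cluster that hides beside it
  (\<open>par\<close>), and witnesses that tell it apart from larger clusters. Every point then goes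
  to the smallest discovered cluster still allowed to contain it. Discovered clusters get exactly
  their own points and possibly some points of undiscovered ones (\<open>own\<close>,
  \<open>piece\<close>). Each undiscovered cluster lies in the ball of a marker
  (\<open>undiscovered\<close>), so linking whatever shares a marker puts every target cluster into
  one component (\<open>cluster_label\<close>). Foreign points are within \<open>O(DD/th)\<close> of
  the cluster that received them, and chains of markers grow geometrically
  (\<open>hub_near\<close>). So the diameter of a component is at most \<open>1 + 114/th\<close>
  times the sum of \<open>DD\<close> over its clusters (\<open>component_diam\<close>,
  \<open>labelling_good\<close>). The theorem \<open>advice\<close> counts the bits.

  The unknown dimension. The parameter \<open>g\<close> runs through 1, 2, ... . Whenever a greedy
  net is not exhausted by the number of centres that \<open>g\<close> allows, a flag is raised and
  the round is discarded. A round without a flag is correct whatever \<open>g\<close> is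
  (\<open>finished_approx\<close>), and from \<open>g >= 2*d\<close> on no flag is raised
  (\<open>no_overflow\<close>). The losses \<open>1 + 1/th\<close> (diameter estimates),
  \<open>1 + 114/th\<close> (components) and \<open>1 + 30/th\<close> (penalty and rounding)
  multiply to at most \<open>1 + \<epsilon>\<close> (\<open>precision_bound\<close>).

  Running time. Programs are counting loops whose bounds are never written in their bodies, and
  loops over the points are not nested, which gives a bound linear in \<open>n + f n\<close> with a
  factor polynomial in \<open>2^B\<close> (\<open>exec_time\<close>, \<open>cost_linear\<close>,
  \<open>MAIN_within\<close>). Balanced clusters are an instance, with a linear-time validator
  (\<open>fair_mergeable\<close>, \<open>CHECK_validates\<close>).\<close>

datatype prog =
  PSkip
 | PISet nat iexp iexp
 | PRSet nat iexp rexp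
 | PCall nat nat
 | Sq prog prog (infixr ";;" 60)
 | If bexp prog prog
 | For nat nat int prog

abbreviation (input) iff_ascii :: "bool => bool => bool" (infixr "<->" 25) where "A <-> B == A = B"
abbreviation "I0 == IConst 0"
abbreviation "I1 == IConst 1"

text \<open>The only loop is a counting loop against a memory cell. If its body writes neither that
  cell nor the counter, the number of iterations is known on entry, and both correctness and time
  follow by induction on it.\<close>

primrec compile :: "prog => com" where
 "compile PSkip = Skip"
| "compile (PISet a e1 e2) = ISet a e1 e2"
| "compile (PRSet a e1 e2) = RSet a e1 e2"
| "compile (PCall x a) = Call x a"
| "compile (p ;; r) = Seq (compile p) (compile r)"
| "compile (If b p r) = Cond b (compile p) (compile r)"
| "compile (For v a i p) = Seq (ISet v I0 I0)
   (Loop (ILess (IGet v I0) (IGet a (IConst i)))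
    (Seq (compile p) (ISet v I0 (IPlus (IGet v I0) I1))))"

primrec iw :: "com => nat set" where
 "iw Skip = {}"
| "iw (ISet a e1 e2) = {a}"
| "iw (RSet a e1 e2) = {}"
| "iw (Seq c1 c2) = iw c1 \<union> iw c2"
| "iw (Cond b c1 c2) = iw c1 \<union> iw c2"
| "iw (Loop b c) = iw c"
| "iw (Call x a) = {x}"

primrec rw :: "com => nat set" where
 "rw Skip = {}"
| "rw (ISet a e1 e2) = {}"
| "rw (RSet a e1 e2) = {a}"
| "rw (Seq c1 c2) = rw c1 \<union> rw c2"
| "rw (Cond b c1 c2) = rw c1 \<union> rw c2"
| "rw (Loop b c) = rw c"
| "rw (Call x a) = {}"

lemma exec_frame:
 assumes "exec K I c s t s'"
 shows "a ~: iw c ==> ints s' a = ints s a" and "a ~: rw c ==> reals s' a = reals s a" using assms by (induction rule: exec.induct) (auto simp: iupd_def rupd_def)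

text \<open>Lets a run be analysed with a smaller call relation that has convenient properties; the
  run is transferred to the real one afterwards.\<close>

lemma exec_mono:
 assumes "exec K I c s t s'" and "!!C t v. K C t v ==> K' C t v"
 shows "exec K' I c s t s'" using assms(1) by (induction rule: exec.induct) (blast intro: exec.intros assms(2))+

primrec piw :: "prog => nat set" where
 "piw PSkip = {}"
| "piw (PISet a e1 e2) = {a}"
| "piw (PRSet a e1 e2) = {}"
| "piw (PCall x a) = {x}"
| "piw (p ;; r) = piw p \<union> piw r"
| "piw (If b p r) = piw p \<union> piw r"
| "piw (For v a i p) = insert v (piw p)"

primrec prw :: "prog => nat set" where
 "prw PSkip = {}"
| "prw (PISet a e1 e2) = {}"
| "prw (PRSet a e1 e2) = {a}"
| "prw (PCall x a) = {}"
| "prw (p ;; r) = prw p \<union> prw r"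
| "prw (If b p r) = prw p \<union> prw r"
| "prw (For v a i p) = prw p"

lemma iw_compile: "iw (compile p) = piw p" and rw_compile: "rw (compile p) = prw p" by (induction p) auto

text \<open>What a run cannot have changed according to the syntax. Most invariants survive a
  subprogram for this reason alone.\<close>

definition frame :: "prog => state => state => bool" where
 "frame p s s' <-> (ALL a. a ~: piw p --> ints s' a = ints s a) & (ALL a. a ~: prw p --> reals s' a = reals s a)"

lemma frameD: "frame p s s' ==> a ~: piw p ==> ints s' a = ints s a"
 "frame p s s' ==> a ~: prw p ==> reals s' a = reals s a" by (auto simp: frame_def)

lemma ints_iupd [simp]: "ints (iupd a i v s) b j = (if b = a & j = i then v else ints s b j)" by (simp add: iupd_def)
lemma iupd_other: "b ~= a ==> ints (iupd a i v s) b = ints s b" by (simp add: iupd_def)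
lemma reals_iupd [simp]: "reals (iupd a i v s) = reals s" by (simp add: iupd_def)
lemma reals_rupd [simp]: "reals (rupd a i v s) b j = (if b = a & j = i then v else reals s b j)" by (simp add: rupd_def)
lemma ints_rupd [simp]: "ints (rupd a i v s) = ints s" by (simp add: rupd_def)

subsection \<open>Total correctness\<close>

text \<open>Total correctness with the number of steps left open. Time is bounded independently by
  \<open>exec_time\<close>, so invariants carry no step counts.\<close>

definition wp :: "(nat set => nat => int => bool) => inst => prog => state => (state => bool) => bool" where
 "wp K I p s Q <-> (EX t s'. exec K I (compile p) s t s' & Q s')"

inductive_cases exec_SkipE: "exec K I Skip s t s'"
inductive_cases exec_ISetE: "exec K I (ISet a e1 e2) s t s'"
inductive_cases exec_RSetE: "exec K I (RSet a e1 e2) s t s'"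
inductive_cases exec_SeqE: "exec K I (Seq c1 c2) s t s'"
inductive_cases exec_CondE: "exec K I (Cond b c1 c2) s t s'"
inductive_cases exec_CallE: "exec K I (Call x a) s t s'"
inductive_cases exec_LoopE: "exec K I (Loop b c) s t s'"

lemma wp_PSkip [simp]: "wp K I PSkip s Q <-> Q s" by (auto simp: wp_def intro: exec.intros elim: exec_SkipE)
lemma wp_PISet [simp]: "wp K I (PISet a e1 e2) s Q <-> Q (iupd a (ival I s e1) (ival I s e2) s)" by (auto simp: wp_def intro: exec.intros elim: exec_ISetE)
lemma wp_PRSet [simp]: "wp K I (PRSet a e1 e2) s Q <-> Q (rupd a (ival I s e1) (rval I s e2) s)" by (auto simp: wp_def intro: exec.intros elim: exec_RSetE)
lemma wp_PCall: "wp K I (PCall x a) s Q <-> (EX t v. K (marked I s a) t v & Q (iupd x 0 v s))" by (auto simp: wp_def elim!: exec_CallE) (blast intro: exec.intros)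
lemma wp_Sq [simp]: "wp K I (p ;; r) s Q <-> wp K I p s (%s1. wp K I r s1 Q)" by (auto simp: wp_def elim!: exec_SeqE) (blast intro: exec.intros)+
lemma wp_If [simp]: "wp K I (If b p r) s Q <-> (if bval I s b then wp K I p s Q else wp K I r s Q)" by (auto simp: wp_def elim!: exec_CondE) (blast intro: exec.intros)+

lemma wp_conseq:
 assumes "wp K I p s Q'" and "!!s'. Q' s' ==> frame p s s' ==> Q s'"
 shows "wp K I p s Q" using assms exec_frame unfolding wp_def frame_def by (metis iw_compile rw_compile)

lemma frame_refl [simp]: "frame p s s" by (simp add: frame_def)

text \<open>The premise \<open>stable\<close> is there because the counter is written between
  iterations by code outside the body \<open>p\<close>.\<close>

lemma wp_For:
 assumes N: "ints s a i = int N" and vp: "v ~: piw p" "a ~: piw p" "a ~= v"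
  and init: "Inv 0 s"
  and stable: "!!j s x. Inv j s ==> Inv j (iupd v 0 x s)"
  and body: "!!j s'. j<N ==> Inv j s' ==> ints s' v 0 = int j ==> frame (For v a i p) s s' ==>
    wp K I p s' (Inv (Suc j))"
  and final: "!!s'. Inv N s' ==> frame (For v a i p) s s' ==> Q s'"
 shows "wp K I (For v a i p) s Q"
proof -
 let ?b = "ILess (IGet v I0) (IGet a (IConst i))"
 let ?c = "Seq (compile p) (ISet v I0 (IPlus (IGet v I0) I1))"
 have loop: "EX t s''. exec K I (Loop ?b ?c) s' t s'' & Inv N s'' & frame (For v a i p) s s''"
  if "j<=N" "Inv j s'" "ints s' v 0 = int j" "frame (For v a i p) s s'" for j s' using that
 proof (induction "N - j" arbitrary: j s')
  case 0
  hence "j = N" by simp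
  moreover have "ints s' a i = int N" using frameD(1)[OF 0(5), of a] vp N by simp
  ultimately have "~ bval I s' ?b" using 0 by simp
  thus ?case using 0 \<open>j = N\<close> by (blast intro: exec.intros)
 next
  case (Suc m)
  hence j: "j<N" by simp
  have Na: "ints s' a i = int N" using frameD(1)[OF Suc(6), of a] vp N by simp
  have b: "bval I s' ?b" using Suc j Na by simp
  obtain t1 s1 where e1: "exec K I (compile p) s' t1 s1" and i1: "Inv (Suc j) s1" using body[OF j Suc(4,5,6)] unfolding wp_def by blast
  have f1: "frame p s' s1" using exec_frame[OF e1] by (simp add: frame_def iw_compile rw_compile)
  let ?s2 = "iupd v 0 (int (Suc j)) s1"
  have v1: "ints s1 v 0 = int j" using frameD(1)[OF f1 vp(1)] Suc by simp
  have "exec K I (ISet v I0 (IPlus (IGet v I0) I1)) s1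
    (1+icost I0+icost (IPlus (IGet v I0) I1))
    (iupd v (ival I s1 I0) (ival I s1 (IPlus (IGet v I0) I1)) s1)" by (rule exec.ISet)
  moreover have "iupd v (ival I s1 I0) (ival I s1 (IPlus (IGet v I0) I1)) s1 = ?s2" using v1 by (simp add: algebra_simps)
  ultimately obtain t2 where e2: "exec K I ?c s' t2 ?s2" using e1 by (metis exec.Seq)
  have fr: "frame (For v a i p) s ?s2" using Suc(6) f1 by (auto simp: frame_def iupd_def)
  have "m = N - Suc j" using Suc(2) by simp
  from Suc(1)[OF this _ stable[OF i1] _ fr] j
  obtain t s'' where "exec K I (Loop ?b ?c) ?s2 t s''" "Inv N s''" "frame (For v a i p) s s''" by auto
  thus ?case using exec.LoopT[OF b e2] by blast
 qed
 have f0: "frame (For v a i p) s (iupd v 0 0 s)" by (auto simp: frame_def iupd_def)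
 from loop[of 0 "iupd v 0 0 s", OF _ stable[OF init] _ f0] obtain t s''
  where e: "exec K I (Loop ?b ?c) (iupd v 0 0 s) t s''" and q: "Inv N s''" "frame (For v a i p) s s''" by auto
 have "exec K I (ISet v I0 I0) s (1+icost I0+icost I0) (iupd v 0 0 s)" using exec.ISet[of K I v "IConst 0" "IConst 0" s] by simp
 from exec.Seq[OF this e] final[OF q] show ?thesis unfolding wp_def by auto
qed

subsection \<open>Running time\<close>

primrec wf :: "prog => bool" where
 "wf PSkip = True"
| "wf (PISet a e1 e2) = True"
| "wf (PRSet a e1 e2) = True"
| "wf (PCall x a) = True"
| "wf (p ;; r) = (wf p & wf r)"
| "wf (If b p r) = (wf p & wf r)"
| "wf (For v a i p) = (wf p & v ~: piw p)"

primrec bounds :: "prog => (nat \<times> int) set" where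
 "bounds PSkip = {}"
| "bounds (PISet a e1 e2) = {}"
| "bounds (PRSet a e1 e2) = {}"
| "bounds (PCall x a) = {}"
| "bounds (p ;; r) = bounds p \<union> bounds r"
| "bounds (If b p r) = bounds p \<union> bounds r"
| "bounds (For v a i p) = insert (a, i) (bounds p)"

text \<open>Both branches of a conditional are charged. For a loop, 9 is 3 for the initial
  assignment plus 6 for the failing test, and 12 is 6 for a successful test plus 6 for the
  increment.\<close>

primrec cost_of :: "(nat \<times> int => nat) => nat => prog => nat" where
 "cost_of W F PSkip = 1"
| "cost_of W F (PISet a e1 e2) = 1+icost e1+icost e2"
| "cost_of W F (PRSet a e1 e2) = 1+icost e1+rcost e2"
| "cost_of W F (PCall x a) = 1+F"
| "cost_of W F (p ;; r) = cost_of W F p+cost_of W F r"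
| "cost_of W F (If b p r) = 1+bcost b+cost_of W F p+cost_of W F r"
| "cost_of W F (For v a i p) = 9+W (a, i)*(12+cost_of W F p)"

lemma exec_time:
 assumes "exec K I (compile p) s t s'" and "wf p"
  and "!!a i. (a, i) : bounds p ==> a ~: piw p & ints s a i<=int (W (a, i))"
  and F: "!!C t v. K C t v ==> t<=F"
 shows "t<=cost_of W F p" using assms(1-3)
proof (induction p arbitrary: s t s')
 case PSkip
 thus ?case by (auto elim: exec_SkipE)
next
 case (PISet a e1 e2)
 thus ?case by (auto elim: exec_ISetE)
next
 case (PRSet a e1 e2)
 thus ?case by (auto elim: exec_RSetE)
next
 case (PCall x a)
 thus ?case using F by (auto elim!: exec_CallE)
next
 case (Sq p r)
 from Sq.prems(1) obtain t1 s1 t2 where e: "exec K I (compile p) s t1 s1" "exec K I (compile r) s1 t2 s'"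
  and t: "t = t1+t2" by (auto elim: exec_SeqE)
 have "t1<=cost_of W F p" by (rule Sq.IH(1)[OF e(1)]) (use Sq.prems in auto)
 moreover have "t2<=cost_of W F r"
 proof (rule Sq.IH(2)[OF e(2)])
  show "wf r" using Sq.prems by simp
  fix a i assume "(a, i) : bounds r"
  thus "a ~: piw r & ints s1 a i<=int (W (a, i))" using Sq.prems(3)[of a i] exec_frame(1)[OF e(1), of a] by (auto simp: iw_compile)
 qed
 ultimately show ?case using t by simp
next
 case (If b p r)
 from If.prems(1) have "exec K I (Cond b (compile p) (compile r)) s t s'" by simp
 then consider (1) t1 where "t = 1+bcost b+t1" "exec K I (compile p) s t1 s'"
  | (2) t1 where "t = 1+bcost b+t1" "exec K I (compile r) s t1 s'" by (elim exec_CondE) auto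
 hence "t<=Suc (bcost b+cost_of W F p+cost_of W F r)"
 proof cases
  case (1 t1)
  have "t1<=cost_of W F p" by (rule If.IH(1)[OF 1(2)]) (use If.prems in auto)
  thus ?thesis using 1 by simp
 next
  case (2 t1)
  have "t1<=cost_of W F r" by (rule If.IH(2)[OF 2(2)]) (use If.prems in auto)
  thus ?thesis using 2 by simp
 qed
 thus ?case by simp
next
 case (For v a i p)
 let ?b = "ILess (IGet v I0) (IGet a (IConst i))"
 let ?c = "Seq (compile p) (ISet v I0 (IPlus (IGet v I0) I1))"
 have av: "a ~= v" "a ~: piw p" and N: "ints s a i<=int (W (a, i))" using For.prems(3)[of a i] by auto
 have vp: "v ~: piw p" using For.prems by simp
 \<comment> \<open>The iterations still to come are counted from the current value of the counter,
   so the claim goes through by induction on the execution of the raw loop.\<close>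
 have loop: "t<=6+nat (ints s a i - ints s0 v 0)*(12+cost_of W F p)"
  if "exec K I c s0 t s'" "c = Loop ?b ?c" "ALL a. a ~: insert v (piw p) --> ints s0 a = ints s a" for c s0 t s' using that
 proof (induction rule: exec.induct)
  case (LoopF s0 b c)
  thus ?case by auto
 next
  case (LoopT s0 b c t1 s1 t2 s2)
  from LoopT(2,6) obtain t3 s3 t4 where e: "exec K I (compile p) s0 t3 s3"
   "exec K I (ISet v I0 (IPlus (IGet v I0) I1)) s3 t4 s1" and t1: "t1 = t3+t4" by (auto elim: exec_SeqE)
  have t3: "t3<=cost_of W F p"
  proof (rule For.IH[OF e(1)])
   show "wf p" using For.prems by simp
   fix a i assume "(a, i) : bounds p"
   thus "a ~: piw p & ints s0 a i<=int (W (a, i))" using For.prems(3)[of a i] LoopT(7) by auto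
  qed
  from e(2) have s1: "s1 = iupd v 0 (ints s3 v 0+1) s3" and t4: "t4 = 6" by (auto elim: exec_ISetE)
  have f: "ALL a. a ~: piw p --> ints s3 a = ints s0 a" using exec_frame(1)[OF e(1)] by (simp add: iw_compile)
  have v: "ints s1 v 0 = ints s0 v 0+1" using s1 f vp by simp
  have "t2<=6+nat (ints s a i - ints s1 v 0)*(12+cost_of W F p)" by (rule LoopT(5)) (use LoopT f s1 in "auto simp: iupd_other")
  moreover have "ints s0 v 0<ints s a i" using LoopT(1,6,7) av by simp
  hence "nat (ints s a i - ints s0 v 0) = Suc (nat (ints s a i - ints s1 v 0))" using v by simp
  ultimately show ?case using t1 t3 t4 LoopT(6) by simp
 qed auto
 from For.prems(1) obtain t1 s1 t2 where e: "exec K I (ISet v I0 I0) s t1 s1" "exec K I (Loop ?b ?c) s1 t2 s'"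
  and t: "t = t1+t2" by (auto elim: exec_SeqE)
 from e(1) have s1: "s1 = iupd v 0 0 s" and t1: "t1 = 3" by (auto elim: exec_ISetE)
 have "t2<=6+nat (ints s a i - ints s1 v 0)*(12+cost_of W F p)" by (rule loop[OF e(2)]) (auto simp: s1 iupd_other)
 also have "...<=6+W (a, i)*(12+cost_of W F p)" using N s1 by (intro add_left_mono mult_right_mono) auto
 finally show ?case using t t1 by simp
qed

primrec sz :: "prog => nat" where
 "sz PSkip = 1"
| "sz (PISet a e1 e2) = 1+icost e1+icost e2"
| "sz (PRSet a e1 e2) = 1+icost e1+rcost e2"
| "sz (PCall x a) = 2"
| "sz (p ;; r) = sz p + sz r"
| "sz (If b p r) = 1+bcost b + sz p + sz r"
| "sz (For v a i p) = 21 + sz p"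

primrec dep :: "prog => nat" where
 "dep PSkip = 0"
| "dep (PISet a e1 e2) = 0"
| "dep (PRSet a e1 e2) = 0"
| "dep (PCall x a) = 0"
| "dep (p ;; r) = max (dep p) (dep r)"
| "dep (If b p r) = max (dep p) (dep r)"
| "dep (For v a i p) = Suc (dep p)"

text \<open>Loops over the points, whose bound is cell 0 of array 0, are not nested.\<close>

primrec pointfree :: "prog => bool" where
 "pointfree PSkip = True"
| "pointfree (PISet a e1 e2) = True"
| "pointfree (PRSet a e1 e2) = True"
| "pointfree (PCall x a) = False"
| "pointfree (p ;; r) = (pointfree p & pointfree r)"
| "pointfree (If b p r) = (pointfree p & pointfree r)"
| "pointfree (For v a i p) = ((a, i) ~= (0, 0) & pointfree p)"

primrec linear_prog :: "prog => bool" where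
 "linear_prog PSkip = True"
| "linear_prog (PISet a e1 e2) = True"
| "linear_prog (PRSet a e1 e2) = True"
| "linear_prog (PCall x a) = True"
| "linear_prog (p ;; r) = (linear_prog p & linear_prog r)"
| "linear_prog (If b p r) = (linear_prog p & linear_prog r)"
| "linear_prog (For v a i p) = (if (a, i) = (0, 0) then pointfree p else linear_prog p)"

lemma pow_le: "H >= (1::nat) ==> m<=m' ==> H ^ m<=H ^ m'" by (rule power_increasing) auto

lemma cost_pointfree:
 assumes "pointfree p" "H >= 1" and "!!x. x : bounds p ==> x ~= (0, 0) ==> W x<=H"
 shows "cost_of W F p <= sz p*H ^ dep p" using assms(1,3)
proof (induction p)
 case (Sq p r)
 have "cost_of W F (p ;; r) <= sz p*H ^ dep p + sz r*H ^ dep r" using Sq by simp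
 also have "... <= sz p*H ^ dep (p ;; r) + sz r*H ^ dep (p ;; r)" by (intro add_mono mult_left_mono pow_le assms) auto
 finally show ?case by (simp add: algebra_simps)
next
 case (If b p r)
 have "cost_of W F (If b p r)<=(1+bcost b)*1 + sz p*H ^ dep p + sz r*H ^ dep r" using If by simp
 also have "...<=(1+bcost b)*H ^ dep (If b p r) + sz p*H ^ dep (If b p r) + sz r*H ^ dep (If b p r)" using assms(2) by (intro add_mono mult_left_mono pow_le assms) auto
 finally show ?case by (simp add: algebra_simps)
next
 case (For v a i p)
 have W: "W (a, i)<=H" using For by auto
 have "cost_of W F (For v a i p)<=9+H*(12 + sz p*H ^ dep p)" using For W by (auto intro!: mult_mono)
 also have "...<=9*(H*H ^ dep p)+H*(12*H ^ dep p + sz p*H ^ dep p)" using assms(2) by (intro add_mono mult_left_mono) auto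
 finally show ?case by (simp add: algebra_simps)
qed (use assms(2) in auto)

text \<open>A loop over the points contains neither another such loop nor a call, so
  \<open>n\<close> and the call cost \<open>F\<close> enter only linearly. Every other loop runs at
  most \<open>H\<close> times and contributes one factor \<open>H\<close> per nesting level.\<close>

lemma cost_linear:
 assumes "linear_prog p" "H >= 1" "n >= 1" "W (0, 0)<=n"
  and "!!x. x : bounds p ==> x ~= (0, 0) ==> W x<=H"
 shows "cost_of W F p <= sz p*H ^ dep p*(n+F)" using assms(1,5)
proof (induction p)
 case (Sq p r)
 have "cost_of W F (p ;; r) <= sz p*H ^ dep p*(n+F) + sz r*H ^ dep r*(n+F)" using Sq by simp
 also have "... <= sz p*H ^ dep (p ;; r)*(n+F) + sz r*H ^ dep (p ;; r)*(n+F)" by (intro add_mono mult_right_mono mult_left_mono pow_le assms) auto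
 finally show ?case by (simp add: algebra_simps)
next
 case (If b p r)
 have "cost_of W F (If b p r)<=(1+bcost b)*1*1 + sz p*H ^ dep p*(n+F) + sz r*H ^ dep r*(n+F)" using If by simp
 also have "...<=(1+bcost b)*H ^ dep (If b p r)*(n+F) + sz p*H ^ dep (If b p r)*(n+F) + sz r*H ^ dep (If b p r)*(n+F)" using assms(2,3) by (intro add_mono mult_mono mult_right_mono mult_left_mono pow_le assms) auto
 finally show ?case by (simp add: algebra_simps)
next
 case (For v a i p)
 show ?case
 proof (cases "(a, i) = (0, 0)")
  case True
  have "cost_of W F (For v a i p)<=9+n*(12 + sz p*H ^ dep p)" using For cost_pointfree[of p H W F] assms True by (auto intro!: mult_mono)
  also have "...<=9*(n*(H*H ^ dep p))+n*(12*(H*H ^ dep p) + sz p*(H*H ^ dep p))" using assms(2,3) by (intro add_mono mult_left_mono) auto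
  also have "... = sz (For v a i p)*H ^ dep (For v a i p)*n" by (simp add: algebra_simps)
  also have "... <= sz (For v a i p)*H ^ dep (For v a i p)*(n+F)" by simp
  finally show ?thesis .
 next
  case False
  have W: "W (a, i)<=H" using For False by auto
  have "cost_of W F (For v a i p)<=9+H*(12 + sz p*H ^ dep p*(n+F))" using For W False by (auto intro!: mult_mono)
  also have "...<=9*(H*H ^ dep p*(n+F))+H*(12*(H ^ dep p*(n+F)) + sz p*H ^ dep p*(n+F))" using assms(2,3) by (intro add_mono mult_left_mono) auto
  finally show ?thesis by (simp add: algebra_simps)
 qed
next
 case (PISet a e1 e2)
 have "(1+icost e1+icost e2)*1<=(1+icost e1+icost e2)*(n+F)" using assms(3) by (intro mult_left_mono) auto
 thus ?case by (simp del: mult_1_right)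
next
 case (PRSet a e1 e2)
 have "(1+icost e1+rcost e2)*1<=(1+icost e1+rcost e2)*(n+F)" using assms(3) by (intro mult_left_mono) auto
 thus ?case by (simp del: mult_1_right)
qed (use assms(3) in auto)

section \<open>The decoder: from a bit string to a labelling of the points\<close>

section \<open>Decoding an advice string\<close>

text \<open>An exhausted tape reads as zeros, which makes the decoder total.\<close>

definition hdb :: "bool list => bool" where "hdb tp <-> tp ~= [] & hd tp"

lemma hdb_simps [simp]: "hdb [] = False" "hdb (b # tp) = b" by (auto simp: hdb_def)

text \<open>Unary reading: one application of \<open>f\<close> per leading one, stopping at the
  first zero. The flag freezes the state, so the step can be iterated a fixed number of
  times.\<close>

definition gstep :: "('a => 'a) => 'a \<times> bool \<times> bool list => 'a \<times> bool \<times> bool list" where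
 "gstep f = (%(v, go, tp). if go then (if hdb tp then f v else v, hdb tp, tl tp) else (v, go, tp))"

definition bstep :: "real => real \<times> bool list => real \<times> bool list" where
 "bstep dl = (%(v, tp). (if hdb tp then v + v+dl else v + v, tl tp))"

definition nstep :: "nat \<times> bool list => nat \<times> bool list" where
 "nstep = (%(v, tp). (if hdb tp then v + v+1 else v + v, tl tp))"

text \<open>
  Besides the unread part of the advice, a decoder state holds the clusters discovered so far
  (approximate centre and radius), the markers (position, radius of the parent cluster, a flag
  that is set if the marker is close to some cluster at least as large as its parent), the
  witnesses (index of the owner, position), and an overflow flag.
\<close>

record dstate =
 cens :: "nat list"
 rads :: "real list"
 ents :: "(nat \<times> real \<times> bool) list"
 wits :: "(nat \<times> nat) list"
 tape :: "bool list"
 ovf :: bool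

text \<open>\<open>z\<close> and \<open>r\<close> are the greedy centres and their separation;
  \<open>q\<close> sets the precision \<open>th\<close>, \<open>g\<close> is the number of bits that
  select a net point, and \<open>B\<close> is the length of the advice and the bound of most
  loops.\<close>

locale decoder =
 fixes n k g q B :: nat and dd :: "nat => nat => real" and z :: "nat => nat" and r :: real
begin

abbreviation th :: real where "th \<equiv> 2 ^ q"

text \<open>Written with a negated strict comparison, as the machine computes it.\<close>

definition ballp :: "nat => real => nat set" where
 "ballp c R = {p. p<n & ~ R<dd c p}"

text \<open>What is left of \<open>W\<close> after \<open>t\<close> greedy steps, each deleting the
  \<open>R\<close>-ball around the least remaining point. The centres used are more than
  \<open>R\<close> apart, and \<open>net W R T = {}\<close> means that \<open>T\<close> of them
  cover \<open>W\<close>.\<close>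

primrec net :: "nat set => real => nat => nat set" where
 "net W R 0 = W"
| "net W R (Suc t) = (if net W R t = {} then {} else net W R t - ballp (Min (net W R t)) R)"

text \<open>A positive multiple of \<open>dl\<close>: the remainder modulo \<open>th\<close> in
  \<open>q\<close> binary digits, the quotient in unary in units of \<open>lm = th*dl\<close>. Unary
  is affordable because the quotients of all clusters sum to at most \<open>3*k\<close>.\<close>

definition readD :: "real => real => bool list => real \<times> bool list" where
 "readD dl lm tp = (let (D, tp1) = (bstep dl ^^ q) (0, tp);
   (D', _, tp2) = (gstep (%D. D+lm) ^^ B) (D+dl, True, tp1) in (D', tp2))"

definition pick :: "nat => real => nat => nat" where
 "pick c R t = (if net (ballp c R) (R/2) t = {} then c else Min (net (ballp c R) (R/2) t))"

text \<open>The flag records that \<open>2^g\<close> greedy centres did not exhaust the ball, that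
  is, \<open>g\<close> bits may not suffice to select a nearby net point.\<close>

definition mstep :: "real => nat \<times> real \<times> bool list \<times> bool => nat \<times> real \<times> bool list \<times> bool" where
 "mstep tgt = (%(c, R, tp, ov). if tgt < R then
   (let (idx, tp') = (nstep ^^ g) (0, tp) in
    (pick c R idx, R/2, tp', ov | net (ballp c R) (R/2) (2 ^ g) ~= {})) else (c, R, tp, ov))"

definition name :: "nat => real => real => bool list => bool => nat \<times> real \<times> bool list \<times> bool" where
 "name c R tgt tp ov = (mstep tgt ^^ B) (c, R, tp, ov)"

text \<open>Prefix code: 11 announces a neighbouring cluster, 101 sets a marker, 100 a witness, 0
  ends the list. The radius \<open>10*D\<close> reaches every point that honest advice wants to name
  from here.\<close>

definition item :: "real => real => nat => dstate \<times> bool => dstate \<times> bool" where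
 "item dl lm cur = (%(d, go).
   if go then
   (let t1 = tl (tape d); x = cens d ! cur; D = rads d ! cur in
    if hdb (tape d) then
    (let t2 = tl t1 in
    if hdb t1 then
    (let (D', t3) = readD dl lm t2; (c, _, t4, ov) = name x (10*D) D' t3 (ovf d) in
    (d(|cens := (if length (cens d)<k then cens d @ [c] else cens d),
    rads := (if length (cens d)<k then rads d @ [D'] else rads d), tape := t4, ovf := ov|), True))
    else
    (let t3 = tl t2 in
    if hdb t2 then
    (let (c, _, t4, ov) = name x (10*D) (D/th) t3 (ovf d) in
    (d(|ents := ents d @ [(c, D, hdb t4)], tape := tl t4, ovf := ov|), True))
    else
    (let (c, _, t4, ov) = name x (10*D) dl t3 (ovf d) in
    (d(|wits := wits d @ [(cur, c)], tape := t4, ovf := ov|), True))))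
    else (d(|tape := t1|), False))
   else (d, go))"

definition listing :: "real => real => nat => dstate => dstate" where
 "listing dl lm cur d = fst ((item dl lm cur ^^ B) (d, True))"

text \<open>A marker with unset flag certifies that no cluster at least as large as its parent comes
  near. A discovered cluster of size \<open>D >= s\<close> therefore owns no point of its ball and
  must not count as covering one.\<close>

definition blocked :: "(nat \<times> real \<times> bool) list => real => nat => bool" where
 "blocked E D p <-> (EX (e, s, nr):set E. ~ nr & ~ D < s & ~ 8*(s/th)<dd e p)"

definition covered :: "dstate => nat => bool" where
 "covered d p <-> (EX j<length (cens d). ~ 2*(rads d ! j)<dd (cens d ! j) p & ~ blocked (ents d) (rads d ! j) p)"

definition uncov :: "dstate => nat set" where
 "uncov d = {p. p<n & ~ covered d p}"

definition discover :: "real => real => dstate \<times> nat => dstate" where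
 "discover dl lm = (%(d, cur). if ~ cur<length (cens d) & uncov d ~= {} then
    (let (D, t) = readD dl lm (tape d) in
    d(|cens := cens d @ [Min (uncov d)], rads := rads d @ [D], tape := t|)) else d)"

text \<open>\<open>cur\<close> counts the clusters already listed. When it has caught up with the
  discovered ones, an uncovered point yields a new cluster; if nothing is uncovered, the turn
  idles.\<close>

definition turn :: "real => real => dstate \<times> nat => dstate \<times> nat" where
 "turn dl lm = (%(d, cur). let d1 = discover dl lm (d, cur)
   in if cur<length (cens d1) then (listing dl lm cur d1, Suc cur) else (d1, cur))"

definition turns :: "real => real => bool list => dstate" where
 "turns dl lm t = fst ((turn dl lm ^^ k)
   ((|cens = [], rads = [], ents = [], wits = [], tape = t, ovf = False|), 0))"

text \<open>Guesses the cost as a power of two times the distance of two greedy centres enlarged by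
  \<open>2*r\<close>. The results are the units \<open>dl\<close> and \<open>lm\<close>.\<close>

definition scale :: "bool list => real \<times> real \<times> bool list" where
 "scale tp = (let (a, _, t1) = (gstep Suc ^^ k) (0, True, tp); (b, _, t2) = (gstep Suc ^^ k) (0, True, t1);
   (E, _, t3) = (gstep (%E. E+E) ^^ B) (dd (z a) (z b)+2*r, True, t2)
   in (E/real k/th, E/real k, t3))"

text \<open>A bit is read only for a flagged marker within a factor \<open>th\<close> of the cluster
  in scale and within \<open>3*D\<close> of its centre. All other decisions are forced.\<close>

definition sstep :: "dstate => nat => nat set \<times> bool list => nat \<times> real \<times> bool => nat set \<times> bool list" where
 "sstep d i = (%(S, tp) (e, s, nr). let D = rads d ! i in
   if D < s then (S, tp)
   else if nr then
    (if D/th < s & ~ 3*D<dd (cens d ! i) e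
    then (if hdb tp then S else S - ballp e (8*(s/th)), tl tp) else (S, tp))
   else (S - ballp e (8*(s/th)), tp))"

definition sset :: "real => dstate => nat => bool list => nat set \<times> bool list" where
 "sset dl d i tp = (let (S, tp') = foldl (sstep d i) (ballp (cens d ! i) (2*(rads d ! i)), tp) (ents d)
   in (S \<inter> {p. ALL (w, y):set (wits d). w = i --> ~ rads d ! i+dl<dd y p}, tp'))"

text \<open>Among the clusters that may contain a point the one of smallest radius wins. Larger
  rivals are thereby excluded without advice, smaller ones by witnesses.\<close>

definition astep :: "real => dstate => (nat => nat option) \<times> bool list => nat => (nat => nat option) \<times> bool list" where
 "astep dl d = (%(pl, tp) i. let (S, tp') = sset dl d i tp in
   (%p. if p : S & (case pl p of None => True | Some j => rads d ! i<rads d ! j) then Some i else pl p, tp'))"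

definition assign :: "real => dstate => nat => nat option" where
 "assign dl d = fst (foldl (astep dl d) (%_. None, tape d) [0..<length (cens d)])"

text \<open>The nodes of the merging graph: cluster \<open>i\<close> is \<open>i\<close>, marker \<open>a\<close> is \<open>B + a\<close>.\<close>

definition hub :: "dstate => (nat => nat option) => nat => nat => bool" where
 "hub d pl a p <-> a<length (ents d) & (case ents d ! a of (e, s, nr) => nr & ~ 8*(s/th)<dd e p &
   (case pl p of None => True | Some i => ~ rads d ! i < s))"

definition nodes :: "dstate => (nat => nat option) => nat => nat set" where
 "nodes d pl p = {i. pl p = Some i} \<union> {B+a | a. hub d pl a p}"

definition links :: "dstate => (nat => nat option) => (nat \<times> nat) set" where
 "links d pl = {(u, v). EX p<n. u : nodes d pl p & v : nodes d pl p}"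

text \<open>\<open>lb\<close> identifies components and is at most every node in its component, so a
  component containing a cluster gets a label below \<open>k\<close>. Other components arise only
  from dishonest advice, and there \<open>L\<close> is left free.\<close>

definition labelling :: "dstate => (nat => nat option) => (nat => nat) => bool" where
 "labelling d pl L <-> (EX lb. (ALL u v. lb u = lb v <-> (u, v) : (links d pl)\<^sup>*) & (ALL u. lb u<=u) &
   (ALL p<n. ALL u:nodes d pl p. lb u<k --> L p = lb u))"

definition core :: "bool list => real \<times> dstate" where
 "core tp = (let (dl, lm, t) = scale tp in (dl, turns dl lm t))"

definition candidate :: "bool list => (nat => nat) => bool" where
 "candidate tp L <-> (ALL p<n. L p<k) &
   (case core tp of (dl, d) => labelling d (assign dl d) L)"

subsection \<open>Reading numbers\<close>

lemma gstep_simps [simp]: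
 "gstep f (v, True, tp) = (if hdb tp then f v else v, hdb tp, tl tp)"
 "gstep f (v, False, tp) = (v, False, tp)" by (auto simp: gstep_def)

lemma gstep_stopped: "(gstep f ^^ m) (v, False, tp) = (v, False, tp)" by (induction m) auto

lemma funpow_Suc_apply: "(f ^^ Suc m) x = (f ^^ m) (f x)" by (simp only: funpow_Suc_right comp_apply)

lemma gstep_unary:
 assumes "u<m"
 shows "(gstep f ^^ m) (v, True, replicate u True @ False # rest) = ((f ^^ u) v, False, rest)" using assms
proof (induction u arbitrary: m v)
 case 0
 then obtain m' where m: "m = Suc m'" by (cases m) auto
 show ?case unfolding m funpow_Suc_apply by (simp add: gstep_stopped)
next
 case (Suc u)
 then obtain m' where m: "m = Suc m'" "u<m'" by (cases m) auto
 show ?case unfolding m(1) funpow_Suc_apply using Suc.IH[OF m(2)] by simp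
qed

lemma gstep_full:
 "(gstep f ^^ m) (v, True, replicate m True @ rest) = ((f ^^ m) v, True, rest)"
proof (induction m arbitrary: v)
 case (Suc m)
 show ?case unfolding funpow_Suc_apply using Suc.IH by simp
qed simp

lemma funpow_add_real: "((%D. D+(c::real)) ^^ u) v = v+real u*c" by (induction u) (auto simp: algebra_simps)

lemma funpow_double: "((%E. E+(E::real)) ^^ u) v = 2 ^ u * v" by (induction u) auto

lemma half_less:
 assumes "(m::nat)<2 ^ Suc l"
 obtains h b where "m = 2*h + of_bool b" "h<2 ^ l"
proof
 show "m = 2*(m div 2) + of_bool (odd m)" by (cases "even m") (auto elim: oddE)
 show "m div 2<2 ^ l" using assms by auto
qed

lemma nstep_read:
 "m<2 ^ l ==> EX bs. length bs = l & (ALL rest v. (nstep ^^ l) (v, bs @ rest) = (2 ^ l * v+m, rest))"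
proof (induction l arbitrary: m)
 case (Suc l)
 obtain h b where m: "m = 2*h + of_bool b" "h<2 ^ l" using half_less[OF Suc.prems] by blast
 obtain bs where bs: "length bs = l" "!!rest v. (nstep ^^ l) (v, bs @ rest) = (2 ^ l * v+h, rest)" using Suc.IH m by blast
 have "(nstep ^^ Suc l) (v, (bs @ [b]) @ rest) = (2 ^ Suc l * v+m, rest)" for rest v using bs(2)[of v "b # rest"] m(1) by (simp add: nstep_def)
 thus ?case using bs(1) by (intro exI[of _ "bs @ [b]"]) auto
qed auto

lemma bstep_read:
 "m<2 ^ l ==> EX bs. length bs = l & (ALL rest v. (bstep dl ^^ l) (v, bs @ rest) = (2 ^ l * v+real m*dl, rest))"
proof (induction l arbitrary: m)
 case (Suc l)
 obtain h b where m: "m = 2*h + of_bool b" "h<2 ^ l" using half_less[OF Suc.prems] by blast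
 obtain bs where bs: "length bs = l" "!!rest v. (bstep dl ^^ l) (v, bs @ rest) = (2 ^ l * v+real h*dl, rest)" using Suc.IH m by blast
 have "(bstep dl ^^ Suc l) (v, (bs @ [b]) @ rest) = (2 ^ Suc l * v+real m*dl, rest)" for rest v using bs(2)[of v "b # rest"] m(1) by (simp add: bstep_def algebra_simps)
 thus ?case using bs(1) by (intro exI[of _ "bs @ [b]"]) auto
qed auto

lemma readD_read:
 assumes "lm = th*dl" "t div 2 ^ q<B"
 shows "EX bs. length bs = q+t div 2 ^ q+1 & (ALL rest. readD dl lm (bs @ rest) = (real (t+1)*dl, rest))"
proof -
 obtain u w where u: "u = t div 2 ^ q" and w: "w = t mod 2 ^ q" by blast
 have "w<2 ^ q" using w by simp
 then obtain bs where bs: "length bs = q"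
  "!!rest v. (bstep dl ^^ q) (v, bs @ rest) = (2 ^ q * v+real w*dl, rest)" using bstep_read by blast
 let ?bs = "bs @ replicate u True @ [False]"
 have "t = u*2 ^ q+w" by (simp only: u w div_mult_mod_eq)
 hence t: "real (t+1)*dl = real w*dl+dl+real u*lm" using assms(1) by (simp add: algebra_simps)
 have "(bstep dl ^^ q) (0, ?bs @ rest) = (real w*dl, replicate u True @ False # rest)" for rest using bs(2)[of 0] by simp
 hence "readD dl lm (?bs @ rest) = (real (t+1)*dl, rest)" for rest using gstep_unary[of u B "%D. D+lm" "real w*dl+dl" rest] assms(2) u unfolding t readD_def by (simp add: funpow_add_real)
 thus ?thesis using bs(1) u by (intro exI[of _ ?bs]) auto
qed

subsection \<open>Nets\<close>

lemma net_sub: "net W R t<=W" by (induction t) auto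

lemma net_antimono: "t<=t' ==> net W R t'<=net W R t" by (induction t' rule: dec_induct) auto

lemma finite_ballp [simp]: "finite (ballp c R)" by (simp add: ballp_def)

lemma pick_less: "c<n ==> pick c R t<n"
proof -
 assume "c<n"
 have "net (ballp c R) (R/2) t<=ballp c R" by (rule net_sub)
 moreover have "finite (net (ballp c R) (R/2) t)" by (meson finite_ballp finite_subset net_sub)
 ultimately show ?thesis using \<open>c<n\<close> Min_in unfolding pick_def ballp_def by fastforce
qed

text \<open>The point \<open>p\<close> is deleted at some greedy step, and the centre of that step
  is within \<open>R/2\<close> of it.\<close>

lemma pick_near:
 assumes "p : ballp c R" "net (ballp c R) (R/2) T = {}"
 shows "EX t<T. dd (pick c R t) p <= R/2"
proof -
 let ?N = "net (ballp c R) (R/2)"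
 have p0: "p : ?N 0" using assms by simp
 have "EX t<T. p : ?N t & p ~: ?N (Suc t)"
 proof (rule ccontr)
  assume "~ ?thesis"
  hence "p : ?N t" if "t<=T" for t using that p0 by (induction t) (auto simp del: net.simps)
  thus False using assms(2) by blast
 qed
 then obtain t where t: "t<T" "p : ?N t" "p ~: ?N (Suc t)" by blast
 hence "p : ballp (Min (?N t)) (R/2)" by (auto split: if_splits)
 thus ?thesis using t by (auto simp: pick_def ballp_def intro!: exI[of _ t])
qed

lemma mstep_ovf: "snd (snd (snd st)) ==> snd (snd (snd ((mstep tgt ^^ m) st)))"
proof (induction m)
 case (Suc m)
 obtain c R tp ov where st: "(mstep tgt ^^ m) st = (c, R, tp, ov)" by (metis prod_cases4)
 hence ov using Suc by simp
 thus ?case using st by (simp add: mstep_def split: prod.splits)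
qed simp

lemma mstep_done: "~ tgt < R ==> (mstep tgt ^^ m) (c, R, tp, ov) = (c, R, tp, ov)" by (induction m) (auto simp: mstep_def)

text \<open>How a point \<open>p\<close> is named from a known \<open>c\<close>: each group of
  \<open>g\<close> bits moves to a net point within half the radius of \<open>p\<close>, and
  \<open>s\<close> halvings reach the precision \<open>tgt\<close>. A run that overflows is
  discarded later, hence the disjunction.\<close>

lemma mstep_read:
 assumes "R/2 ^ s<=tgt" "s<=m" "p<n" "c<n" "dd c p <= R" "dd p p<=tgt"
 shows "EX bs c'. length bs<=g * s & c'<n & dd c' p<=tgt &
  (ALL rest ov. snd (snd (snd ((mstep tgt ^^ m) (c, R, bs @ rest, ov)))) | 
   (EX R'. (mstep tgt ^^ m) (c, R, bs @ rest, ov) = (c', R', rest, ov)))" using assms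
proof (induction s arbitrary: m R c)
 case 0
 thus ?case by (intro exI[of _ "[]"] exI[of _ c]) (auto simp: mstep_done)
next
 case (Suc s)
 show ?case
 proof (cases "tgt < R")
  case False
  thus ?thesis using Suc.prems by (intro exI[of _ "[]"] exI[of _ c]) (auto simp: mstep_done)
 next
  case True
  obtain m' where m: "m = Suc m'" "s<=m'" using Suc.prems by (cases m) auto
  show ?thesis
  proof (cases "net (ballp c R) (R/2) (2 ^ g) = {}")
   case ne: False
   have ov': "snd (snd (snd ((mstep tgt ^^ m) (c, R, tp, ov))))" for tp ov
   proof -
    have "snd (snd (snd (mstep tgt (c, R, tp, ov))))" using True ne by (simp add: mstep_def split: prod.splits)
    from mstep_ovf[OF this, of m' tgt] show ?thesis unfolding m(1) funpow_Suc_apply .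
   qed
   \<comment> \<open>Here every run overflows and the flag is never cleared, so any admissible point
     serves as \<open>c'\<close>.\<close>
   thus ?thesis using Suc.prems by (intro exI[of _ "[]"] exI[of _ p]) auto
  next
   case e: True
   obtain t where t: "t<2 ^ g" "dd (pick c R t) p <= R/2" using pick_near[OF _ e, of p] Suc.prems by (auto simp: ballp_def)
   obtain bs1 where bs1: "length bs1 = g" "!!rest v. (nstep ^^ g) (v, bs1 @ rest) = (2 ^ g * v+t, rest)" using nstep_read[OF t(1)] by blast
   have "R/2/2 ^ s<=tgt" using Suc.prems by (simp add: field_simps)
   from Suc.IH[OF this m(2) Suc.prems(3) pick_less[OF Suc.prems(4)] t(2) Suc.prems(6)]
   obtain bs c' where bs: "length bs<=g * s" "c'<n" "dd c' p<=tgt" 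
    "!!rest ov. snd (snd (snd ((mstep tgt ^^ m') (pick c R t, R/2, bs @ rest, ov)))) | 
    (EX R'. (mstep tgt ^^ m') (pick c R t, R/2, bs @ rest, ov) = (c', R', rest, ov))" by blast
   have "mstep tgt (c, R, (bs1 @ bs) @ rest, ov) = (pick c R t, R/2, bs @ rest, ov)" for rest ov using True e bs1(2)[of 0] by (simp add: mstep_def)
   thus ?thesis unfolding m(1) funpow_Suc_apply using bs bs1(1) by (intro exI[of _ "bs1 @ bs"] exI[of _ c']) (simp add: algebra_simps)
  qed
 qed
qed

end

section \<open>Geometry of the target clustering and of the merging graph\<close>

section \<open>The structure of a target clustering\<close>

text \<open>Distinct nodes ensure that along a path every cluster is paid for only once.\<close>

lemma rtrancl_distinct_path:
 assumes "(i, j) : R\<^sup>*"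
 shows "EX ps. ps ~= [] & hd ps = i & last ps = j & distinct ps & successively (%u v. (u, v) : R) ps" using assms
proof (induction rule: rtrancl_induct)
 case base
 show ?case by (intro exI[of _ "[i]"]) auto
next
 case (step y w)
 then obtain ps where ps: "ps ~= []" "hd ps = i" "last ps = y" "distinct ps" "successively (%u v. (u, v) : R) ps" by blast
 show ?case
 proof (cases "w : set ps")
  case True
  then obtain us vs where "ps = us @ w # vs" by (meson split_list)
  with ps show ?thesis by (intro exI[of _ "us @ [w]"]) (auto simp: hd_append successively_append_iff)
 next
  case False
  thus ?thesis using ps step by (intro exI[of _ "ps @ [w]"]) (auto simp: successively_append_iff)
 qed
qed

text \<open>The facts about the penalised optimum on which the geometry rests: uniting clusters does
  not pay. \<open>DD C\<close> is the diameter rounded up to a multiple of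
  \<open>dl\<close>.\<close>

locale target = decoder +
 fixes P :: "nat set set" and DD :: "nat set => real" and dl :: real
 assumes metric: "Metric_space {..<n} dd"
  and part: "partition_on {..<n} P"
  and q10: "10<=q" and dl0: "0<=dl"
  and DDge: "!!C x y. C : P ==> x : C ==> y : C ==> dd x y<=DD C"
  and dl_DD: "!!C. C : P ==> dl<=DD C" "!!C. C : P ==> dl = 0 ==> DD C = 0"
  and union_diam: "!!A. A<=P ==> 2<=card A ==> EX x:\<Union>A. EX y:\<Union>A. sum DD A<=dd x y"
  and pair_diam: "!!C C'. C : P ==> C' : P ==> C ~= C' ==>
    EX x:C. EX y:C'. DD C+DD C'+4*dl<=dd x y"
begin

lemma in_n: "C : P ==> p : C ==> p<n" using part by (auto simp: partition_on_def)

lemma tri: "x<n ==> y<n ==> w<n ==> dd x w<=dd x y+dd y w" using metric Metric_space.triangle[of "{..<n}" dd] by auto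

lemma symd: "dd x y = dd y x" using metric by (simp add: Metric_space.commute)

lemma nonneg: "0<=dd x y" using metric by (simp add: Metric_space.nonneg)

lemma self0: "x<n ==> dd x x = 0" using metric Metric_space.zero[of "{..<n}" dd] by auto

lemma dist_pos: "x<n ==> y<n ==> x ~= y ==> 0<dd x y" using metric Metric_space.zero[of "{..<n}" dd x y] nonneg[of x y] by (auto simp: less_le)

lemma disj: "C : P ==> C' : P ==> p : C ==> p : C' ==> C = C'" using part by (auto simp: partition_on_def disjoint_def)

lemma nonempty: "C : P ==> EX p. p : C" using part by (auto simp: partition_on_def)

lemma cluster_of: "p<n ==> EX C:P. p : C" using part by (auto simp: partition_on_def)

lemma finP: "finite P" using part finite_UnionD[of P] by (simp add: partition_on_def)

lemma DD0: "C : P ==> 0<=DD C" using dl_DD(1) dl0 by force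

lemma theta: "1024<=th"
proof -
 have "(2::real) ^ 10<=2 ^ q" using q10 by (rule power_increasing) simp
 thus ?thesis by simp
qed

lemma theta0: "0<th" by simp

definition close :: "nat set => nat set => real => bool" where
 "close C C' s <-> (EX p:C. EX p':C'. dd p p' <= s)"

lemma close_mono: "close C C' s ==> s <= s' ==> close C C' s'" unfolding close_def by force

lemma close_sym: "close C C' s ==> close C' C s" unfolding close_def using symd by metis

lemma close_trans:
 assumes "close A C s" "close C E s'" "A : P" "C : P" "E : P"
 shows "close A E (s+DD C + s')"
proof -
 obtain a c where 1: "a : A" "c : C" "dd a c <= s" using assms by (auto simp: close_def)
 obtain c' e where 2: "c' : C" "e : E" "dd c' e <= s'" using assms by (auto simp: close_def)
 have "dd a e<=dd a c+dd c c'+dd c' e" using tri[of a c e] tri[of c c' e] 1 2 assms in_n by force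
 thus ?thesis using 1 2 DDge[of C c c'] assms unfolding close_def by (intro bexI[of _ a] bexI[of _ e]) auto
qed

lemma close_pos: "close C C' s ==> C : P ==> C' : P ==> C ~= C' ==> 0 < s" unfolding close_def by (metis disj dist_pos in_n less_le_trans)

text \<open>A cluster hidden by \<open>h\<close> is negligible compared with \<open>h\<close> and
  close to it. It may escape discovery, because the ball around \<open>h\<close> can cover
  it.\<close>

definition hid :: "nat set => nat set => bool" where
 "hid h a <-> h : P & a : P & h ~= a & th*DD a<=DD h & close a h (4*DD h)"

text \<open>The smallest host. Its minimality is what forces the flag of the marker of an
  undiscovered cluster to be set.\<close>

definition par :: "nat set => nat set option" where
 "par a = (if EX h. hid h a then Some (SOME h. hid h a & (ALL h'. hid h' a --> DD h<=DD h')) else None)"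

lemma par_ex:
 assumes "hid i a"
 shows "EX h. par a = Some h & hid h a & DD h<=DD i"
proof -
 let ?S = "{h. hid h a}"
 have "finite ?S" using finP by (rule rev_finite_subset) (auto simp: hid_def)
 moreover have "?S ~= {}" using assms by auto
 ultimately have "Min (DD ` ?S) : DD ` ?S" by (intro Min_in) auto
 then obtain h where "hid h a" "DD h = Min (DD ` ?S)" by auto
 moreover have "DD h<=DD h'" if "hid h' a" for h' using \<open>finite ?S\<close> that unfolding \<open>DD h = Min (DD ` ?S)\<close> by (intro Min_le) auto
 ultimately have "EX h. hid h a & (ALL h'. hid h' a --> DD h<=DD h')" by blast
 from someI_ex[OF this] show ?thesis using assms unfolding par_def by (metis (no_types, lifting))
qed

lemma par_hid: "par a = Some h ==> hid h a" by (metis option.discI option.inject par_def par_ex)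

lemma hid_pos: "hid h a ==> 0<DD h" using close_pos[of a h "4*DD h"] by (auto simp: hid_def)

lemma hid_less: assumes "hid h a" shows "DD a<DD h"
proof (cases "DD a = 0")
 case True thus ?thesis using hid_pos[OF assms] by simp
next
 case False
 hence "0<DD a" using assms DD0[of a] by (auto simp: hid_def)
 hence "1*DD a<th*DD a" using theta by (intro mult_strict_right_mono) auto
 thus ?thesis using assms by (auto simp: hid_def)
qed

text \<open>Climbing from \<open>l\<close> along parents until their size is comparable with \<open>i\<close>.\<close>

lemma climb:
 assumes i: "i : P" and "a : P" "a ~= i" "th*DD a<=DD i" "close a i (3*DD i+10*DD a)"
  and "l : P" "ALL p:l. EX w:a. dd p w<=5*DD a" "DD l<=DD a"
 shows "EX a h. a : P & par a = Some h & DD h<=DD i & DD i<th*DD h & close h i (8*DD i) &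
   (ALL p:l. EX w:a. dd p w<=5*DD a) & DD l<=DD a" using assms(2-)
proof (induction "card {C : P. DD a<DD C}" arbitrary: a rule: less_induct)
 case less
 have a1: "1024*DD a<=DD i" using mult_right_mono[OF theta DD0[OF less(2)]] less(4) by linarith
 have "close a i (4*DD i)" using close_mono[OF less(5)] a1 DD0[OF less(2)] by auto
 hence hi: "hid i a" using less i by (auto simp: hid_def)
 obtain h where h: "par a = Some h" "hid h a" "DD h<=DD i" using par_ex[OF hi] by blast
 have hP: "h : P" "close a h (4*DD h)" using h by (auto simp: hid_def)
 have ha: "1024*DD a<=DD h" using mult_right_mono[OF theta DD0[OF less(2)]] h(2) by (auto simp: hid_def)
 have c: "close h i (4*DD h+DD a+(3*DD i+10*DD a))" by (rule close_trans[OF close_sym[OF hP(2)] less(5)]) (use hP less i in auto)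
 show ?case
 proof (cases "DD i<th*DD h")
  case True
  have "close h i (8*DD i)" by (rule close_mono[OF c]) (use h(3) a1 DD0[OF less(2)] in linarith)
  thus ?thesis using True h less by blast
 next
  case False
  show ?thesis
  proof (rule less(1)[of h])
   have "{C : P. DD h<DD C} \<subset> {C : P. DD a<DD C}" using hid_less[OF h(2)] hP by auto
   thus "card {C : P. DD h<DD C}<card {C : P. DD a<DD C}" using finP by (intro psubset_card_mono) auto
   show "th*DD h<=DD i" using False by simp
   show "h ~= i"
   proof
    assume "h = i"
    hence "th*DD i<=1*DD i" using False by simp
    thus False using hid_pos[OF hi] theta by simp
   qed
   \<comment> \<open>The factors 3, 10 and 5 are invariant along the climb: sizes grow by at least
     1024 per step, so the terms in \<open>DD a\<close> are swallowed by those in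
     \<open>DD h\<close>.\<close>
   show "close h i (3*DD i+10*DD h)" by (rule close_mono[OF c]) (use ha DD0[OF less(2)] in linarith)
   show "ALL p:l. EX w:h. dd p w<=5*DD h"
   proof
    fix p assume p: "p : l"
    then obtain w where w: "w : a" "dd p w<=5*DD a" using less(7) by blast
    obtain u v where uv: "u : a" "v : h" "dd u v<=4*DD h" using hP by (auto simp: close_def)
    have "dd p v<=dd p w+(dd w u+dd u v)" using tri[of p w v] tri[of w u v] in_n[OF less(6) p] in_n[OF less(2) w(1)] in_n[OF less(2) uv(1)]
    in_n[OF hP(1) uv(2)] by linarith
    thus "EX w:h. dd p w<=5*DD h" using w uv DDge[of a w u] less(2) ha DD0[OF less(2)] by (intro bexI[of _ v]) linarith+
   qed
   show "DD l<=DD h" using less(8) hid_less[OF h(2)] by simp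
  qed (use hP less in auto)
 qed
qed

lemma climb0:
 assumes "i : P" "l : P" "l ~= i" "th*DD l<=DD i" "close l i (3*DD i)"
 shows "EX a h. a : P & par a = Some h & DD h<=DD i & DD i<th*DD h & close h i (8*DD i) &
   (ALL p:l. EX w:a. dd p w<=5*DD a) & DD l<=DD a"
proof (rule climb)
 show "close l i (3*DD i+10*DD l)" by (rule close_mono[OF assms(5)]) (use DD0[OF assms(2)] in simp)
 show "ALL p:l. EX w:l. dd p w<=5*DD l" using self0 in_n assms(2) DD0[OF assms(2)] by (metis mult_nonneg_nonneg zero_le_numeral)
qed (use assms in auto)

end

text \<open>
  A completed decoder state: \<open>Cs\<close> are the discovered clusters, \<open>xc\<close> their approximate centres,
  \<open>E\<close> the markers with the clusters \<open>As\<close> they belong to, and \<open>W\<close> the witnesses.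
\<close>

locale completed = target +
 fixes Cs :: "nat set list" and xc :: "nat list" and E :: "(nat \<times> real \<times> bool) list"
  and As :: "nat set list" and W :: "(nat \<times> nat) list" and pl :: "nat => nat option" and d :: dstate
 assumes Cs: "distinct Cs" "set Cs<=P" "length xc = length Cs"
  and CsB: "length Cs<=B" "length Cs<=k"
  and centre: "!!j. j<length Cs ==> xc ! j<n & (EX w:Cs ! j. dd (xc ! j) w<=DD (Cs ! j))"
  and lenE: "length As = length E"
  and marker: "!!b. b<length E ==> EX e h nr. E ! b = (e, DD h, nr) & par (As ! b) = Some h & h : set Cs & e<n &
    (EX w:As ! b. dd e w<=DD h/th) & (nr <-> (EX C:P. DD h<=DD C & (EX p:C. dd e p<=8*(DD h/th))))"
  and announced: "!!j C. j<length Cs ==> C : P ==> DD (Cs ! j)<th*DD C ==>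
    close C (Cs ! j) (8*DD (Cs ! j)) ==> C : set Cs"
  and marked: "!!j a. j<length Cs ==> par a = Some (Cs ! j) ==> a : set As"
  and separated: "!!j C p. j<length Cs ==> C : P ==> C ~= Cs ! j ==> DD (Cs ! j)<=DD C ==> p : C ==>
    dd (xc ! j) p<=2*DD (Cs ! j) ==> EX y. (j, y) : set W & (ALL p:C. DD (Cs ! j)+dl<dd y p)"
  and witness: "!!w y. (w, y) : set W ==> w<length Cs & (ALL p:Cs ! w. dd y p<=DD (Cs ! w)+dl)"
  and covering: "!!p. p<n ==> EX j<length Cs. dd (xc ! j) p<=2*DD (Cs ! j) & ~ blocked E (DD (Cs ! j)) p"
  and d_ents: "ents d = E" and d_rads: "rads d = map DD Cs"
  and pl_some: "!!p i. p<n ==> pl p = Some i ==> i<length Cs & dd (xc ! i) p<=2*DD (Cs ! i) &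
    (ALL (e, s, nr):set E. s<=DD (Cs ! i) --> dd e p<=8*(s/th) -->
    nr & (DD (Cs ! i)/th < s --> dd (xc ! i) e<=3*DD (Cs ! i) --> (EX c:Cs ! i. dd e c<=8*(s/th)))) &
    (ALL y. (i, y) : set W --> dd y p<=DD (Cs ! i)+dl)"
  and pl_cluster: "!!p i. i<length Cs ==> p : Cs ! i ==> EX j. pl p = Some j & DD (Cs ! j)<=DD (Cs ! i)"
begin

lemma CsP: "j<length Cs ==> Cs ! j : P" using Cs by auto

lemma centre_close: 
 assumes "j<length Cs" "l : P" "p : l" "dd (xc ! j) p<=2*DD (Cs ! j)"
 shows "close l (Cs ! j) (3*DD (Cs ! j))"
proof -
 obtain w where w: "w : Cs ! j" "dd (xc ! j) w<=DD (Cs ! j)" "xc ! j<n" using centre assms by blast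
 have "dd p w<=dd p (xc ! j)+dd (xc ! j) w" using tri in_n assms w CsP by blast
 thus ?thesis using assms w symd[of p "xc ! j"] unfolding close_def by force
qed

text \<open>A neighbour that is not smaller by the factor \<open>th\<close> would have been
  announced.\<close>

lemma hidden_small:
 assumes "j<length Cs" "l : P" "l ~: set Cs" "p : l" "dd (xc ! j) p<=2*DD (Cs ! j)"
 shows "th*DD l<=DD (Cs ! j)" "close l (Cs ! j) (3*DD (Cs ! j))" "l ~= Cs ! j"
proof -
 show c: "close l (Cs ! j) (3*DD (Cs ! j))" using centre_close assms by blast
 hence "close l (Cs ! j) (8*DD (Cs ! j))" using close_mono DD0[OF CsP[OF assms(1)]] by auto
 thus "th*DD l<=DD (Cs ! j)" using announced[OF assms(1,2)] assms(3) by force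
 show "l ~= Cs ! j" using assms by auto
qed

text \<open>In units of \<open>s/th\<close>: the marker is within 1 of its cluster
  \<open>As ! b\<close>, which has size at most 1, and \<open>l\<close> stays within 5 of it. The
  total 7 is below 8.\<close>

lemma region:
 assumes "b<length E" "E ! b = (e, s, nr)" "ALL p:l. EX w:As ! b. dd p w<=5*DD (As ! b)" "l : P" "p : l"
 shows "dd e p<=8*(s/th)"
proof -
 obtain h where h: "s = DD h" "par (As ! b) = Some h" "e<n" and "EX w:As ! b. dd e w<=DD h/th" using marker[OF assms(1)] assms(2) by auto
 then obtain u where u: "u : As ! b" "dd e u<=DD h/th" by blast
 obtain w where w: "w : As ! b" "dd p w<=5*DD (As ! b)" using assms by blast
 have a: "As ! b : P" "th*DD (As ! b)<=DD h" using par_hid[OF h(2)] by (auto simp: hid_def)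
 hence "DD (As ! b)<=DD h/th" by (simp add: field_simps)
 moreover have "dd e p<=dd e u+(dd u w+dd w p)" using tri[of e u p] tri[of u w p] in_n a(1) u w h(3) assms(4,5) by (meson add_left_mono order_trans)
 moreover have "dd u w<=DD (As ! b)" using DDge a u w by blast
 moreover have "0<=DD h/th" using hid_pos[OF par_hid[OF h(2)]] by (simp add: less_imp_le)
 ultimately show ?thesis using u w symd[of w p] unfolding h(1) by linarith
qed

text \<open>\<open>p\<close> lies in an undiscovered \<open>l\<close> but was given to cluster
  \<open>i\<close>. Climbing from \<open>l\<close> leads to some \<open>a\<close> whose parent
  \<open>h\<close> is comparable with \<open>i\<close>; \<open>h\<close> was announced, so
  \<open>a\<close> was marked, and the ball of that marker contains \<open>l\<close>. Since
  \<open>p\<close> survived the deletions for \<open>i\<close>, the marker is flagged and was kept,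
  which means that cluster \<open>i\<close> has a point in its ball.\<close>

lemma piece:
 assumes "p<n" "pl p = Some i" "l : P" "p : l" "l ~: set Cs"
 shows "EX b<length E. EX e s. E ! b = (e, s, True) & s<=DD (Cs ! i) & (ALL p:l. dd e p<=8*(s/th)) &
   (EX c:Cs ! i. dd e c<=8*(s/th)) & th*DD l <= s"
proof -
 note ps = pl_some[OF assms(1,2)]
 have i: "i<length Cs" and x: "dd (xc ! i) p<=2*DD (Cs ! i)" using ps by auto
 note hs = hidden_small[OF i assms(3,5,4) x]
 obtain a h where a: "a : P" "par a = Some h" "DD h<=DD (Cs ! i)" "DD (Cs ! i)<th*DD h"
   "close h (Cs ! i) (8*DD (Cs ! i))" "ALL p:l. EX w:a. dd p w<=5*DD a" "DD l<=DD a" using climb0[OF CsP[OF i] assms(3) hs(3,1,2)] by blast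
 have hid: "hid h a" using par_hid a by blast
 have "h : set Cs" using announced[OF i _ a(4,5)] hid by (auto simp: hid_def)
 hence "a : set As" using marked a(2) by (metis in_set_conv_nth)
 then obtain b where b: "b<length E" "As ! b = a" using lenE by (metis in_set_conv_nth)
 obtain e nr where e: "E ! b = (e, DD h, nr)" using marker[OF b(1)] b a(2) by auto
 have reg: "ALL p:l. dd e p<=8*(DD h/th)" using region[OF b(1) e] a(6) b(2) assms(3) by auto
 have "E ! b : set E" using b by auto
 hence in_E: "(e, DD h, nr) : set E" using e by simp
 have keep: "nr & (DD (Cs ! i)/th<DD h --> dd (xc ! i) e<=3*DD (Cs ! i) --> (EX c:Cs ! i. dd e c<=8*(DD h/th)))" using ps in_E a(3) reg assms(4) by fastforce
 have "DD (Cs ! i)/th<DD h" using a(4) by (simp add: divide_less_eq mult.commute)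
 moreover have "dd (xc ! i) e<=3*DD (Cs ! i)"
 proof -
  have "8*(DD h/th)<=DD (Cs ! i)"
  proof -
   have "8*DD h<=th*DD h" using theta hid_pos[OF hid] by (intro mult_right_mono) auto
   hence "8*(DD h/th)<=DD h" by (simp add: field_simps)
   thus ?thesis using a(3) by simp
  qed
  moreover have "dd (xc ! i) e<=dd (xc ! i) p+dd p e" using tri centre[OF i] assms(1) marker[OF b(1)] e by auto
  ultimately show ?thesis using x reg assms(4) symd[of p e] by fastforce
 qed
 ultimately have "EX c:Cs ! i. dd e c<=8*(DD h/th)" using keep by blast
 moreover have "th*DD l<=DD h"
 proof -
  have "th*DD l<=th*DD a" using a(7) by simp
  also have "th*DD a<=DD h" using hid by (simp add: hid_def)
  finally show ?thesis .
 qed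
 ultimately show ?thesis using b(1) e keep a(3) reg by (intro exI[of _ b] conjI exI[of _ e] exI[of _ "DD h"]) simp_all
qed

text \<open>A competitor for a point of cluster \<open>i\<close> is no larger than \<open>i\<close>.
  Such a competitor has a witness that is too far from all of cluster \<open>i\<close>, so it cannot
  receive the point.\<close>

lemma own: "i<length Cs ==> p : Cs ! i ==> pl p = Some i"
proof -
 assume i: "i<length Cs" "p : Cs ! i"
 obtain j where j: "pl p = Some j" "DD (Cs ! j)<=DD (Cs ! i)" using pl_cluster i by blast
 have p: "p<n" using in_n CsP i by blast
 note ps = pl_some[OF p j(1)]
 have "j = i"
 proof (rule ccontr)
  assume "j ~= i"
  hence "Cs ! i ~= Cs ! j" using Cs(1) i ps by (auto simp: nth_eq_iff_index_eq)
  from separated[OF _ CsP[OF i(1)] this j(2) i(2)] ps obtain y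
   where "(j, y) : set W" "ALL p:Cs ! i. DD (Cs ! j)+dl<dd y p" by blast
  thus False using ps i(2) by force
 qed
 thus ?thesis using j by simp
qed

text \<open>Climb from \<open>l\<close> along parents to the first \<open>a\<close> whose parent is
  discovered. It carries a marker, and the ball of the marker contains \<open>l\<close>.\<close>

lemma undiscovered:
 assumes "l : P" "l ~: set Cs"
 shows "EX b<length E. EX e s. E ! b = (e, s, True) & (ALL p:l. dd e p<=8*(s/th)) & th*DD l <= s"
proof -
 have step: "EX i. i : P & hid i a" if a: "a : P" "a ~: set Cs" for a
 proof -
  obtain p where p: "p : a" using nonempty a by blast
  obtain j where j: "j<length Cs" "dd (xc ! j) p<=2*DD (Cs ! j)" using covering[OF in_n[OF a(1) p]] by blast
  note hs = hidden_small[OF j(1) a p j(2)]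
  have "close a (Cs ! j) (4*DD (Cs ! j))" using close_mono[OF hs(2)] DD0[OF CsP[OF j(1)]] by simp
  thus ?thesis using hs CsP[OF j(1)] a by (intro exI[of _ "Cs ! j"]) (auto simp: hid_def)
 qed
 have "EX a h. a : P & a ~: set Cs & par a = Some h & h : set Cs & (ALL p:l. EX w:a. dd p w<=5*DD a) & DD l<=DD a"
  if "a : P" "a ~: set Cs" "ALL p:l. EX w:a. dd p w<=5*DD a" "DD l<=DD a" for a using that
 proof (induction "card {C : P. DD a<DD C}" arbitrary: a rule: less_induct)
  case less
  obtain i where i: "hid i a" using step less by blast
  obtain h where h: "par a = Some h" "hid h a" using par_ex[OF i] by blast
  have hP: "h : P" "close a h (4*DD h)" using h by (auto simp: hid_def)
  show ?case
  proof (cases "h : set Cs")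
   case True thus ?thesis using less h by blast
  next
   case False
   show ?thesis
   proof (rule less(1)[of h])
    have "{C : P. DD h<DD C} \<subset> {C : P. DD a<DD C}" using hid_less[OF h(2)] hP by auto
    thus "card {C : P. DD h<DD C}<card {C : P. DD a<DD C}" using finP by (intro psubset_card_mono) auto
    show "ALL p:l. EX w:h. dd p w<=5*DD h"
    proof
    fix p assume p: "p : l"
    then obtain w where w: "w : a" "dd p w<=5*DD a" using less by blast
    obtain u v where uv: "u : a" "v : h" "dd u v<=4*DD h" using hP by (auto simp: close_def)
    have "dd p v<=dd p w+(dd w u+dd u v)" using tri[of p w v] tri[of w u v] in_n[OF assms(1) p] in_n[OF less(2) w(1)] in_n[OF less(2) uv(1)]
    in_n[OF hP(1) uv(2)] by linarith
    moreover have "1024*DD a<=DD h" using mult_right_mono[OF theta DD0[OF less(2)]] h(2) by (auto simp: hid_def)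
    ultimately show "EX w:h. dd p w<=5*DD h" using w uv DDge[of a w u] less(2) DD0[OF less(2)] by (intro bexI[of _ v]) linarith+
    qed
    show "DD l<=DD h" using less hid_less[OF h(2)] by simp
   qed (use hP False in auto)
  qed
 qed
 moreover have "ALL p:l. EX w:l. dd p w<=5*DD l" using self0 in_n assms(1) DD0[OF assms(1)] by (metis mult_nonneg_nonneg zero_le_numeral)
 ultimately obtain a h where a: "a : P" "a ~: set Cs" "par a = Some h" "h : set Cs"
   "ALL p:l. EX w:a. dd p w<=5*DD a" "DD l<=DD a" using assms by blast
 have hid: "hid h a" using par_hid a by blast
 have "a : set As" using marked a(3,4) by (metis in_set_conv_nth)
 then obtain b where b: "b<length E" "As ! b = a" using lenE by (metis in_set_conv_nth)
 obtain e nr where e: "E ! b = (e, DD h, nr)" "e<n" "EX w:a. dd e w<=DD h/th" using marker[OF b(1)] b a(3) by auto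
 have reg: "ALL p:l. dd e p<=8*(DD h/th)" using region[OF b(1) e(1)] a(5) b(2) assms(1) by auto
 \<comment> \<open>Otherwise a point of \<open>a\<close> near the marker is covered by a discovered
   cluster that is not blocked there, hence is smaller than \<open>h\<close>. That cluster hides
   \<open>a\<close> as well, against the minimality in \<open>par a\<close>.\<close>
 have nr
 proof (rule ccontr)
  assume nr: "~ nr"
  obtain w where w: "w : a" "dd e w<=DD h/th" using e by blast
  obtain j where j: "j<length Cs" "dd (xc ! j) w<=2*DD (Cs ! j)" "~ blocked E (DD (Cs ! j)) w" using covering[OF in_n[OF a(1) w(1)]] by blast
  have "(e, DD h, nr) : set E" using e b by (metis nth_mem)
  moreover have "dd e w<=8*(DD h/th)" using w hid_pos[OF hid] by (simp add: field_simps)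
  ultimately have lt: "DD (Cs ! j)<DD h" using j(3) nr unfolding blocked_def by fastforce
  note hs = hidden_small[OF j(1) a(1,2) w(1) j(2)]
  have "close a (Cs ! j) (4*DD (Cs ! j))" using close_mono[OF hs(2)] DD0[OF CsP[OF j(1)]] by simp
  hence "hid (Cs ! j) a" using hs CsP[OF j(1)] a by (auto simp: hid_def)
  thus False using par_ex a(3) lt by fastforce
 qed
 moreover have "th*DD l<=DD h"
 proof -
  have "th*DD l<=th*DD a" using a(6) by simp
  also have "th*DD a<=DD h" using hid by (simp add: hid_def)
  finally show ?thesis .
 qed
 ultimately show ?thesis using b(1) e(1) reg by (intro exI[of _ b] conjI exI[of _ e] exI[of _ "DD h"]) simp_all
qed


lemma rho_arith1: "(u::real)<=8*t ==> t <= R ==> 0 <= R ==> u<=17 * R+32*(R - t)" by argo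
lemma rho_arith2: "(t::real) <= R ==> 0<=t ==> 8*t+(17 * R+32*(R - t))<=57 * R" by argo
lemma rho_arith3: "(u::real)<=a+(e+f) ==> a<=D ==> e<=57 * R+57*t ==> f<=S - 57*t - 57*l ==>
   u<=(D+114 * R)+S - 57 * R - 57*l" by argo

lemma rho_arith4: "1024*(t::real)<=u ==> 0<=t ==> 8*t+8*u+(17 * R+32*(R - u))<=17 * R+32*(R - t)" by argo

lemma rho_arith5: "0<=(R::real) ==> 16 * R<=57 * R" by argo

abbreviation rho :: "nat => real" where "rho i \<equiv> DD (Cs ! i)/th"

definition nearby :: "nat => nat => real => bool" where
 "nearby p i s <-> (EX c:Cs ! i. dd p c <= s)"

lemma nearby_mono: "nearby p i s ==> s <= s' ==> nearby p i s'" unfolding nearby_def by force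

lemma nearby_move:
 "nearby p i s ==> dd u p <= s' ==> u<n ==> p<n ==> i<length Cs ==> nearby u i (s' + s)" unfolding nearby_def by (smt (verit) CsP in_n tri)

lemma rho0: "i<length Cs ==> 0<=rho i" using DD0[OF CsP] by simp

lemma marker_less: "b<length E ==> E ! b = (e, s, nr) ==> e<n & 0 < s" using marker[of b] hid_pos par_hid by fastforce

lemma node_cluster: "i : nodes d pl p ==> i<B ==> pl p = Some i" by (auto simp: nodes_def)

lemma cluster_node: "pl p = Some i ==> i : nodes d pl p" by (auto simp: nodes_def)

lemma hub_node:
 "b<length E ==> E ! b = (e, s, True) ==> dd e p<=8*(s/th) ==>
  (!!i. pl p = Some i ==> i<length Cs & s<=DD (Cs ! i)) ==> B+b : nodes d pl p" by (auto simp: nodes_def hub_def d_ents d_rads split: option.splits)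

text \<open>A foreign point reaches the cluster through the marker of \<open>piece\<close>: 8 units
  to the marker and 8 from there to the cluster.\<close>

lemma labelled_nearby:
 assumes "p<n" "pl p = Some i"
 shows "nearby p i (16*rho i)"
proof -
 obtain l where l: "l : P" "p : l" using cluster_of assms by blast
 have i: "i<length Cs" using pl_some[OF assms] by simp
 show ?thesis
 proof (cases "l : set Cs")
  case True
  then obtain j where j: "j<length Cs" "Cs ! j = l" by (metis in_set_conv_nth)
  hence "j = i" using own[OF j(1), of p] l assms by simp
  thus ?thesis using j l self0[OF assms(1)] rho0[OF i] unfolding nearby_def by (intro bexI[of _ p]) auto
 next
  case False
  obtain b e s where b: "b<length E" "E ! b = (e, s, True)" "s<=DD (Cs ! i)" "ALL p:l. dd e p<=8*(s/th)"
   "EX c:Cs ! i. dd e c<=8*(s/th)" using piece[OF assms l False] by blast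
  have "nearby e i (8*(s/th))" using b(5) by (simp add: nearby_def)
  from nearby_move[OF this _ assms(1) _ i, of "8*(s/th)"] b(4) l marker_less[OF b(1,2)] symd[of p e]
  have "nearby p i (8*(s/th)+8*(s/th))" by auto
  moreover have "s/th<=rho i" using b(3) by (simp add: divide_right_mono)
  ultimately show ?thesis by (elim nearby_mono) linarith
 qed
qed

definition lab_fun :: "(nat => nat) => bool" where
 "lab_fun lb <-> (ALL u v. lb u = lb v <-> (u, v) : (links d pl)\<^sup>*) & (ALL u. lb u<=u)"

lemma lab_same: "lab_fun lb ==> p<n ==> u : nodes d pl p ==> v : nodes d pl p ==> lb u = lb v" unfolding lab_fun_def links_def by blast

text \<open>A marker's component contains a cluster close to it, found by climbing along larger markers.\<close>

lemma hub_near: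
 assumes "lab_fun lb" and "b<length E" "E ! b = (e, s, True)"
 shows "EX i<length Cs. lb i = lb (B+b) & s<=DD (Cs ! i) & nearby e i (17*rho i+32*(rho i - s/th))" using assms(2,3)
proof (induction "card {b'. b'<length E & s<fst (snd (E ! b'))}" arbitrary: b e s rule: less_induct)
 case less
 obtain C p where C: "C : P" "s<=DD C" "p : C" "dd e p<=8*(s/th)" using marker[OF less(2)] less(3) by auto
 have es: "e<n" "0 < s" using marker_less less by blast+
 have p: "p<n" using in_n C by blast
 show ?case
 proof (cases "C : set Cs")
  case True
  then obtain i where i: "i<length Cs" "Cs ! i = C" by (metis in_set_conv_nth)
  have pl: "pl p = Some i" using own[OF i(1)] C i by simp
  have "B+b : nodes d pl p" by (rule hub_node[OF less(2,3) C(4)]) (use pl i C in auto)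
  hence "lb i = lb (B+b)" using lab_same[OF assms(1) p cluster_node[OF pl]] by simp
  moreover have le: "s/th<=rho i" using C i by (simp add: divide_right_mono)
  hence "nearby e i (17*rho i+32*(rho i - s/th))" unfolding nearby_def using C(3) i(2) rho_arith1[OF C(4) le rho0[OF i(1)]] by (intro bexI[of _ p]) auto
  ultimately show ?thesis using i C by blast
 next
  case False
  show ?thesis
  proof (cases "pl p")
   case (Some i)
   have i: "i<length Cs" using pl_some[OF p Some] by simp
   obtain b2 e2 s2 where b2: "b2<length E" "E ! b2 = (e2, s2, True)" "s2<=DD (Cs ! i)" "th*DD C <= s2" using piece[OF p Some C(1,3) False] by blast
   have s2: "th * s<=DD (Cs ! i)"
   proof -
    have "th * s<=th*DD C" using C(2) by simp
    thus ?thesis using b2 by linarith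
   qed
   have "1024 * s<=th * s" using theta es by (intro mult_right_mono) auto
   hence "8 * s<=DD (Cs ! i)" using s2 es by argo
   hence s3: "s<=DD (Cs ! i)" "8*(s/th)<=rho i" using es divide_right_mono[of "8 * s" "DD (Cs ! i)" th] by simp_all
   have "B+b : nodes d pl p" by (rule hub_node[OF less(2,3) C(4)]) (use Some i s3 in auto)
   hence "lb i = lb (B+b)" using lab_same[OF assms(1) p cluster_node[OF Some]] by simp
   moreover have "nearby e i (8*(s/th)+16*rho i)" by (rule nearby_move[OF labelled_nearby[OF p Some] C(4) es(1) p i])
   hence "nearby e i (17*rho i+32*(rho i - s/th))" by (rule nearby_mono) (use s3 rho0[OF i] es in "simp add: field_simps")
   ultimately show ?thesis using i s3 by blast
  next
   case None
   \<comment> \<open>\<open>p\<close> is assigned to nobody, so the marker found for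
     \<open>C\<close> and the given one are both hubs at \<open>p\<close>. The new marker is larger
     by at least 1024, and the induction continues with it.\<close>
   obtain b2 e2 s2 where b2: "b2<length E" "E ! b2 = (e2, s2, True)" "ALL p:C. dd e2 p<=8*(s2/th)"
    "th*DD C <= s2" using undiscovered[OF C(1) False] by blast
   have s2: "1024 * s <= s2"
   proof -
    have "1024 * s<=th*DD C" using theta C(2) es(2) by (intro mult_mono) auto
    thus ?thesis using b2 by simp
   qed
   have "card {b'. b'<length E & s2<fst (snd (E ! b'))}<card {b'. b'<length E & s<fst (snd (E ! b'))}"
   proof (rule psubset_card_mono)
    have "b2 : {b'. b'<length E & s<fst (snd (E ! b'))}" using b2 s2 es by simp
    moreover have "b2 ~: {b'. b'<length E & s2<fst (snd (E ! b'))}" using b2 by simp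
    moreover have "{b'. b'<length E & s2<fst (snd (E ! b'))}<={b'. b'<length E & s<fst (snd (E ! b'))}" using s2 es by auto
    ultimately show "{b'. b'<length E & s2<fst (snd (E ! b'))} \<subset> {b'. b'<length E & s<fst (snd (E ! b'))}" by blast
   qed simp
   from less(1)[OF this b2(1,2)] obtain i where i: "i<length Cs" "lb i = lb (B+b2)" "s2<=DD (Cs ! i)"
    "nearby e2 i (17*rho i+32*(rho i - s2/th))" by blast
   have "dd e2 p<=8*(s2/th)" using b2(3) C(3) by blast
   hence "B+b : nodes d pl p" "B+b2 : nodes d pl p" using None by (auto intro!: hub_node[OF less(2,3) C(4)] hub_node[OF b2(1,2)])
   hence "lb (B+b) = lb (B+b2)" by (rule lab_same[OF assms(1) p])
   hence "lb i = lb (B+b)" using i(2) by simp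
   moreover have "dd e e2<=8*(s/th)+8*(s2/th)"
   proof -
    have "dd e e2<=dd e p+dd p e2" using tri es p marker_less[OF b2(1,2)] by blast
    moreover have "dd p e2<=8*(s2/th)" using b2(3) C(3) symd[of p e2] by simp
    ultimately show ?thesis using C(4) by linarith
   qed
   hence "nearby e i (8*(s/th)+8*(s2/th)+(17*rho i+32*(rho i - s2/th)))" using nearby_move[OF i(4) _ es(1) _ i(1)] marker_less[OF b2(1,2)] by blast
   hence "nearby e i (17*rho i+32*(rho i - s/th))"
   proof (rule nearby_mono)
    \<comment> \<open>The distance bound telescopes: moving to the larger marker costs
      \<open>8*(s/th) + 8*(s2/th)\<close>, which the drop of \<open>32*(rho i - s/th)\<close> pays
      for.\<close>
    have "1024*(s/th) <= s2/th" using s2 by (simp add: field_simps)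
    moreover have "0 <= s/th" using es by simp
    ultimately show "8*(s/th)+8*(s2/th)+(17*rho i+32*(rho i - s2/th))
    <=17*rho i+32*(rho i - s/th)" by (rule rho_arith4)
   qed
   ultimately show ?thesis using i s2 es by fastforce
  qed
 qed
qed

text \<open>The constant 57 is \<open>8 + 17 + 32\<close>: the radius of the marker ball and the
  distance from the marker to a cluster given by \<open>hub_near\<close>.\<close>

lemma node_near:
 assumes "lab_fun lb" "v : nodes d pl p" "p<n"
 shows "EX i<length Cs. lb i = lb v & (ALL p<n. v : nodes d pl p --> nearby p i (57*rho i))"
proof (cases "v<B")
 case True
 have "nearby p' v (57*rho v)" if "p'<n" "v : nodes d pl p'" for p'
 proof -
  have pl: "pl p' = Some v" using node_cluster that True by blast
  hence "v<length Cs" using pl_some[OF that(1)] by simp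
  thus ?thesis using nearby_mono[OF labelled_nearby[OF that(1) pl] rho_arith5[OF rho0]] by blast
 qed
 moreover have "v<length Cs" using node_cluster[OF assms(2) True] pl_some[OF assms(3)] by simp
 ultimately show ?thesis by blast
next
 case False
 have "v ~= i" if "pl p' = Some i" "p'<n" for i p' using False pl_some[OF that(2,1)] CsB by auto
 hence hub: "EX b. v = B+b & hub d pl b p'" if "v : nodes d pl p'" "p'<n" for p' using that unfolding nodes_def by blast
 then obtain b where b: "v = B+b" "hub d pl b p" using assms by blast
 then obtain e s where e: "b<length E" "E ! b = (e, s, True)" by (auto simp: hub_def d_ents split: prod.splits)
 obtain i where i: "i<length Cs" "lb i = lb (B+b)" "s<=DD (Cs ! i)"
   "nearby e i (17*rho i+32*(rho i - s/th))" using hub_near[OF assms(1) e] by blast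
 have "nearby p' i (57*rho i)" if "p'<n" "v : nodes d pl p'" for p'
 proof -
  have "hub d pl b p'" using hub[OF that(2,1)] b(1) by auto
  hence "dd p' e<=8*(s/th)" using e symd[of p' e] by (auto simp: hub_def d_ents)
  from nearby_move[OF i(4) this that(1) _ i(1)] marker_less[OF e]
  have "nearby p' i (8*(s/th)+(17*rho i+32*(rho i - s/th)))" by blast
  moreover have "s/th<=rho i" "0 <= s/th" using i(3) marker_less[OF e] by (auto simp: divide_right_mono)
  ultimately show ?thesis using nearby_mono[OF _ rho_arith2] by blast
 qed
 thus ?thesis using i b(1) by blast
qed

lemma nodes_nonempty: "p<n ==> EX u. u : nodes d pl p" by (metis cluster_of cluster_node own in_set_conv_nth option.discI undiscovered hub_node)

text \<open>Each target cluster lies in a single component.\<close>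

lemma cluster_label:
 assumes "lab_fun lb" "l : P"
 shows "EX c. ALL p:l. ALL u:nodes d pl p. lb u = c"
proof -
 have single: ?thesis if "EX v. ALL p:l. v : nodes d pl p" using that lab_same[OF assms(1)] in_n[OF assms(2)] by metis
 show ?thesis
 proof (cases "l : set Cs")
  case True
  then obtain i where "i<length Cs" "Cs ! i = l" by (metis in_set_conv_nth)
  thus ?thesis using own cluster_node by (intro single) blast
 next
  case False
  let ?L = "{i. EX p:l. pl p = Some i}"
  have "?L<={..<length Cs}" using pl_some in_n[OF assms(2)] by auto
  hence fin: "finite ?L" using finite_subset by blast
  show ?thesis
  proof (cases "?L = {}")
   case True
   obtain b e s where "b<length E" "E ! b = (e, s, True)" "ALL p:l. dd e p<=8*(s/th)" using undiscovered[OF assms(2) False] by blast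
   thus ?thesis using True hub_node by (intro single exI[of _ "B+b"]) fastforce
  next
   case ne: False
   \<comment> \<open>The smallest cluster that receives a point of \<open>l\<close> provides, via
     \<open>piece\<close>, a marker of scale at most the radius of every cluster receiving points of
     \<open>l\<close>. It is therefore a hub at all points of \<open>l\<close>.\<close>
   hence "Min ((%i. DD (Cs ! i)) ` ?L) : (%i. DD (Cs ! i)) ` ?L" using fin by (intro Min_in) auto
   then obtain i p where i: "DD (Cs ! i) = Min ((%i. DD (Cs ! i)) ` ?L)" "p : l" "pl p = Some i" by auto
   have le: "DD (Cs ! i)<=DD (Cs ! j)" if "p' : l" "pl p' = Some j" for j p' using fin that unfolding i(1) by (intro Min_le) auto
   obtain b e s where b: "b<length E" "E ! b = (e, s, True)" "s<=DD (Cs ! i)" "ALL p:l. dd e p<=8*(s/th)" using piece[OF in_n[OF assms(2) i(2)] i(3) assms(2) i(2) False] by blast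
   have "B+b : nodes d pl p'" if "p' : l" for p' using that b le[OF that] pl_some[OF in_n[OF assms(2) that]] by (intro hub_node[OF b(1,2)]) force+
   thus ?thesis by (intro single) blast
  qed
 qed
qed

text \<open>\<open>114 = 2*57\<close>: a path through cluster \<open>i\<close> pays at most
  \<open>57*rho i\<close> for entering and again for leaving it.\<close>

definition wt :: "nat => real" where "wt i = DD (Cs ! i)+114*rho i"

definition nbr :: "(nat \<times> nat) set" where
 "nbr = {(i, j). i<length Cs & j<length Cs & (EX c:Cs ! i. EX c':Cs ! j. dd c c'<=57*rho i+57*rho j)}"

lemma nbrI:
 assumes "nearby p i (57*rho i)" "nearby p j (57*rho j)" "i<length Cs" "j<length Cs" "p<n"
 shows "(i, j) : nbr"
proof -
 obtain c c' where c: "c : Cs ! i" "dd p c<=57*rho i" "c' : Cs ! j" "dd p c'<=57*rho j" using assms by (auto simp: nearby_def)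
 have "dd c c'<=dd c p+dd p c'" using tri c assms in_n CsP by blast
 thus ?thesis unfolding nbr_def using c assms symd[of c p] by force
qed

text \<open>Each node on a path of the merging graph is replaced by a cluster of the same component
  that is near all points of the node. Consecutive nodes share a point, so consecutive
  representatives are neighbours.\<close>

lemma linked_path:
 assumes lb: "lab_fun lb" and i: "i<length Cs" and j: "j<length Cs" and eq: "lb i = lb j"
 shows "(i, j) : {(u, v) : nbr. lb u = lb i & lb v = lb i}\<^sup>*"
proof -
 let ?R = "{(u, v) : nbr. lb u = lb i & lb v = lb i}"
 let ?rep = "%v i'. i'<length Cs & lb i' = lb v & (ALL p<n. v : nodes d pl p --> nearby p i' (57*rho i'))"
 have rep_self: "?rep v v" if v: "v<length Cs" for v using node_cluster v CsB nearby_mono labelled_nearby rho_arith5 rho0 by fastforce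
 have "(i, j) : (links d pl)\<^sup>*" using lb eq by (simp add: lab_fun_def)
 hence "ALL i'. ?rep j i' --> (i, i') : ?R\<^sup>*"
 proof (induction rule: rtrancl_induct)
  case base
  show ?case
  proof (intro allI impI)
   fix i' assume r: "?rep i i'"
   obtain p where p: "p : Cs ! i" using nonempty CsP i by blast
   have pn: "p<n" using in_n CsP i p by blast
   have "i : nodes d pl p" using own[OF i p] cluster_node by blast
   hence "nearby p i (57*rho i)" "nearby p i' (57*rho i')" using r rep_self[OF i] pn by blast+
   hence "(i, i') : nbr" using nbrI i r pn by blast
   thus "(i, i') : ?R\<^sup>*" using r by blast
  qed
 next
  case (step v w)
  show ?case
  proof (intro allI impI)
   fix i' assume r: "?rep w i'"
   obtain p where p: "p<n" "v : nodes d pl p" "w : nodes d pl p" using step(2) by (auto simp: links_def)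
   obtain i1 where i1: "?rep v i1" using node_near[OF lb p(2,1)] by blast
   have 1: "(i, i1) : ?R\<^sup>*" using step(3) i1 by blast
   have "lb i = lb v" using step(1) lb by (simp add: lab_fun_def)
   moreover have "lb v = lb w" using lab_same[OF lb p] .
   moreover have "(i1, i') : nbr" using nbrI[OF _ _ _ _ p(1)] i1 r p by blast
   ultimately have "(i1, i') : ?R" using i1 r by simp
   with 1 show "(i, i') : ?R\<^sup>*" by (rule rtrancl_into_rtrancl)
  qed
 qed
 thus ?thesis using rep_self[OF j] by blast
qed

text \<open>The outer allowance of the two end clusters is not consumed;
  \<open>component_diam\<close> spends it on reaching points outside these clusters.\<close>

lemma path_length:
 assumes "ps ~= []" "successively (%u v. (u, v) : nbr) ps" "set ps<={..<length Cs}" "a : Cs ! hd ps" "b : Cs ! last ps"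
 shows "dd a b <= sum_list (map wt ps) - 57*rho (hd ps) - 57*rho (last ps)" using assms
proof (induction ps arbitrary: a rule: induct_list012)
 case (2 x)
 thus ?case using DDge[OF CsP, of x a b] by (simp add: wt_def)
next
 case (3 x y ps)
 obtain c c' where c: "c : Cs ! x" "c' : Cs ! y" "dd c c'<=57*rho x+57*rho y" using 3(4) by (auto simp: nbr_def)
 have l: "last (y # ps) : set (y # ps)" by (rule last_in_set) simp
 have lt: "x<length Cs" "y<length Cs" "last (y # ps)<length Cs" using 3(5) l by auto
 have "dd c' b <= sum_list (map wt (y # ps)) - 57*rho y - 57*rho (last (y # ps))" using 3(2)[of c'] 3(4-7) c by simp
 moreover have "a : Cs ! x" "b : Cs ! last (y # ps)" using 3(6,7) by auto
 hence "dd a b<=dd a c+(dd c c'+dd c' b)" "dd a c<=DD (Cs ! x)" using tri[of a c b] tri[of c c' b] in_n CsP[OF lt(1)] CsP[OF lt(2)] CsP[OF lt(3)] c DDge[OF CsP[OF lt(1)]] by force+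
 ultimately have "dd a b<=wt x + sum_list (map wt (y # ps)) - 57*rho x - 57*rho (last (y # ps))" unfolding wt_def[of x] using c(3) rho_arith3 by blast
 thus ?case by simp
qed simp

lemma successively_closed:
 "successively Q ps ==> ps ~= [] ==> hd ps : S ==> (!!u v. Q u v ==> v : S) ==> set ps<=S" by (induction ps rule: induct_list012) auto

text \<open>Both points are near clusters of the component, and these are joined by a simple path of
  neighbouring clusters. The walk along it costs at most the sum of \<open>wt\<close> over the
  path.\<close>

lemma component_diam:
 assumes lb: "lab_fun lb" and p: "p<n" "p'<n" "u : nodes d pl p" "v : nodes d pl p'" "lb u = c" "lb v = c"
 shows "dd p p' <= sum wt {i. i<length Cs & lb i = c}"
proof -
 let ?S = "{i. i<length Cs & lb i = c}"
 obtain i where "i<length Cs" "lb i = lb u" and i: "ALL p<n. u : nodes d pl p --> nearby p i (57*rho i)" using node_near[OF lb p(3,1)] by (elim exE conjE) (rule that)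
 hence i: "i<length Cs" "lb i = c" "nearby p i (57*rho i)" using p by simp_all
 obtain j where "j<length Cs" "lb j = lb v" and j: "ALL p<n. v : nodes d pl p --> nearby p j (57*rho j)" using node_near[OF lb p(4,2)] by (elim exE conjE) (rule that)
 hence j: "j<length Cs" "lb j = c" "nearby p' j (57*rho j)" using p by simp_all
 have "(i, j) : {(u, v) : nbr. lb u = lb i & lb v = lb i}\<^sup>*" using linked_path[OF lb i(1) j(1)] i j by simp
 then obtain ps where ps: "ps ~= []" "hd ps = i" "last ps = j" "distinct ps"
   "successively (%u v. (u, v) : {(u, v) : nbr. lb u = lb i & lb v = lb i}) ps" by (elim rtrancl_distinct_path[THEN exE] conjE) (rule that)
 have sub: "set ps<=?S" by (rule successively_closed[OF ps(5,1)]) (use ps(2) i(1,2) in "auto simp: nbr_def")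
 obtain a b where ab: "a : Cs ! i" "dd p a<=57*rho i" "b : Cs ! j" "dd p' b<=57*rho j" using i(3) j(3) unfolding nearby_def by blast
 have "successively (%u v. (u, v) : nbr) ps" using ps(5) by (rule successively_mono) auto
 hence "dd a b <= sum_list (map wt ps) - 57*rho i - 57*rho j" using path_length[of ps a b] ps ab sub by auto
 moreover have "sum_list (map wt ps) = sum wt (set ps)" using ps(4) by (rule sum_list_distinct_conv_sum_set)
 moreover have "sum wt (set ps) <= sum wt ?S" using sub DD0[OF CsP] by (intro sum_mono2) (auto simp: wt_def)
 moreover have "dd p p'<=dd p a+(dd a b+dd b p')" using tri[of p a p'] tri[of a b p'] p ab in_n CsP[OF i(1)] CsP[OF j(1)] by force
 ultimately show ?thesis using ab symd[of b p'] by linarith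
qed

text \<open>Components consist of disjoint sets of clusters, so their budgets add up to at most
  \<open>1 + 114/th\<close> times the target cost.\<close>

theorem labelling_good:
 assumes "labelling d pl L"
 shows "ALL l:P. EX c. ALL p:l. L p = c"
  and "EX D. (ALL p<n. ALL p'<n. L p = L p' --> dd p p'<=D (L p)) & (ALL v. 0<=D v) & 
    (ALL K. finite K --> sum D K<=(1+114/th) * sum DD P)"
proof -
 obtain lb where lb: "lab_fun lb" and L: "ALL p<n. ALL u:nodes d pl p. lb u<k --> L p = lb u" using assms unfolding labelling_def lab_fun_def by blast
 \<comment> \<open>\<open>node_near\<close> puts a cluster \<open>i\<close> into the component, and
   \<open>lb i <= i < k\<close>, so the label is one of those that \<open>labelling\<close>
   fixes.\<close>
 have Leq: "L p = lb u" if pu: "p<n" "u : nodes d pl p" for p u by (metis node_near lb pu CsB lab_fun_def le_less_trans less_le_trans L)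
 show "ALL l:P. EX c. ALL p:l. L p = c" using cluster_label[OF lb] Leq nodes_nonempty in_n by metis
 let ?D = "%v. sum wt {i. i<length Cs & lb i = v}"
 have wt0: "0<=wt i" if "i<length Cs" for i using DD0[OF CsP[OF that]] by (simp add: wt_def)
 have "dd p p'<=?D (L p)" if "p<n" "p'<n" "L p = L p'" for p p' using component_diam[OF lb that(1,2)] nodes_nonempty Leq that by metis
 moreover have "0<=?D v" for v by (intro sum_nonneg) (use wt0 in auto)
 moreover have "sum ?D K<=(1+114/th) * sum DD P" if "finite K" for K
 proof -
  have "sum ?D K = sum wt (UN v:K. {i. i<length Cs & lb i = v})" using that by (intro sum.UNION_disjoint[symmetric]) auto
  also have "... <= sum wt {..<length Cs}" by (intro sum_mono2) (use wt0 in auto)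
  also have "... = (SUM i<length Cs. (1+114/th)*DD (Cs ! i))" by (intro sum.cong) (auto simp: wt_def algebra_simps)
  also have "... = (1+114/th) * sum DD (set Cs)" using Cs(1) by (simp add: sum_distrib_left[symmetric] sum_list_distinct_conv_sum_set[symmetric] sum_list_sum_nth atLeast0LessThan)
  also have "...<=(1+114/th) * sum DD P" using Cs(2) finP DD0 by (intro mult_left_mono sum_mono2) auto
  finally show ?thesis .
 qed
 ultimately show "EX D. (ALL p<n. ALL p'<n. L p = L p' --> dd p p'<=D (L p)) & (ALL v. 0<=D v) & 
    (ALL K. finite K --> sum D K<=(1+114/th) * sum DD P)" by (intro exI[of _ ?D] conjI allI impI)
qed

end

section \<open>Advice that describes a target clustering, and its length\<close>

section \<open>Advice describing a target clustering\<close>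

text \<open>\<open>tt C\<close> is the integer behind \<open>DD C\<close>, and
  \<open>tt C div 2 ^ q\<close> is the part written in unary; its sum over all clusters is what
  makes the total length linear in \<open>k\<close>.\<close>

locale guide = target +
 fixes lm :: real and tt :: "nat set => nat"
 assumes lm: "lm = th*dl" and DDtt: "!!C. C : P ==> DD C = real (tt C+1)*dl"
  and kP: "card P<=k" and k1: "1<=k" and g1: "1<=g"
  and tt_sum: "(SUM C:P. tt C div 2 ^ q)<=3*k" and B: "100*k*g*q<=B"
begin

abbreviation uu :: "nat set => nat" where "uu C \<equiv> tt C div 2 ^ q"

lemma uu_le: "C : P ==> uu C<=3*k" using tt_sum finP member_le_sum[of C P uu] by fastforce

lemma kgq: "k<=k*g*q" "q<=k*g*q" "g*q<=k*g*q" "k*g<=k*g*q" "k*q<=k*g*q" using k1 g1 q10 by auto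

lemma kgq1: "10<=k*g*q"
proof -
 have "1*1*10<=k*g*q" using k1 g1 q10 by (intro mult_mono) auto
 thus ?thesis by simp
qed

lemma steps_B: "C : P ==> q+uu C+5<B" using uu_le[of C] kgq kgq1 B by linarith

lemma name_ovf: "ov ==> snd (snd (snd (name c R tgt tp ov)))" unfolding name_def by (rule mstep_ovf) simp

lemma item_ovf: "ovf (fst st) ==> ovf (fst (item dl lm cur st))"
proof -
 assume o: "ovf (fst st)"
 have n: "ov'" if "name c R tgt tp True = (c', R', tp', ov')" for c R tgt tp c' R' tp' ov' using name_ovf[of True c R tgt tp] that by simp
 show ?thesis using o by (cases st) (auto simp: item_def Let_def dest: n split: prod.splits)
qed

lemma items_ovf: "ovf (fst st) ==> ovf (fst ((item dl lm cur ^^ m) st))" by (induction m) (auto intro: item_ovf)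

lemma name_read:
 assumes "R/2 ^ s<=tgt" "s<=B" "p<n" "c<n" "dd c p <= R" "0<=tgt"
 shows "EX bs c'. length bs<=g * s & c'<n & dd c' p<=tgt &
  (ALL rest ov. snd (snd (snd (name c R tgt (bs @ rest) ov))) | (EX R'. name c R tgt (bs @ rest) ov = (c', R', rest, ov)))" unfolding name_def by (rule mstep_read[OF assms(1-5)]) (use self0 assms in simp)

text \<open>The bits work in front of any continuation, so transitions compose by concatenation.
  After an overflow nothing is promised.\<close>

definition steps :: "nat => nat => dstate => dstate => bool" where
 "steps cur L d d' <-> (EX m<=L. EX bs. length bs<=L & (ALL rest.
   ovf (fst ((item dl lm cur ^^ m) (d(|tape := bs @ rest|), True))) |
   (item dl lm cur ^^ m) (d(|tape := bs @ rest|), True) = (d'(|tape := rest|), True)))"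

lemma steps_refl: "steps cur 0 d d" unfolding steps_def by auto

lemma steps_trans:
 assumes "steps cur L d d'" "steps cur L' d' d''"
 shows "steps cur (L+L') d d''"
proof -
 obtain m bs where 1: "m<=L" "length bs<=L" "!!rest. 
   ovf (fst ((item dl lm cur ^^ m) (d(|tape := bs @ rest|), True))) |
   (item dl lm cur ^^ m) (d(|tape := bs @ rest|), True) = (d'(|tape := rest|), True)" using assms(1) unfolding steps_def by blast
 obtain m' bs' where 2: "m'<=L'" "length bs'<=L'" "!!rest. 
   ovf (fst ((item dl lm cur ^^ m') (d'(|tape := bs' @ rest|), True))) |
   (item dl lm cur ^^ m') (d'(|tape := bs' @ rest|), True) = (d''(|tape := rest|), True)" using assms(2) unfolding steps_def by blast
 have e: "(item dl lm cur ^^ (m'+m)) st = (item dl lm cur ^^ m') ((item dl lm cur ^^ m) st)" for st by (simp add: funpow_add)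
 show ?thesis unfolding steps_def
 proof (intro exI[of _ "m'+m"] exI[of _ "bs @ bs'"] conjI allI)
  fix rest
  show "ovf (fst ((item dl lm cur ^^ (m'+m)) (d(|tape := (bs @ bs') @ rest|), True))) |
   (item dl lm cur ^^ (m'+m)) (d(|tape := (bs @ bs') @ rest|), True) = (d''(|tape := rest|), True)" unfolding e append_assoc using 1(3)[of "bs' @ rest"] 2(3)[of rest] items_ovf by metis
 qed (use 1 2 in auto)
qed

lemma steps_mono: "steps cur L d d' ==> L<=L' ==> steps cur L' d d'" unfolding steps_def by (meson order_trans)

lemma steps1:
 assumes "length bs<=L" "1<=L"
  "!!rest. ovf (fst (item dl lm cur (d(|tape := bs @ rest|), True))) |
   item dl lm cur (d(|tape := bs @ rest|), True) = (d'(|tape := rest|), True)"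
 shows "steps cur L d d'" unfolding steps_def using assms by (intro exI[of _ 1] exI[of _ bs]) auto

definition marker_ok :: "nat set list => nat set => nat \<times> real \<times> bool => bool" where
 "marker_ok Hs a E <-> (EX e h nr. E = (e, DD h, nr) & par a = Some h & h : set Hs & e<n &
    (EX w:a. dd e w<=DD h/th) & (nr <-> (EX C:P. DD h<=DD C & (EX p:C. dd e p<=8*(DD h/th)))))"

text \<open>The invariant of an honest run. Markers have their parents among the first
  \<open>m\<close> clusters, so when the next cluster is listed none of its markers is present
  yet.\<close>

definition good :: "dstate => nat set list => nat set list => nat => bool" where
 "good d Cs As m <-> distinct Cs & set Cs<=P & length (cens d) = length Cs & rads d = map DD Cs &
   (ALL j<length Cs. cens d ! j<n & (EX w:Cs ! j. dd (cens d ! j) w<=DD (Cs ! j))) &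
   distinct As & list_all2 (marker_ok (take m Cs)) As (ents d) &
   (ALL (w, y):set (wits d). w<length Cs & (ALL p:Cs ! w. dd y p<=DD (Cs ! w)+dl))"

lemma good_len: "good d Cs As m ==> length Cs<=k" unfolding good_def using kP card_mono[OF finP, of "set Cs"] distinct_card[of Cs] by auto

lemma append_ok: "P' x ==> ALL j<length xs. P' (xs ! j) ==> j<Suc (length xs) ==> P' ((xs @ [x]) ! j)" by (cases "j = length xs") (auto simp: nth_append)

lemma good_add_cluster:
 assumes "good d Cs As m" "C : P" "C ~: set Cs" "c<n" "EX w:C. dd c w<=DD C" "m<=length Cs"
 shows "good (d(|cens := cens d @ [c], rads := rads d @ [DD C]|)) (Cs @ [C]) As m"
proof -
 have "ALL j<Suc (length Cs). (cens d @ [c]) ! j<n & (EX w:(Cs @ [C]) ! j. dd ((cens d @ [c]) ! j) w<=DD ((Cs @ [C]) ! j))" using assms by (auto simp: good_def nth_append less_Suc_eq)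
 moreover have "ALL (w, y):set (wits d). w<Suc (length Cs) & (ALL p:(Cs @ [C]) ! w. dd y p<=DD ((Cs @ [C]) ! w)+dl)" using assms(1) by (fastforce simp: good_def nth_append)
 ultimately show ?thesis using assms by (simp add: good_def)
qed

lemma to_centre:
 assumes "good d Cs As m" "j<length Cs" "p' : Cs ! j"
 shows "dd (cens d ! j) p'<=2*DD (Cs ! j)" "cens d ! j<n" "Cs ! j : P"
proof -
 obtain w where w: "w : Cs ! j" "dd (cens d ! j) w<=DD (Cs ! j)" "cens d ! j<n" using assms by (auto simp: good_def)
 show P: "Cs ! j : P" using assms by (auto simp: good_def)
 have "dd (cens d ! j) p'<=dd (cens d ! j) w+dd w p'" using tri w assms in_n P by blast
 thus "dd (cens d ! j) p'<=2*DD (Cs ! j)" using w DDge[OF P w(1) assms(3)] by linarith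
 show "cens d ! j<n" by fact
qed

text \<open>A point of \<open>C\<close> lies within \<open>2*D + 8*D\<close> of the centre, and
  \<open>q + 5\<close> halvings bring \<open>10*D\<close> below \<open>DD C\<close> because
  \<open>D < th*DD C\<close>.\<close>

lemma item_announce:
 assumes gd: "good d Cs As (Suc cur)" and cur: "cur<length Cs" and C: "C : P" "C ~: set Cs"
  "DD (Cs ! cur)<th*DD C" "close C (Cs ! cur) (8*DD (Cs ! cur))"
 shows "EX d'. steps cur (3+q+uu C+g*(q+5)) d d' & good d' (Cs @ [C]) As (Suc cur) &
   (EX c. cens d' = cens d @ [c]) & ents d' = ents d & wits d' = wits d & ovf d' = ovf d"
proof -
 let ?x = "cens d ! cur" and ?D = "DD (Cs ! cur)"
 have D: "rads d ! cur = ?D" using gd cur by (auto simp: good_def)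
 have lenk: "length (cens d)<k"
 proof -
  have "card (insert C (set Cs))<=card P" using gd C finP by (intro card_mono) (auto simp: good_def)
  thus ?thesis using gd C(2) kP distinct_card[of Cs] by (auto simp: good_def)
 qed
 obtain p p' where p: "p : C" "p' : Cs ! cur" "dd p p'<=8*?D" using C(4) by (auto simp: close_def)
 note tc = to_centre[OF gd cur p(2)]
 have "dd ?x p<=dd ?x p'+dd p' p" using tri tc in_n p C by blast
 hence xp: "dd ?x p<=10*?D" using tc p symd[of p' p] by linarith
 have st: "10*?D/2 ^ (q+5)<=DD C"
 proof -
  have "10*?D<=32*(th*DD C)" using C(3) DD0[OF C(1)] DD0[OF tc(3)] by argo
  thus ?thesis by (simp add: power_add field_simps)
 qed
 obtain bs1 where bs1: "length bs1 = q+uu C+1" "!!rest. readD dl lm (bs1 @ rest) = (DD C, rest)" using readD_read[OF lm, of "tt C"] steps_B[OF C(1)] DDtt[OF C(1)] by auto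
 obtain bs2 c where bs2: "length bs2<=g*(q+5)" "c<n" "dd c p<=DD C"
   "!!rest ov. snd (snd (snd (name ?x (10*?D) (DD C) (bs2 @ rest) ov))) |
    (EX R'. name ?x (10*?D) (DD C) (bs2 @ rest) ov = (c, R', rest, ov))" using name_read[OF st _ in_n[OF C(1) p(1)] tc(2) xp DD0[OF C(1)]] steps_B[OF C(1)] by auto
 let ?d = "d(|cens := cens d @ [c], rads := rads d @ [DD C]|)"
 have "steps cur (3+q+uu C+g*(q+5)) d ?d"
 proof (rule steps1)
  show "length (True # True # bs1 @ bs2)<=3+q+uu C+g*(q+5)" using bs1 bs2 by simp
  fix rest
  obtain c' R' t' o' where nm: "name ?x (10*?D) (DD C) (bs2 @ rest) (ovf d) = (c', R', t', o')" by (metis prod_cases4)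
  show "ovf (fst (item dl lm cur (d(|tape := (True # True # bs1 @ bs2) @ rest|), True))) |
    item dl lm cur (d(|tape := (True # True # bs1 @ bs2) @ rest|), True) = (?d(|tape := rest|), True)" using bs2(4)[of rest "ovf d"] nm lenk by (auto simp: item_def Let_def bs1(2) D intro!: dstate.equality)
 qed simp
 moreover have "good ?d (Cs @ [C]) As (Suc cur)" using good_add_cluster[OF gd C(1,2) bs2(2)] bs2(3) p(1) cur by auto
 ultimately show ?thesis by (intro exI[of _ ?d]) auto
qed

text \<open>The hidden cluster has a point within \<open>2*D + 4*D\<close> of the centre, and
  \<open>q + 5\<close> halvings bring \<open>10*D\<close> below \<open>D/th\<close>. The last bit is
  the flag.\<close>

lemma item_marker:
 assumes gd: "good d Cs As (Suc cur)" and cur: "cur<length Cs" and a: "par a = Some (Cs ! cur)" "a ~: set As"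
 shows "EX d'. steps cur (4+g*(q+5)) d d' & good d' Cs (As @ [a]) (Suc cur) &
   cens d' = cens d & rads d' = rads d & wits d' = wits d & ovf d' = ovf d"
proof -
 let ?x = "cens d ! cur" and ?D = "DD (Cs ! cur)"
 have D: "rads d ! cur = ?D" using gd cur by (auto simp: good_def)
 have hid: "hid (Cs ! cur) a" using par_hid a by blast
 hence aP: "a : P" by (simp add: hid_def)
 obtain p p' where p: "p : a" "p' : Cs ! cur" "dd p p'<=4*?D" using hid by (auto simp: close_def hid_def)
 note tc = to_centre[OF gd cur p(2)]
 have "dd ?x p<=dd ?x p'+dd p' p" using tri tc in_n p aP by blast
 hence xp: "dd ?x p<=10*?D" using tc p symd[of p' p] DD0[OF tc(3)] by linarith
 have st: "10*?D/2 ^ (q+5)<=?D/th" using DD0[OF tc(3)] by (simp add: power_add field_simps)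
 have "0<=?D/th" using DD0[OF tc(3)] by simp
 then obtain bs2 c where bs2: "length bs2<=g*(q+5)" "c<n" "dd c p<=?D/th"
   "!!rest ov. snd (snd (snd (name ?x (10*?D) (?D/th) (bs2 @ rest) ov))) |
    (EX R'. name ?x (10*?D) (?D/th) (bs2 @ rest) ov = (c, R', rest, ov))" using name_read[OF st _ in_n[OF aP p(1)] tc(2) xp] steps_B[OF aP] by auto
 obtain nr where nr: "nr = (EX C:P. ?D<=DD C & (EX p:C. dd c p<=8*(?D/th)))" by blast
 let ?d = "d(|ents := ents d @ [(c, ?D, nr)]|)"
 have "steps cur (4+g*(q+5)) d ?d"
 proof (rule steps1)
  show "length (True # False # True # bs2 @ [nr])<=4+g*(q+5)" using bs2 by simp
  fix rest
  obtain c' R' t' o' where nm: "name ?x (10*?D) (?D/th) (bs2 @ nr # rest) (ovf d) = (c', R', t', o')" by (metis prod_cases4)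
  show "ovf (fst (item dl lm cur (d(|tape := (True # False # True # bs2 @ [nr]) @ rest|), True))) |
    item dl lm cur (d(|tape := (True # False # True # bs2 @ [nr]) @ rest|), True) = (?d(|tape := rest|), True)" using bs2(4)[of "nr # rest" "ovf d"] nm by (auto simp: item_def Let_def D intro!: dstate.equality)
 qed simp
 moreover have "Cs ! cur : set (take (Suc cur) Cs)" using cur by (simp add: take_Suc_conv_app_nth)
 hence "marker_ok (take (Suc cur) Cs) a (c, ?D, nr)" unfolding marker_ok_def using a(1) bs2(2,3) p(1) by (intro exI[of _ c] exI[of _ "Cs ! cur"] exI[of _ nr]) (auto simp: nr)
 hence "good ?d Cs (As @ [a]) (Suc cur)" using gd a by (auto simp: good_def intro!: list_all2_appendI)
 ultimately show ?thesis by (intro exI[of _ ?d]) auto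
qed

text \<open>By \<open>pair_diam\<close> the current cluster has a point \<open>y\<close> with some
  \<open>x\<close> in \<open>C\<close> at distance at least
  \<open>DD (Cs ! cur) + DD C + 4*dl\<close>. A point within \<open>dl\<close> of \<open>y\<close>
  is then still farther than \<open>DD (Cs ! cur) + dl\<close> from all of \<open>C\<close>, but not
  from its own cluster.\<close>

lemma item_witness:
 assumes gd: "good d Cs As (Suc cur)" and cur: "cur<length Cs" and C: "C : P" "C ~= Cs ! cur"
  "DD (Cs ! cur)<=DD C" "p : C" "dd (cens d ! cur) p<=2*DD (Cs ! cur)"
 shows "EX d' y. steps cur (3+g*(q+uu (Cs ! cur)+4)) d d' & good d' Cs As (Suc cur) &
   cens d' = cens d & rads d' = rads d & ents d' = ents d & wits d' = wits d @ [(cur, y)] & ovf d' = ovf d &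
   (ALL p:C. DD (Cs ! cur)+dl<dd y p)"
proof -
 let ?x = "cens d ! cur" and ?D = "DD (Cs ! cur)" and ?s = "q+uu (Cs ! cur)+4"
 have D: "rads d ! cur = ?D" using gd cur by (auto simp: good_def)
 have P: "Cs ! cur : P" using gd cur by (auto simp: good_def)
 obtain w0 where w0: "w0 : Cs ! cur" "dd ?x w0<=?D" "?x<n" using gd cur by (auto simp: good_def)
 \<comment> \<open>With \<open>dl = 0\<close> the current cluster has diameter 0, so the centre
   would equal both its point \<open>w0\<close> and the point \<open>p\<close> of
   \<open>C\<close>.\<close>
 have dlpos: "0<dl"
 proof (rule ccontr)
  assume "~ 0<dl"
  hence "?D = 0" using dl0 dl_DD(2)[OF P] by simp
  hence "~ 0<dd ?x w0" "~ 0<dd ?x p" using w0(2) C(5) by auto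
  hence "?x = w0" "?x = p" using dist_pos[OF w0(3) in_n[OF P w0(1)]] dist_pos[OF w0(3) in_n[OF C(1,4)]] by blast+
  hence "p : Cs ! cur" using w0(1) by simp
  thus False using disj[OF P C(1) _ C(4)] C(2) by blast
 qed
 obtain y x where yx: "y : Cs ! cur" "x : C" "?D+DD C+4*dl<=dd y x" using pair_diam[OF P C(1)] C(2) by metis
 have xy: "dd ?x y<=10*?D" using to_centre(1)[OF gd cur yx(1)] DD0[OF P] by linarith
 \<comment> \<open>Down to precision \<open>dl\<close> the number of halvings depends on
   \<open>DD/dl\<close>: \<open>q\<close> accounts for the factor \<open>th\<close>, the unary part
   for the rest, and 4 for the factor 10.\<close>
 have st: "10*?D/2 ^ ?s<=dl"
 proof -
  have "tt (Cs ! cur)<(uu (Cs ! cur)+1)*2 ^ q" by (simp add: dividend_less_div_times)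
  moreover have "uu (Cs ! cur)+1<=2 ^ uu (Cs ! cur)" using less_exp[of "uu (Cs ! cur)"] by linarith
  hence "(uu (Cs ! cur)+1)*2 ^ q<=2 ^ uu (Cs ! cur)*2 ^ q" by (rule mult_right_mono) simp
  ultimately have "tt (Cs ! cur)+1<=2 ^ uu (Cs ! cur)*2 ^ q" by linarith
  hence "real (tt (Cs ! cur)+1)<=real (2 ^ uu (Cs ! cur)*2 ^ q)" by (simp only: of_nat_le_iff)
  hence "real (tt (Cs ! cur)+1)<=2 ^ uu (Cs ! cur)*2 ^ q" by simp
  hence "?D<=2 ^ uu (Cs ! cur)*2 ^ q*dl" unfolding DDtt[OF P] using dl0 by (rule mult_right_mono)
  hence "10*?D<=16*(2 ^ uu (Cs ! cur)*2 ^ q*dl)" using DD0[OF P] by argo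
  thus ?thesis by (simp add: power_add field_simps)
 qed
 have sB: "?s<=B" using steps_B[OF P] by simp
 obtain bs2 c where bs2: "length bs2<=g*?s" "c<n" "dd c y<=dl"
   "!!rest ov. snd (snd (snd (name ?x (10*?D) dl (bs2 @ rest) ov))) |
    (EX R'. name ?x (10*?D) dl (bs2 @ rest) ov = (c, R', rest, ov))" using name_read[OF st sB in_n[OF P yx(1)] w0(3) xy dl0] by blast
 let ?d = "d(|wits := wits d @ [(cur, c)]|)"
 have "steps cur (3+g*?s) d ?d"
 proof (rule steps1)
  show "length (True # False # False # bs2)<=3+g*?s" using bs2 by simp
  fix rest
  obtain c' R' t' o' where nm: "name ?x (10*?D) dl (bs2 @ rest) (ovf d) = (c', R', t', o')" by (metis prod_cases4)
  show "ovf (fst (item dl lm cur (d(|tape := (True # False # False # bs2) @ rest|), True))) |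
    item dl lm cur (d(|tape := (True # False # False # bs2) @ rest|), True) = (?d(|tape := rest|), True)" using bs2(4)[of rest "ovf d"] nm by (auto simp: item_def Let_def D intro!: dstate.equality)
 qed simp
 moreover have "ALL p:Cs ! cur. dd c p<=?D+dl"
 proof
  fix p assume p: "p : Cs ! cur"
  have "dd c p<=dd c y+dd y p" using tri bs2(2) in_n P yx p by blast
  thus "dd c p<=?D+dl" using bs2(3) DDge[OF P yx(1) p] by linarith
 qed
 hence "good ?d Cs As (Suc cur)" using gd cur by (auto simp: good_def)
 moreover have "ALL p:C. ?D+dl<dd c p"
 proof
  fix p assume p: "p : C"
  have "dd y x<=dd y c+(dd c p+dd p x)"  using tri[of y c x] tri[of c p x] bs2(2) in_n[OF P yx(1)] in_n[OF C(1) p] in_n[OF C(1) yx(2)] by linarith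
  thus "?D+dl<dd c p" using yx(3) bs2(3) symd[of y c] DDge[OF C(1) p yx(2)] dlpos by linarith
 qed
 ultimately show ?thesis by (intro exI[of _ ?d] exI[of _ c]) auto
qed

end

context guide
begin

abbreviation \<alpha> :: "nat set => nat" where "\<alpha> C \<equiv> 3+q+uu C+g*(q+5)"
abbreviation \<beta> :: nat where "\<beta> \<equiv> 4+g*(q+5)"
abbreviation \<gamma> :: "nat set => nat" where "\<gamma> C \<equiv> 3+g*(q+uu C+4)"

lemma marker_ok_mono: "marker_ok Hs a E ==> set Hs <= set Hs' ==> marker_ok Hs' a E" unfolding marker_ok_def by blast

lemma good_weaken: "good d Cs As m ==> m<=m' ==> good d Cs As m'" unfolding good_def using marker_ok_mono[OF _ set_take_subset_set_take] by (auto elim!: list_all2_mono)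

lemma announce_all:
 assumes "finite S" "good d Cs As (Suc cur)" "cur<length Cs"
  "ALL C:S. C : P & C ~: set Cs & DD (Cs ! cur)<th*DD C & close C (Cs ! cur) (8*DD (Cs ! cur))"
 shows "EX d' Cs2 cs. steps cur (SUM C:S. \<alpha> C) d d' & good d' (Cs @ Cs2) As (Suc cur) & set Cs2 = S &
   ents d' = ents d & wits d' = wits d & cens d' = cens d @ cs" using assms
proof (induction S arbitrary: d Cs rule: finite_induct)
 case empty
 thus ?case using steps_refl[of cur d] by (intro exI[of _ d] exI[of _ "[]"]) auto
next
 case (insert C F)
 have C: "C : P" "C ~: set Cs" "DD (Cs ! cur)<th*DD C" "close C (Cs ! cur) (8*DD (Cs ! cur))" using insert.prems by auto
 obtain d1 c where d1: "steps cur (\<alpha> C) d d1" "good d1 (Cs @ [C]) As (Suc cur)"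
  "cens d1 = cens d @ [c]" "ents d1 = ents d" "wits d1 = wits d" using item_announce[OF insert.prems(1,2) C] by blast
 have nth: "(Cs @ [C]) ! cur = Cs ! cur" using insert.prems by (simp add: nth_append)
 obtain d2 Cs2 cs where d2: "steps cur (SUM C:F. \<alpha> C) d1 d2" "good d2 ((Cs @ [C]) @ Cs2) As (Suc cur)" "set Cs2 = F"
   "ents d2 = ents d1" "wits d2 = wits d1" "cens d2 = cens d1 @ cs" using insert.IH[OF d1(2)] insert.prems insert.hyps unfolding nth by auto
 have "steps cur (SUM C:insert C F. \<alpha> C) d d2" using steps_trans[OF d1(1) d2(1)] insert.hyps by simp
 thus ?case using d1 d2 by (intro exI[of _ d2] exI[of _ "C # Cs2"] exI[of _ "c # cs"]) auto
qed

lemma mark_all: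
 assumes "finite S" "good d Cs As (Suc cur)" "cur<length Cs" "ALL a:S. par a = Some (Cs ! cur) & a ~: set As"
 shows "EX d' As2. steps cur (card S*\<beta>) d d' & good d' Cs (As @ As2) (Suc cur) & set As2 = S &
   cens d' = cens d & wits d' = wits d" using assms
proof (induction S arbitrary: d As rule: finite_induct)
 case empty
 thus ?case using steps_refl[of cur d] by (intro exI[of _ d] exI[of _ "[]"]) auto
next
 case (insert a F)
 obtain d1 where d1: "steps cur \<beta> d d1" "good d1 Cs (As @ [a]) (Suc cur)" "cens d1 = cens d" "wits d1 = wits d" using item_marker[OF insert.prems(1,2), of a] insert.prems by blast
 obtain d2 As2 where d2: "steps cur (card F*\<beta>) d1 d2" "good d2 Cs ((As @ [a]) @ As2) (Suc cur)" "set As2 = F"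
   "cens d2 = cens d1" "wits d2 = wits d1" using insert.IH[OF d1(2)] insert.prems insert.hyps by auto
 have "steps cur (card (insert a F)*\<beta>) d d2" using steps_trans[OF d1(1) d2(1)] insert.hyps by simp
 thus ?case using d1 d2 by (intro exI[of _ d2] exI[of _ "a # As2"]) auto
qed

lemma witness_all:
 assumes "finite S" "good d Cs As (Suc cur)" "cur<length Cs"
  "ALL C:S. C : P & C ~= Cs ! cur & DD (Cs ! cur)<=DD C & (EX p:C. dd (cens d ! cur) p<=2*DD (Cs ! cur))"
 shows "EX d'. steps cur (card S*\<gamma> (Cs ! cur)) d d' & good d' Cs As (Suc cur) &
   cens d' = cens d & set (wits d) <= set (wits d') &
   (ALL C:S. EX y. (cur, y) : set (wits d') & (ALL p:C. DD (Cs ! cur)+dl<dd y p))" using assms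
proof (induction S arbitrary: d rule: finite_induct)
 case empty
 thus ?case using steps_refl[of cur d] by (intro exI[of _ d]) auto
next
 case (insert C F)
 obtain p where p: "p : C" "dd (cens d ! cur) p<=2*DD (Cs ! cur)" using insert.prems by auto
 have C: "C : P" "C ~= Cs ! cur" "DD (Cs ! cur)<=DD C" using insert.prems by auto
 obtain d1 y where d1: "steps cur (\<gamma> (Cs ! cur)) d d1" "good d1 Cs As (Suc cur)" "cens d1 = cens d"
  "wits d1 = wits d @ [(cur, y)]" "ALL p:C. DD (Cs ! cur)+dl<dd y p" using item_witness[OF insert.prems(1,2) C p] by blast
 have F: "ALL C:F. C : P & C ~= Cs ! cur & DD (Cs ! cur)<=DD C & (EX p:C. dd (cens d1 ! cur) p<=2*DD (Cs ! cur))" using insert.prems(3) d1(3) by auto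
 obtain d2 where d2: "steps cur (card F*\<gamma> (Cs ! cur)) d1 d2" "good d2 Cs As (Suc cur)"
   "cens d2 = cens d1" "set (wits d1) <= set (wits d2)"
   "ALL C:F. EX y. (cur, y) : set (wits d2) & (ALL p:C. DD (Cs ! cur)+dl<dd y p)" using insert.IH[OF d1(2) insert.prems(2) F] by blast
 have "steps cur (card (insert C F)*\<gamma> (Cs ! cur)) d d2" using steps_trans[OF d1(1) d2(1)] insert.hyps by simp
 moreover have "(cur, y) : set (wits d2)" using d1(4) d2(4) by auto
 ultimately show ?case using d1 d2 by (intro exI[of _ d2]) auto
qed

text \<open>Let \<open>x\<close> in \<open>C1\<close> and \<open>y\<close> in \<open>C2\<close>
  realise the diameter of the union. Then
  \<open>sum DD A <= dd x y <= DD C1 + 2*\<rho> + DD C2\<close>, which leaves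
  \<open>2*\<rho>\<close> for the remaining clusters, each of size at least \<open>R\<close>. If
  \<open>C1 = C2\<close>, nothing is left for the others.\<close>

lemma card_meeting:
 assumes A: "A<=P" "ALL C:A. R<=DD C & (EX p:C. dd e p<=\<rho>)" and e: "e<n" and R: "0 < R" and \<rho>: "0<=\<rho>"
 shows "(real (card A) - 2) * R<=2*\<rho>"
proof (cases "2<=card A")
 case False
 hence "(real (card A) - 2) * R<=0" using R by (intro mult_nonpos_nonneg) auto
 thus ?thesis using \<rho> by simp
next
 case True
 obtain x y where xy: "x : \<Union>A" "y : \<Union>A" "sum DD A<=dd x y" using union_diam[OF A(1) True] by blast
 then obtain C1 C2 where C: "C1 : A" "C2 : A" "x : C1" "y : C2" by blast
 have CP: "C1 : P" "C2 : P" using C A by auto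
 have fin: "finite A" using finP A finite_subset by blast
 show ?thesis
 proof (cases "C1 = C2")
  case eq: True
  have "sum DD A = DD C1 + sum DD (A - {C1})" using C fin by (simp add: sum.remove)
  moreover have "real (card (A - {C1})) * R <= sum DD (A - {C1})" using A by (intro sum_bounded_below) auto
  moreover have "dd x y<=DD C1" using DDge CP C eq by blast
  moreover have "real (card (A - {C1})) = real (card A) - 1" using C fin True by (simp add: of_nat_diff)
  ultimately have "(real (card A) - 1) * R<=0" using xy by simp
  moreover have "1 * R<=(real (card A) - 1) * R" using True R by (intro mult_right_mono) auto
  ultimately show ?thesis using R by simp
 next
  case False
  obtain p1 p2 where p: "p1 : C1" "dd e p1<=\<rho>" "p2 : C2" "dd e p2<=\<rho>" using bspec[OF A(2) C(1)] bspec[OF A(2) C(2)] by (elim conjE bexE) (rule that)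
  have "sum DD A = DD C1+(DD C2 + sum DD (A - {C1} - {C2}))" using C fin False by (simp add: sum.remove)
  moreover have "real (card (A - {C1} - {C2})) * R <= sum DD (A - {C1} - {C2})" using A by (intro sum_bounded_below) auto
  moreover have "card (A - {C1} - {C2}) = card A - 2" using C fin False by simp
  moreover have "dd x y<=dd x p1+(dd p1 e+(dd e p2+dd p2 y))" using tri[of x p1 y] tri[of p1 e y] tri[of e p2 y] e in_n[OF CP(1)] in_n[OF CP(2)] C p by (meson add_left_mono order_trans)
  moreover have "dd x p1<=DD C1" "dd p2 y<=DD C2" using DDge CP C p by auto
  ultimately have "real (card A - 2) * R<=2*\<rho>" using xy p symd[of p1 e] by simp
  thus ?thesis using True by (simp add: of_nat_diff)
 qed
qed

text \<open>\<open>card_meeting\<close> with radius \<open>2*D\<close> gives at most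
  \<open>2 + 4\<close>. For \<open>D = 0\<close> such a cluster would contain the centre and share
  it with cluster \<open>j\<close>.\<close>

lemma card_larger:
 assumes gd: "good d Cs As m" and j: "j<length Cs"
 shows "card {C : P. C ~= Cs ! j & DD (Cs ! j)<=DD C & (EX p:C. dd (cens d ! j) p<=2*DD (Cs ! j))}<=6"
  (is "card ?S<=6")
proof (cases "DD (Cs ! j) = 0")
 case False
 have P: "Cs ! j : P" "cens d ! j<n" using gd j by (auto simp: good_def)
 hence pos: "0<DD (Cs ! j)" using False DD0[OF P(1)] by simp
 have "(real (card ?S) - 2)*DD (Cs ! j)<=2*(2*DD (Cs ! j))" by (rule card_meeting) (use P pos in auto)
 hence "(real (card ?S) - 2)*DD (Cs ! j)<=4*DD (Cs ! j)" by simp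
 hence "real (card ?S) - 2<=4" using pos by (simp only: mult_le_cancel_right_pos)
 thus ?thesis by linarith
next
 case True
 have "cens d ! j<n & (EX w:Cs ! j. dd (cens d ! j) w<=DD (Cs ! j))" "Cs ! j : P" using gd j by (auto simp: good_def)
 then obtain w where w: "w : Cs ! j" "dd (cens d ! j) w<=DD (Cs ! j)" "cens d ! j<n" "Cs ! j : P" by blast
 have "False" if CS: "C : ?S" for C
 proof -
  obtain p where p: "p : C" "dd (cens d ! j) p<=0" "C : P" "C ~= Cs ! j" using CS unfolding True by auto
  have "~ 0<dd (cens d ! j) w" "~ 0<dd (cens d ! j) p" using w(2) p(2) True by auto
  hence "cens d ! j = w" "cens d ! j = p" using dist_pos w(3) in_n[OF w(4,1)] in_n[OF p(3,1)] by blast+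
  thus False using disj[OF p(3) w(4) p(1)] w(1) p(4) by simp
 qed
 hence "?S = {}" by blast
 thus ?thesis by (metis card.empty zero_le)
qed

text \<open>What the list of cluster \<open>j\<close> has to achieve. The three clauses are the
  conditions \<open>announced\<close>, \<open>marked\<close> and \<open>separated\<close> of a
  completed state.\<close>

definition finished :: "dstate => nat set list => nat set list => nat => bool" where
 "finished d Cs As j <->
   (ALL C:P. DD (Cs ! j)<th*DD C --> close C (Cs ! j) (8*DD (Cs ! j)) --> C : set Cs) &
   (ALL a. par a = Some (Cs ! j) --> a : set As) &
   (ALL C:P. ALL p:C. C ~= Cs ! j --> DD (Cs ! j)<=DD C --> dd (cens d ! j) p<=2*DD (Cs ! j) -->
    (EX y. (j, y) : set (wits d) & (ALL p:C. DD (Cs ! j)+dl<dd y p)))"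

lemma finished_mono:
 assumes "finished d Cs As j" "j<length Cs" "length (cens d) = length Cs"
  "cens d' = cens d @ cs" "set (wits d) <= set (wits d')" "set As <= set As'"
 shows "finished d' (Cs @ Cs2) As' j"
proof -
 have e: "(Cs @ Cs2) ! j = Cs ! j" "cens d' ! j = cens d ! j" using assms by (auto simp: nth_append)
 note f = assms(1)[unfolded finished_def]
 show ?thesis unfolding finished_def e
 proof (intro conjI ballI allI impI)
  fix C p assume "C : P" "p : C" "C ~= Cs ! j" "DD (Cs ! j)<=DD C" "dd (cens d ! j) p<=2*DD (Cs ! j)"
  hence "EX y. (j, y) : set (wits d) & (ALL p:C. DD (Cs ! j)+dl<dd y p)" using f by blast
  thus "EX y. (j, y) : set (wits d') & (ALL p:C. DD (Cs ! j)+dl<dd y p)" using assms(5) by blast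
 qed (use f assms(6) in auto)
qed

lemma list_cluster:
 assumes gd: "good d Cs As cur" and cur: "cur<length Cs"
 shows "EX d' Cs2 As2 cs. steps cur ((SUM C:set Cs2. \<alpha> C)+card (set As2)*\<beta>+6*\<gamma> (Cs ! cur)) d d' &
   good d' (Cs @ Cs2) (As @ As2) (Suc cur) & finished d' (Cs @ Cs2) (As @ As2) cur & cens d' = cens d @ cs &
   set (wits d) <= set (wits d')"
proof -
 let ?C = "Cs ! cur"
 have gd1: "good d Cs As (Suc cur)" using good_weaken[OF gd] by simp
 let ?S1 = "{C : P. C ~: set Cs & DD ?C<th*DD C & close C ?C (8*DD ?C)}"
 obtain d1 Cs2 cs where d1: "steps cur (SUM C:?S1. \<alpha> C) d d1" "good d1 (Cs @ Cs2) As (Suc cur)" "set Cs2 = ?S1"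
   "ents d1 = ents d" "wits d1 = wits d" "cens d1 = cens d @ cs" using announce_all[OF _ gd1 cur, of ?S1] finP by fastforce
 have cur1: "cur<length (Cs @ Cs2)" and nth: "(Cs @ Cs2) ! cur = ?C" using cur by (auto simp: nth_append)
 let ?S2 = "{a. par a = Some ?C}"
 have "?S2<=P" using par_hid by (auto simp: hid_def)
 hence fin2: "finite ?S2" using finP finite_subset by blast
 \<comment> \<open>In \<open>good d Cs As cur\<close> all parents of markers are among the first
   \<open>cur\<close> clusters, and \<open>Cs\<close> is distinct.\<close>
 have new: "a ~: set As" if "par a = Some ?C" for a
 proof
  assume "a : set As"
  then obtain b where b: "b<length As" "As ! b = a" by (metis in_set_conv_nth)
  hence "marker_ok (take cur Cs) a (ents d ! b)" using gd by (auto simp: good_def list_all2_conv_all_nth)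
  hence "?C : set (take cur Cs)" using that unfolding marker_ok_def by auto
  then obtain i where "i<cur" "Cs ! i = ?C" using cur by (auto simp: in_set_conv_nth)
  thus False using gd cur nth_eq_iff_index_eq[of Cs i cur] by (auto simp: good_def)
 qed
 hence "ALL a:?S2. par a = Some ((Cs @ Cs2) ! cur) & a ~: set As" unfolding nth by auto
 from mark_all[OF fin2 d1(2) cur1 this]
 obtain d2 As2 where d2: "steps cur (card ?S2*\<beta>) d1 d2" "good d2 (Cs @ Cs2) (As @ As2) (Suc cur)" "set As2 = ?S2"
   "cens d2 = cens d1" "wits d2 = wits d1" by blast
 let ?S3 = "{C : P. C ~= ?C & DD ?C<=DD C & (EX p:C. dd (cens d2 ! cur) p<=2*DD ?C)}"
 have "card ?S3<=6" using card_larger[OF d2(2) cur1] unfolding nth .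
 moreover have "finite ?S3" using finP by simp
 moreover have "ALL C:?S3. C : P & C ~= (Cs @ Cs2) ! cur & DD ((Cs @ Cs2) ! cur)<=DD C &
   (EX p:C. dd (cens d2 ! cur) p<=2*DD ((Cs @ Cs2) ! cur))" unfolding nth by simp
 moreover note wa = calculation
 obtain d3 where d3: "steps cur (card ?S3*\<gamma> ?C) d2 d3" "good d3 (Cs @ Cs2) (As @ As2) (Suc cur)"
   "cens d3 = cens d2" "set (wits d2) <= set (wits d3)"
   "ALL C:?S3. EX y. (cur, y) : set (wits d3) & (ALL p:C. DD ?C+dl<dd y p)" using witness_all[OF wa(2) d2(2) cur1 wa(3)] unfolding nth by (elim exE conjE) (rule that)
 have s3: "steps cur ((SUM C:set Cs2. \<alpha> C)+card (set As2)*\<beta>+6*\<gamma> ?C) d d3" using steps_mono[OF steps_trans[OF steps_trans[OF d1(1) d2(1)] d3(1)]] unfolding d1(3) d2(3) using wa(1) by (meson add_left_mono mult_le_mono1)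
 have f3: "finished d3 (Cs @ Cs2) (As @ As2) cur" unfolding finished_def nth
 proof (intro conjI ballI allI impI)
  fix C p assume "C : P" "p : C" "C ~= ?C" "DD ?C<=DD C" "dd (cens d3 ! cur) p<=2*DD ?C"
  hence "C : ?S3" using d3(3) by auto
  thus "EX y. (cur, y) : set (wits d3) & (ALL p:C. DD ?C+dl<dd y p)" using d3(5) by blast
 qed (use d1(3) d2(3) in auto)
 have "cens d3 = cens d @ cs" "set (wits d) <= set (wits d3)" using d1 d2 d3 by simp_all
 thus ?thesis by (intro exI conjI) (rule s3 d3(2) f3 | assumption)+
qed

lemma item_stopped: "(item dl lm cur ^^ m) (d, False) = (d, False)" by (induction m) (auto simp: item_def)

lemma listing_read:
 assumes "steps cur L d d'" "L<B"
 shows "EX bs. length bs<=L+1 & (ALL rest. ovf (listing dl lm cur (d(|tape := bs @ rest|))) |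
   listing dl lm cur (d(|tape := bs @ rest|)) = d'(|tape := rest|))"
proof -
 obtain m bs where 1: "m<=L" "length bs<=L" "!!rest. 
   ovf (fst ((item dl lm cur ^^ m) (d(|tape := bs @ rest|), True))) |
   (item dl lm cur ^^ m) (d(|tape := bs @ rest|), True) = (d'(|tape := rest|), True)" using assms(1) unfolding steps_def by blast
 have B: "B = (B - Suc m)+Suc m" using 1(1) assms(2) by simp
 have e: "(item dl lm cur ^^ B) st = (item dl lm cur ^^ (B - Suc m)) (item dl lm cur ((item dl lm cur ^^ m) st))" for st by (subst B) (simp only: funpow_add funpow.simps comp_apply)
 show ?thesis
 proof (intro exI[of _ "bs @ [False]"] conjI allI)
  fix rest
  have s1: "item dl lm cur (d'(|tape := False # rest|), True) = (d'(|tape := rest|), False)" by (simp add: item_def)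
  from 1(3)[of "False # rest"]
  show "ovf (listing dl lm cur (d(|tape := (bs @ [False]) @ rest|))) |
   listing dl lm cur (d(|tape := (bs @ [False]) @ rest|)) = d'(|tape := rest|)"
  proof
   assume "ovf (fst ((item dl lm cur ^^ m) (d(|tape := bs @ False # rest|), True)))"
   thus ?thesis unfolding listing_def e by (simp add: items_ovf item_ovf)
  next
   assume "(item dl lm cur ^^ m) (d(|tape := bs @ False # rest|), True) = (d'(|tape := False # rest|), True)"
   thus ?thesis unfolding listing_def e by (simp add: s1 item_stopped)
  qed
 qed (use 1 in auto)
qed

text \<open>The bits are charged to clusters, so the lengths of the turns telescope. Each listed
  cluster needs at most 6 witnesses and one closing bit.\<close>

definition pot :: "nat set list => nat set list => nat => nat" where
 "pot Cs As cur = (SUM C:set Cs. \<alpha> C)+card (set As)*\<beta>+(SUM j<cur. 6*\<gamma> (Cs ! j)+1)"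

lemma good_As: "good d Cs As m ==> set As<=P"
proof
 fix a assume "good d Cs As m" "a : set As"
 then obtain b where "b<length As" "As ! b = a" "marker_ok (take m Cs) a (ents d ! b)" by (auto simp: good_def list_all2_conv_all_nth in_set_conv_nth)
 thus "a : P" using par_hid unfolding marker_ok_def hid_def by blast
qed

lemma pot_le:
 assumes gd: "good d Cs As m" and cur: "cur<=length Cs"
 shows "pot Cs As cur<=18*(k*g*q)"
proof -
 have CsP: "set Cs<=P" "distinct Cs" using gd by (auto simp: good_def)
 have a: "(SUM C:set Cs. \<alpha> C)<=k*(3+q+g*(q+5))+3*k"
 proof -
  have "(SUM C:set Cs. \<alpha> C)<=(SUM C:P. \<alpha> C)" using CsP finP by (intro sum_mono2) auto
  also have "... = card P*(3+q+g*(q+5)) + sum uu P" by (simp add: sum.distrib algebra_simps)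
  also have "...<=k*(3+q+g*(q+5))+3*k" using kP tt_sum by (intro add_mono mult_right_mono) auto
  finally show ?thesis .
 qed
 have b: "card (set As)*\<beta><=k*\<beta>" using card_mono[OF finP good_As[OF gd]] kP by (intro mult_right_mono) auto
 have c: "(SUM j<cur. 6*\<gamma> (Cs ! j)+1)<=k*(19+6*(g*(q+4)))+6*(g*(3*k))"
 proof -
  have "(SUM j<cur. 6*\<gamma> (Cs ! j)+1) = (SUM C:(!) Cs ` {..<cur}. 6*\<gamma> C+1)" using CsP cur by (subst sum.reindex) (auto simp: inj_on_def nth_eq_iff_index_eq)
  also have "...<=(SUM C:P. 6*\<gamma> C+1)" using CsP cur finP by (intro sum_mono2) (auto simp: subset_iff)
  also have "... = card P*(19+6*(g*(q+4)))+6*(g * sum uu P)" by (simp add: sum.distrib sum_distrib_left algebra_simps)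
  also have "...<=k*(19+6*(g*(q+4)))+6*(g*(3*k))" using kP tt_sum by (intro add_mono mult_left_mono mult_right_mono) auto
  finally show ?thesis .
 qed
 have "10*(k*g)<=k*g*q" using q10 by simp
 moreover have "10*k<=k*g*q"
 proof -
  have "k*1*10<=k*g*q" using g1 q10 by (intro mult_mono) auto
  thus ?thesis by simp
 qed
 \<comment> \<open>The four terms are at most 2.9, 1, 8 and 5.2 times \<open>k*g*q\<close>, since
   \<open>q >= 10\<close>.\<close>
 moreover have "k*(3+q+g*(q+5))+3*k+k*\<beta>+(k*(19+6*(g*(q+4)))+6*(g*(3*k))) =
  29*k+k*q+8*(k*g*q)+52*(k*g)" by (simp add: algebra_simps)
 ultimately show ?thesis using a b c kgq(5) unfolding pot_def by linarith
qed

definition stage :: "nat => dstate => nat set list => nat set list => bool" where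
 "stage cur d Cs As <-> good d Cs As cur & cur<=length Cs & (ALL j<cur. finished d Cs As j)"

text \<open>An honest flag is unset only if no cluster of size at least that of the parent meets the
  marker ball.\<close>

lemma unblocked:
 assumes "C : P" "p : C" "list_all2 (marker_ok Hs) As E"
 shows "~ blocked E (DD C) p"
proof
 assume "blocked E (DD C) p"
 then obtain e s where e: "(e, s, False) : set E" "~ DD C < s" "~ 8*(s/th)<dd e p" unfolding blocked_def by auto
 then obtain b where "b<length E" "E ! b = (e, s, False)" by (metis in_set_conv_nth)
 hence "marker_ok Hs (As ! b) (e, s, False)" using assms(3) by (auto simp: list_all2_conv_all_nth)
 hence "~ (EX C:P. s<=DD C & (EX p:C. dd e p<=8*(s/th)))" unfolding marker_ok_def by auto
 thus False using e assms(1,2) by (metis not_less)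
qed

text \<open>It follows that an uncovered point always belongs to a cluster not yet
  discovered.\<close>

lemma cluster_covered:
 assumes gd: "good d Cs As m" and C: "C : set Cs" "p : C"
 shows "covered d p"
proof -
 obtain j where j: "j<length Cs" "Cs ! j = C" using C by (metis in_set_conv_nth)
 note tc = to_centre[OF gd j(1), of p]
 have "~ blocked (ents d) (DD C) p" using unblocked C gd by (auto simp: good_def)
 thus ?thesis using tc j C gd unfolding covered_def by (intro exI[of _ j]) (auto simp: good_def not_less)
qed

lemma uncov_tape [simp]: "uncov (d(|tape := t|)) = uncov d" by (simp add: uncov_def covered_def)

lemma finite_uncov: "finite (uncov d)" by (simp add: uncov_def)

lemma listing_turn:
 assumes st: "stage cur d Cs As" and cur: "cur<length Cs"
 shows "EX bs d' Cs' As'. stage (Suc cur) d' Cs' As' & length bs+pot Cs As cur<=pot Cs' As' (Suc cur) &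
  (ALL rest. ovf (listing dl lm cur (d(|tape := bs @ rest|))) |
   listing dl lm cur (d(|tape := bs @ rest|)) = d'(|tape := rest|))"
proof -
 have gd: "good d Cs As cur" using st by (simp add: stage_def)
 obtain d' Cs2 As2 cs where d': "steps cur ((SUM C:set Cs2. \<alpha> C)+card (set As2)*\<beta>+6*\<gamma> (Cs ! cur)) d d'"
   "good d' (Cs @ Cs2) (As @ As2) (Suc cur)" "finished d' (Cs @ Cs2) (As @ As2) cur" "cens d' = cens d @ cs"
   "set (wits d) <= set (wits d')" using list_cluster[OF gd cur] by blast
 let ?L = "(SUM C:set Cs2. \<alpha> C)+card (set As2)*\<beta>+6*\<gamma> (Cs ! cur)"
 have dis: "set Cs \<inter> set Cs2 = {}" "set As \<inter> set As2 = {}" using d'(2) by (auto simp: good_def)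
 have p1: "(SUM j<Suc cur. 6*\<gamma> ((Cs @ Cs2) ! j)+1) = (SUM j<cur. 6*\<gamma> (Cs ! j)+1)+(6*\<gamma> (Cs ! cur)+1)" using cur by (simp add: nth_append)
 have p2: "card (set (As @ As2)) = card (set As)+card (set As2)" using dis by (simp add: card_Un_disjoint)
 have p3: "(SUM C:set (Cs @ Cs2). \<alpha> C) = (SUM C:set Cs. \<alpha> C)+(SUM C:set Cs2. \<alpha> C)" using dis by (simp add: sum.union_disjoint)
 have pot: "pot (Cs @ Cs2) (As @ As2) (Suc cur) = pot Cs As cur+?L+1" unfolding pot_def p1 p2 p3 by (simp add: algebra_simps)
 have "?L<B" using pot pot_le[OF d'(2), of "Suc cur"] cur B kgq1 by simp
 from listing_read[OF d'(1) this] obtain bs where bs: "length bs<=?L+1" "!!rest. ovf (listing dl lm cur (d(|tape := bs @ rest|))) |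
   listing dl lm cur (d(|tape := bs @ rest|)) = d'(|tape := rest|)" by blast
 have "stage (Suc cur) d' (Cs @ Cs2) (As @ As2)" unfolding stage_def
 proof (intro conjI allI impI d'(2))
  fix j assume "j<Suc cur"
  then consider "j<cur" | "j = cur" by linarith
  thus "finished d' (Cs @ Cs2) (As @ As2) j"
  proof cases
   case 1
   show ?thesis by (rule finished_mono[OF _ _ _ d'(4,5)]) (use 1 st cur gd in "auto simp: stage_def good_def")
  qed (use d' in simp)
 qed (use cur in simp)
 thus ?thesis using bs pot by (intro exI[of _ bs] exI[of _ d'] exI[of _ "Cs @ Cs2"] exI[of _ "As @ As2"]) auto
qed

lemma turn_read:
 assumes st: "stage cur d Cs As" and ne: "~ (cur = length Cs & uncov d = {})"
 shows "EX bs d' Cs' As'. stage (Suc cur) d' Cs' As' & length bs+pot Cs As cur<=pot Cs' As' (Suc cur) &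
  (ALL rest. ovf (fst (turn dl lm (d(|tape := bs @ rest|), cur))) |
   turn dl lm (d(|tape := bs @ rest|), cur) = (d'(|tape := rest|), Suc cur))"
proof (cases "cur<length Cs")
 case True
 have len: "length (cens d) = length Cs" using st by (simp add: stage_def good_def)
 have "turn dl lm (d(|tape := t|), cur) = (listing dl lm cur (d(|tape := t|)), Suc cur)" for t using True len by (simp add: turn_def discover_def)
 thus ?thesis using listing_turn[OF st True] by simp
next
 case False
 have gd: "good d Cs As cur" and cur: "cur = length Cs" using st False by (auto simp: stage_def)
 have len: "length (cens d) = length Cs" using gd by (simp add: good_def)
 have un: "uncov d ~= {}" using ne cur by simp
 let ?p = "Min (uncov d)"
 have p: "?p : uncov d" using un finite_uncov by (rule Min_in[rotated])
 hence pn: "?p<n" "~ covered d ?p" by (auto simp: uncov_def)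
 then obtain C where C: "C : P" "?p : C" using cluster_of by blast
 have new: "C ~: set Cs" using cluster_covered[OF gd] pn C by blast
 let ?d = "d(|cens := cens d @ [?p], rads := rads d @ [DD C]|)"
 have "EX w:C. dd ?p w<=DD C" using C(2) self0[OF pn(1)] DD0[OF C(1)] by force
 hence gd1: "good ?d (Cs @ [C]) As cur" using good_add_cluster[OF gd C(1) new pn(1)] cur by simp
 have st1: "stage cur ?d (Cs @ [C]) As" unfolding stage_def
 proof (intro conjI gd1 allI impI)
  fix j assume "j<cur"
  thus "finished ?d (Cs @ [C]) As j" using finished_mono[of d Cs As j ?d "[?p]" As "[C]"] st len cur by (auto simp: stage_def)
 qed (use cur in simp)
 obtain bs1 where bs1: "length bs1 = q+uu C+1" "!!rest. readD dl lm (bs1 @ rest) = (DD C, rest)" using readD_read[OF lm, of "tt C"] steps_B[OF C(1)] DDtt[OF C(1)] by auto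
 obtain bs2 d' Cs' As' where bs2: "stage (Suc cur) d' Cs' As'" "length bs2+pot (Cs @ [C]) As cur<=pot Cs' As' (Suc cur)"
  "!!rest. ovf (listing dl lm cur (?d(|tape := bs2 @ rest|))) |
   listing dl lm cur (?d(|tape := bs2 @ rest|)) = d'(|tape := rest|)" using listing_turn[OF st1] cur by auto
 have "(SUM j<cur. 6*\<gamma> ((Cs @ [C]) ! j)+1) = (SUM j<cur. 6*\<gamma> (Cs ! j)+1)" using cur by (intro sum.cong) (auto simp: nth_append)
 hence "pot (Cs @ [C]) As cur = pot Cs As cur+\<alpha> C" using new unfolding pot_def by simp
 hence "length (bs1 @ bs2)+pot Cs As cur<=pot Cs' As' (Suc cur)" using bs1(1) bs2(2) by simp
 moreover have "turn dl lm (d(|tape := (bs1 @ bs2) @ rest|), cur) = (listing dl lm cur (?d(|tape := bs2 @ rest|)), Suc cur)" for rest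
 proof -
  have "discover dl lm (d(|tape := (bs1 @ bs2) @ rest|), cur) = ?d(|tape := bs2 @ rest|)" using un cur len bs1(2) by (simp add: discover_def)
  thus ?thesis unfolding turn_def Let_def prod.case using cur len by simp
 qed
 ultimately show ?thesis using bs2(1,3) by (intro exI[of _ "bs1 @ bs2"] exI[of _ d'] exI[of _ Cs'] exI[of _ As']) simp
qed

lemma turn_done: "cur = length (cens d) ==> uncov d = {} ==> turn dl lm (d, cur) = (d, cur)" by (simp add: turn_def discover_def)

lemma turn_ovf: "ovf (fst st) ==> ovf (fst (turn dl lm st))"
proof -
 assume o: "ovf (fst st)"
 obtain d cur where st: "st = (d, cur)" by fastforce
 have "ovf (discover dl lm (d, cur))" using o st by (auto simp: discover_def split: prod.splits)
 hence "ovf (listing dl lm cur (discover dl lm (d, cur)))" unfolding listing_def by (intro items_ovf) simp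
 thus ?thesis using st \<open>ovf (discover dl lm (d, cur))\<close> by (auto simp: turn_def Let_def)
qed

text \<open>As long as a cluster is unlisted or a point is uncovered, each turn lists one more
  cluster; afterwards turns idle. Hence the two alternatives for \<open>cur\<close>.\<close>

lemma turns_read:
 "EX bs d Cs As cur. stage cur d Cs As & length bs<=pot Cs As cur & (cur = m | cur = length Cs & uncov d = {}) &
  (ALL rest. ovf (fst ((turn dl lm ^^ m) ((|cens = [], rads = [], ents = [], wits = [], tape = bs @ rest, ovf = False|), 0))) |
   (turn dl lm ^^ m) ((|cens = [], rads = [], ents = [], wits = [], tape = bs @ rest, ovf = False|), 0) = (d(|tape := rest|), cur))"
proof (induction m)
 case 0
 show ?case by (intro exI[of _ "[]"] exI[of _ "(|cens = [], rads = [], ents = [], wits = [], tape = [], ovf = False|)"] exI[of _ 0])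
   (auto simp: stage_def good_def)
next
 case (Suc m)
 let ?i = "%t. ((|cens = [], rads = [], ents = [], wits = [], tape = t, ovf = False|), 0)"
 obtain bs d Cs As cur where 1: "stage cur d Cs As" "length bs<=pot Cs As cur" "cur = m | cur = length Cs & uncov d = {}"
   "!!rest. ovf (fst ((turn dl lm ^^ m) (?i (bs @ rest)))) | (turn dl lm ^^ m) (?i (bs @ rest)) = (d(|tape := rest|), cur)" using Suc.IH by blast
 have len: "length (cens d) = length Cs" using 1(1) by (simp add: stage_def good_def)
 show ?case
 proof (cases "cur = length Cs & uncov d = {}")
  case True
  have "ovf (fst ((turn dl lm ^^ Suc m) (?i (bs @ rest)))) | (turn dl lm ^^ Suc m) (?i (bs @ rest)) = (d(|tape := rest|), cur)" for rest
  proof -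
   have "turn dl lm (d(|tape := rest|), cur) = (d(|tape := rest|), cur)" by (rule turn_done) (use True len in auto)
   thus ?thesis using 1(4)[of rest] turn_ovf[of "(turn dl lm ^^ m) (?i (bs @ rest))"] by auto
  qed
  hence F: "stage cur d Cs As & length bs<=pot Cs As cur & (cur = Suc m | cur = length Cs & uncov d = {}) &
   (ALL rest. ovf (fst ((turn dl lm ^^ Suc m) (?i (bs @ rest)))) | (turn dl lm ^^ Suc m) (?i (bs @ rest)) = (d(|tape := rest|), cur))" using 1(1,2) True by blast
  show ?thesis by (intro exI) (rule F)
 next
  case False
  hence cm: "cur = m" using 1(3) by blast
  obtain bs' d' Cs' As' where 2: "stage (Suc cur) d' Cs' As'" "length bs'+pot Cs As cur<=pot Cs' As' (Suc cur)"
   "!!rest. ovf (fst (turn dl lm (d(|tape := bs' @ rest|), cur))) |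
    turn dl lm (d(|tape := bs' @ rest|), cur) = (d'(|tape := rest|), Suc cur)" using turn_read[OF 1(1) False] by blast
  have "ovf (fst ((turn dl lm ^^ Suc m) (?i ((bs @ bs') @ rest)))) |
   (turn dl lm ^^ Suc m) (?i ((bs @ bs') @ rest)) = (d'(|tape := rest|), Suc cur)" for rest using 1(4)[of "bs' @ rest"] 2(3)[of rest] turn_ovf[of "(turn dl lm ^^ m) (?i (bs @ bs' @ rest))"] by auto
  moreover have "length (bs @ bs')<=pot Cs' As' (Suc cur)" using 1(2) 2(2) by simp
  ultimately have F: "stage (Suc cur) d' Cs' As' & length (bs @ bs')<=pot Cs' As' (Suc cur) & (Suc cur = Suc m | Suc cur = length Cs' & uncov d' = {}) &
   (ALL rest. ovf (fst ((turn dl lm ^^ Suc m) (?i ((bs @ bs') @ rest)))) | (turn dl lm ^^ Suc m) (?i ((bs @ bs') @ rest)) = (d'(|tape := rest|), Suc cur))" using 2(1) cm by blast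
  show ?thesis by (intro exI) (rule F)
 qed
qed

subsection \<open>Guiding the assignment\<close>

definition asks :: "real => nat => nat \<times> real \<times> bool => bool" where
 "asks D x = (%(e, s, nr). ~ D < s & nr & D/th < s & ~ 3*D<dd x e)"

text \<open>The effect of one marker on a point when the bits are answered by \<open>keep\<close>:
  an unflagged marker of small enough scale expels its ball, and a flagged one does so only if it is
  queried and answered negatively.\<close>

definition stays :: "real => nat => (nat => real => bool) => nat => nat \<times> real \<times> bool => bool" where
 "stays D x keep p = (%(e, s, nr). s<=D --> dd e p<=8*(s/th) -->
   nr & (D/th < s --> dd x e<=3*D --> keep e s))"

lemma sstep_read:
 "EX bs. length bs = length (filter (asks (rads d ! i) (cens d ! i)) es) &
  (ALL S rest. EX T. foldl (sstep d i) (S, bs @ rest) es = (T, rest) & T<=S &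
    (ALL p<n. p : T <-> p : S & (ALL en:set es. stays (rads d ! i) (cens d ! i) keep p en)))"
proof (induction es)
 case Nil
 thus ?case by auto
next
 case (Cons en es)
 obtain e s nr where en: "en = (e, s, nr)" by (metis prod_cases3)
 let ?D = "rads d ! i" and ?x = "cens d ! i"
 obtain bs where bs: "length bs = length (filter (asks ?D ?x) es)"
  "!!S rest. EX T. foldl (sstep d i) (S, bs @ rest) es = (T, rest) & T<=S &
    (ALL p<n. p : T <-> p : S & (ALL en:set es. stays ?D ?x keep p en))" using Cons.IH by blast
 obtain b where b: "b = keep e s" by blast
 let ?bs = "if asks ?D ?x en then b # bs else bs"
 have step: "EX S'. sstep d i (S, ?bs @ rest) en = (S', bs @ rest) & S'<=S & (ALL p<n. p : S' <-> p : S & stays ?D ?x keep p en)" for S rest unfolding en sstep_def asks_def stays_def Let_def by (cases b) (auto simp: ballp_def not_less b[symmetric])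
 hence "EX T. foldl (sstep d i) (S, ?bs @ rest) (en # es) = (T, rest) & T<=S &
    (ALL p<n. p : T <-> p : S & (ALL en:set (en # es). stays ?D ?x keep p en))" for S rest
 proof -
  obtain S' where S': "sstep d i (S, ?bs @ rest) en = (S', bs @ rest)" "S'<=S"
    "ALL p<n. p : S' <-> p : S & stays ?D ?x keep p en" using step by blast
  obtain T where T: "foldl (sstep d i) (S', bs @ rest) es = (T, rest)" "T<=S'"
    "ALL p<n. p : T <-> p : S' & (ALL en:set es. stays ?D ?x keep p en)" using bs(2) by blast
  show ?thesis using S' T by (intro exI[of _ T]) auto
 qed
 moreover have "length ?bs = length (filter (asks ?D ?x) (en # es))" using bs(1) by simp
 ultimately show ?case by blast
qed

definition inS :: "dstate => (nat => nat => real => bool) => nat => nat => bool" where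
 "inS d keep i p <-> p<n & dd (cens d ! i) p<=2*rads d ! i &
   (ALL en:set (ents d). stays (rads d ! i) (cens d ! i) (keep i) p en) &
   (ALL y. (i, y) : set (wits d) --> dd y p<=rads d ! i+dl)"

lemma sset_read:
 "EX bs. length bs = length (filter (asks (rads d ! i) (cens d ! i)) (ents d)) &
  (ALL rest. sset dl d i (bs @ rest) = ({p. inS d keep i p}, rest))"
proof -
 obtain bs where bs: "length bs = length (filter (asks (rads d ! i) (cens d ! i)) (ents d))"
  "!!S rest. EX T. foldl (sstep d i) (S, bs @ rest) (ents d) = (T, rest) & T<=S &
    (ALL p<n. p : T <-> p : S & (ALL en:set (ents d). stays (rads d ! i) (cens d ! i) (keep i) p en))" using sstep_read[of d i "ents d" "keep i"] by blast
 have "sset dl d i (bs @ rest) = ({p. inS d keep i p}, rest)" for rest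
 proof -
  obtain T where T: "foldl (sstep d i) (ballp (cens d ! i) (2*rads d ! i), bs @ rest) (ents d) = (T, rest)"
   "T<=ballp (cens d ! i) (2*rads d ! i)"
    "ALL p<n. p : T <-> p : ballp (cens d ! i) (2*rads d ! i) & (ALL en:set (ents d). stays (rads d ! i) (cens d ! i) (keep i) p en)" using bs(2) by blast
  have "T \<inter> {p. ALL (w, y):set (wits d). w = i --> ~ rads d ! i+dl<dd y p} = {p. inS d keep i p}" using T(2,3) unfolding inS_def ballp_def by (auto simp: not_less)
  thus ?thesis unfolding sset_def T(1) by simp
 qed
 thus ?thesis using bs(1) by blast
qed

lemma assign_read:
 "EX bs. length bs = (SUM i<m. length (filter (asks (rads d ! i) (cens d ! i)) (ents d))) &
  (ALL rest. EX pl. foldl (astep dl d) (%_. None, bs @ rest) [0..<m] = (pl, rest) &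
    (ALL p i. pl p = Some i --> i<m & inS d keep i p) &
    (ALL p i. i<m --> inS d keep i p --> (EX j. pl p = Some j & rads d ! j<=rads d ! i)))"
proof (induction m)
 case 0
 thus ?case by auto
next
 case (Suc m)
 obtain bs where bs: "length bs = (SUM i<m. length (filter (asks (rads d ! i) (cens d ! i)) (ents d)))"
  "!!rest. EX pl. foldl (astep dl d) (%_. None, bs @ rest) [0..<m] = (pl, rest) &
    (ALL p i. pl p = Some i --> i<m & inS d keep i p) &
    (ALL p i. i<m --> inS d keep i p --> (EX j. pl p = Some j & rads d ! j<=rads d ! i))" using Suc.IH by blast
 obtain bs' where bs': "length bs' = length (filter (asks (rads d ! m) (cens d ! m)) (ents d))"
  "!!rest. sset dl d m (bs' @ rest) = ({p. inS d keep m p}, rest)" using sset_read[of d m keep] by blast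
 have "EX pl. foldl (astep dl d) (%_. None, (bs @ bs') @ rest) [0..<Suc m] = (pl, rest) &
    (ALL p i. pl p = Some i --> i<Suc m & inS d keep i p) &
    (ALL p i. i<Suc m --> inS d keep i p --> (EX j. pl p = Some j & rads d ! j<=rads d ! i))" for rest
 proof -
  obtain pl where pl: "foldl (astep dl d) (%_. None, bs @ bs' @ rest) [0..<m] = (pl, bs' @ rest)"
    "ALL p i. pl p = Some i --> i<m & inS d keep i p"
    "ALL p i. i<m --> inS d keep i p --> (EX j. pl p = Some j & rads d ! j<=rads d ! i)" using bs(2)[of "bs' @ rest"] by blast
  let ?pl = "%p. if p : {p. inS d keep m p} & (case pl p of None => True | Some j => rads d ! m<rads d ! j) then Some m else pl p"
  have "foldl (astep dl d) (%_. None, (bs @ bs') @ rest) [0..<Suc m] = (?pl, rest)"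
  proof -
   have "astep dl d (pl, bs' @ rest) m = (?pl, rest)" unfolding astep_def prod.case bs'(2) Let_def ..
   thus ?thesis using pl(1) by simp
  qed
  moreover have "i<Suc m & inS d keep i p" if "?pl p = Some i" for p i using that pl(2) by (auto split: if_splits intro: less_SucI)
  moreover have "EX j. ?pl p = Some j & rads d ! j<=rads d ! i" if ip: "i<Suc m" "inS d keep i p" for p i
  proof (cases "i = m")
   case True
   thus ?thesis using that by (auto split: option.splits)
  next
   case False
   hence "i<m" using that by simp
   then obtain j where "pl p = Some j" "rads d ! j<=rads d ! i" using pl(3) ip by blast
   thus ?thesis by auto
  qed
  ultimately show ?thesis by blast
 qed
 moreover have "length (bs @ bs') = (SUM i<Suc m. length (filter (asks (rads d ! i) (cens d ! i)) (ents d)))" using bs(1) bs'(1) by simp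
 ultimately show ?case by blast
qed

lemma scale_split: "s<=D ==> D<2 ^ m * s ==> EX t<m. 2 ^ t * s<=D & D<2*(2 ^ t*(s::real))"
proof (induction m)
 case (Suc m)
 show ?case
 proof (cases "D<2 ^ m * s")
  case True
  thus ?thesis using Suc less_SucI by blast
 next
  case False
  thus ?thesis using Suc.prems by (intro exI[of _ m]) auto
 qed
qed simp

text \<open>A marker of scale \<open>s\<close> is queried only by clusters with size in
  \<open>[s, th*s)\<close> and centre within three times that size. Split the sizes into
  \<open>q\<close> dyadic ranges; in the range starting at \<open>R\<close> all these clusters meet
  the ball of radius \<open>8*R\<close> around the marker, so by \<open>card_meeting\<close> there
  are at most 18.\<close>

lemma asks_le:
 assumes gd: "good d Cs As m" and b: "b<length (ents d)"
 shows "card {i. i<length Cs & asks (rads d ! i) (cens d ! i) (ents d ! b)}<=18*q"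
proof -
 have "marker_ok (take m Cs) (As ! b) (ents d ! b)" using gd b by (auto simp: good_def list_all2_conv_all_nth)
 then obtain e h nr where en: "ents d ! b = (e, DD h, nr)" "e<n" "par (As ! b) = Some h" unfolding marker_ok_def by blast
 have s: "0<DD h" using hid_pos par_hid en by blast
 define G where "G t = {i. i<length Cs & 2 ^ t*DD h<=DD (Cs ! i) & DD (Cs ! i)<2*(2 ^ t*DD h) & dd (cens d ! i) e<=3*DD (Cs ! i)}" for t
 have "{i. i<length Cs & asks (rads d ! i) (cens d ! i) (ents d ! b)}<=(UN t<q. G t)"
 proof
  fix i assume "i : {i. i<length Cs & asks (rads d ! i) (cens d ! i) (ents d ! b)}"
  hence i: "i<length Cs" "DD h<=DD (Cs ! i)" "DD (Cs ! i)/th<DD h" "dd (cens d ! i) e<=3*DD (Cs ! i)" using gd en by (auto simp: asks_def good_def)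
  have "DD (Cs ! i)<2 ^ q*DD h" using i(3) by (simp add: field_simps)
  from scale_split[OF i(2) this] show "i : (UN t<q. G t)" using i unfolding G_def by blast
 qed
 moreover have G18: "card (G t)<=18" for t
 proof -
  let ?R = "2 ^ t*DD h"
  have R: "0<?R" using s by simp
  have inj: "inj_on ((!) Cs) (G t)" using gd by (auto simp: inj_on_def G_def good_def nth_eq_iff_index_eq)
  have "(real (card ((!) Cs ` G t)) - 2)*?R<=2*(8*?R)"
  proof (rule card_meeting[OF _ _ en(2) R])
   show "(!) Cs ` G t<=P" using gd by (auto simp: G_def good_def)
   show "ALL C:(!) Cs ` G t. ?R<=DD C & (EX p:C. dd e p<=8*?R)"
   proof
    fix C assume "C : (!) Cs ` G t"
    then obtain i where i: "C = Cs ! i" "i<length Cs" "?R<=DD C" "DD C<2*?R" "dd (cens d ! i) e<=3*DD C" by (auto simp: G_def)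
    have "cens d ! i<n & (EX w:C. dd (cens d ! i) w<=DD C)" "C : P" using gd i(1,2) by (auto simp: good_def)
    then obtain w where w: "w : C" "dd (cens d ! i) w<=DD C" "cens d ! i<n" "C : P" by blast
    have "dd e w<=dd e (cens d ! i)+dd (cens d ! i) w" using tri en(2) w in_n by blast
    hence "dd e w<=8*?R" using w i symd[of e "cens d ! i"] by linarith
    thus "?R<=DD C & (EX p:C. dd e p<=8*?R)" using i w by blast
   qed
  qed (use R in simp)
  hence "(real (card (G t)) - 2)*?R<=16*?R" using card_image[OF inj] by simp
  hence "real (card (G t)) - 2<=16" using R by (simp only: mult_le_cancel_right_pos)
  thus ?thesis by linarith
 qed
 ultimately have "card {i. i<length Cs & asks (rads d ! i) (cens d ! i) (ents d ! b)}<=card (UN t<q. G t)" by (intro card_mono) (auto simp: G_def)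
 also have "...<=(SUM t<q. card (G t))" by (rule card_UN_le) simp
 also have "...<=(SUM t<q. 18)" by (rule sum_mono) (rule G18)
 finally show ?thesis by simp
qed

lemma asks_sum:
 assumes gd: "good d Cs As m"
 shows "(SUM i<length Cs. length (filter (asks (rads d ! i) (cens d ! i)) (ents d)))<=18*(k*g*q)"
proof -
 let ?a = "%i b. asks (rads d ! i) (cens d ! i) (ents d ! b)"
 have card: "card {x. x<N & Q x} = (SUM x<N. if Q x then 1 else 0)" for N :: nat and Q :: "nat => bool"
 proof -
  have "{x. x<N & Q x} = {x:{..<N}. Q x}" by auto
  thus ?thesis by (simp only: sum.inter_filter[symmetric] finite_lessThan card_eq_sum)
 qed
 have "(SUM i<length Cs. length (filter (asks (rads d ! i) (cens d ! i)) (ents d))) =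
  (SUM i<length Cs. SUM b<length (ents d). if ?a i b then 1 else 0)" by (simp only: length_filter_conv_card card)
 also have "... = (SUM b<length (ents d). SUM i<length Cs. if ?a i b then 1 else 0)" by (rule sum.swap)
 also have "... = (SUM b<length (ents d). card {i. i<length Cs & ?a i b})" by (simp only: card)
 also have "...<=(SUM b<length (ents d). 18*q)" using asks_le[OF gd] by (intro sum_mono) simp
 also have "... = length (ents d)*(18*q)" by simp
 also have "...<=k*(18*q)"
 proof -
  have "length (ents d) = length As" using gd by (auto simp: good_def dest: list_all2_lengthD)
  also have "... = card (set As)" using gd by (simp add: good_def distinct_card)
  also have "...<=k" using card_mono[OF finP good_As[OF gd]] kP by simp
  finally show ?thesis by (rule mult_right_mono) simp
 qed
 also have "...<=18*(k*g*q)" using g1 by simp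
 finally show ?thesis .
qed

text \<open>The bits for the turns and the bits for the assignment each number at most
  \<open>18*(k*g*q)\<close>. The resulting state satisfies the locale \<open>completed\<close>, so
  \<open>labelling_good\<close> applies.\<close>

theorem advice:
 "EX bs. length bs<=36*(k*g*q) & (ALL rest. ovf (turns dl lm (bs @ rest)) |
   (ALL L. labelling (turns dl lm (bs @ rest)) (assign dl (turns dl lm (bs @ rest))) L -->
    (ALL l:P. EX c. ALL p:l. L p = c) &
    (EX D. (ALL p<n. ALL p'<n. L p = L p' --> dd p p'<=D (L p)) & (ALL v. 0<=D v) &
    (ALL K. finite K --> sum D K<=(1+114/th) * sum DD P))))"
proof -
 obtain bs d Cs As cur where 1: "stage cur d Cs As" "length bs<=pot Cs As cur" "cur = k | cur = length Cs & uncov d = {}"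
  and tr: "!!rest. ovf (turns dl lm (bs @ rest)) | turns dl lm (bs @ rest) = d(|tape := rest|)"
 proof -
  obtain bs d Cs As cur where 1: "stage cur d Cs As" "length bs<=pot Cs As cur" "cur = k | cur = length Cs & uncov d = {}"
   "!!rest. ovf (fst ((turn dl lm ^^ k) ((|cens = [], rads = [], ents = [], wits = [], tape = bs @ rest, ovf = False|), 0))) |
    (turn dl lm ^^ k) ((|cens = [], rads = [], ents = [], wits = [], tape = bs @ rest, ovf = False|), 0) = (d(|tape := rest|), cur)" using turns_read[of k] by (elim exE conjE) (rule that, assumption+, erule spec)
  have "ovf (turns dl lm (bs @ rest)) | turns dl lm (bs @ rest) = d(|tape := rest|)" for rest using 1(4)[of rest] unfolding turns_def by auto
  thus thesis using that 1(1-3) by blast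
 qed
 have gd: "good d Cs As cur" and curle: "cur<=length Cs" and fin: "!!j. j<cur ==> finished d Cs As j" using 1(1) by (auto simp: stage_def)
 have CsP: "set Cs<=P" "distinct Cs" "length (cens d) = length Cs" "rads d = map DD Cs" using gd by (auto simp: good_def)
 \<comment> \<open>If all \<open>k\<close> turns were used, \<open>k\<close> distinct clusters have
   been found. These are all of \<open>P\<close>, so no point is uncovered.\<close>
 have cur: "cur = length Cs" and un: "uncov d = {}"
 proof -
  have "cur = length Cs & uncov d = {}"
  proof (cases "cur = k")
   case True
   hence len: "length Cs = k" using good_len[OF gd] curle by simp
   hence "card (set Cs) = k" using CsP by (simp add: distinct_card)
   hence "set Cs = P" using card_seteq[OF finP CsP(1)] kP by simp
   hence "covered d p" if "p<n" for p using cluster_of[OF that] cluster_covered[OF gd] by blast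
   thus ?thesis using True len by (auto simp: uncov_def)
  qed (use 1 in blast)
  thus "cur = length Cs" "uncov d = {}" by auto
 qed
 \<comment> \<open>The honest answer to a query: cluster \<open>i\<close> has a point in the ball of
   the marker.\<close>
 define keep where "keep = (%i e s. EX c:Cs ! i. dd e c<=8*(s/th))"
 obtain bs2 where bs2: "length bs2 = (SUM i<length Cs. length (filter (asks (rads d ! i) (cens d ! i)) (ents d)))"
  "!!rest. EX pl. foldl (astep dl d) (%_. None, bs2 @ rest) [0..<length Cs] = (pl, rest) &
    (ALL p i. pl p = Some i --> i<length Cs & inS d keep i p) &
    (ALL p i. i<length Cs --> inS d keep i p --> (EX j. pl p = Some j & rads d ! j<=rads d ! i))" using assign_read[where m = "length Cs" and d = d and keep = keep] by blast
 have "length (bs @ bs2)<=36*(k*g*q)" using 1(2) pot_le[OF gd curle] bs2(1) asks_sum[OF gd] by simp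
 moreover have "ovf (turns dl lm ((bs @ bs2) @ rest)) | (ALL L. labelling (turns dl lm ((bs @ bs2) @ rest)) (assign dl (turns dl lm ((bs @ bs2) @ rest))) L -->
    (ALL l:P. EX c. ALL p:l. L p = c) &
    (EX D. (ALL p<n. ALL p'<n. L p = L p' --> dd p p'<=D (L p)) & (ALL v. 0<=D v) &
    (ALL K. finite K --> sum D K<=(1+114/th) * sum DD P)))" for rest
 proof (cases "ovf (turns dl lm ((bs @ bs2) @ rest))")
  case False
  let ?d = "d(|tape := bs2 @ rest|)"
  have td: "turns dl lm ((bs @ bs2) @ rest) = ?d" using tr[of "bs2 @ rest"] False by simp
  obtain pl where pl: "foldl (astep dl d) (%_. None, bs2 @ rest) [0..<length Cs] = (pl, rest)"
    "!!p i. pl p = Some i ==> i<length Cs & inS d keep i p"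
    "!!p i. i<length Cs ==> inS d keep i p ==> (EX j. pl p = Some j & rads d ! j<=rads d ! i)" using bs2(2)[of rest] by blast
  have "sstep ?d = sstep d" unfolding sstep_def Let_def by (auto simp: fun_eq_iff)
  hence "sset dl ?d = sset dl d" by (intro ext) (simp add: sset_def)
  moreover have "rads ?d = rads d" by simp
  ultimately have "astep dl ?d = astep dl d" unfolding astep_def by (simp only:)
  hence as: "assign dl ?d = pl" unfolding assign_def using pl(1) CsP(3) by simp
  interpret C: completed n k g q B dd z r P DD dl Cs "cens d" "ents d" As "wits d" pl ?d
  proof unfold_locales
   show "length Cs<=k" by (rule good_len[OF gd])
   thus "length Cs<=B" using kgq(1) B by linarith
   show "length As = length (ents d)" using gd by (auto simp: good_def dest: list_all2_lengthD)
   show "cens d ! j<n & (EX w:Cs ! j. dd (cens d ! j) w<=DD (Cs ! j))" if "j<length Cs" for j using gd that by (auto simp: good_def)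
   show "EX e h nr. ents d ! b = (e, DD h, nr) & par (As ! b) = Some h & h : set Cs & e<n &
    (EX w:As ! b. dd e w<=DD h/th) & (nr <-> (EX C:P. DD h<=DD C & (EX p:C. dd e p<=8*(DD h/th))))"
    if "b<length (ents d)" for b
   proof -
    have "marker_ok (take cur Cs) (As ! b) (ents d ! b)" using gd that by (auto simp: good_def list_all2_conv_all_nth)
    thus ?thesis unfolding marker_ok_def cur by simp
   qed
   have fj: "finished d Cs As j" if "j<length Cs" for j using fin[of j] that cur by simp
   show "C : set Cs" if "j<length Cs" "C : P" "DD (Cs ! j)<th*DD C" "close C (Cs ! j) (8*DD (Cs ! j))" for j C using fj[OF that(1), unfolded finished_def, THEN conjunct1] that(2-4) by simp
   show "a : set As" if "j<length Cs" "par a = Some (Cs ! j)" for j a using fj[OF that(1), unfolded finished_def, THEN conjunct2, THEN conjunct1] that(2) by simp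
   show "EX y. (j, y) : set (wits d) & (ALL p:C. DD (Cs ! j)+dl<dd y p)"
    if "j<length Cs" "C : P" "C ~= Cs ! j" "DD (Cs ! j)<=DD C" "p : C" "dd (cens d ! j) p<=2*DD (Cs ! j)" for j C p by (rule fj[OF that(1), unfolded finished_def, THEN conjunct2, THEN conjunct2, rule_format, OF that(2,5,3,4,6)])
   show "w<length Cs & (ALL p:Cs ! w. dd y p<=DD (Cs ! w)+dl)" if "(w, y) : set (wits d)" for w y using gd that by (auto simp: good_def)
   show "EX j<length Cs. dd (cens d ! j) p<=2*DD (Cs ! j) & ~ blocked (ents d) (DD (Cs ! j)) p" if "p<n" for p
   proof -
    have "covered d p" using un that by (auto simp: uncov_def)
    then obtain j where "j<length Cs" "~ 2*DD (Cs ! j)<dd (cens d ! j) p" "~ blocked (ents d) (DD (Cs ! j)) p" using CsP unfolding covered_def by auto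
    thus ?thesis by (intro exI[of _ j]) auto
   qed
   show "i<length Cs & dd (cens d ! i) p<=2*DD (Cs ! i) &
    (ALL (e, s, nr):set (ents d). s<=DD (Cs ! i) --> dd e p<=8*(s/th) -->
    nr & (DD (Cs ! i)/th < s --> dd (cens d ! i) e<=3*DD (Cs ! i) --> (EX c:Cs ! i. dd e c<=8*(s/th)))) &
    (ALL y. (i, y) : set (wits d) --> dd y p<=DD (Cs ! i)+dl)" if "p<n" "pl p = Some i" for p i
   proof -
    have i: "i<length Cs" "inS d keep i p" using pl(2) that by auto
    hence "rads d ! i = DD (Cs ! i)" using CsP by simp
    thus ?thesis using i unfolding inS_def stays_def keep_def by simp
   qed
   show "EX j. pl p = Some j & DD (Cs ! j)<=DD (Cs ! i)" if i: "i<length Cs" "p : Cs ! i" for p i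
   proof -
    have D: "rads d ! i = DD (Cs ! i)" using CsP i by simp
    note tc = to_centre[OF gd i]
    have nb: "~ blocked (ents d) (DD (Cs ! i)) p" using unblocked[OF tc(3) i(2)] gd by (auto simp: good_def)
    have "stays (DD (Cs ! i)) (cens d ! i) (keep i) p en" if "en : set (ents d)" for en using that nb i(2) unfolding stays_def keep_def blocked_def by (fastforce simp: not_less)
    moreover have "dd y p<=DD (Cs ! i)+dl" if "(i, y) : set (wits d)" for y using gd that i(2) by (auto simp: good_def)
    ultimately have "inS d keep i p" using tc(1) in_n[OF tc(3) i(2)] unfolding inS_def D by blast
    then obtain j where j: "pl p = Some j" "rads d ! j<=rads d ! i" using pl(3) i by blast
    hence "j<length Cs" using pl(2) by blast
    thus ?thesis using j D CsP by auto
   qed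
  qed (use CsP in auto)
  show ?thesis unfolding td as using C.labelling_good by blast
 qed blast
 ultimately show ?thesis by blast
qed

end

section \<open>Machine code for reading advice and naming points\<close>

section \<open>The program: reading advice and naming points\<close>

lemma wp_step:
 assumes "wp K I p s Q'" "!!s'. Q' s' ==> frame p s s' ==> wp K I r s' Q"
 shows "wp K I (p ;; r) s Q" using wp_conseq[OF assms] by simp

lemma wp_mono: "wp K I p s Q ==> (!!s'. Q s' ==> Q' s') ==> wp K I p s Q'" by (rule wp_conseq)

lemma wp_For_fold:
 assumes "ints s a i = int N" "v ~: piw p" "a ~: piw p" "a ~= v"
  and "R st s"
  and stable: "!!st s x. R st s ==> R st (iupd v 0 x s)"
  and body: "!!j st s'. j<N ==> R st s' ==> ints s' v 0 = int j ==> frame (For v a i p) s s' ==> wp K I p s' (R (f st j))"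
 shows "wp K I (For v a i p) s (R (foldl f st [0..<N]))" by (rule wp_For[where Inv = "%j. R (foldl f st [0..<j])", OF assms(1-4)]) (use assms in auto)

lemma foldl_funpow: "foldl (%st _. f st) st [0..<N] = (f ^^ N) st" by (induction N) auto

lemma wp_For_funpow:
 assumes "ints s a i = int N" "v ~: piw p" "a ~: piw p" "a ~= v"
  and "R st s"
  and stable: "!!st s x. R st s ==> R st (iupd v 0 x s)"
  and body: "!!st s'. R st s' ==> frame (For v a i p) s s' ==> wp K I p s' (R (f st))"
 shows "wp K I (For v a i p) s (R ((f ^^ N) st))" unfolding foldl_funpow[symmetric] by (rule wp_For_fold[where f = "%st _. f st" and R = R, OF assms(1-5)]) (use stable body in auto)

abbreviation iv :: "nat => iexp" where "iv a \<equiv> IGet a I0"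
abbreviation rv :: "nat => rexp" where "rv a \<equiv> RGet a I0"
abbreviation seti :: "nat => iexp => prog" where "seti a e \<equiv> PISet a I0 e"
abbreviation setr :: "nat => rexp => prog" where "setr a e \<equiv> PRSet a I0 e"
abbreviation pos :: "nat => bexp" where "pos a \<equiv> ILess I0 (iv a)"
abbreviation rnum :: "int => rexp" where "rnum c \<equiv> ROfInt (IConst c)"

text \<open>
  Integer arrays: 3--9 hold \<open>B\<close>, \<open>q\<close>, \<open>g\<close>, \<open>2^B\<close>, \<open>2^g\<close>, \<open>2^(g q)\<close>, \<open>2 B\<close>; 10 the advice bits,
  11 the reading position, 12 the last bit read, 13 a flag, 15 the initial centres; 16 an index,
  17 the overflow flag, 18 a point, 19 a picked point; 30 a set of points, 32 its minimum.
  Real arrays: 1 and 2 hold \<open>th\<close> and \<open>r\<close>, 3 and 4 the units \<open>\<delta>\<close> and \<open>\<lambda>\<close>, 7 a number read from the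
  advice, 8, 9, 12 radii.
\<close>

definition READ :: prog where
 "READ = If (ILess (iv 11) (iv 3)) (seti 12 (IGet 10 (iv 11))) (seti 12 I0);;
   seti 11 (IPlus (iv 11) I1)"

definition UNARY :: "nat => int => prog => prog" where
 "UNARY a i p = seti 13 I1;; For 14 a i (If (pos 13) (READ;; If (pos 12) p (seti 13 I0)) PSkip)"

definition READD :: prog where
 "READD = setr 7 (rnum 0);;
   For 14 4 0 (READ;; If (pos 12) (setr 7 (RPlus (RPlus (rv 7) (rv 7)) (rv 3))) (setr 7 (RPlus (rv 7) (rv 7))));;
   setr 7 (RPlus (rv 7) (rv 3));; UNARY 3 0 (setr 7 (RPlus (rv 7) (rv 4)))"

definition NUM :: prog where
 "NUM = seti 16 I0;;
   For 14 5 0 (READ;; If (pos 12) (seti 16 (IPlus (IPlus (iv 16) (iv 16)) I1)) (seti 16 (IPlus (iv 16) (iv 16))))"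

definition FILL :: "nat => bexp => prog" where
 "FILL A b = For 31 0 0 (If b (PISet A (iv 31) I1) (PISet A (iv 31) I0))"

definition KILL :: "nat => bexp => prog" where
 "KILL A b = For 31 0 0 (If b (PISet A (iv 31) I0) PSkip)"

definition MINPT :: prog where
 "MINPT = seti 32 (IConst (-1));;
   For 31 0 0 (If (BAnd (ILess (iv 32) I0) (ILess I0 (IGet 30 (iv 31)))) (seti 32 (iv 31)) PSkip)"

definition DROPBALL :: prog where
 "DROPBALL = KILL 30 (BNot (RLess (rv 12) (RDist (iv 32) (iv 31))))"

definition NETPICK :: prog where
 "NETPICK = seti 19 (iv 18);; FILL 30 (BNot (RLess (rv 8) (RDist (iv 18) (iv 31))));; setr 12 (RDivide (rv 8) (rnum 2));;
   For 20 7 0 (MINPT;; If (BNot (ILess (iv 32) I0))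
    (If (BNot (BAnd (BNot (ILess (iv 20) (iv 16))) (BNot (ILess (iv 16) (iv 20))))) PSkip (seti 19 (iv 32));; DROPBALL) PSkip);;
   MINPT;; If (BNot (ILess (iv 32) I0)) (seti 17 I1) PSkip"

definition NAME :: prog where
 "NAME = For 21 3 0 (If (RLess (rv 9) (rv 8)) (NUM;; NETPICK;; seti 18 (iv 19);; setr 8 (RDivide (rv 8) (rnum 2))) PSkip)"

lemma [simp]: "piw READ = {11,12}" "prw READ = {}" by (auto simp: READ_def)
lemma [simp]: "piw (UNARY a i p) = {11,12,13,14} \<union> piw p" "prw (UNARY a i p) = prw p" by (auto simp: UNARY_def)
lemma [simp]: "piw READD = {11,12,13,14}" "prw READD = {7}" by (auto simp: READD_def)
lemma [simp]: "piw NUM = {11,12,14,16}" "prw NUM = {}" by (auto simp: NUM_def)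
lemma [simp]: "piw (FILL A b) = {31, A}" "prw (FILL A b) = {}" by (auto simp: FILL_def)
lemma [simp]: "piw (KILL A b) = {31, A}" "prw (KILL A b) = {}" by (auto simp: KILL_def)
lemma [simp]: "piw MINPT = {31,32}" "prw MINPT = {}" by (auto simp: MINPT_def)
lemma [simp]: "piw DROPBALL = {30,31}" "prw DROPBALL = {}" by (auto simp: DROPBALL_def)
lemma [simp]: "piw NETPICK = {17,19,20,30,31,32}" "prw NETPICK = {12}" by (auto simp: NETPICK_def)
lemma [simp]: "piw NAME = {11,12,14,16,17,18,19,20,21,30,31,32}" "prw NAME = {8,12}" by (auto simp: NAME_def)

lemma frame_For_var: "frame (For v a i p) s s' ==> b ~: piw (For v a i p) ==> ints s' b = ints s b" by (rule frameD)

locale machine = decoder +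
 fixes K :: "nat set => nat => int => bool" and I :: inst
 assumes nI: "npts I = n" and dI: "dst I = dd" and n1: "1<=n" and k1: "1<=k"
begin

text \<open>Powers and products sit in cells because integers can only be added, subtracted and
  compared, and because loop bounds must be cells.\<close>

definition consts_ok :: "state => bool" where
 "consts_ok s <-> ints s 0 0 = int n & ints s 0 1 = int k & ints s 3 0 = int B & ints s 4 0 = int q & ints s 5 0 = int g &
   ints s 6 0 = int (2 ^ B) & ints s 7 0 = int (2 ^ g) & ints s 8 0 = int (2 ^ (g*q)) & ints s 9 0 = int (2*B) &
   (ALL i<=k. ints s 15 (int i) = int (z i)) & reals s 1 0 = th & reals s 2 0 = r"

lemma consts_ok_cong:
 assumes "consts_ok s" "ALL a:{0,3,4,5,6,7,8,9,15}. ints s' a = ints s a" "ALL a:{1,2}. reals s' a = reals s a"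
 shows "consts_ok s'" using assms by (simp add: consts_ok_def)

lemma consts_ok_frame:
 assumes "consts_ok s" "frame p s s'" "piw p \<inter> {0,3,4,5,6,7,8,9,15} = {}" "prw p \<inter> {1,2} = {}"
 shows "consts_ok s'" by (rule consts_ok_cong[OF assms(1)]) (use frameD[OF assms(2)] assms(3,4) in auto)

lemma consts_ok_upd [simp]:
 "a ~: {0,3,4,5,6,7,8,9,15} ==> consts_ok (iupd a i x s) = consts_ok s"
 "a ~: {1,2} ==> consts_ok (rupd a i y s) = consts_ok s" by (auto simp: consts_ok_def)

definition tp :: "state => bool list" where
 "tp s = drop (nat (ints s 11 0)) (map (%i. 0<ints s 10 (int i)) [0..<B])"

definition tape_ok :: "state => bool" where "tape_ok s <-> 0<=ints s 11 0"

lemma tp_cong: "ints s' 10 = ints s 10 ==> ints s' 11 = ints s 11 ==> tp s' = tp s" by (simp add: tp_def)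

lemma tape_ok_cong: "ints s' 11 = ints s 11 ==> tape_ok s' = tape_ok s" by (simp add: tape_ok_def)

lemma tp_upd [simp]:
 "a ~: {10,11} ==> tp (iupd a i x s) = tp s" "tp (rupd a i y s) = tp s"
 "a ~= 11 ==> tape_ok (iupd a i x s) = tape_ok s" "tape_ok (rupd a i y s) = tape_ok s" by (auto simp: tp_def tape_ok_def)

lemma hdb_drop: "hdb (drop m xs) <-> m<length xs & xs ! m" by (cases "m<length xs") (auto simp: hdb_def hd_drop_conv_nth)

lemma READ_wp:
 assumes "consts_ok s" "tape_ok s"
 shows "wp K I READ s (%s'. tape_ok s' & (0<ints s' 12 0 <-> hdb (tp s)) & tp s' = tl (tp s))"
proof -
 let ?p = "ints s 11 0"
 have p: "0<=?p" "ints s 3 0 = int B" using assms by (auto simp: tape_ok_def consts_ok_def)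
 hence "nat (?p+1) = Suc (nat ?p)" by simp
 hence t: "tl (tp s) = drop (nat (?p+1)) (map (%i. 0<ints s 10 (int i)) [0..<B])" unfolding tp_def tl_drop by (simp add: drop_Suc tl_drop)
 have h: "hdb (tp s) <-> ?p<int B & 0<ints s 10 ?p" using p unfolding tp_def hdb_drop by (cases "?p<int B") (auto simp: nat_less_iff)
 show ?thesis unfolding t h using p by (auto simp: READ_def tape_ok_def tp_def iupd_other)
qed

text \<open>
  \<open>V\<close> relates a value to the state and must not depend on the cells used for reading.
\<close>

lemma UNARY_wp:
 assumes s: "consts_ok s" "tape_ok s" and V: "V v s"
  and bd: "ints s a i = int N" "a ~: {11,12,13,14}" "a ~: piw p"
  and p: "piw p \<inter> {0,3,4,5,6,7,8,9,10,11,13,14,15} = {}" "prw p \<inter> {1,2} = {}"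
  and stable: "!!v s s'. V v s ==> (!!a. a ~: {11,12,13,14} ==> ints s' a = ints s a) ==> reals s' = reals s ==> V v s'"
  and step: "!!v s. V v s ==> wp K I p s (V (f v))"
 shows "wp K I (UNARY a i p) s (%s'. tape_ok s' & (EX v' go. (gstep f ^^ N) (v, True, tp s) = (v', go, tp s') & V v' s'))"
proof -
 let ?R = "%(v', go, t) s'. consts_ok s' & tape_ok s' & (0<ints s' 13 0 <-> go) & tp s' = t & V v' s'"
 have 1: "wp K I (For 14 a i (If (pos 13) (READ;; If (pos 12) p (seti 13 I0)) PSkip)) (iupd 13 0 1 s)
  (?R ((gstep f ^^ N) (v, True, tp s)))"
 proof (rule wp_For_funpow)
  show "?R (v, True, tp s) (iupd 13 0 1 s)" using s V stable[OF V] by (auto simp: iupd_other)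
  fix st s x assume "?R st s"
  thus "?R st (iupd 14 0 x s)" using stable by (fastforce simp: iupd_other split: prod.splits)
 next
  fix st s' assume R: "?R st s'"
  obtain v go t where st: "st = (v, go, t)" by (metis prod_cases3)
  show "wp K I (If (pos 13) (READ;; If (pos 12) p (seti 13 I0)) PSkip) s' (?R (gstep f st))"
  proof (cases go)
   case False
   thus ?thesis using R st by simp
  next
   case True
   have "wp K I (READ;; If (pos 12) p (seti 13 I0)) s' (?R (gstep f st))"
   proof (rule wp_step[OF READ_wp])
    fix s1 assume 1: "tape_ok s1 & (0<ints s1 12 0 <-> hdb (tp s')) & tp s1 = tl (tp s')" and fr: "frame READ s' s1"
    have c: "consts_ok s1" by (rule consts_ok_frame[OF _ fr]) (use R st in auto)
    have V1: "V v s1" by (rule stable[of v s']) (use R st frameD[OF fr] in auto)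
    have go1: "0<ints s1 13 0" using R st True frameD[OF fr] by simp
    show "wp K I (If (pos 12) p (seti 13 I0)) s1 (?R (gstep f st))"
    proof (cases "hdb t")
    case hd: True
    have "wp K I p s1 (?R (gstep f st))"
    proof (rule wp_conseq[OF step[OF V1]])
    fix s2 assume 2: "V (f v) s2" and fr2: "frame p s1 s2"
    have "consts_ok s2" by (rule consts_ok_frame[OF c fr2]) (use p in auto)
    moreover have "tp s2 = tp s1" by (rule tp_cong) (use frameD[OF fr2] p in auto)
    moreover have "tape_ok s2 = tape_ok s1" by (rule tape_ok_cong) (use frameD[OF fr2] p in auto)
    moreover have "ints s2 13 = ints s1 13" by (rule frameD[OF fr2]) (use p in auto)
    ultimately show "?R (gstep f st) s2" using 1 2 R st True hd go1 by simp
    qed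
    thus ?thesis using 1 hd R st by simp
    next
    case hd: False
    have "V v (iupd 13 0 0 s1)" by (rule stable[OF V1]) (auto simp: iupd_other)
    thus ?thesis using 1 hd R st True c by (simp add: iupd_other)
    qed
   qed (use R st in auto)
   thus ?thesis using True R st by simp
  qed
 qed (use bd p in "auto simp: iupd_other")
 have 2: "wp K I (UNARY a i p) s (?R ((gstep f ^^ N) (v, True, tp s)))" using 1 by (simp add: UNARY_def)
 show ?thesis by (rule wp_mono[OF 2]) (auto split: prod.splits)
qed

lemma READD_wp:
 assumes s: "consts_ok s" "tape_ok s" and u: "reals s 3 0 = dl" "reals s 4 0 = lm"
 shows "wp K I READD s (%s'. tape_ok s' & readD dl lm (tp s) = (reals s' 7 0, tp s'))"
proof -
 let ?s = "rupd 7 0 0 s"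
 let ?R = "%(v, t) s'. consts_ok s' & tape_ok s' & tp s' = t & reals s' 7 0 = v & reals s' 3 0 = dl & reals s' 4 0 = lm"
 let ?p = "READ;; If (pos 12) (setr 7 (RPlus (RPlus (rv 7) (rv 7)) (rv 3))) (setr 7 (RPlus (rv 7) (rv 7)))"
 have 1: "wp K I (For 14 4 0 ?p) ?s (?R ((bstep dl ^^ q) (0, tp s)))"
 proof (rule wp_For_funpow)
  show "?R (0, tp s) ?s" using s u by simp
  fix st s' assume R: "?R st s'"
  show "wp K I ?p s' (?R (bstep dl st))"
  proof (rule wp_step[OF READ_wp])
   fix s1 assume 1: "tape_ok s1 & (0<ints s1 12 0 <-> hdb (tp s')) & tp s1 = tl (tp s')" and fr: "frame READ s' s1"
   have c: "consts_ok s1" by (rule consts_ok_frame[OF _ fr]) (use R in auto)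
   show "wp K I (If (pos 12) (setr 7 (RPlus (RPlus (rv 7) (rv 7)) (rv 3))) (setr 7 (RPlus (rv 7) (rv 7)))) s1 (?R (bstep dl st))" using 1 c R frameD(2)[OF fr] by (auto simp: bstep_def)
  qed (use R in auto)
 qed (use s in "auto simp: consts_ok_def")
 show ?thesis unfolding READD_def wp_Sq wp_PRSet
 proof (rule wp_mono, simp)
  show "wp K I (For 14 4 0 ?p) ?s (?R ((bstep dl ^^ q) (0, tp s)))" by (rule 1)
 next
  fix s1 assume R: "?R ((bstep dl ^^ q) (0, tp s)) s1"
  obtain D t where D: "(bstep dl ^^ q) (0, tp s) = (D, t)" by fastforce
  let ?s1 = "rupd 7 (ival I s1 I0) (rval I s1 (RPlus (rv 7) (rv 3))) s1"
  have "wp K I (UNARY 3 0 (setr 7 (RPlus (rv 7) (rv 4)))) ?s1 (%s'. tape_ok s' &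
    (EX v' go. (gstep (%D. D+lm) ^^ B) (D+dl, True, tp ?s1) = (v', go, tp s') & (reals s' 7 0 = v' & reals s' 4 0 = lm)))" by (rule UNARY_wp) (use R D in "auto simp: consts_ok_def")
  thus "wp K I (UNARY 3 0 (setr 7 (RPlus (rv 7) (rv 4)))) ?s1 (%s'. tape_ok s' & readD dl lm (tp s) = (reals s' 7 0, tp s'))" by (rule wp_mono) (use R D in "auto simp: readD_def")
 qed
qed

lemma NUM_wp:
 assumes s: "consts_ok s" "tape_ok s"
 shows "wp K I NUM s (%s'. tape_ok s' & (EX m. ints s' 16 0 = int m & (nstep ^^ g) (0, tp s) = (m, tp s')))"
proof -
 let ?R = "%(v, t) s'. consts_ok s' & tape_ok s' & tp s' = t & ints s' 16 0 = int v"
 let ?p = "READ;; If (pos 12) (seti 16 (IPlus (IPlus (iv 16) (iv 16)) I1)) (seti 16 (IPlus (iv 16) (iv 16)))"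
 have 1: "wp K I (For 14 5 0 ?p) (iupd 16 0 0 s) (?R ((nstep ^^ g) (0, tp s)))"
 proof (rule wp_For_funpow)
  show "?R (0, tp s) (iupd 16 0 0 s)" using s by simp
  fix st s' assume R: "?R st s'"
  show "wp K I ?p s' (?R (nstep st))"
  proof (rule wp_step[OF READ_wp])
   fix s1 assume 1: "tape_ok s1 & (0<ints s1 12 0 <-> hdb (tp s')) & tp s1 = tl (tp s')" and fr: "frame READ s' s1"
   have c: "consts_ok s1" by (rule consts_ok_frame[OF _ fr]) (use R in auto)
   show "wp K I (If (pos 12) (seti 16 (IPlus (IPlus (iv 16) (iv 16)) I1)) (seti 16 (IPlus (iv 16) (iv 16)))) s1 (?R (nstep st))" using 1 c R frameD(1)[OF fr] by (auto simp: nstep_def)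
  qed (use R in auto)
 qed (use s in "auto simp: consts_ok_def")
 have 2: "wp K I NUM s (?R ((nstep ^^ g) (0, tp s)))" using 1 by (simp add: NUM_def)
 show ?thesis by (rule wp_mono[OF 2]) (auto split: prod.splits)
qed

lemma nstep_bound: "fst ((nstep ^^ m) (0, t))<2 ^ m"
proof (induction m)
 case (Suc m)
 thus ?case by (cases "(nstep ^^ m) (0, t)") (auto simp: nstep_def)
qed simp

definition pts :: "nat => state => nat set" where
 "pts A s = {p. p<n & 0<ints s A (int p)}"

lemma pts_cong: "ints s' A = ints s A ==> pts A s' = pts A s" by (simp add: pts_def)

lemma pts_upd [simp]: "a ~= A ==> pts A (iupd a i x s) = pts A s" "pts A (rupd a i y s) = pts A s" by (auto simp: pts_def)

lemma finite_pts [simp]: "finite (pts A s)" by (simp add: pts_def)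

lemma FILL_wp:
 assumes "ints s 0 0 = int n" "A ~= 31" "A ~= 0"
  and b: "!!j s'. j<n ==> ints s' 31 0 = int j ==> frame (FILL A b) s s' ==> bval I s' b = h j"
 shows "wp K I (FILL A b) s (%s'. pts A s' = {p. p<n & h p})" unfolding FILL_def
proof (rule wp_For[where N = n and Inv = "%j s'. ALL p<j. 0<ints s' A (int p) <-> h p"])
 fix j s' assume j: "j<n" and inv: "ALL p<j. 0<ints s' A (int p) <-> h p" and v: "ints s' 31 0 = int j"
  and fr: "frame (For 31 0 0 (If b (PISet A (iv 31) I1) (PISet A (iv 31) I0))) s s'"
 have "bval I s' b = h j" using b[OF j v] fr by (simp add: FILL_def)
 thus "wp K I (If b (PISet A (iv 31) I1) (PISet A (iv 31) I0)) s'
   (%s'. ALL p<Suc j. 0<ints s' A (int p) <-> h p)" using inv v by (auto simp: less_Suc_eq)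
qed (use assms in "auto simp: pts_def iupd_other")

lemma KILL_wp:
 assumes "ints s 0 0 = int n" "A ~= 31" "A ~= 0"
  and b: "!!j s'. j<n ==> ints s' 31 0 = int j ==> frame (KILL A b) s s' ==> bval I s' b = h j"
 shows "wp K I (KILL A b) s (%s'. pts A s' = pts A s - {p. h p})" unfolding KILL_def
proof (rule wp_For[where N = n and Inv = "%j s'. ALL p<n. 0<ints s' A (int p) <-> 0<ints s A (int p) & (p<j --> ~ h p)"])
 fix j s' assume j: "j<n" and inv: "ALL p<n. 0<ints s' A (int p) <-> 0<ints s A (int p) & (p<j --> ~ h p)" and v: "ints s' 31 0 = int j"
  and fr: "frame (For 31 0 0 (If b (PISet A (iv 31) I0) PSkip)) s s'"
 have "bval I s' b = h j" using b[OF j v] fr by (simp add: KILL_def)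
 thus "wp K I (If b (PISet A (iv 31) I0) PSkip) s'
   (%s'. ALL p<n. 0<ints s' A (int p) <-> 0<ints s A (int p) & (p<Suc j --> ~ h p))" using inv v by (auto simp: less_Suc_eq)
qed (use assms in "auto simp: pts_def iupd_other")

lemma MINPT_wp:
 assumes "ints s 0 0 = int n"
 shows "wp K I MINPT s (%s'. ints s' 32 0 = (if pts 30 s = {} then -1 else int (Min (pts 30 s))))" unfolding MINPT_def wp_Sq wp_PISet
proof (rule wp_For[where N = n and Inv = "%j s'. ints s' 30 = ints s 30 &
  (if pts 30 s \<inter> {..<j} = {} then ints s' 32 0 = -1 else ints s' 32 0 = int (Min (pts 30 s)))"])
 fix j :: nat and s' :: state assume j: "j<n" and inv: "ints s' 30 = ints s 30 &
  (if pts 30 s \<inter> {..<j} = {} then ints s' 32 0 = -1 else ints s' 32 0 = int (Min (pts 30 s)))" and v: "ints s' 31 0 = int j"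
 have b: "0<ints s' 30 (int j) <-> j : pts 30 s" using inv j by (simp add: pts_def)
 have l: "pts 30 s \<inter> {..<Suc j} = (if j : pts 30 s then insert j (pts 30 s \<inter> {..<j}) else pts 30 s \<inter> {..<j})" by (auto simp: less_Suc_eq)
 have m: "Min (pts 30 s) = j" if "j : pts 30 s" "pts 30 s \<inter> {..<j} = {}" using that by (intro Min_eqI) (auto simp: not_less)
 show "wp K I (If (BAnd (ILess (iv 32) I0) (ILess I0 (IGet 30 (iv 31)))) (seti 32 (iv 31)) PSkip) s'
   (%s'. ints s' 30 = ints s 30 & (if pts 30 s \<inter> {..<Suc j} = {} then ints s' 32 0 = -1 else ints s' 32 0 = int (Min (pts 30 s))))" using inv v b m unfolding l by (auto simp: iupd_other split: if_splits)
next
 fix s' :: state assume inv: "ints s' 30 = ints s 30 &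
  (if pts 30 s \<inter> {..<n} = {} then ints s' 32 0 = -1 else ints s' 32 0 = int (Min (pts 30 s)))"
 have "pts 30 s \<inter> {..<n} = pts 30 s" by (auto simp: pts_def)
 thus "ints s' 32 0 = (if pts 30 s = {} then -1 else int (Min (pts 30 s)))" using inv by simp
qed (use assms in "auto simp: iupd_other")

lemma DROPBALL_wp:
 assumes "ints s 0 0 = int n" "ints s 32 0 = int c"
 shows "wp K I DROPBALL s (%s'. pts 30 s' = pts 30 s - ballp c (reals s 12 0))" unfolding DROPBALL_def
proof (rule wp_mono[OF KILL_wp[where h = "%j. ~ reals s 12 0<dd c j"]])
 fix j s' assume "ints s' 31 0 = int j" and fr: "frame (KILL 30 (BNot (RLess (rv 12) (RDist (iv 32) (iv 31))))) s s'"
 thus "bval I s' (BNot (RLess (rv 12) (RDist (iv 32) (iv 31)))) = (~ reals s 12 0<dd c j)" using frameD[OF fr] assms by (simp add: dI)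
qed (use assms in "auto simp: ballp_def pts_def")

text \<open>All \<open>2 ^ g\<close> greedy steps are carried out. The centre of step
  \<open>m\<close> is remembered on the way, and points left over at the end raise the overflow
  cell.\<close>

lemma NETPICK_wp:
 assumes s: "consts_ok s" and c: "ints s 18 0 = int c" and R: "reals s 8 0 = R" and m: "ints s 16 0 = int m" "m<2 ^ g"
 shows "wp K I NETPICK s (%s'. ints s' 19 0 = int (pick c R m) &
   (0<ints s' 17 0 <-> 0<ints s 17 0 | net (ballp c R) (R/2) (2 ^ g) ~= {}))"
proof -
 let ?net = "net (ballp c R) (R/2)"
 let ?body = "MINPT;; If (BNot (ILess (iv 32) I0))
    (If (BNot (BAnd (BNot (ILess (iv 20) (iv 16))) (BNot (ILess (iv 16) (iv 20))))) PSkip (seti 19 (iv 32));; DROPBALL) PSkip"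
 let ?C = "%s'. consts_ok s' & ints s' 16 0 = int m & ints s' 17 0 = ints s 17 0 & reals s' 12 0 = R/2"
 let ?P = "%j s'. ints s' 19 0 = int (if j<=m then c else pick c R m)"
 let ?Inv = "%j s'. ?C s' & pts 30 s' = ?net j & ?P j s'"
 have n0: "ints s 0 0 = int n" using s by (simp add: consts_ok_def)
 have fin: "finite (?net j)" for j by (meson finite_ballp finite_subset net_sub)
 have loop: "wp K I (For 20 7 0 ?body) s1 (?Inv (2 ^ g))" if s1: "?Inv 0 s1" for s1
 proof (rule wp_For[where N = "2 ^ g" and Inv = ?Inv])
  fix j s' assume inv: "?Inv j s'" and v: "ints s' 20 0 = int j"
  have n0': "ints s' 0 0 = int n" using inv by (simp add: consts_ok_def)
  show "wp K I ?body s' (?Inv (Suc j))"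
  proof (rule wp_step[OF MINPT_wp[OF n0']])
   fix s2 assume M: "ints s2 32 0 = (if pts 30 s' = {} then -1 else int (Min (pts 30 s')))" and fr: "frame MINPT s' s2"
   have c2: "consts_ok s2" by (rule consts_ok_frame[OF _ fr]) (use inv in auto)
   have p2: "pts 30 s2 = pts 30 s'" by (rule pts_cong) (use frameD[OF fr] in simp)
   note f2 = frameD[OF fr]
   show "wp K I (If (BNot (ILess (iv 32) I0))
    (If (BNot (BAnd (BNot (ILess (iv 20) (iv 16))) (BNot (ILess (iv 16) (iv 20))))) PSkip (seti 19 (iv 32));; DROPBALL) PSkip) s2 (?Inv (Suc j))"
   proof (cases "?net j = {}")
    case True
    have "pick c R m = c" if "j<=m" using net_antimono[OF that, of "ballp c R" "R/2"] True by (simp add: pick_def)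
    thus ?thesis using True M inv c2 p2 f2 by auto
   next
    case False
    let ?s3 = "if j = m then iupd 19 0 (int (Min (?net j))) s2 else s2"
    have "wp K I DROPBALL ?s3 (?Inv (Suc j))"
    proof (rule wp_conseq[OF DROPBALL_wp[where c = "Min (?net j)"]])
    show "ints ?s3 0 0 = int n" using n0' f2 by simp
    show "ints ?s3 32 0 = int (Min (?net j))" using M False inv by simp
    fix s4 assume 4: "pts 30 s4 = pts 30 ?s3 - ballp (Min (?net j)) (reals ?s3 12 0)" and fr4: "frame DROPBALL ?s3 s4"
    have "consts_ok s4" by (rule consts_ok_frame[OF _ fr4]) (use c2 in auto)
    moreover have i12: "reals s' 12 0 = R/2" using inv by blast
    have e: "pts 30 ?s3 = ?net j" "reals ?s3 12 0 = R/2" using p2 inv by (simp_all add: f2 i12)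
    have "pts 30 s4 = ?net (Suc j)" using 4 False unfolding e by simp
    moreover have "?P (Suc j) s4" using frameD[OF fr4] inv f2 False by (auto simp: pick_def)
    ultimately show "?Inv (Suc j) s4" using frameD[OF fr4] inv f2 by (auto split: if_splits)
    qed
    thus ?thesis using M False inv v f2 by (simp split: if_splits)
   qed
  qed
 qed (use s1 in "auto simp: consts_ok_def iupd_other")
 show ?thesis unfolding NETPICK_def wp_Sq[of _ _ "seti 19 (iv 18)"] wp_PISet
 proof (rule wp_step[OF FILL_wp[where h = "%j. ~ R<dd c j"]])
  show "bval I s' (BNot (RLess (rv 8) (RDist (iv 18) (iv 31)))) = (~ R<dd c j)"
   if "ints s' 31 0 = int j" "frame (FILL 30 (BNot (RLess (rv 8) (RDist (iv 18) (iv 31))))) (iupd 19 (ival I s I0) (ival I s (iv 18)) s) s'" for j s' using that(1) frameD[OF that(2)] c R by (simp add: dI)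
 next
  fix s1 assume 1: "pts 30 s1 = {p. p<n & ~ R<dd c p}"
   and fr: "frame (FILL 30 (BNot (RLess (rv 8) (RDist (iv 18) (iv 31))))) (iupd 19 (ival I s I0) (ival I s (iv 18)) s) s1"
  note f1 = frameD[OF fr]
  have c1: "consts_ok s1" by (rule consts_ok_frame[OF _ fr]) (use s in auto)
  have inv0: "?Inv 0 (rupd 12 0 (R/2) s1)" using f1 c1 1 c m by (auto simp: ballp_def)
  have "wp K I (For 20 7 0 ?body;; MINPT;; If (BNot (ILess (iv 32) I0)) (seti 17 I1) PSkip) (rupd 12 0 (R/2) s1)
   (%s'. ints s' 19 0 = int (pick c R m) & (0<ints s' 17 0 <-> 0<ints s 17 0 | ?net (2 ^ g) ~= {}))"
  proof (rule wp_step[OF loop[OF inv0]])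
   fix s2 assume 2: "?Inv (2 ^ g) s2"
   have n2: "ints s2 0 0 = int n" using 2 by (simp add: consts_ok_def)
   show "wp K I (MINPT;; If (BNot (ILess (iv 32) I0)) (seti 17 I1) PSkip) s2
    (%s'. ints s' 19 0 = int (pick c R m) & (0<ints s' 17 0 <-> 0<ints s 17 0 | ?net (2 ^ g) ~= {}))"
   proof (rule wp_step[OF MINPT_wp[OF n2]])
    fix s3 assume M: "ints s3 32 0 = (if pts 30 s2 = {} then -1 else int (Min (pts 30 s2)))" and fr3: "frame MINPT s2 s3"
    show "wp K I (If (BNot (ILess (iv 32) I0)) (seti 17 I1) PSkip) s3
    (%s'. ints s' 19 0 = int (pick c R m) & (0<ints s' 17 0 <-> 0<ints s 17 0 | ?net (2 ^ g) ~= {}))" using 2 M frameD[OF fr3] m(2) by auto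
   qed
  qed
  thus "wp K I (setr 12 (RDivide (rv 8) (rnum 2));; For 20 7 0 ?body;; MINPT;; If (BNot (ILess (iv 32) I0)) (seti 17 I1) PSkip) s1
   (%s'. ints s' 19 0 = int (pick c R m) & (0<ints s' 17 0 <-> 0<ints s 17 0 | ?net (2 ^ g) ~= {}))" using f1 R by simp
 qed (use n0 in auto)
qed

lemma NAME_wp:
 assumes s: "consts_ok s" "tape_ok s" and c: "ints s 18 0 = int c"
 shows "wp K I NAME s (%s'. tape_ok s' & (EX c' R'. ints s' 18 0 = int c' &
   name c (reals s 8 0) (reals s 9 0) (tp s) (0<ints s 17 0) = (c', R', tp s', 0<ints s' 17 0)))"
proof -
 let ?tg = "reals s 9 0"
 let ?R = "%(c, R, t, ov) s'. consts_ok s' & tape_ok s' & reals s' 9 0 = ?tg & ints s' 18 0 = int c & reals s' 8 0 = R & tp s' = t & (0<ints s' 17 0 <-> ov)"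
 let ?p = "If (RLess (rv 9) (rv 8)) (NUM;; NETPICK;; seti 18 (iv 19);; setr 8 (RDivide (rv 8) (rnum 2))) PSkip"
 have 1: "wp K I (For 21 3 0 ?p) s (?R ((mstep ?tg ^^ B) (c, reals s 8 0, tp s, 0<ints s 17 0)))"
 proof (rule wp_For_funpow)
  fix st s' assume R: "?R st s'"
  obtain c R t ov where st: "st = (c, R, t, ov)" by (metis prod_cases4)
  show "wp K I ?p s' (?R (mstep ?tg st))"
  proof (cases "?tg < R")
   case False
   thus ?thesis using R st by (simp add: mstep_def)
  next
   case True
   have "wp K I (NUM;; NETPICK;; seti 18 (iv 19);; setr 8 (RDivide (rv 8) (rnum 2))) s' (?R (mstep ?tg st))"
   proof (rule wp_step[OF NUM_wp])
    fix s1 assume 1: "tape_ok s1 & (EX m. ints s1 16 0 = int m & (nstep ^^ g) (0, tp s') = (m, tp s1))" and fr: "frame NUM s' s1"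
    then obtain m where m: "ints s1 16 0 = int m" "(nstep ^^ g) (0, t) = (m, tp s1)" using R st by auto
    have "m<2 ^ g" using nstep_bound[of g t] m by simp
    note f1 = frameD[OF fr]
    have c1: "consts_ok s1" by (rule consts_ok_frame[OF _ fr]) (use R st in auto)
    show "wp K I (NETPICK;; seti 18 (iv 19);; setr 8 (RDivide (rv 8) (rnum 2))) s1 (?R (mstep ?tg st))"
    proof (rule wp_step[OF NETPICK_wp[OF c1 _ _ m(1) \<open>m<2 ^ g\<close>]])
    show "ints s1 18 0 = int c" "reals s1 8 0 = R" using f1 R st by auto
    fix s2 assume 2: "ints s2 19 0 = int (pick c R m) &
    (0<ints s2 17 0 <-> 0<ints s1 17 0 | net (ballp c R) (R/2) (2 ^ g) ~= {})" and fr2: "frame NETPICK s1 s2"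
    note f2 = frameD[OF fr2]
    have c2: "consts_ok s2" by (rule consts_ok_frame[OF c1 fr2]) auto
    have "tp s2 = tp s1" by (rule tp_cong) (use f2 in auto)
    moreover have "tape_ok s2 = tape_ok s1" by (rule tape_ok_cong) (use f2 in auto)
    ultimately have t2: "tp s2 = tp s1" "tape_ok s2 = tape_ok s1" by auto
    show "wp K I (seti 18 (iv 19);; setr 8 (RDivide (rv 8) (rnum 2))) s2 (?R (mstep ?tg st))" using c2 t2 1 2 f1 f2 True m R st by (simp add: mstep_def)
    qed
   qed (use R st in auto)
   thus ?thesis using True R st by simp
  qed
 qed (use s c in "auto simp: consts_ok_def")
 show ?thesis unfolding NAME_def name_def by (rule wp_mono[OF 1]) (auto split: prod.splits)
qed

end

section \<open>Machine code for discovering and listing clusters\<close>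

section \<open>The program: listing clusters\<close>

text \<open>
  Integer arrays: 22 the number of clusters, 23 their centres; 24 the number of markers, 25 and
  26 their positions and flags; 27 the number of witnesses, 28 and 29 their owners and positions;
  35 the current cluster.  Real arrays: 5 the radii of the clusters, 6 those of the markers.
\<close>

definition ANNOUNCE :: prog where
 "ANNOUNCE = READD;; setr 9 (rv 7);; NAME;; If (ILess (iv 22) (IGet 0 I1))
   (PISet 23 (iv 22) (iv 18);; PRSet 5 (iv 22) (rv 7);; seti 22 (IPlus (iv 22) I1)) PSkip"

definition MARK :: prog where
 "MARK = setr 9 (RDivide (RGet 5 (iv 35)) (rv 1));; NAME;; READ;; PISet 25 (iv 24) (iv 18);;
   PRSet 6 (iv 24) (RGet 5 (iv 35));; PISet 26 (iv 24) (iv 12);; seti 24 (IPlus (iv 24) I1)"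

definition WITNESS :: prog where
 "WITNESS = setr 9 (rv 3);; NAME;; PISet 28 (iv 27) (iv 35);; PISet 29 (iv 27) (iv 18);;
   seti 27 (IPlus (iv 27) I1)"

definition ITEM :: prog where
 "ITEM = If (pos 36) (READ;; If (pos 12)
   (READ;; seti 18 (IGet 23 (iv 35));; setr 8 (RTimes (rnum 10) (RGet 5 (iv 35)));;
   If (pos 12) ANNOUNCE (READ;; If (pos 12) MARK WITNESS))
   (seti 36 I0)) PSkip"

definition LISTING :: prog where "LISTING = seti 36 I1;; For 37 3 0 ITEM"

definition BLOCKED :: prog where
 "BLOCKED = seti 46 I0;; For 47 3 0
   (If (BAnd (ILess (iv 47) (iv 24)) (BAnd (BNot (ILess I0 (IGet 26 (iv 47))))
    (BAnd (BNot (RLess (RGet 5 (iv 45)) (RGet 6 (iv 47))))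
    (BNot (RLess (RTimes (rnum 8) (RDivide (RGet 6 (iv 47)) (rv 1))) (RDist (IGet 25 (iv 47)) (iv 31)))))))
   (seti 46 I1) PSkip)"

definition COVERED :: prog where
 "COVERED = seti 44 I1;; For 45 0 1
   (If (BAnd (ILess (iv 45) (iv 22)) (BNot (RLess (RTimes (rnum 2) (RGet 5 (iv 45))) (RDist (IGet 23 (iv 45)) (iv 31)))))
    (BLOCKED;; If (pos 46) PSkip (seti 44 I0)) PSkip)"

definition UNCOV :: prog where "UNCOV = For 31 0 0 (COVERED;; PISet 30 (iv 31) (iv 44))"

definition DISCOVER :: prog where
 "DISCOVER = If (ILess (iv 35) (iv 22)) PSkip (UNCOV;; MINPT;; If (BNot (ILess (iv 32) I0))
   (READD;; PISet 23 (iv 22) (iv 32);; PRSet 5 (iv 22) (rv 7);; seti 22 (IPlus (iv 22) I1)) PSkip)"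

definition TURN :: prog where
 "TURN = DISCOVER;; If (ILess (iv 35) (iv 22)) (LISTING;; seti 35 (IPlus (iv 35) I1)) PSkip"

definition TURNS :: prog where
 "TURNS = seti 22 I0;; seti 24 I0;; seti 27 I0;; seti 35 I0;; For 38 0 1 TURN"

definition SCALE :: prog where
 "SCALE = seti 39 I0;; UNARY 0 1 (seti 39 (IPlus (iv 39) I1));;
   seti 48 I0;; UNARY 0 1 (seti 48 (IPlus (iv 48) I1));;
   setr 10 (RPlus (RDist (IGet 15 (iv 39)) (IGet 15 (iv 48))) (RTimes (rnum 2) (rv 2)));;
   UNARY 3 0 (setr 10 (RPlus (rv 10) (rv 10)));;
   setr 4 (RDivide (rv 10) (ROfInt (IGet 0 I1)));; setr 3 (RDivide (rv 4) (rv 1))"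

lemma [simp]: "piw ANNOUNCE = {11,12,13,14,16,17,18,19,20,21,22,23,30,31,32}" "prw ANNOUNCE = {5,7,8,9,12}" by (auto simp: ANNOUNCE_def)
lemma [simp]: "piw MARK = {11,12,14,16,17,18,19,20,21,24,25,26,30,31,32}" "prw MARK = {6,8,9,12}" by (auto simp: MARK_def)
lemma [simp]: "piw WITNESS = {11,12,14,16,17,18,19,20,21,27,28,29,30,31,32}" "prw WITNESS = {8,9,12}" by (auto simp: WITNESS_def)
lemma [simp]: "piw ITEM = {11,12,13,14,16,17,18,19,20,21,22,23,24,25,26,27,28,29,30,31,32,36}"
  "prw ITEM = {5,6,7,8,9,12}" by (auto simp: ITEM_def)
lemma [simp]: "piw LISTING = {11,12,13,14,16,17,18,19,20,21,22,23,24,25,26,27,28,29,30,31,32,36,37}"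
  "prw LISTING = {5,6,7,8,9,12}" by (auto simp: LISTING_def)
lemma [simp]: "piw BLOCKED = {46,47}" "prw BLOCKED = {}" by (auto simp: BLOCKED_def)
lemma [simp]: "piw COVERED = {44,45,46,47}" "prw COVERED = {}" by (auto simp: COVERED_def)
lemma [simp]: "piw UNCOV = {30,31,44,45,46,47}" "prw UNCOV = {}" by (auto simp: UNCOV_def)
lemma [simp]: "piw DISCOVER = {11,12,13,14,22,23,30,31,32,44,45,46,47}" "prw DISCOVER = {5,7}" by (auto simp: DISCOVER_def)
lemma [simp]: "piw TURN = {11,12,13,14,16,17,18,19,20,21,22,23,24,25,26,27,28,29,30,31,32,35,36,37,44,45,46,47}"
  "prw TURN = {5,6,7,8,9,12}" by (auto simp: TURN_def)
lemma [simp]: "piw TURNS = {11,12,13,14,16,17,18,19,20,21,22,23,24,25,26,27,28,29,30,31,32,35,36,37,38,44,45,46,47}"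
  "prw TURNS = {5,6,7,8,9,12}" by (auto simp: TURNS_def)
lemma [simp]: "piw SCALE = {11,12,13,14,39,48}" "prw SCALE = {3,4,10}" by (auto simp: SCALE_def)

lemma map_shrinks:
 assumes "!!st. (m :: 'a => nat) (f st)<=m st"
 shows "m ((f ^^ N) st)<=m st" by (induction N) (auto intro: order_trans assms)

lemma bex_nth: "length xs<=N ==> (EX x:set xs. Q x) <-> (EX b<N. b<length xs & Q (xs ! b))" by (metis in_set_conv_nth order_less_le_trans)

lemma ex_less_guard: "l<=(N::nat) ==> (EX j<l. Q j) <-> (EX j<N. j<l & Q j)" by (meson order_less_le_trans)

context decoder
begin

text \<open>\<open>g\<close> is large enough for naming: no ball can make the walk overflow.\<close>

definition nice :: bool where "nice <-> (ALL c<n. ALL R. net (ballp c R) (R/2) (2 ^ g) = {})"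

text \<open>Holds for every string, honest or not. Each marker and each witness consumes at least
  one bit, so loops up to \<open>B\<close> scan the whole arrays.\<close>

definition dinv :: "dstate => bool" where
 "dinv d <-> length (rads d) = length (cens d) & length (cens d)<=k & (ALL c:set (cens d). c<n) &
   length (ents d)+length (tape d)<=B & length (wits d)+length (tape d)<=B & (nice --> ~ ovf d)"

lemma readD_len: "readD dl lm t = (D, t') ==> length t'<=length t"
proof -
 assume r: "readD dl lm t = (D, t')"
 obtain D1 t1 where 1: "(bstep dl ^^ q) (0, t) = (D1, t1)" by fastforce
 obtain D2 go t2 where 2: "(gstep (%D. D+lm) ^^ B) (D1+dl, True, t1) = (D2, go, t2)" by (metis prod_cases3)
 have "length t1<=length t" using map_shrinks[of "%st. length (snd st)" "bstep dl" q "(0, t)"] 1 by (auto simp: bstep_def split: prod.splits)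
 moreover have "length t2<=length t1" using map_shrinks[of "%st. length (snd (snd st))" "gstep (%D. D+lm)" B "(D1+dl, True, t1)"] 2 by (auto simp: gstep_def split: prod.splits)
 ultimately show ?thesis using r 1 2 by (auto simp: readD_def)
qed

lemma num_len: "(nstep ^^ m) (v, t) = (v', t') ==> length t'<=length t" using map_shrinks[of "%st. length (snd st)" nstep m "(v, t)"] by (auto simp: nstep_def split: prod.splits)

lemma mstep_inv:
 assumes "(mstep tgt ^^ m) (c, R, t, ov) = (c', R', t', ov')" "c<n"
 shows "c'<n & length t'<=length t & (nice --> ov' = ov)" using assms
proof (induction m arbitrary: c' R' t' ov')
 case (Suc m)
 obtain c1 R1 t1 ov1 where 1: "(mstep tgt ^^ m) (c, R, t, ov) = (c1, R1, t1, ov1)" by (metis prod_cases4)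
 note IH = Suc.IH[OF 1 Suc.prems(2)]
 obtain i t2 where i: "(nstep ^^ g) (0, t1) = (i, t2)" by fastforce
 have "mstep tgt (c1, R1, t1, ov1) = (c', R', t', ov')" using Suc.prems 1 by simp
 thus ?case using IH i num_len[OF i] pick_less[of c1 R1 i] unfolding mstep_def nice_def by (auto split: if_splits)
qed auto

lemma name_inv:
 assumes "name c R tgt t ov = (c', R', t', ov')" "c<n"
 shows "c'<n" "length t'<=length t" "nice ==> ov' = ov" using mstep_inv[OF assms[unfolded name_def]] by auto

lemma hdb_tl: "hdb t ==> length (tl t)<length t" by (cases t) auto

lemma item_dinv:
 assumes "dinv d" "cur<length (cens d)" "item dl lm cur (d, go) = (d', go')"
 shows "dinv d' & cur<length (cens d')"
proof (cases "go & hdb (tape d)")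
 case False
 thus ?thesis using assms by (cases go) (auto simp: item_def dinv_def Let_def)
next
 case True
 let ?x = "cens d ! cur" and ?D = "rads d ! cur"
 let ?t1 = "tl (tape d)" let ?t2 = "tl ?t1"
 have x: "?x<n" using assms by (auto simp: dinv_def)
 have l: "length ?t1<length (tape d)" "length ?t2<=length ?t1" using hdb_tl True by auto
 note dv = assms(1)[unfolded dinv_def]
 consider (a) "hdb ?t1" | (m) "~ hdb ?t1" "hdb ?t2" | (w) "~ hdb ?t1" "~ hdb ?t2" by blast
 thus ?thesis
 proof cases
  case a
  obtain D' t3 where 3: "readD dl lm ?t2 = (D', t3)" by fastforce
  obtain c R' t4 ov where 4: "name ?x (10*?D) D' t3 (ovf d) = (c, R', t4, ov)" by (metis prod_cases4)
  have "d' = d(|cens := (if length (cens d)<k then cens d @ [c] else cens d),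
    rads := (if length (cens d)<k then rads d @ [D'] else rads d), tape := t4, ovf := ov|)" using assms(3) True a 3 4 by (simp add: item_def Let_def)
  thus ?thesis using dv l readD_len[OF 3] name_inv[OF 4 x] assms(2) by (auto simp: dinv_def)
 next
  case m
  obtain c R' t4 ov where 4: "name ?x (10*?D) (?D/th) (tl ?t2) (ovf d) = (c, R', t4, ov)" by (metis prod_cases4)
  have "d' = d(|ents := ents d @ [(c, ?D, hdb t4)], tape := tl t4, ovf := ov|)" using assms(3) True m 4 by (simp add: item_def Let_def)
  thus ?thesis using dv l name_inv[OF 4 x] assms(2) by (auto simp: dinv_def)
 next
  case w
  obtain c R' t4 ov where 4: "name ?x (10*?D) dl (tl ?t2) (ovf d) = (c, R', t4, ov)" by (metis prod_cases4)
  have "d' = d(|wits := wits d @ [(cur, c)], tape := t4, ovf := ov|)" using assms(3) True w 4 by (simp add: item_def Let_def)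
  thus ?thesis using dv l name_inv[OF 4 x] assms(2) by (auto simp: dinv_def)
 qed
qed

lemma discover_dinv:
 assumes "dinv d" "cur<k"
 shows "dinv (discover dl lm (d, cur))"
proof (cases "~ cur<length (cens d) & uncov d ~= {}")
 case True
 obtain D t where r: "readD dl lm (tape d) = (D, t)" by fastforce
 have "Min (uncov d) : uncov d" using True by (intro Min_in) (auto simp: uncov_def)
 hence "Min (uncov d)<n" by (simp add: uncov_def)
 thus ?thesis using True r readD_len[OF r] assms by (auto simp: discover_def dinv_def)
qed (use assms in "auto simp: discover_def")

end

context machine
begin

definition data :: "dstate => state => bool" where
 "data d s <-> ints s 22 0 = int (length (cens d)) &
   (ALL i<length (cens d). ints s 23 (int i) = int (cens d ! i) & reals s 5 (int i) = rads d ! i) &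
   ints s 24 0 = int (length (ents d)) &
   (ALL b<length (ents d). ints s 25 (int b) = int (fst (ents d ! b)) & reals s 6 (int b) = fst (snd (ents d ! b)) &
    (0<ints s 26 (int b) <-> snd (snd (ents d ! b)))) &
   ints s 27 0 = int (length (wits d)) &
   (ALL w<length (wits d). ints s 28 (int w) = int (fst (wits d ! w)) & ints s 29 (int w) = int (snd (wits d ! w)))"

lemma data_cong:
 assumes "data d s" "ALL a:{22,23,24,25,26,27,28,29}. ints s' a = ints s a" "ALL a:{5,6}. reals s' a = reals s a"
 shows "data d s'" using assms by (simp add: data_def)

lemma data_frame:
 assumes "data d s" "frame p s s'" "piw p \<inter> {22,23,24,25,26,27,28,29} = {}" "prw p \<inter> {5,6} = {}"
 shows "data d s'" by (rule data_cong[OF assms(1)]) (use frameD[OF assms(2)] assms(3,4) in auto)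

lemma data_upd [simp]:
 "a ~: {22,23,24,25,26,27,28,29} ==> data d (iupd a i x s) = data d s"
 "a ~: {5,6} ==> data d (rupd a i y s) = data d s"
 "data (d(|tape := t|)) s = data d s" "data (d(|ovf := ov|)) s = data d s" by (auto simp: data_def)

definition rel :: "real => real => dstate => state => bool" where
 "rel dl lm d s <-> consts_ok s & tape_ok s & tp s = tape d & (0<ints s 17 0 <-> ovf d) & data d s &
   reals s 3 0 = dl & reals s 4 0 = lm"

lemma rel_frame:
 assumes "rel dl lm d s" "frame p s s'" "piw p \<inter> {0,3,4,5,6,7,8,9,10,11,15,17,22,23,24,25,26,27,28,29} = {}"
  "prw p \<inter> {1,2,3,4,5,6} = {}"
 shows "rel dl lm d s'"
proof -
 have "consts_ok s'" by (rule consts_ok_frame[OF _ assms(2)]) (use assms in "auto simp: rel_def")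
 moreover have "data d s'" by (rule data_frame[OF _ assms(2)]) (use assms in "auto simp: rel_def")
 moreover have "tp s' = tp s" by (rule tp_cong) (use frameD[OF assms(2)] assms(3) in auto)
 moreover have "tape_ok s' = tape_ok s" by (rule tape_ok_cong) (use frameD[OF assms(2)] assms(3) in auto)
 moreover have "ints s' 17 = ints s 17" "reals s' 3 = reals s 3" "reals s' 4 = reals s 4" using frameD[OF assms(2)] assms(3,4) by auto
 ultimately show ?thesis using assms(1) by (simp add: rel_def)
qed

lemma rel_upd [simp]:
 "a ~: {0,3,4,5,6,7,8,9,10,11,15,17,22,23,24,25,26,27,28,29} ==> rel dl lm d (iupd a i x s) = rel dl lm d s"
 "a ~: {1,2,3,4,5,6} ==> rel dl lm d (rupd a i y s) = rel dl lm d s" by (auto simp: rel_def)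

lemma READ_rel:
 assumes "rel dl lm d s"
 shows "wp K I READ s (%s'. (0<ints s' 12 0 <-> hdb (tape d)) & rel dl lm (d(|tape := tl (tape d)|)) s')"
proof (rule wp_conseq[OF READ_wp])
 fix s' assume 1: "tape_ok s' & (0<ints s' 12 0 <-> hdb (tp s)) & tp s' = tl (tp s)" and fr: "frame READ s s'"
 have "consts_ok s'" by (rule consts_ok_frame[OF _ fr]) (use assms in "auto simp: rel_def")
 moreover have "data d s'" by (rule data_frame[OF _ fr]) (use assms in "auto simp: rel_def")
 ultimately show "(0<ints s' 12 0 <-> hdb (tape d)) & rel dl lm (d(|tape := tl (tape d)|)) s'" using 1 assms frameD[OF fr] by (simp add: rel_def)
qed (use assms in "auto simp: rel_def")

lemma READD_rel:
 assumes "rel dl lm d s" "readD dl lm (tape d) = (D, t)"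
 shows "wp K I READD s (%s'. reals s' 7 0 = D & rel dl lm (d(|tape := t|)) s')"
proof (rule wp_conseq[OF READD_wp[where dl = dl and lm = lm]])
 fix s' assume 1: "tape_ok s' & readD dl lm (tp s) = (reals s' 7 0, tp s')" and fr: "frame READD s s'"
 have "consts_ok s'" by (rule consts_ok_frame[OF _ fr]) (use assms in "auto simp: rel_def")
 moreover have "data d s'" by (rule data_frame[OF _ fr]) (use assms in "auto simp: rel_def")
 ultimately show "reals s' 7 0 = D & rel dl lm (d(|tape := t|)) s'" using 1 assms frameD[OF fr] by (simp add: rel_def)
qed (use assms in "auto simp: rel_def")

lemma NAME_rel:
 assumes "rel dl lm d s" "ints s 18 0 = int x" "name x (reals s 8 0) (reals s 9 0) (tape d) (ovf d) = (c, R', t, ov)"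
 shows "wp K I NAME s (%s'. ints s' 18 0 = int c & rel dl lm (d(|tape := t, ovf := ov|)) s')"
proof (rule wp_conseq[OF NAME_wp[where c = x]])
 fix s' assume 1: "tape_ok s' & (EX c' R'. ints s' 18 0 = int c' &
   name x (reals s 8 0) (reals s 9 0) (tp s) (0<ints s 17 0) = (c', R', tp s', 0<ints s' 17 0))" and fr: "frame NAME s s'"
 have "consts_ok s'" by (rule consts_ok_frame[OF _ fr]) (use assms in "auto simp: rel_def")
 moreover have "data d s'" by (rule data_frame[OF _ fr]) (use assms in "auto simp: rel_def")
 ultimately show "ints s' 18 0 = int c & rel dl lm (d(|tape := t, ovf := ov|)) s'" using 1 assms frameD[OF fr] by (auto simp: rel_def)
qed (use assms in "auto simp: rel_def")

lemma push_cluster: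
 assumes "data d s" "length (rads d) = length (cens d)"
 shows "data (d(|cens := cens d @ [c], rads := rads d @ [D]|))
  (iupd 22 0 (int (length (cens d))+1) (rupd 5 (int (length (cens d))) D (iupd 23 (int (length (cens d))) (int c) s)))" using assms unfolding data_def by (auto simp: less_Suc_eq nth_append)

lemma push_marker:
 assumes "data d s" "0 < v <-> nr"
 shows "data (d(|ents := ents d @ [(e, D, nr)]|))
  (iupd 24 0 (int (length (ents d))+1) (iupd 26 (int (length (ents d))) v (rupd 6 (int (length (ents d))) D
   (iupd 25 (int (length (ents d))) (int e) s))))" using assms unfolding data_def by (auto simp: less_Suc_eq nth_append)

lemma push_witness:
 assumes "data d s"
 shows "data (d(|wits := wits d @ [(w, y)]|))
  (iupd 27 0 (int (length (wits d))+1) (iupd 29 (int (length (wits d))) (int y) (iupd 28 (int (length (wits d))) (int w) s)))" using assms unfolding data_def by (auto simp: less_Suc_eq nth_append)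

lemma ANNOUNCE_wp:
 assumes r: "rel dl lm d s" and x: "ints s 18 0 = int x" and len: "length (rads d) = length (cens d)"
  and 1: "readD dl lm (tape d) = (D', t3)" "name x (reals s 8 0) D' t3 (ovf d) = (c, R', t4, ov)"
 shows "wp K I ANNOUNCE s (rel dl lm (d(|cens := (if length (cens d)<k then cens d @ [c] else cens d),
   rads := (if length (cens d)<k then rads d @ [D'] else rads d), tape := t4, ovf := ov|)))" unfolding ANNOUNCE_def
proof (rule wp_step[OF READD_rel[OF r 1(1)]])
 fix s1 assume s1: "reals s1 7 0 = D' & rel dl lm (d(|tape := t3|)) s1" and fr1: "frame READD s s1"
 let ?s1 = "rupd 9 0 D' s1"
 have "wp K I (NAME;; If (ILess (iv 22) (IGet 0 I1))
   (PISet 23 (iv 22) (iv 18);; PRSet 5 (iv 22) (rv 7);; seti 22 (IPlus (iv 22) I1)) PSkip) ?s1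
   (rel dl lm (d(|cens := (if length (cens d)<k then cens d @ [c] else cens d),
   rads := (if length (cens d)<k then rads d @ [D'] else rads d), tape := t4, ovf := ov|)))"
 proof (rule wp_step[OF NAME_rel[where d = "d(|tape := t3|)" and x = x and dl = dl and lm = lm]])
  show "rel dl lm (d(|tape := t3|)) ?s1" using s1 by simp
  show "ints ?s1 18 0 = int x" using x frameD[OF fr1] by simp
  show "name x (reals ?s1 8 0) (reals ?s1 9 0) (tape (d(|tape := t3|))) (ovf (d(|tape := t3|))) = (c, R', t4, ov)" using 1 frameD[OF fr1] by simp
  fix s2 assume s2: "ints s2 18 0 = int c & rel dl lm (d(|tape := t3, tape := t4, ovf := ov|)) s2" and fr2: "frame NAME ?s1 s2"
  have D: "reals s2 7 0 = D'" using s1 frameD[OF fr2] by simp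
  have c: "ints s2 22 0 = int (length (cens d))" "ints s2 0 1 = int k" "data d s2" using s2 by (auto simp: rel_def data_def consts_ok_def)
  show "wp K I (If (ILess (iv 22) (IGet 0 I1))
   (PISet 23 (iv 22) (iv 18);; PRSet 5 (iv 22) (rv 7);; seti 22 (IPlus (iv 22) I1)) PSkip) s2
   (rel dl lm (d(|cens := (if length (cens d)<k then cens d @ [c] else cens d),
   rads := (if length (cens d)<k then rads d @ [D'] else rads d), tape := t4, ovf := ov|)))" using push_cluster[OF c(3) len, where c = c and D = D'] c s2 D by (auto simp: rel_def)
 qed
 thus "wp K I (setr 9 (rv 7);; NAME;; If (ILess (iv 22) (IGet 0 I1))
   (PISet 23 (iv 22) (iv 18);; PRSet 5 (iv 22) (rv 7);; seti 22 (IPlus (iv 22) I1)) PSkip) s1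
   (rel dl lm (d(|cens := (if length (cens d)<k then cens d @ [c] else cens d),
   rads := (if length (cens d)<k then rads d @ [D'] else rads d), tape := t4, ovf := ov|)))" using s1 by simp
qed

lemma MARK_wp:
 assumes r: "rel dl lm d s" and x: "ints s 18 0 = int x" and cur: "ints s 35 0 = int cur" "cur<length (cens d)"
  and 1: "name x (reals s 8 0) (rads d ! cur/th) (tape d) (ovf d) = (c, R', t4, ov)"
 shows "wp K I MARK s (rel dl lm (d(|ents := ents d @ [(c, rads d ! cur, hdb t4)], tape := tl t4, ovf := ov|)))"
proof -
 let ?D = "rads d ! cur"
 let ?s = "rupd 9 0 (?D/th) s"
 have D: "reals s 5 (int cur) = ?D" "reals s 1 0 = th" using r cur by (auto simp: rel_def data_def consts_ok_def)
 have "wp K I (NAME;; READ;; PISet 25 (iv 24) (iv 18);;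
   PRSet 6 (iv 24) (RGet 5 (iv 35));; PISet 26 (iv 24) (iv 12);; seti 24 (IPlus (iv 24) I1)) ?s
   (rel dl lm (d(|ents := ents d @ [(c, rads d ! cur, hdb t4)], tape := tl t4, ovf := ov|)))"
 proof (rule wp_step[OF NAME_rel[where d = d and x = x and dl = dl and lm = lm]])
  show "rel dl lm d ?s" using r by simp
  show "ints ?s 18 0 = int x" using x by simp
  show "name x (reals ?s 8 0) (reals ?s 9 0) (tape d) (ovf d) = (c, R', t4, ov)" using 1 by simp
  fix s2 assume s2: "ints s2 18 0 = int c & rel dl lm (d(|tape := t4, ovf := ov|)) s2" and fr2: "frame NAME ?s s2"
  have r2: "rel dl lm (d(|tape := t4, ovf := ov|)) s2" using s2 by blast
  show "wp K I (READ;; PISet 25 (iv 24) (iv 18);;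
   PRSet 6 (iv 24) (RGet 5 (iv 35));; PISet 26 (iv 24) (iv 12);; seti 24 (IPlus (iv 24) I1)) s2
   (rel dl lm (d(|ents := ents d @ [(c, rads d ! cur, hdb t4)], tape := tl t4, ovf := ov|)))"
  proof (rule wp_step[OF READ_rel[OF r2]])
   fix s3 assume s3: "(0<ints s3 12 0 <-> hdb (tape (d(|tape := t4, ovf := ov|)))) &
    rel dl lm (d(|tape := t4, ovf := ov, tape := tl (tape (d(|tape := t4, ovf := ov|)))|)) s3" and fr3: "frame READ s2 s3"
   have c: "ints s3 18 0 = int c" "ints s3 35 0 = int cur" using s2 cur frameD[OF fr3] frameD[OF fr2] by auto
   have E: "ints s3 24 0 = int (length (ents d))" "data d s3" "reals s3 5 (int cur) = ?D" using s3 cur(2) by (auto simp: rel_def data_def)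
   have nr: "0<ints s3 12 0 <-> hdb t4" using s3 by simp
   show "wp K I (PISet 25 (iv 24) (iv 18);; PRSet 6 (iv 24) (RGet 5 (iv 35));; PISet 26 (iv 24) (iv 12);; seti 24 (IPlus (iv 24) I1)) s3
    (rel dl lm (d(|ents := ents d @ [(c, rads d ! cur, hdb t4)], tape := tl t4, ovf := ov|)))" using push_marker[OF E(2) nr, where e = c and D = ?D] c E s3 by (auto simp: rel_def)
  qed
 qed
 thus ?thesis unfolding MARK_def using D cur by simp
qed

lemma WITNESS_wp:
 assumes r: "rel dl lm d s" and x: "ints s 18 0 = int x" and cur: "ints s 35 0 = int cur"
  and 1: "name x (reals s 8 0) dl (tape d) (ovf d) = (c, R', t4, ov)"
 shows "wp K I WITNESS s (rel dl lm (d(|wits := wits d @ [(cur, c)], tape := t4, ovf := ov|)))"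
proof -
 let ?s = "rupd 9 0 dl s"
 have D: "reals s 3 0 = dl" using r by (auto simp: rel_def)
 have "wp K I (NAME;; PISet 28 (iv 27) (iv 35);; PISet 29 (iv 27) (iv 18);; seti 27 (IPlus (iv 27) I1)) ?s
   (rel dl lm (d(|wits := wits d @ [(cur, c)], tape := t4, ovf := ov|)))"
 proof (rule wp_step[OF NAME_rel[where d = d and x = x and dl = dl and lm = lm]])
  show "rel dl lm d ?s" using r by simp
  show "ints ?s 18 0 = int x" using x by simp
  show "name x (reals ?s 8 0) (reals ?s 9 0) (tape d) (ovf d) = (c, R', t4, ov)" using 1 by simp
  fix s2 assume s2: "ints s2 18 0 = int c & rel dl lm (d(|tape := t4, ovf := ov|)) s2" and fr2: "frame NAME ?s s2"
  have c: "ints s2 35 0 = int cur" using cur frameD[OF fr2] by auto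
  have E: "ints s2 27 0 = int (length (wits d))" "data d s2" using s2 by (auto simp: rel_def data_def)
  show "wp K I (PISet 28 (iv 27) (iv 35);; PISet 29 (iv 27) (iv 18);; seti 27 (IPlus (iv 27) I1)) s2
   (rel dl lm (d(|wits := wits d @ [(cur, c)], tape := t4, ovf := ov|)))" using push_witness[OF E(2), where w = cur and y = c] c E s2 by (auto simp: rel_def)
 qed
 thus ?thesis unfolding WITNESS_def using D by simp
qed

lemma ITEM_wp:
 assumes r: "rel dl lm d s" and dv: "dinv d" and cur: "ints s 35 0 = int cur" "cur<length (cens d)"
  and go: "0<ints s 36 0 <-> go" and it: "item dl lm cur (d, go) = (d', go')"
 shows "wp K I ITEM s (%s'. rel dl lm d' s' & (0<ints s' 36 0 <-> go'))"
proof (cases go)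
 case False
 thus ?thesis using r go it by (simp add: ITEM_def item_def)
next
 case True
 let ?Q = "%s'. rel dl lm d' s' & (0<ints s' 36 0 <-> go')"
 let ?t1 = "tl (tape d)" let ?t2 = "tl ?t1"
 let ?x = "cens d ! cur" and ?D = "rads d ! cur"
 let ?rest = "READ;; seti 18 (IGet 23 (iv 35));; setr 8 (RTimes (rnum 10) (RGet 5 (iv 35)));;
   If (pos 12) ANNOUNCE (READ;; If (pos 12) MARK WITNESS)"
 have len: "length (rads d) = length (cens d)" using dv by (simp add: dinv_def)
 have "wp K I (READ;; If (pos 12) ?rest (seti 36 I0)) s ?Q"
 proof (rule wp_step[OF READ_rel[OF r]])
  fix s1 assume s1: "(0<ints s1 12 0 <-> hdb (tape d)) & rel dl lm (d(|tape := ?t1|)) s1" and fr1: "frame READ s s1"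
  have r1: "rel dl lm (d(|tape := ?t1|)) s1" using s1 by blast
  show "wp K I (If (pos 12) ?rest (seti 36 I0)) s1 ?Q"
  proof (cases "hdb (tape d)")
   case False
   thus ?thesis using s1 it True by (auto simp: item_def)
  next
   case hd: True
   have "wp K I ?rest s1 ?Q"
   proof (rule wp_step[OF READ_rel[OF r1]])
    fix s2 assume s2: "(0<ints s2 12 0 <-> hdb (tape (d(|tape := ?t1|)))) &
    rel dl lm (d(|tape := ?t1, tape := tl (tape (d(|tape := ?t1|)))|)) s2" and fr2: "frame READ s1 s2"
    have c2: "ints s2 35 0 = int cur" "0<ints s2 36 0" using cur go True frameD[OF fr1] frameD[OF fr2] by auto
    have r2: "rel dl lm (d(|tape := ?t2|)) s2" and h2: "0<ints s2 12 0 <-> hdb ?t1" using s2 by auto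
    have v2: "ints s2 23 (int cur) = int ?x" "reals s2 5 (int cur) = ?D" using r2 cur(2) by (auto simp: rel_def data_def)
    let ?s3 = "rupd 8 0 (10*?D) (iupd 18 0 (int ?x) s2)"
    have r3: "rel dl lm (d(|tape := ?t2|)) ?s3" using r2 by simp
    have x3: "ints ?s3 18 0 = int ?x" by simp
    have "wp K I (If (pos 12) ANNOUNCE (READ;; If (pos 12) MARK WITNESS)) ?s3 ?Q"
    proof (cases "hdb ?t1")
    case a: True
    obtain D' t3 where 3: "readD dl lm ?t2 = (D', t3)" by fastforce
    obtain c R' t4 ov where 4: "name ?x (10*?D) D' t3 (ovf d) = (c, R', t4, ov)" by (metis prod_cases4)
    have d': "d' = d(|cens := (if length (cens d)<k then cens d @ [c] else cens d),
    rads := (if length (cens d)<k then rads d @ [D'] else rads d), tape := t4, ovf := ov|)" and go': "go'" using it True hd a 3 4 by (simp_all add: item_def Let_def)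
    have "wp K I ANNOUNCE ?s3 ?Q" by (rule wp_conseq[OF ANNOUNCE_wp[OF r3 x3, of D' t3 c R' t4 ov]])
    (use len 3 4 in \<open>auto simp: d' go' c2 frameD(1)[of ANNOUNCE "?s3"]\<close>)
    thus ?thesis using a h2 by simp
    next
    case na: False
    have "wp K I (READ;; If (pos 12) MARK WITNESS) ?s3 ?Q"
    proof (rule wp_step[OF READ_rel[OF r3]])
    fix s4 assume s4: "(0<ints s4 12 0 <-> hdb (tape (d(|tape := ?t2|)))) &
    rel dl lm (d(|tape := ?t2, tape := tl (tape (d(|tape := ?t2|)))|)) s4" and fr4: "frame READ ?s3 s4"
    have r4: "rel dl lm (d(|tape := tl ?t2|)) s4" and h4: "0<ints s4 12 0 <-> hdb ?t2" using s4 by auto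
    have v4: "ints s4 18 0 = int ?x" "ints s4 35 0 = int cur" "0<ints s4 36 0" "reals s4 8 0 = 10*?D" using c2 frameD[OF fr4] by auto
    show "wp K I (If (pos 12) MARK WITNESS) s4 ?Q"
    proof (cases "hdb ?t2")
    case m: True
    obtain c R' t4 ov where 4: "name ?x (10*?D) (?D/th) (tl ?t2) (ovf d) = (c, R', t4, ov)" by (metis prod_cases4)
    have d': "d' = d(|ents := ents d @ [(c, ?D, hdb t4)], tape := tl t4, ovf := ov|)" and go': "go'" using it True hd na m 4 by (simp_all add: item_def Let_def)
    have "wp K I MARK s4 ?Q"
    proof (rule wp_conseq[OF MARK_wp[OF r4 v4(1,2), of c R' t4 ov]])
    fix s' assume "rel dl lm (d(|tape := tl ?t2, ents := ents (d(|tape := tl ?t2|)) @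
    [(c, rads (d(|tape := tl ?t2|)) ! cur, hdb t4)], tape := tl t4, ovf := ov|)) s'" and fr: "frame MARK s4 s'"
    hence "rel dl lm d' s'" unfolding d' by simp
    moreover have "ints s' 36 0 = ints s4 36 0" using frameD(1)[OF fr, of 36] by simp
    ultimately show "?Q s'" using v4(3) go' by simp
    next
    show "name ?x (reals s4 8 0) (rads (d(|tape := tl ?t2|)) ! cur/th) (tape (d(|tape := tl ?t2|))) (ovf (d(|tape := tl ?t2|))) = (c, R', t4, ov)" using 4 unfolding v4(4) by simp
    show "cur<length (cens (d(|tape := tl ?t2|)))" using cur(2) by simp
    qed
    thus ?thesis using m h4 by simp
    next
    case w: False
    obtain c R' t4 ov where 4: "name ?x (10*?D) dl (tl ?t2) (ovf d) = (c, R', t4, ov)" by (metis prod_cases4)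
    have d': "d' = d(|wits := wits d @ [(cur, c)], tape := t4, ovf := ov|)" and go': "go'" using it True hd na w 4 by (simp_all add: item_def Let_def)
    have "wp K I WITNESS s4 ?Q"
    proof (rule wp_conseq[OF WITNESS_wp[OF r4 v4(1,2), of c R' t4 ov]])
    fix s' assume "rel dl lm (d(|tape := tl ?t2, wits := wits (d(|tape := tl ?t2|)) @ [(cur, c)], tape := t4, ovf := ov|)) s'"
    and fr: "frame WITNESS s4 s'"
    hence "rel dl lm d' s'" unfolding d' by simp
    moreover have "ints s' 36 0 = ints s4 36 0" using frameD(1)[OF fr, of 36] by simp
    ultimately show "?Q s'" using v4(3) go' by simp
    next
    show "name ?x (reals s4 8 0) dl (tape (d(|tape := tl ?t2|))) (ovf (d(|tape := tl ?t2|))) = (c, R', t4, ov)" using 4 unfolding v4(4) by simp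
    qed
    thus ?thesis using w h4 by simp
    qed
    qed
    thus ?thesis using na h2 by simp
    qed
    moreover have "wp K I (seti 18 (IGet 23 (iv 35));; setr 8 (RTimes (rnum 10) (RGet 5 (iv 35)));; X) s2 ?Q = wp K I X ?s3 ?Q" for X using c2 v2 by simp
    ultimately show "wp K I (seti 18 (IGet 23 (iv 35));; setr 8 (RTimes (rnum 10) (RGet 5 (iv 35)));;
    If (pos 12) ANNOUNCE (READ;; If (pos 12) MARK WITNESS)) s2 ?Q" by blast
   qed
   thus ?thesis using hd s1 by simp
  qed
 qed
 thus ?thesis using go True by (simp add: ITEM_def)
qed

lemma LISTING_wp:
 assumes r: "rel dl lm d s" and dv: "dinv d" and cur: "ints s 35 0 = int cur" "cur<length (cens d)"
 shows "wp K I LISTING s (%s'. rel dl lm (listing dl lm cur d) s' & dinv (listing dl lm cur d))"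
proof -
 let ?R = "%(d, go) s'. rel dl lm d s' & dinv d & cur<length (cens d) & ints s' 35 0 = int cur & (0<ints s' 36 0 <-> go)"
 have 1: "wp K I (For 37 3 0 ITEM) (iupd 36 0 1 s) (?R ((item dl lm cur ^^ B) (d, True)))"
 proof (rule wp_For_funpow)
  fix st s' assume R: "?R st s'"
  obtain d go where st: "st = (d, go)" by fastforce
  obtain d' go' where it: "item dl lm cur (d, go) = (d', go')" by fastforce
  show "wp K I ITEM s' (?R (item dl lm cur st))"
  proof (rule wp_conseq[OF ITEM_wp[where dl = dl and lm = lm and d = d and cur = cur and go = go, OF _ _ _ _ _ it]])
   fix s2 assume 2: "rel dl lm d' s2 & (0<ints s2 36 0 <-> go')" and fr: "frame ITEM s' s2"
   show "?R (item dl lm cur st) s2" using 2 it st R frameD[OF fr] item_dinv[OF _ _ it] by auto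
  qed (use R st in auto)
 qed (use assms in "auto simp: rel_def consts_ok_def split: prod.splits")
 have 2: "wp K I LISTING s (?R ((item dl lm cur ^^ B) (d, True)))" using 1 by (simp add: LISTING_def)
 show ?thesis by (rule wp_mono[OF 2]) (auto simp: listing_def split: prod.splits)
qed

lemma BLOCKED_wp:
 assumes c: "consts_ok s" and dt: "data d s" and E: "length (ents d)<=B" and j: "ints s 45 0 = int j" "j<length (cens d)"
  and p: "ints s 31 0 = int p"
 shows "wp K I BLOCKED s (%s'. 0<ints s' 46 0 <-> blocked (ents d) (rads d ! j) p)"
proof -
 let ?h = "%b. b<length (ents d) & ~ snd (snd (ents d ! b)) & ~ rads d ! j<fst (snd (ents d ! b)) &
   ~ 8*(fst (snd (ents d ! b))/th)<dd (fst (ents d ! b)) p"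
 have bl: "blocked (ents d) (rads d ! j) p <-> (EX b<B. ?h b)" unfolding blocked_def case_prod_beta by (rule bex_nth[OF E])
 show ?thesis unfolding BLOCKED_def wp_Sq wp_PISet bl
 proof (rule wp_For[where N = B and Inv = "%m s'. 0<ints s' 46 0 <-> (EX b<m. ?h b)"])
  fix m :: nat and s' assume m: "m<B" and inv: "0<ints s' 46 0 <-> (EX b<m. ?h b)" and v: "ints s' 47 0 = int m"
   and fr: "frame (For 47 3 0
   (If (BAnd (ILess (iv 47) (iv 24)) (BAnd (BNot (ILess I0 (IGet 26 (iv 47))))
    (BAnd (BNot (RLess (RGet 5 (iv 45)) (RGet 6 (iv 47))))
    (BNot (RLess (RTimes (rnum 8) (RDivide (RGet 6 (iv 47)) (rv 1))) (RDist (IGet 25 (iv 47)) (iv 31)))))))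
   (seti 46 I1) PSkip)) (iupd 46 (ival I s I0) (ival I s I0) s) s'"
  note f = frameD[OF fr]
  have c': "consts_ok s'" by (rule consts_ok_frame[OF _ fr]) (use c in auto)
  have d': "data d s'" by (rule data_frame[OF _ fr]) (use dt in auto)
  have b: "bval I s' (BAnd (ILess (iv 47) (iv 24)) (BAnd (BNot (ILess I0 (IGet 26 (iv 47))))
    (BAnd (BNot (RLess (RGet 5 (iv 45)) (RGet 6 (iv 47))))
    (BNot (RLess (RTimes (rnum 8) (RDivide (RGet 6 (iv 47)) (rv 1))) (RDist (IGet 25 (iv 47)) (iv 31))))))) <-> ?h m" using v d' c' f j p by (auto simp: data_def consts_ok_def dI)
  show "wp K I (If (BAnd (ILess (iv 47) (iv 24)) (BAnd (BNot (ILess I0 (IGet 26 (iv 47))))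
    (BAnd (BNot (RLess (RGet 5 (iv 45)) (RGet 6 (iv 47))))
    (BNot (RLess (RTimes (rnum 8) (RDivide (RGet 6 (iv 47)) (rv 1))) (RDist (IGet 25 (iv 47)) (iv 31)))))))
   (seti 46 I1) PSkip) s' (%s'. 0<ints s' 46 0 <-> (EX b<Suc m. ?h b))" unfolding wp_If b using inv by (auto simp: less_Suc_eq)
 qed (use c in "auto simp: consts_ok_def")
qed

lemma COVERED_wp:
 assumes c: "consts_ok s" and dt: "data d s" and dv: "dinv d" and p: "ints s 31 0 = int p"
 shows "wp K I COVERED s (%s'. 0<ints s' 44 0 <-> ~ covered d p)"
proof -
 let ?h = "%j. j<length (cens d) & ~ 2*(rads d ! j)<dd (cens d ! j) p & ~ blocked (ents d) (rads d ! j) p"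
 have cv: "covered d p <-> (EX j<k. ?h j)" unfolding covered_def by (rule ex_less_guard) (use dv in "simp add: dinv_def")
 let ?b = "BAnd (ILess (iv 45) (iv 22)) (BNot (RLess (RTimes (rnum 2) (RGet 5 (iv 45))) (RDist (IGet 23 (iv 45)) (iv 31))))"
 let ?body = "If ?b (BLOCKED;; If (pos 46) PSkip (seti 44 I0)) PSkip"
 show ?thesis unfolding COVERED_def wp_Sq wp_PISet cv
 proof (rule wp_For[where N = k and Inv = "%m s'. 0<ints s' 44 0 <-> ~ (EX j<m. ?h j)"])
  fix m :: nat and s' assume m: "m<k" and inv: "0<ints s' 44 0 <-> ~ (EX j<m. ?h j)" and v: "ints s' 45 0 = int m"
   and fr: "frame (For 45 0 1 ?body) (iupd 44 (ival I s I0) (ival I s I1) s) s'"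
  note f = frameD[OF fr]
  have c': "consts_ok s'" by (rule consts_ok_frame[OF _ fr]) (use c in auto)
  have d': "data d s'" by (rule data_frame[OF _ fr]) (use dt in auto)
  have p': "ints s' 31 0 = int p" using f p by simp
  have b: "bval I s' ?b <-> m<length (cens d) & ~ 2*(rads d ! m)<dd (cens d ! m) p" using v d' f p by (auto simp: data_def dI)
  show "wp K I ?body s' (%s'. 0<ints s' 44 0 <-> ~ (EX j<Suc m. ?h j))"
  proof (cases "bval I s' ?b")
   case True
   hence ml: "m<length (cens d)" using b by blast
   have "wp K I (BLOCKED;; If (pos 46) PSkip (seti 44 I0)) s' (%s'. 0<ints s' 44 0 <-> ~ (EX j<Suc m. ?h j))"
   proof (rule wp_step[OF BLOCKED_wp[OF c' d' _ v ml p']])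
    fix s2 assume 2: "0<ints s2 46 0 <-> blocked (ents d) (rads d ! m) p" and fr2: "frame BLOCKED s' s2"
    have "ints s2 44 0 = ints s' 44 0" using frameD[OF fr2] by simp
    thus "wp K I (If (pos 46) PSkip (seti 44 I0)) s2 (%s'. 0<ints s' 44 0 <-> ~ (EX j<Suc m. ?h j))" using 2 inv True b by (auto simp: less_Suc_eq)
   qed (use dv in "simp add: dinv_def")
   thus ?thesis unfolding wp_If using True by simp
  next
   case False
   thus ?thesis unfolding wp_If using inv b by (auto simp: less_Suc_eq)
  qed
 qed (use c in "auto simp: consts_ok_def")
qed

lemma UNCOV_wp:
 assumes c: "consts_ok s" and dt: "data d s" and dv: "dinv d"
 shows "wp K I UNCOV s (%s'. pts 30 s' = uncov d)" unfolding UNCOV_def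
proof (rule wp_For[where N = n and Inv = "%m s'. ALL p<m. 0<ints s' 30 (int p) <-> ~ covered d p"])
 fix m :: nat and s' assume m: "m<n" and inv: "ALL p<m. 0<ints s' 30 (int p) <-> ~ covered d p" and v: "ints s' 31 0 = int m"
  and fr: "frame (For 31 0 0 (COVERED;; PISet 30 (iv 31) (iv 44))) s s'"
 have c': "consts_ok s'" by (rule consts_ok_frame[OF c fr]) auto
 have d': "data d s'" by (rule data_frame[OF dt fr]) auto
 show "wp K I (COVERED;; PISet 30 (iv 31) (iv 44)) s' (%s'. ALL p<Suc m. 0<ints s' 30 (int p) <-> ~ covered d p)"
 proof (rule wp_step[OF COVERED_wp[OF c' d' dv v]])
  fix s2 assume "0<ints s2 44 0 <-> ~ covered d m" and "frame COVERED s' s2"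
  thus "wp K I (PISet 30 (iv 31) (iv 44)) s2 (%s'. ALL p<Suc m. 0<ints s' 30 (int p) <-> ~ covered d p)" using inv v frameD[of COVERED s' s2] by (auto simp: less_Suc_eq)
 qed
qed (use c in "auto simp: consts_ok_def pts_def uncov_def iupd_other")

lemma DISCOVER_wp:
 assumes r: "rel dl lm d s" and dv: "dinv d" and cur: "ints s 35 0 = int cur"
 shows "wp K I DISCOVER s (rel dl lm (discover dl lm (d, cur)))"
proof (cases "cur<length (cens d)")
 case True
 thus ?thesis using r cur by (simp add: DISCOVER_def discover_def rel_def data_def)
next
 case False
 let ?d' = "discover dl lm (d, cur)"
 let ?rest = "If (BNot (ILess (iv 32) I0))
   (READD;; PISet 23 (iv 22) (iv 32);; PRSet 5 (iv 22) (rv 7);; seti 22 (IPlus (iv 22) I1)) PSkip"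
 have c: "consts_ok s" "data d s" using r by (auto simp: rel_def)
 have "wp K I (UNCOV;; MINPT;; ?rest) s (rel dl lm ?d')"
 proof (rule wp_step[OF UNCOV_wp[OF c dv]])
  fix s1 assume s1: "pts 30 s1 = uncov d" and fr1: "frame UNCOV s s1"
  have r1: "rel dl lm d s1" by (rule rel_frame[OF r fr1]) auto
  hence n0: "ints s1 0 0 = int n" by (simp add: rel_def consts_ok_def)
  show "wp K I (MINPT;; ?rest) s1 (rel dl lm ?d')"
  proof (rule wp_step[OF MINPT_wp[OF n0]])
   fix s2 assume s2: "ints s2 32 0 = (if pts 30 s1 = {} then -1 else int (Min (pts 30 s1)))" and fr2: "frame MINPT s1 s2"
   have r2: "rel dl lm d s2" by (rule rel_frame[OF r1 fr2]) auto
   show "wp K I ?rest s2 (rel dl lm ?d')"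
   proof (cases "uncov d = {}")
    case True
    thus ?thesis using s2 s1 r2 by (simp add: discover_def)
   next
    case ne: False
    obtain D t where rd: "readD dl lm (tape d) = (D, t)" by fastforce
    have "wp K I (READD;; PISet 23 (iv 22) (iv 32);; PRSet 5 (iv 22) (rv 7);; seti 22 (IPlus (iv 22) I1)) s2 (rel dl lm ?d')"
    proof (rule wp_step[OF READD_rel[OF r2 rd]])
    fix s3 assume s3: "reals s3 7 0 = D & rel dl lm (d(|tape := t|)) s3" and fr3: "frame READD s2 s3"
    have E: "ints s3 22 0 = int (length (cens d))" "data d s3" using s3 by (auto simp: rel_def data_def)
    have len: "length (rads d) = length (cens d)" using dv by (simp add: dinv_def)
    have m: "ints s3 32 0 = int (Min (uncov d))" using s2 s1 ne frameD[OF fr3] by simp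
    have d': "?d' = d(|cens := cens d @ [Min (uncov d)], rads := rads d @ [D], tape := t|)" using False ne rd by (simp add: discover_def)
    show "wp K I (PISet 23 (iv 22) (iv 32);; PRSet 5 (iv 22) (rv 7);; seti 22 (IPlus (iv 22) I1)) s3 (rel dl lm ?d')" using push_cluster[OF E(2) len, where c = "Min (uncov d)" and D = D] E m s3 unfolding d' by (auto simp: rel_def)
    qed
    thus ?thesis using s2 s1 ne by simp
   qed
  qed
 qed
 thus ?thesis using False c cur by (simp add: DISCOVER_def data_def)
qed

lemma TURN_wp:
 assumes r: "rel dl lm d s" and dv: "dinv d" and cur: "ints s 35 0 = int cur" "cur<k"
  and t: "turn dl lm (d, cur) = (d', cur')"
 shows "wp K I TURN s (%s'. rel dl lm d' s' & dinv d' & ints s' 35 0 = int cur' & cur'<=Suc cur)" unfolding TURN_def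
proof (rule wp_step[OF DISCOVER_wp[OF r dv cur(1)]])
 let ?d1 = "discover dl lm (d, cur)"
 fix s1 assume r1: "rel dl lm ?d1 s1" and fr1: "frame DISCOVER s s1"
 have dv1: "dinv ?d1" by (rule discover_dinv[OF dv cur(2)])
 have c1: "ints s1 35 0 = int cur" using cur frameD[OF fr1] by simp
 have l: "ints s1 22 0 = int (length (cens ?d1))" using r1 by (simp add: rel_def data_def)
 show "wp K I (If (ILess (iv 35) (iv 22)) (LISTING;; seti 35 (IPlus (iv 35) I1)) PSkip) s1
  (%s'. rel dl lm d' s' & dinv d' & ints s' 35 0 = int cur' & cur'<=Suc cur)"
 proof (cases "cur<length (cens ?d1)")
  case False
  thus ?thesis using t r1 dv1 c1 l by (auto simp: turn_def Let_def)
 next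
  case True
  have e: "d' = listing dl lm cur ?d1" "cur' = Suc cur" using t True by (auto simp: turn_def Let_def)
  have "wp K I (LISTING;; seti 35 (IPlus (iv 35) I1)) s1
   (%s'. rel dl lm d' s' & dinv d' & ints s' 35 0 = int cur' & cur'<=Suc cur)"
  proof (rule wp_step[OF LISTING_wp[OF r1 dv1 c1 True]])
   fix s2 assume "rel dl lm (listing dl lm cur ?d1) s2 & dinv (listing dl lm cur ?d1)" and fr2: "frame LISTING s1 s2"
   thus "wp K I (seti 35 (IPlus (iv 35) I1)) s2
    (%s'. rel dl lm d' s' & dinv d' & ints s' 35 0 = int cur' & cur'<=Suc cur)" using e c1 frameD[OF fr2] by simp
  qed
  thus ?thesis using True c1 l by simp
 qed
qed

lemma TURNS_wp:
 assumes c: "consts_ok s" "tape_ok s" and dl: "reals s 3 0 = dl" "reals s 4 0 = lm" and o: "~ 0<ints s 17 0"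
  and len: "length (tp s)<=B"
 shows "wp K I TURNS s (%s'. rel dl lm (turns dl lm (tp s)) s' & dinv (turns dl lm (tp s)))"
proof -
 let ?d0 = "(|cens = [], rads = [], ents = [], wits = [], tape = tp s, ovf = False|)"
 let ?s = "iupd 35 0 0 (iupd 27 0 0 (iupd 24 0 0 (iupd 22 0 0 s)))"
 let ?R = "%m s'. EX d cur. (turn dl lm ^^ m) (?d0, 0) = (d, cur) & rel dl lm d s' & dinv d & ints s' 35 0 = int cur & cur<=m"
 have "wp K I (For 38 0 1 TURN) ?s (%s'. rel dl lm (turns dl lm (tp s)) s' & dinv (turns dl lm (tp s)))"
 proof (rule wp_For[where N = k and Inv = ?R])
  show "?R 0 ?s" using c dl o len by (auto simp: rel_def data_def dinv_def)
  fix m s' assume m: "m<k" and "?R m s'"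
  then obtain d cur where R: "(turn dl lm ^^ m) (?d0, 0) = (d, cur)" "rel dl lm d s'" "dinv d" "ints s' 35 0 = int cur" "cur<=m" by blast
  obtain d' cur' where t: "turn dl lm (d, cur) = (d', cur')" by fastforce
  show "wp K I TURN s' (?R (Suc m))" by (rule wp_mono[OF TURN_wp[OF R(2,3,4) _ t]]) (use R t m in auto)
 next
  fix s' assume "?R k s'"
  thus "rel dl lm (turns dl lm (tp s)) s' & dinv (turns dl lm (tp s))" by (auto simp: turns_def)
 next
  show "?R m (iupd 38 0 x s')" if "?R m s'" for m s' x using that by auto
 qed (use c in "auto simp: consts_ok_def")
 thus ?thesis by (simp add: TURNS_def)
qed

lemma gstep_Suc_le: "fst ((gstep Suc ^^ m) (v, go, t)) <= v+m"
proof (induction m)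
 case (Suc m)
 thus ?case by (cases "(gstep Suc ^^ m) (v, go, t)") (auto simp: gstep_def)
qed simp

lemma SCALE_wp:
 assumes c: "consts_ok s" "tape_ok s"
 shows "wp K I SCALE s (%s'. consts_ok s' & tape_ok s' & scale (tp s) = (reals s' 3 0, reals s' 4 0, tp s'))"
proof -
 let ?Q = "%s'. consts_ok s' & tape_ok s' & scale (tp s) = (reals s' 3 0, reals s' 4 0, tp s')"
 let ?s0 = "iupd 39 0 0 s"
 have u1: "wp K I (UNARY 0 1 (seti 39 (IPlus (iv 39) I1))) ?s0
  (%s'. tape_ok s' & (EX v' go. (gstep Suc ^^ k) (0, True, tp ?s0) = (v', go, tp s') & ints s' 39 0 = int v'))" by (rule UNARY_wp[where V = "%v s'. ints s' 39 0 = int v"]) (use c in "auto simp: consts_ok_def")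
 have "wp K I (UNARY 0 1 (seti 39 (IPlus (iv 39) I1));;
   seti 48 I0;; UNARY 0 1 (seti 48 (IPlus (iv 48) I1));;
   setr 10 (RPlus (RDist (IGet 15 (iv 39)) (IGet 15 (iv 48))) (RTimes (rnum 2) (rv 2)));;
   UNARY 3 0 (setr 10 (RPlus (rv 10) (rv 10)));;
   setr 4 (RDivide (rv 10) (ROfInt (IGet 0 I1)));; setr 3 (RDivide (rv 4) (rv 1))) ?s0 ?Q"
 proof (rule wp_step[OF u1])
  fix s1 assume 1: "tape_ok s1 & (EX v' go. (gstep Suc ^^ k) (0, True, tp ?s0) = (v', go, tp s1) & ints s1 39 0 = int v')"
   and fr1: "frame (UNARY 0 1 (seti 39 (IPlus (iv 39) I1))) ?s0 s1"
  then obtain a ga where a: "(gstep Suc ^^ k) (0, True, tp s) = (a, ga, tp s1)" "ints s1 39 0 = int a" by auto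
  have ak: "a<=k" using gstep_Suc_le[of k 0 True "tp s"] a by simp
  have c1: "consts_ok s1" by (rule consts_ok_frame[OF _ fr1]) (use c in auto)
  let ?s1 = "iupd 48 0 0 s1"
  have u2: "wp K I (UNARY 0 1 (seti 48 (IPlus (iv 48) I1))) ?s1
   (%s'. tape_ok s' & (EX v' go. (gstep Suc ^^ k) (0, True, tp ?s1) = (v', go, tp s') & ints s' 48 0 = int v'))" by (rule UNARY_wp[where V = "%v s'. ints s' 48 0 = int v"]) (use c1 1 in "auto simp: consts_ok_def")
  have "wp K I (UNARY 0 1 (seti 48 (IPlus (iv 48) I1));;
    setr 10 (RPlus (RDist (IGet 15 (iv 39)) (IGet 15 (iv 48))) (RTimes (rnum 2) (rv 2)));;
    UNARY 3 0 (setr 10 (RPlus (rv 10) (rv 10)));;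
    setr 4 (RDivide (rv 10) (ROfInt (IGet 0 I1)));; setr 3 (RDivide (rv 4) (rv 1))) ?s1 ?Q"
  proof (rule wp_step[OF u2])
   fix s2 assume 2: "tape_ok s2 & (EX v' go. (gstep Suc ^^ k) (0, True, tp ?s1) = (v', go, tp s2) & ints s2 48 0 = int v')"
    and fr2: "frame (UNARY 0 1 (seti 48 (IPlus (iv 48) I1))) ?s1 s2"
   then obtain b gb where b: "(gstep Suc ^^ k) (0, True, tp s1) = (b, gb, tp s2)" "ints s2 48 0 = int b" by auto
   have bk: "b<=k" using gstep_Suc_le[of k 0 True "tp s1"] b by simp
   have c2: "consts_ok s2" by (rule consts_ok_frame[OF _ fr2]) (use c1 in auto)
   have a2: "ints s2 39 0 = int a" using a frameD[OF fr2] by simp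
   let ?E = "dd (z a) (z b)+2*r"
   let ?s2 = "rupd 10 0 ?E s2"
   have e: "rval I s2 (RPlus (RDist (IGet 15 (iv 39)) (IGet 15 (iv 48))) (RTimes (rnum 2) (rv 2))) = ?E" using c2 a2 b(2) ak bk by (simp add: consts_ok_def dI)
   have u3: "wp K I (UNARY 3 0 (setr 10 (RPlus (rv 10) (rv 10)))) ?s2
    (%s'. tape_ok s' & (EX v' go. (gstep (%E. E+E) ^^ B) (?E, True, tp ?s2) = (v', go, tp s') & reals s' 10 0 = v'))" by (rule UNARY_wp[where V = "%v s'. reals s' 10 0 = v"]) (use c2 2 in "auto simp: consts_ok_def")
   have "wp K I (UNARY 3 0 (setr 10 (RPlus (rv 10) (rv 10)));;
    setr 4 (RDivide (rv 10) (ROfInt (IGet 0 I1)));; setr 3 (RDivide (rv 4) (rv 1))) ?s2 ?Q"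
   proof (rule wp_step[OF u3])
    fix s3 assume 3: "tape_ok s3 & (EX v' go. (gstep (%E. E+E) ^^ B) (?E, True, tp ?s2) = (v', go, tp s3) & reals s3 10 0 = v')"
    and fr3: "frame (UNARY 3 0 (setr 10 (RPlus (rv 10) (rv 10)))) ?s2 s3"
    then obtain E ge where E: "(gstep (%E. E+E) ^^ B) (?E, True, tp s2) = (E, ge, tp s3)" "reals s3 10 0 = E" by auto
    have c3: "consts_ok s3" by (rule consts_ok_frame[OF _ fr3]) (use c2 in auto)
    have v: "ints s3 0 1 = int k" "reals s3 1 0 = th" using c3 by (auto simp: consts_ok_def)
    have "scale (tp s) = (E/real k/th, E/real k, tp s3)" using a b E by (simp add: scale_def)
    thus "wp K I (setr 4 (RDivide (rv 10) (ROfInt (IGet 0 I1)));; setr 3 (RDivide (rv 4) (rv 1))) s3 ?Q" using 3 c3 E v by simp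
   qed
   thus "wp K I (setr 10 (RPlus (RDist (IGet 15 (iv 39)) (IGet 15 (iv 48))) (RTimes (rnum 2) (rv 2)));;
    UNARY 3 0 (setr 10 (RPlus (rv 10) (rv 10)));;
    setr 4 (RDivide (rv 10) (ROfInt (IGet 0 I1)));; setr 3 (RDivide (rv 4) (rv 1))) s2 ?Q" unfolding wp_Sq wp_PRSet e by simp
  qed
  thus "wp K I (seti 48 I0;; UNARY 0 1 (seti 48 (IPlus (iv 48) I1));;
    setr 10 (RPlus (RDist (IGet 15 (iv 39)) (IGet 15 (iv 48))) (RTimes (rnum 2) (rv 2)));;
    UNARY 3 0 (setr 10 (RPlus (rv 10) (rv 10)));;
    setr 4 (RDivide (rv 10) (ROfInt (IGet 0 I1)));; setr 3 (RDivide (rv 4) (rv 1))) s1 ?Q" by simp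
 qed
 thus ?thesis unfolding SCALE_def by simp
qed

end

section \<open>Machine code for assigning points and merging components\<close>

section \<open>The program: assigning points and merging\<close>

text \<open>
  Integer arrays: 40 the cluster a point is assigned to (negative for none), 41 a cluster,
  42 and 51 a marker, 43 a witness; 49 the labels of the nodes of the merging graph, 50 the last
  node visited, 52 a node; 58 the labels of the points.
\<close>

abbreviation bor :: "bexp => bexp => bexp" where "bor a b \<equiv> BNot (BAnd (BNot a) (BNot b))"
abbreviation ieq :: "iexp => iexp => bexp" where "ieq a b \<equiv> BAnd (BNot (ILess a b)) (BNot (ILess b a))"

definition RMV :: prog where
 "RMV = seti 32 (IGet 25 (iv 42));; setr 12 (RTimes (rnum 8) (RDivide (RGet 6 (iv 42)) (rv 1)));; DROPBALL"

definition SSTEP :: prog where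
 "SSTEP = If (BAnd (ILess (iv 42) (iv 24)) (BNot (RLess (RGet 5 (iv 41)) (RGet 6 (iv 42)))))
   (If (ILess I0 (IGet 26 (iv 42)))
    (If (BAnd (RLess (RDivide (RGet 5 (iv 41)) (rv 1)) (RGet 6 (iv 42)))
    (BNot (RLess (RTimes (rnum 3) (RGet 5 (iv 41))) (RDist (IGet 23 (iv 41)) (IGet 25 (iv 42))))))
    (READ;; If (pos 12) PSkip RMV) PSkip) RMV) PSkip"

definition WSTEP :: prog where
 "WSTEP = If (BAnd (ILess (iv 43) (iv 27)) (ieq (IGet 28 (iv 43)) (iv 41)))
   (KILL 30 (RLess (RPlus (RGet 5 (iv 41)) (rv 3)) (RDist (IGet 29 (iv 43)) (iv 31)))) PSkip"

definition SSET :: prog where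
 "SSET = FILL 30 (BNot (RLess (RTimes (rnum 2) (RGet 5 (iv 41))) (RDist (IGet 23 (iv 41)) (iv 31))));;
   For 42 3 0 SSTEP;; For 43 3 0 WSTEP"

definition ASTEP :: prog where
 "ASTEP = If (ILess (iv 41) (iv 22)) (SSET;;
   For 31 0 0 (If (BAnd (ILess I0 (IGet 30 (iv 31))) (bor (ILess (IGet 40 (iv 31)) I0)
    (RLess (RGet 5 (iv 41)) (RGet 5 (IGet 40 (iv 31)))))) (PISet 40 (iv 31) (iv 41)) PSkip)) PSkip"

definition ASSIGN :: prog where
 "ASSIGN = For 31 0 0 (PISet 40 (iv 31) (IConst (-1)));; For 41 0 1 ASTEP"

definition HUB :: bexp where
 "HUB = BAnd (ILess (iv 51) (iv 24)) (BAnd (ILess I0 (IGet 26 (iv 51)))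
   (BAnd (BNot (RLess (RTimes (rnum 8) (RDivide (RGet 6 (iv 51)) (rv 1))) (RDist (IGet 25 (iv 51)) (iv 31))))
    (bor (ILess (IGet 40 (iv 31)) I0) (BNot (RLess (RGet 5 (IGet 40 (iv 31))) (RGet 6 (iv 51)))))))"

definition MERGE :: prog where
 "MERGE = seti 53 (IGet 49 (iv 50));; seti 54 (IGet 49 (iv 52));;
   If (ILess (iv 53) (iv 54)) (seti 55 (iv 53)) (seti 55 (iv 54));;
   For 56 9 0 (If (bor (ieq (IGet 49 (iv 56)) (iv 53)) (ieq (IGet 49 (iv 56)) (iv 54))) (PISet 49 (iv 56) (iv 55)) PSkip)"

definition UNITE :: prog where
 "UNITE = If (ILess (iv 50) I0) PSkip MERGE;; seti 50 (iv 52)"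

definition VISIT :: prog where
 "VISIT = seti 50 (IConst (-1));; If (ILess (IGet 40 (iv 31)) I0) PSkip (seti 52 (IGet 40 (iv 31));; UNITE);;
   For 51 3 0 (If HUB (seti 52 (IPlus (iv 3) (iv 51));; UNITE) PSkip)"

definition UNIONS :: prog where
 "UNIONS = For 57 9 0 (PISet 49 (iv 57) (iv 57));; For 31 0 0 VISIT"

definition LABELPT :: prog where
 "LABELPT = PISet 58 (iv 31) I0;;
   If (ILess (IGet 40 (iv 31)) I0) PSkip (PISet 58 (iv 31) (IGet 49 (IGet 40 (iv 31))));;
   For 51 3 0 (If HUB (PISet 58 (iv 31) (IGet 49 (IPlus (iv 3) (iv 51)))) PSkip);;
   If (ILess (IGet 58 (iv 31)) (IGet 0 I1)) PSkip (PISet 58 (iv 31) I0)"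

definition LABEL :: prog where "LABEL = For 31 0 0 LABELPT"

definition DECODE :: prog where
 "DECODE = seti 11 I0;; seti 17 I0;; SCALE;; TURNS;; ASSIGN;; UNIONS;; LABEL"

lemma [simp]: "piw RMV = {30,31,32}" "prw RMV = {12}" by (auto simp: RMV_def)
lemma [simp]: "piw SSTEP = {11,12,30,31,32}" "prw SSTEP = {12}" by (auto simp: SSTEP_def)
lemma [simp]: "piw WSTEP = {30,31}" "prw WSTEP = {}" by (auto simp: WSTEP_def)
lemma [simp]: "piw SSET = {11,12,30,31,32,42,43}" "prw SSET = {12}" by (auto simp: SSET_def)
lemma [simp]: "piw ASTEP = {11,12,30,31,32,40,42,43}" "prw ASTEP = {12}" by (auto simp: ASTEP_def)
lemma [simp]: "piw ASSIGN = {11,12,30,31,32,40,41,42,43}" "prw ASSIGN = {12}" by (auto simp: ASSIGN_def)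
lemma [simp]: "piw MERGE = {49,53,54,55,56}" "prw MERGE = {}" by (auto simp: MERGE_def)
lemma [simp]: "piw UNITE = {49,50,53,54,55,56}" "prw UNITE = {}" by (auto simp: UNITE_def)
lemma [simp]: "piw VISIT = {49,50,51,52,53,54,55,56}" "prw VISIT = {}" by (auto simp: VISIT_def)
lemma [simp]: "piw UNIONS = {31,49,50,51,52,53,54,55,56,57}" "prw UNIONS = {}" by (auto simp: UNIONS_def)
lemma [simp]: "piw LABELPT = {51,58}" "prw LABELPT = {}" by (auto simp: LABELPT_def)
lemma [simp]: "piw LABEL = {31,51,58}" "prw LABEL = {}" by (auto simp: LABEL_def)
lemma [simp]: "piw DECODE = {11, 12, 13, 14, 16, 17, 18, 19, 20, 21, 22, 23, 24, 25, 26, 27, 28, 29, 30, 31, 32, 35, 36, 37,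
  38, 39, 40, 41, 42, 43, 44, 45, 46, 47, 48, 49, 50, 51, 52, 53, 54, 55, 56, 57, 58}"
  "prw DECODE = {3,4,5,6,7,8,9,10,12}" by (auto simp: DECODE_def)

text \<open>Machine loops run to the fixed bounds \<open>k\<close> and \<open>B\<close>; the guard
  makes the iterations beyond the current length idle.\<close>

lemma foldl_upt_guard: "l<=N ==> foldl (%st j. if j<l then f st j else st) st [0..<N] = foldl f st [0..<l]"
proof (induction N)
 case (Suc N)
 show ?case
 proof (cases "l = Suc N")
  case True
  have "foldl (%st j. if j<l then f st j else st) st xs = foldl f st xs" if "ALL x:set xs. x<l" for xs st using that by (induction xs arbitrary: st) auto
  thus ?thesis using True by simp
 qed (use Suc in auto)
qed simp

lemma foldl_nth: "foldl f st xs = foldl (%st j. f st (xs ! j)) st [0..<length xs]" using foldl_map[of f st "%j. xs ! j" "[0..<length xs]"] by (simp add: map_nth)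

definition unite :: "(nat => nat) => nat => nat => nat => nat" where
 "unite lb u v w = (if lb w = lb u | lb w = lb v then min (lb u) (lb v) else lb w)"

lemma unite_coarser: "lb w = lb w' ==> unite lb u v w = unite lb u v w'" by (simp add: unite_def)

lemma unite_united: "unite lb u v u = unite lb u v v" by (simp add: unite_def)

definition plval :: "nat option => int => bool" where
 "plval x v <-> (case x of None => v<0 | Some j => v = int j)"

lemma plval_simps [simp]: "plval None v = (v<0)" "plval (Some j) v = (v = int j)" by (auto simp: plval_def)

context machine
begin

lemma RMV_wp:
 assumes c: "consts_ok s" and dt: "data d s" and b: "ints s 42 0 = int b" "b<length (ents d)"
 shows "wp K I RMV s (%s'. pts 30 s' = pts 30 s - ballp (fst (ents d ! b)) (8*(fst (snd (ents d ! b))/th)))"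
proof -
 let ?s = "rupd 12 0 (8*(fst (snd (ents d ! b))/th)) (iupd 32 0 (int (fst (ents d ! b))) s)"
 have v: "ints s 25 (int b) = int (fst (ents d ! b))" "reals s 6 (int b) = fst (snd (ents d ! b))" "reals s 1 0 = th" "ints s 0 0 = int n" using c dt b by (auto simp: consts_ok_def data_def)
 have "wp K I DROPBALL ?s (%s'. pts 30 s' = pts 30 ?s - ballp (fst (ents d ! b)) (reals ?s 12 0))" by (rule DROPBALL_wp) (use v in auto)
 thus ?thesis unfolding RMV_def using v b by simp
qed

lemma SSTEP_wp:
 assumes r: "rel dl lm (d(|tape := t|)) s" and i: "ints s 41 0 = int i" "i<length (cens d)"
  and b: "ints s 42 0 = int b"
 shows "wp K I SSTEP s (%s'. EX t'. (if b<length (ents d) then sstep d i (pts 30 s, t) (ents d ! b) else (pts 30 s, t)) = (pts 30 s', t') &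
   rel dl lm (d(|tape := t'|)) s')"
proof (cases "b<length (ents d)")
 case False
 thus ?thesis using r b by (auto simp: SSTEP_def rel_def data_def)
next
 case True
 obtain e \<sigma> nr where en: "ents d ! b = (e, \<sigma>, nr)" by (metis prod_cases3)
 have c: "consts_ok s" and dt: "data d s" using r by (auto simp: rel_def)
 have v: "ints s 24 0 = int (length (ents d))" "reals s 5 (int i) = rads d ! i" "reals s 6 (int b) = \<sigma>" "0<ints s 26 (int b) <-> nr"
   "ints s 25 (int b) = int e" "ints s 23 (int i) = int (cens d ! i)" "reals s 1 0 = th" using dt c i True en by (auto simp: data_def consts_ok_def)
 let ?Q = "%s'. EX t'. sstep d i (pts 30 s, t) (ents d ! b) = (pts 30 s', t') & rel dl lm (d(|tape := t'|)) s'"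
 have rmv: "wp K I RMV s1 (%s'. pts 30 s' = pts 30 s - ballp e (8*(\<sigma>/th)) & rel dl lm (d(|tape := t1|)) s')"
  if r1: "rel dl lm (d(|tape := t1|)) s1" and p1: "pts 30 s1 = pts 30 s" and b1: "ints s1 42 0 = int b" for s1 t1
 proof (rule wp_conseq[OF RMV_wp[OF _ _ b1 True]])
  show "consts_ok s1" "data d s1" using r1 by (auto simp: rel_def)
  fix s' assume 1: "pts 30 s' = pts 30 s1 - ballp (fst (ents d ! b)) (8*(fst (snd (ents d ! b))/th))" and fr: "frame RMV s1 s'"
  have "rel dl lm (d(|tape := t1|)) s'" by (rule rel_frame[OF r1 fr]) auto
  thus "pts 30 s' = pts 30 s - ballp e (8*(\<sigma>/th)) & rel dl lm (d(|tape := t1|)) s'" using 1 p1 en by simp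
 qed
 have rmv0: "wp K I RMV s ?Q" if "sstep d i (pts 30 s, t) (ents d ! b) = (pts 30 s - ballp e (8*(\<sigma>/th)), t)" by (rule wp_mono[OF rmv[OF r _ b]]) (use that in auto)
 have rd: "wp K I (READ;; If (pos 12) PSkip RMV) s ?Q"
  if "sstep d i (pts 30 s, t) (ents d ! b) = (if hdb t then pts 30 s else pts 30 s - ballp e (8*(\<sigma>/th)), tl t)"
 proof (rule wp_step[OF READ_rel[OF r]])
  fix s1 assume 1: "(0<ints s1 12 0 <-> hdb (tape (d(|tape := t|)))) & rel dl lm (d(|tape := t, tape := tl (tape (d(|tape := t|)))|)) s1"
   and fr: "frame READ s s1"
  have r1: "rel dl lm (d(|tape := tl t|)) s1" using 1 by simp
  have p1: "pts 30 s1 = pts 30 s" by (rule pts_cong) (use frameD[OF fr] in simp)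
  have b1: "ints s1 42 0 = int b" using frameD[OF fr] b by simp
  show "wp K I (If (pos 12) PSkip RMV) s1 ?Q"
  proof (cases "hdb t")
   case True
   thus ?thesis using 1 p1 that by auto
  next
   case False
   have "wp K I RMV s1 ?Q" by (rule wp_mono[OF rmv[OF r1 p1 b1]]) (use that False in auto)
   thus ?thesis using 1 False by simp
  qed
 qed
 consider (a) "rads d ! i<\<sigma>" | (b) "~ rads d ! i<\<sigma>" "~ nr" |
  (c) "~ rads d ! i<\<sigma>" "nr" "rads d ! i/th<\<sigma> & ~ 3*rads d ! i<dd (cens d ! i) e" |
  (d) "~ rads d ! i<\<sigma>" "nr" "~ (rads d ! i/th<\<sigma> & ~ 3*rads d ! i<dd (cens d ! i) e)" by blast
 hence "wp K I SSTEP s ?Q"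
 proof cases
  case a
  thus ?thesis using r v i b True en by (auto simp: SSTEP_def sstep_def Let_def)
 next
  case b
  thus ?thesis using rmv0 v i \<open>ints s 42 0 = int b\<close> True en by (simp add: SSTEP_def sstep_def Let_def)
 next
  case c
  have "sstep d i (pts 30 s, t) (ents d ! b) = (if hdb t then pts 30 s else pts 30 s - ballp e (8*(\<sigma>/th)), tl t)" using c en by (simp add: sstep_def Let_def)
  from rd[OF this] show ?thesis using v i \<open>ints s 42 0 = int b\<close> True c unfolding SSTEP_def wp_If by (simp add: dI)
 next
  case d
  hence "sstep d i (pts 30 s, t) (ents d ! b) = (pts 30 s, t)" using en by (auto simp: sstep_def Let_def)
  thus ?thesis using v i \<open>ints s 42 0 = int b\<close> True d r unfolding SSTEP_def wp_If by (auto simp: dI)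
 qed
 thus ?thesis using True by simp
qed

lemma SSET_wp:
 assumes r: "rel dl lm (d(|tape := t|)) s" and i: "ints s 41 0 = int i" "i<length (cens d)"
  and B: "length (ents d)<=B" "length (wits d)<=B"
 shows "wp K I SSET s (%s'. EX t'. sset dl d i t = (pts 30 s', t') & rel dl lm (d(|tape := t'|)) s')"
proof -
 let ?D = "rads d ! i" and ?x = "cens d ! i"
 let ?fill = "FILL 30 (BNot (RLess (RTimes (rnum 2) (RGet 5 (iv 41))) (RDist (IGet 23 (iv 41)) (iv 31))))"
 have n0: "ints s 0 0 = int n" and v: "reals s 5 (int i) = ?D" "ints s 23 (int i) = int ?x" using r i by (auto simp: rel_def consts_ok_def data_def)
 let ?Q = "%s'. EX t'. sset dl d i t = (pts 30 s', t') & rel dl lm (d(|tape := t'|)) s'"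
 show ?thesis unfolding SSET_def
 proof (rule wp_step[OF FILL_wp[OF n0, where h = "%p. ~ 2*?D<dd ?x p"]])
  show "bval I s' (BNot (RLess (RTimes (rnum 2) (RGet 5 (iv 41))) (RDist (IGet 23 (iv 41)) (iv 31)))) = (~ 2*?D<dd ?x j)"
   if "ints s' 31 0 = int j" "frame ?fill s s'" for j s' using that(1) frameD[OF that(2)] v i by (simp add: dI)
 next
  fix s1 assume p1: "pts 30 s1 = {p. p<n & ~ 2*?D<dd ?x p}" and fr1: "frame ?fill s s1"
  have r1: "rel dl lm (d(|tape := t|)) s1" by (rule rel_frame[OF r fr1]) auto
  have i1: "ints s1 41 0 = int i" using frameD[OF fr1] i by simp
  let ?f = "%st b. if b<length (ents d) then sstep d i st (ents d ! b) else st"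
  let ?R = "%st s'. pts 30 s' = fst st & rel dl lm (d(|tape := snd st|)) s' & ints s' 41 0 = int i"
  have loop: "wp K I (For 42 3 0 SSTEP) s1 (?R (foldl ?f (pts 30 s1, t) [0..<B]))"
  proof (rule wp_For_fold)
   fix b st s' assume st: "?R st s'" and b: "ints s' 42 0 = int b"
   obtain S t1 where S: "st = (S, t1)" by fastforce
   show "wp K I SSTEP s' (?R (?f st b))"
   proof (rule wp_conseq[OF SSTEP_wp[OF _ _ i(2) b]])
    show "rel dl lm (d(|tape := t1|)) s'" "ints s' 41 0 = int i" using st S by auto
    fix s2 assume "EX t'. (if b<length (ents d) then sstep d i (pts 30 s', t1) (ents d ! b) else (pts 30 s', t1)) = (pts 30 s2, t') &
    rel dl lm (d(|tape := t'|)) s2" and fr: "frame SSTEP s' s2"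
    then obtain t' where "?f st b = (pts 30 s2, t')" "rel dl lm (d(|tape := t'|)) s2" using st S by auto
    thus "?R (?f st b) s2" using st frameD[OF fr] by simp
   qed
  qed (use r1 i1 in "auto simp: rel_def consts_ok_def")
  have e: "foldl ?f (pts 30 s1, t) [0..<B] = foldl (sstep d i) (pts 30 s1, t) (ents d)" unfolding foldl_upt_guard[OF B(1)] foldl_nth[of _ _ "ents d"] ..
  obtain S t2 where S: "foldl (sstep d i) (pts 30 s1, t) (ents d) = (S, t2)" by fastforce
  have p1': "pts 30 s1 = ballp ?x (2*?D)" using p1 by (simp add: ballp_def)
  let ?T = "%m. S \<inter> {p. ALL w<m. w<length (wits d) --> fst (wits d ! w) = i --> ~ ?D+dl<dd (snd (wits d ! w)) p}"
  have ss: "sset dl d i t = (?T B, t2)"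
  proof -
   have "(ALL (w, y):set (wits d). w = i --> ~ ?D+dl<dd y p) <->
    (ALL w<B. w<length (wits d) --> fst (wits d ! w) = i --> ~ ?D+dl<dd (snd (wits d ! w)) p)" for p using bex_nth[OF B(2), of "%x. ~ (fst x = i --> ~ ?D+dl<dd (snd x) p)"] by (auto simp: case_prod_beta)
   thus ?thesis using S p1' unfolding sset_def by simp
  qed
  show "wp K I (For 42 3 0 SSTEP;; For 43 3 0 WSTEP) s1 ?Q"
  proof (rule wp_step[OF loop[unfolded e S]])
   fix s2 assume s2: "?R (S, t2) s2"
   show "wp K I (For 43 3 0 WSTEP) s2 ?Q"
   proof (rule wp_For[where N = B and Inv = "%m s'. pts 30 s' = ?T m"])
    fix m s' assume m: "m<B" and inv: "pts 30 s' = ?T m" and w: "ints s' 43 0 = int m" and fr: "frame (For 43 3 0 WSTEP) s2 s'"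
    have r': "rel dl lm (d(|tape := t2|)) s'" by (rule rel_frame[OF _ fr]) (use s2 in auto)
    have i': "ints s' 41 0 = int i" using frameD[OF fr] s2 by simp
    have v': "ints s' 27 0 = int (length (wits d))" "reals s' 5 (int i) = ?D" "reals s' 3 0 = dl" "ints s' 0 0 = int n" using r' i by (auto simp: rel_def data_def consts_ok_def)
    have w': "ints s' 28 (int m) = int (fst (wits d ! m))" "ints s' 29 (int m) = int (snd (wits d ! m))" if "m<length (wits d)" using r' that by (auto simp: rel_def data_def)
    show "wp K I WSTEP s' (%s'. pts 30 s' = ?T (Suc m))"
    proof (cases "m<length (wits d) & fst (wits d ! m) = i")
    case False
    hence "?T (Suc m) = ?T m" by (auto simp: less_Suc_eq)
    thus ?thesis using False inv v' w w' i' by (auto simp: WSTEP_def)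
    next
    case True
    let ?k = "KILL 30 (RLess (RPlus (RGet 5 (iv 41)) (rv 3)) (RDist (IGet 29 (iv 43)) (iv 31)))"
    have "wp K I ?k s' (%s'. pts 30 s' = ?T (Suc m))"
    proof (rule wp_mono[OF KILL_wp[OF v'(4), where h = "%p. ?D+dl<dd (snd (wits d ! m)) p"]])
    show "bval I s3 (RLess (RPlus (RGet 5 (iv 41)) (rv 3)) (RDist (IGet 29 (iv 43)) (iv 31))) = (?D+dl<dd (snd (wits d ! m)) j)"
    if "ints s3 31 0 = int j" "frame ?k s' s3" for j s3 using that(1) frameD[OF that(2)] v' w w' i' True by (simp add: dI)
    show "pts 30 s3 = ?T (Suc m)" if "pts 30 s3 = pts 30 s' - {p. ?D+dl<dd (snd (wits d ! m)) p}" for s3 using that inv True by (auto simp: less_Suc_eq)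
    qed auto
    thus ?thesis using True v' w w' i' by (simp add: WSTEP_def)
    qed
   next
    fix s' assume inv: "pts 30 s' = ?T B" and fr: "frame (For 43 3 0 WSTEP) s2 s'"
    have "rel dl lm (d(|tape := t2|)) s'" by (rule rel_frame[OF _ fr]) (use s2 in auto)
    thus "?Q s'" using ss inv by auto
   qed (use s2 in "auto simp: rel_def consts_ok_def")
  qed
 qed auto
qed

definition plrel :: "(nat => nat option) => state => bool" where
 "plrel pl s <-> (ALL p<n. plval (pl p) (ints s 40 (int p)))"

lemma plrel_cong: "plrel pl s ==> ints s' 40 = ints s 40 ==> plrel pl s'" by (simp add: plrel_def)

definition pl_ok :: "dstate => (nat => nat option) => bool" where
 "pl_ok d pl <-> (ALL p j. pl p = Some j --> j<length (cens d))"

lemma ASTEP_wp: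
 assumes r: "rel dl lm (d(|tape := t|)) s" and i: "ints s 41 0 = int i" and B: "length (ents d)<=B" "length (wits d)<=B"
  and pl: "plrel pl s" "pl_ok d pl"
  and st: "(if i<length (cens d) then astep dl d (pl, t) i else (pl, t)) = (pl', t')"
 shows "wp K I ASTEP s (%s'. plrel pl' s' & pl_ok d pl' & rel dl lm (d(|tape := t'|)) s')"
proof (cases "i<length (cens d)")
 case False
 thus ?thesis using st r pl i by (auto simp: ASTEP_def rel_def data_def)
next
 case True
 let ?bx = "BAnd (ILess I0 (IGet 30 (iv 31))) (bor (ILess (IGet 40 (iv 31)) I0)
    (RLess (RGet 5 (iv 41)) (RGet 5 (IGet 40 (iv 31)))))"
 let ?loop = "For 31 0 0 (If ?bx (PISet 40 (iv 31) (iv 41)) PSkip)"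
 let ?Q = "%s'. plrel pl' s' & pl_ok d pl' & rel dl lm (d(|tape := t'|)) s'"
 have "wp K I (SSET;; ?loop) s ?Q"
 proof (rule wp_step[OF SSET_wp[OF r i True B]])
  fix s1 assume "EX t'. sset dl d i t = (pts 30 s1, t') & rel dl lm (d(|tape := t'|)) s1" and fr: "frame SSET s s1"
  then obtain t2 where t2: "sset dl d i t = (pts 30 s1, t2)" "rel dl lm (d(|tape := t2|)) s1" by blast
  let ?S = "pts 30 s1"
  define C where "C p <-> p : ?S & (case pl p of None => True | Some j => rads d ! i<rads d ! j)" for p
  have e: "t' = t2" "pl' = (%p. if C p then Some i else pl p)" using st True t2 by (auto simp: astep_def C_def)
  have pl1: "plrel pl s1" by (rule plrel_cong[OF pl(1)]) (use frameD[OF fr] in simp)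
  have i1: "ints s1 41 0 = int i" using i frameD[OF fr] by simp
  show "wp K I ?loop s1 ?Q"
  proof (rule wp_For[where N = n and Inv = "%m s'. plrel (%p. if p<m & C p then Some i else pl p) s'"])
   fix m s' assume m: "m<n" and inv: "plrel (%p. if p<m & C p then Some i else pl p) s'" and v: "ints s' 31 0 = int m"
    and fr: "frame ?loop s1 s'"
   note f = frameD[OF fr]
   have inv': "plval (if p<m & C p then Some i else pl p) (ints s' 40 (int p))" if "p<n" for p using inv that by (simp only: plrel_def)
   have 40: "plval (pl m) (ints s' 40 (int m))" using inv'[OF m] by simp
   have 30: "0<ints s' 30 (int m) <-> m : ?S" using m f by (simp add: pts_def)
   have R: "reals s' 5 (int j) = rads d ! j" if "j<length (cens d)" for j using t2(2) that f by (simp add: rel_def data_def)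
   have i': "ints s' 41 0 = int i" using i1 f by simp
   have b: "bval I s' ?bx <-> C m" using v 40 30 i' R[OF True] R pl(2) by (cases "pl m") (auto simp: pl_ok_def C_def)
   let ?s2 = "if C m then iupd 40 (int m) (int i) s' else s'"
   have "plrel (%p. if p<Suc m & C p then Some i else pl p) ?s2" unfolding plrel_def
   proof (intro allI impI)
    fix p assume p: "p<n"
    show "plval (if p<Suc m & C p then Some i else pl p) (ints ?s2 40 (int p))" using inv'[OF p] by (cases "p = m"; cases "C m") (auto simp: less_Suc_eq)
   qed
   thus "wp K I (If ?bx (PISet 40 (iv 31) (iv 41)) PSkip) s' (%s'. plrel (%p. if p<Suc m & C p then Some i else pl p) s')" unfolding wp_If b using v i' by (simp split: if_splits)
  next
   fix s' assume inv: "plrel (%p. if p<n & C p then Some i else pl p) s'" and fr: "frame ?loop s1 s'"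
   have "rel dl lm (d(|tape := t2|)) s'" by (rule rel_frame[OF t2(2) fr]) auto
   moreover have "plrel pl' s'" using inv unfolding e plrel_def by simp
   moreover have "pl_ok d pl'" using pl(2) True unfolding e pl_ok_def by auto
   ultimately show "?Q s'" using e by simp
  qed (use pl1 t2 in "auto simp: plrel_def rel_def consts_ok_def iupd_other")
 qed
 thus ?thesis using True i r by (simp add: ASTEP_def rel_def data_def)
qed

lemma ASSIGN_wp:
 assumes r: "rel dl lm d s" and dv: "dinv d"
 shows "wp K I ASSIGN s (%s'. plrel (assign dl d) s' & pl_ok d (assign dl d) & (EX t. rel dl lm (d(|tape := t|)) s'))" unfolding ASSIGN_def
proof (rule wp_step)
 show "wp K I (For 31 0 0 (PISet 40 (iv 31) (IConst (-1)))) s (%s'. plrel (%_. None) s')" by (rule wp_For[where N = n and Inv = "%m s'. ALL p<m. ints s' 40 (int p)<0"])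
   (use r in "auto simp: rel_def consts_ok_def plrel_def less_Suc_eq iupd_other")
 fix s1 assume s1: "plrel (%_. None) s1" and fr: "frame (For 31 0 0 (PISet 40 (iv 31) (IConst (-1)))) s s1"
 have r1: "rel dl lm d s1" by (rule rel_frame[OF r fr]) auto
 let ?f = "%st i. if i<length (cens d) then astep dl d st i else st"
 let ?R = "%(pl, t) s'. plrel pl s' & pl_ok d pl & rel dl lm (d(|tape := t|)) s'"
 have "wp K I (For 41 0 1 ASTEP) s1 (?R (foldl ?f (%_. None, tape d) [0..<k]))"
 proof (rule wp_For_fold)
  fix i st s' assume R: "?R st s'" and i: "ints s' 41 0 = int i"
  obtain pl t where st: "st = (pl, t)" by fastforce
  obtain pl' t' where st': "?f st i = (pl', t')" by fastforce
  show "wp K I ASTEP s' (?R (?f st i))" by (rule wp_mono[OF ASTEP_wp[where t = t and pl = pl and pl' = pl' and t' = t', OF _ i]])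
    (use R st st' dv in "auto simp: dinv_def")
 next
  show "?R st (iupd 41 0 x s)" if "?R st s" for st s x using that by (auto simp: plrel_def)
 qed (use r1 s1 in "auto simp: rel_def consts_ok_def pl_ok_def")
 moreover have "foldl ?f (%_. None, tape d) [0..<k] = foldl (astep dl d) (%_. None, tape d) [0..<length (cens d)]" by (rule foldl_upt_guard) (use dv in "simp add: dinv_def")
 ultimately show "wp K I (For 41 0 1 ASTEP) s1 (%s'. plrel (assign dl d) s' & pl_ok d (assign dl d) & (EX t. rel dl lm (d(|tape := t|)) s'))" by (elim wp_mono[OF subst[where P = "%x. wp K I (For 41 0 1 ASTEP) s1 (?R x)", rotated]]) (auto simp: assign_def split: prod.splits)
qed

lemma HUB_val:
 assumes c: "consts_ok s" and dt: "data d s" and pl: "plrel pl s" "pl_ok d pl" and p: "ints s 31 0 = int p" "p<n"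
  and a: "ints s 51 0 = int a"
 shows "bval I s HUB <-> hub d pl a p"
proof -
 have 40: "case pl p of None => ints s 40 (int p)<0 | Some j => ints s 40 (int p) = int j & reals s 5 (int j) = rads d ! j" using pl p dt unfolding plrel_def plval_def pl_ok_def data_def by (auto split: option.splits)
 show ?thesis unfolding HUB_def hub_def using 40 c dt p a by (auto simp: dI data_def consts_ok_def case_prod_beta split: option.splits)
qed

definition lbrel :: "(nat => nat) => state => bool" where
 "lbrel lb s <-> (ALL u<2*B. ints s 49 (int u) = int (lb u))"

lemma lbrel_cong: "lbrel lb s ==> ints s' 49 = ints s 49 ==> lbrel lb s'" by (simp add: lbrel_def)

lemma MERGE_wp:
 assumes c: "consts_ok s" and lb: "lbrel lb s" and u: "ints s 50 0 = int u" "u<2*B" and v: "ints s 52 0 = int v" "v<2*B"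
 shows "wp K I MERGE s (lbrel (unite lb u v))"
proof -
 let ?m = "min (lb u) (lb v)"
 let ?p = "If (bor (ieq (IGet 49 (iv 56)) (iv 53)) (ieq (IGet 49 (iv 56)) (iv 54))) (PISet 49 (iv 56) (iv 55)) PSkip"
 have uv: "ints s 49 (int u) = int (lb u)" "ints s 49 (int v) = int (lb v)" using lb u v by (auto simp: lbrel_def)
 have "wp K I (For 56 9 0 ?p) s1 (lbrel (unite lb u v))"
  if s1: "ints s1 53 0 = int (lb u)" "ints s1 54 0 = int (lb v)" "ints s1 55 0 = int ?m" "ints s1 9 0 = int (2*B)" "lbrel lb s1" for s1
 proof (rule wp_For[where N = "2*B" and Inv = "%m s'. lbrel (%w. if w<m then unite lb u v w else lb w) s'"])
  fix m s' assume m: "m<2*B" and inv: "lbrel (%w. if w<m then unite lb u v w else lb w) s'" and w: "ints s' 56 0 = int m"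
   and fr: "frame (For 56 9 0 ?p) s1 s'"
  have l: "ints s' 49 (int m) = int (lb m)" using inv m by (simp add: lbrel_def)
  show "wp K I ?p s' (%s'. lbrel (%w. if w<Suc m then unite lb u v w else lb w) s')" using l w inv s1 frameD[OF fr] by (auto simp: lbrel_def unite_def less_Suc_eq)
 qed (use s1 in "auto simp: lbrel_def")
 thus ?thesis unfolding MERGE_def using uv u v c lb by (auto simp: consts_ok_def lbrel_def min_def)
qed

text \<open>Soundness of the label array during merging: equal labels only within a component. The
  converse is established by visiting every point.\<close>

definition good_lb :: "dstate => (nat => nat option) => (nat => nat) => bool" where
 "good_lb d pl lb <-> (ALL u v. lb u = lb v --> (u, v) : (links d pl)\<^sup>*) & (ALL u. lb u<=u) & (ALL u>=2*B. lb u = u)"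

lemma good_lb_unite:
 assumes g: "good_lb d pl lb" and uv: "u : nodes d pl p" "v : nodes d pl p" "p<n" "u<2*B" "v<2*B"
 shows "good_lb d pl (unite lb u v)"
proof -
 have l: "(u, v) : (links d pl)\<^sup>*" "(v, u) : (links d pl)\<^sup>*" using uv by (auto simp: links_def)
 have g1: "lb w = lb w' ==> (w, w') : (links d pl)\<^sup>*" and g2: "lb w<=w" and g3: "2*B<=w ==> lb w = w" for w w' using g by (auto simp: good_lb_def)
 have to_u: "(w, u) : (links d pl)\<^sup>*" "(u, w) : (links d pl)\<^sup>*" if "lb w = lb u | lb w = lb v" for w using that g1 l by (metis rtrancl_trans)+
 have "(w, w') : (links d pl)\<^sup>*" if e: "unite lb u v w = unite lb u v w'" for w w'
 proof (cases "(lb w = lb u | lb w = lb v) & (lb w' = lb u | lb w' = lb v)")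
  case True
  thus ?thesis using to_u by (meson rtrancl_trans)
 next
  case False
  hence "lb w = lb w' | False" using e unfolding unite_def min_def by (auto split: if_splits)
  thus ?thesis using g1 by blast
 qed
 moreover have "unite lb u v w<=w" for w using g2[of w] unfolding unite_def by (auto simp: min_def)
 moreover have "unite lb u v w = w" if "2*B<=w" for w using g3[OF that] g2[of u] g2[of v] uv that unfolding unite_def by auto
 ultimately show ?thesis by (simp add: good_lb_def)
qed

text \<open>The nodes of a point are merged in a chain: cell 50 holds the last node visited,
  negative for none, and all nodes in \<open>vis\<close> already share its label. Labels that agreed
  in \<open>lb0\<close> still agree, so earlier merges persist.\<close>

definition visited :: "dstate => (nat => nat option) => (nat => nat) => nat => nat set => state => bool" where
 "visited d pl lb0 p vis s <-> (EX lb. good_lb d pl lb & lbrel lb s & (ALL u v. lb0 u = lb0 v --> lb u = lb v) &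
   (if ints s 50 0<0 then vis = {} else EX l. ints s 50 0 = int l & l : nodes d pl p & l<2*B & (ALL u:vis. lb u = lb l)))"

lemma UNITE_wp:
 assumes c: "consts_ok s" and vis: "visited d pl lb0 p vis s" and v: "ints s 52 0 = int v" "v : nodes d pl p" "v<2*B" and p: "p<n"
 shows "wp K I UNITE s (visited d pl lb0 p (insert v vis))"
proof -
 obtain lb where lb: "good_lb d pl lb" "lbrel lb s" "!!u v. lb0 u = lb0 v ==> lb u = lb v"
   "if ints s 50 0<0 then vis = {} else EX l. ints s 50 0 = int l & l : nodes d pl p & l<2*B & (ALL u:vis. lb u = lb l)" using vis unfolding visited_def by blast
 show ?thesis
 proof (cases "ints s 50 0<0")
  case True
  have "visited d pl lb0 p {v} (iupd 50 0 (int v) s)" unfolding visited_def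
  proof (intro exI[of _ lb] conjI)
   show "lbrel lb (iupd 50 0 (int v) s)" using lb(2) by (simp add: lbrel_def)
   show "ALL u v. lb0 u = lb0 v --> lb u = lb v" using lb(3) by blast
   show "if ints (iupd 50 0 (int v) s) 50 0<0 then {v} = {} else EX l. ints (iupd 50 0 (int v) s) 50 0 = int l & l : nodes d pl p &
    l<2*B & (ALL u:{v}. lb u = lb l)" using v by simp
  qed (rule lb(1))
  thus ?thesis using True lb(4) v by (simp add: UNITE_def)
 next
  case False
  then obtain l where l: "ints s 50 0 = int l" "l : nodes d pl p" "l<2*B" "ALL u:vis. lb u = lb l" using lb(4) by auto
  have "wp K I (MERGE;; seti 50 (iv 52)) s (visited d pl lb0 p (insert v vis))"
  proof (rule wp_step[OF MERGE_wp[OF c lb(2) l(1,3) v(1,3)]])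
   fix s1 assume s1: "lbrel (unite lb l v) s1" and fr: "frame MERGE s s1"
   have v1: "ints s1 52 0 = int v" using v frameD[OF fr] by simp
   have "visited d pl lb0 p (insert v vis) (iupd 50 0 (int v) s1)" unfolding visited_def
   proof (intro exI[of _ "unite lb l v"] conjI)
    show "good_lb d pl (unite lb l v)" by (rule good_lb_unite[OF lb(1) l(2) v(2) p l(3) v(3)])
    show "lbrel (unite lb l v) (iupd 50 0 (int v) s1)" using s1 by (simp add: lbrel_def)
    show "ALL u va. lb0 u = lb0 va --> unite lb l v u = unite lb l v va" using lb(3) unite_coarser by metis
    show "if ints (iupd 50 0 (int v) s1) 50 0<0 then insert v vis = {}
    else EX la. ints (iupd 50 0 (int v) s1) 50 0 = int la & la : nodes d pl p & la<2*B & (ALL u:insert v vis. unite lb l v u = unite lb l v la)"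
    proof -
    have "unite lb l v w = unite lb l v v" if "w : insert v vis" for w
    proof (cases "w = v")
    case False
    hence "lb w = lb l" using that l(4) by blast
    thus ?thesis using unite_coarser[of lb w l l v] unite_united[of lb l v] by simp
    qed simp
    hence all: "ALL w:insert v vis. unite lb l v w = unite lb l v v" by blast
    have iv: "ints (iupd 50 0 (int v) s1) 50 0 = int v" by simp
    have "~ int v<0" by simp
    thus ?thesis unfolding iv by (subst if_not_P) (auto intro!: exI[of _ v] v(2,3) all[rule_format])
    qed
   qed
   thus "wp K I (seti 50 (iv 52)) s1 (visited d pl lb0 p (insert v vis))" using v1 by simp
  qed
  thus ?thesis using False by (simp add: UNITE_def)
 qed
qed

lemma nodes_less:
 assumes pl: "pl_ok d pl" and dv: "dinv d" and kB: "k<=B" and u: "u : nodes d pl p"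
 shows "u<2*B"
proof (cases "pl p = Some u")
 case True
 hence "u<length (cens d)" using pl unfolding pl_ok_def by blast
 hence "u<k" using dv by (simp add: dinv_def)
 thus ?thesis using kB by simp
next
 case False
 then obtain a where "u = B+a" "a<length (ents d)" using u by (auto simp: nodes_def hub_def)
 thus ?thesis using dv by (auto simp: dinv_def)
qed

definition ready :: "dstate => (nat => nat option) => state => bool" where
 "ready d pl s <-> consts_ok s & data d s & plrel pl s"

lemma ready_frame:
 assumes "ready d pl s" "frame p s s'" "piw p \<inter> {0,3,4,5,6,7,8,9,15,22,23,24,25,26,27,28,29,40} = {}" "prw p \<inter> {1,2,5,6} = {}"
 shows "ready d pl s'"
proof -
 have "consts_ok s'" by (rule consts_ok_frame[OF _ assms(2)]) (use assms in "auto simp: ready_def")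
 moreover have "data d s'" by (rule data_frame[OF _ assms(2)]) (use assms in "auto simp: ready_def")
 moreover have "plrel pl s'" by (rule plrel_cong[of pl s]) (use frameD[OF assms(2)] assms in "auto simp: ready_def")
 ultimately show ?thesis by (simp add: ready_def)
qed

lemma ready_upd [simp]:
 "a ~: {0,3,4,5,6,7,8,9,15,22,23,24,25,26,27,28,29,40} ==> ready d pl (iupd a i x s) = ready d pl s" by (auto simp: ready_def plrel_def)

lemma visited_upd [simp]: "a ~: {49,50} ==> visited d pl lb0 p vis (iupd a i x s) = visited d pl lb0 p vis s" by (auto simp: visited_def lbrel_def)

lemma VISIT_wp:
 assumes r: "ready d pl s" and pl: "pl_ok d pl" and dv: "dinv d" and kB: "k<=B" and lb: "good_lb d pl lb0" "lbrel lb0 s"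
  and p: "ints s 31 0 = int p" "p<n"
 shows "wp K I VISIT s (%s'. EX lb. good_lb d pl lb & lbrel lb s' & (ALL u v. lb0 u = lb0 v --> lb u = lb v) &
   (ALL u:nodes d pl p. ALL v:nodes d pl p. lb u = lb v))"
proof -
 let ?Q = "%s'. EX lb. good_lb d pl lb & lbrel lb s' & (ALL u v. lb0 u = lb0 v --> lb u = lb v) &
   (ALL u:nodes d pl p. ALL v:nodes d pl p. lb u = lb v)"
 note less = nodes_less[OF pl dv kB]
 let ?vis = "%m. {i. pl p = Some i} \<union> {B+a | a. a<m & hub d pl a p}"
 let ?s0 = "iupd 50 0 (-1) s"
 have v0: "visited d pl lb0 p {} ?s0" unfolding visited_def using lb by (intro exI[of _ lb0]) (auto simp: lbrel_def)
 have r0: "ready d pl ?s0" using r by simp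
 have pl40: "plval (pl p) (ints s 40 (int p))" using r p by (auto simp: ready_def plrel_def)
 let ?first = "If (ILess (IGet 40 (iv 31)) I0) PSkip (seti 52 (IGet 40 (iv 31));; UNITE)"
 let ?loop = "For 51 3 0 (If HUB (seti 52 (IPlus (iv 3) (iv 51));; UNITE) PSkip)"
 have first: "wp K I ?first ?s0 (visited d pl lb0 p (?vis 0))"
 proof (cases "pl p")
  case None
  thus ?thesis using v0 pl40 p by simp
 next
  case (Some i)
  have i: "i : nodes d pl p" using Some by (simp add: nodes_def)
  have "wp K I UNITE (iupd 52 0 (int i) ?s0) (visited d pl lb0 p (insert i {}))" by (rule UNITE_wp[OF _ _ _ i less[OF i] p(2)]) (use r v0 in "auto simp: ready_def")
  moreover have "?vis 0 = insert i {}" using Some by auto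
  ultimately show ?thesis using pl40 p Some by simp
 qed
 have "wp K I (?first;; ?loop) ?s0 ?Q"
 proof (rule wp_step[OF first])
  fix s1 assume v1: "visited d pl lb0 p (?vis 0) s1" and fr: "frame ?first ?s0 s1"
  have r1: "ready d pl s1" by (rule ready_frame[OF r0 fr]) auto
  have p1: "ints s1 31 0 = int p" using p frameD[OF fr] by simp
  show "wp K I ?loop s1 ?Q"
  proof (rule wp_For[where N = B and Inv = "%m s'. visited d pl lb0 p (?vis m) s'"])
   fix m s' assume m: "m<B" and inv: "visited d pl lb0 p (?vis m) s'" and a: "ints s' 51 0 = int m" and fr: "frame ?loop s1 s'"
   have r': "ready d pl s'" by (rule ready_frame[OF r1 fr]) auto
   have p': "ints s' 31 0 = int p" using p1 frameD[OF fr] by simp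
   have b: "bval I s' HUB <-> hub d pl m p" using HUB_val[OF _ _ _ pl p' p(2) a] r' by (auto simp: ready_def)
   show "wp K I (If HUB (seti 52 (IPlus (iv 3) (iv 51));; UNITE) PSkip) s' (visited d pl lb0 p (?vis (Suc m)))"
   proof (cases "hub d pl m p")
    case False
    hence "?vis (Suc m) = ?vis m" by (auto simp: less_Suc_eq)
    thus ?thesis using False b inv by simp
   next
    case True
    have u: "B+m : nodes d pl p" using True by (auto simp: nodes_def)
    have "wp K I UNITE (iupd 52 0 (int (B+m)) s') (visited d pl lb0 p (insert (B+m) (?vis m)))" by (rule UNITE_wp[OF _ _ _ u less[OF u] p(2)]) (use r' inv in "auto simp: ready_def")
    moreover have "?vis (Suc m) = insert (B+m) (?vis m)" using True by (auto simp: less_Suc_eq)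
    moreover have "ints s' 3 0 = int B" using r' by (auto simp: ready_def consts_ok_def)
    ultimately show ?thesis using True b a by simp
   qed
  next
   fix s' assume "visited d pl lb0 p (?vis B) s'"
   moreover have "?vis B = nodes d pl p" using dv unfolding nodes_def hub_def dinv_def by auto
   ultimately have v: "visited d pl lb0 p (nodes d pl p) s'" by simp
   thus "?Q s'" unfolding visited_def by (smt (verit, best) empty_iff)
  qed (use v1 r1 in "auto simp: ready_def consts_ok_def")
 qed
 thus ?thesis unfolding VISIT_def wp_Sq[of _ _ "seti 50 (IConst (-1))"] by (simp only: wp_PISet ival.simps)
qed

lemma UNIONS_wp:
 assumes r: "ready d pl s" and pl: "pl_ok d pl" and dv: "dinv d" and kB: "k<=B"
 shows "wp K I UNIONS s (%s'. EX lb. good_lb d pl lb & lbrel lb s' &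
   (ALL p<n. ALL u:nodes d pl p. ALL v:nodes d pl p. lb u = lb v))" unfolding UNIONS_def
proof (rule wp_step)
 have "wp K I (For 57 9 0 (PISet 49 (iv 57) (iv 57))) s (%s'. lbrel (%u. u) s')" by (rule wp_For[where N = "2*B" and Inv = "%m s'. ALL u<m. ints s' 49 (int u) = int u"])
   (use r in "auto simp: ready_def consts_ok_def lbrel_def less_Suc_eq")
 thus "wp K I (For 57 9 0 (PISet 49 (iv 57) (iv 57))) s (%s'. lbrel (%u. u) s')" .
 fix s1 assume l1: "lbrel (%u. u) s1" and fr1: "frame (For 57 9 0 (PISet 49 (iv 57) (iv 57))) s s1"
 have r1: "ready d pl s1" by (rule ready_frame[OF r fr1]) auto
 let ?Inv = "%m s'. EX lb. good_lb d pl lb & lbrel lb s' & (ALL p<m. ALL u:nodes d pl p. ALL v:nodes d pl p. lb u = lb v)"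
 show "wp K I (For 31 0 0 VISIT) s1 (?Inv n)"
 proof (rule wp_For[where N = n and Inv = ?Inv])
  show "?Inv 0 s1" using l1 by (intro exI[of _ "%u. u"]) (auto simp: good_lb_def)
  fix m s' assume m: "m<n" and inv: "?Inv m s'" and v: "ints s' 31 0 = int m" and fr: "frame (For 31 0 0 VISIT) s1 s'"
  obtain lb0 where lb0: "good_lb d pl lb0" "lbrel lb0 s'" "ALL p<m. ALL u:nodes d pl p. ALL v:nodes d pl p. lb0 u = lb0 v" using inv by blast
  have r': "ready d pl s'" by (rule ready_frame[OF r1 fr]) auto
  show "wp K I VISIT s' (?Inv (Suc m))"
  proof (rule wp_mono[OF VISIT_wp[OF r' pl dv kB lb0(1,2) v m]])
   fix s2 assume "EX lb. good_lb d pl lb & lbrel lb s2 & (ALL u v. lb0 u = lb0 v --> lb u = lb v) &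
    (ALL u:nodes d pl m. ALL v:nodes d pl m. lb u = lb v)"
   then obtain lb where lb: "good_lb d pl lb" "lbrel lb s2" "ALL u v. lb0 u = lb0 v --> lb u = lb v"
    "ALL u:nodes d pl m. ALL v:nodes d pl m. lb u = lb v" by blast
   have "ALL p<Suc m. ALL u:nodes d pl p. ALL v:nodes d pl p. lb u = lb v" using lb(3,4) lb0(3) unfolding less_Suc_eq by blast
   thus "?Inv (Suc m) s2" using lb by blast
  qed
 next
  show "?Inv m (iupd 31 0 x s')" if "?Inv m s'" for m s' x using that by (simp add: lbrel_def)
 qed (use r1 in "auto simp: ready_def consts_ok_def")
qed

lemma LABELPT_wp:
 assumes r: "ready d pl s" and pl: "pl_ok d pl" and dv: "dinv d" and kB: "k<=B" and lb: "lbrel lb s"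
  and eq: "ALL u:nodes d pl p. ALL v:nodes d pl p. lb u = lb v"
  and p: "ints s 31 0 = int p" "p<n"
 shows "wp K I LABELPT s (%s'. (EX c<k. ints s' 58 (int p) = int c & (ALL u:nodes d pl p. lb u<k --> c = lb u)) &
   (ALL i. i ~= int p --> ints s' 58 i = ints s 58 i))"
proof -
 let ?oth = "%s'. ALL i. i ~= int p --> ints s' 58 i = ints s 58 i"
 let ?Q = "%s'. (EX c<k. ints s' 58 (int p) = int c & (ALL u:nodes d pl p. lb u<k --> c = lb u)) & ?oth s'"
 note less = nodes_less[OF pl dv kB]
 let ?vis = "%m. {i. pl p = Some i} \<union> {B+a | a. a<m & hub d pl a p}"
 let ?I = "%vis s'. (EX c. ints s' 58 (int p) = int c & (ALL u:vis. c = lb u)) & ?oth s'"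
 let ?first = "If (ILess (IGet 40 (iv 31)) I0) PSkip (PISet 58 (iv 31) (IGet 49 (IGet 40 (iv 31))))"
 let ?hub = "If HUB (PISet 58 (iv 31) (IGet 49 (IPlus (iv 3) (iv 51)))) PSkip"
 let ?last = "If (ILess (IGet 58 (iv 31)) (IGet 0 I1)) PSkip (PISet 58 (iv 31) I0)"
 let ?s0 = "iupd 58 (int p) 0 s"
 have pl40: "plval (pl p) (ints s 40 (int p))" using r p by (auto simp: ready_def plrel_def)
 have r0: "ready d pl ?s0" using r by simp
 have first: "wp K I ?first ?s0 (?I (?vis 0))"
 proof (cases "pl p")
  case None
  thus ?thesis using pl40 p by simp
 next
  case (Some i)
  have "i<2*B" by (rule nodes_less[OF pl dv kB, where p = p]) (use Some in "simp add: nodes_def")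
  hence "ints s 49 (int i) = int (lb i)" using lb by (simp add: lbrel_def)
  thus ?thesis using pl40 p Some by simp
 qed
 have "wp K I (?first;; For 51 3 0 ?hub;; ?last) ?s0 ?Q"
 proof (rule wp_step[OF first])
  fix s1 assume v1: "?I (?vis 0) s1" and fr: "frame ?first ?s0 s1"
  have r1: "ready d pl s1" by (rule ready_frame[OF r0 fr]) auto
  have p1: "ints s1 31 0 = int p" "ints s1 49 = ints s 49" using p frameD[OF fr] by auto
  show "wp K I (For 51 3 0 ?hub;; ?last) s1 ?Q"
  proof (rule wp_step)
   show "wp K I (For 51 3 0 ?hub) s1 (?I (nodes d pl p))"
   proof (rule wp_For[where N = B and Inv = "%m s'. ?I (?vis m) s'"])
    fix m s' assume m: "m<B" and inv: "?I (?vis m) s'" and a: "ints s' 51 0 = int m" and fr: "frame (For 51 3 0 ?hub) s1 s'"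
    have r': "ready d pl s'" by (rule ready_frame[OF r1 fr]) auto
    have p': "ints s' 31 0 = int p" "ints s' 49 = ints s 49" using p1 frameD[OF fr] by auto
    have b: "bval I s' HUB <-> hub d pl m p" using HUB_val[OF _ _ _ pl p'(1) p(2) a] r' by (auto simp: ready_def)
    show "wp K I ?hub s' (?I (?vis (Suc m)))"
    proof (cases "hub d pl m p")
    case False
    hence "?vis (Suc m) = ?vis m" by (auto simp: less_Suc_eq)
    thus ?thesis using False b inv by simp
    next
    case True
    have u: "B+m : nodes d pl p" using True by (auto simp: nodes_def)
    have e: "ints s' 49 (int B+int m) = int (lb (B+m))" using less[OF u] lb p' unfolding lbrel_def by (metis of_nat_add)
    have v: "lb w = lb (B+m)" if "w : ?vis (Suc m)" for w using eq u that by (auto simp: nodes_def)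
    have B0: "ints s' 3 0 = int B" using r' by (auto simp: ready_def consts_ok_def)
    have "?I (?vis (Suc m)) (iupd 58 (int p) (int (lb (B+m))) s')" using v inv by simp
    thus ?thesis using True b a p' e B0 by simp
    qed
   next
    fix s' assume "?I (?vis B) s'"
    moreover have "?vis B = nodes d pl p" using dv unfolding nodes_def hub_def dinv_def by auto
    ultimately show "?I (nodes d pl p) s'" by simp
   qed (use v1 r1 in "auto simp: ready_def consts_ok_def")
   fix s2 assume i2: "?I (nodes d pl p) s2" and fr2: "frame (For 51 3 0 ?hub) s1 s2"
   have r2: "ready d pl s2" by (rule ready_frame[OF r1 fr2]) auto
   have k2: "ints s2 0 1 = int k" "ints s2 31 0 = int p" using r2 p1 frameD[OF fr2] by (auto simp: ready_def consts_ok_def)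
   obtain c where c: "ints s2 58 (int p) = int c" "ALL u:nodes d pl p. c = lb u" using i2 by blast
   show "wp K I ?last s2 ?Q" using c k2 i2 k1 by (auto intro!: exI[of _ "0::nat"])
  qed
 qed
 thus ?thesis unfolding LABELPT_def wp_Sq[of _ _ "PISet 58 (iv 31) I0"] by (simp only: wp_PISet ival.simps p(1))
qed

definition labrel :: "(nat => nat) => state => bool" where
 "labrel L s <-> (ALL p<n. ints s 58 (int p) = int (L p))"

lemma LABEL_wp:
 assumes r: "ready d pl s" and pl: "pl_ok d pl" and dv: "dinv d" and kB: "k<=B" and lb: "good_lb d pl lb" "lbrel lb s"
  and eq: "ALL p<n. ALL u:nodes d pl p. ALL v:nodes d pl p. lb u = lb v"
 shows "wp K I LABEL s (%s'. EX L. labrel L s' & (ALL p<n. L p<k) & labelling d pl L)" unfolding LABEL_def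
proof (rule wp_For[where N = n and Inv = "%m s'. ALL p<m. EX c<k. ints s' 58 (int p) = int c & (ALL u:nodes d pl p. lb u<k --> c = lb u)"])
 fix m s' assume m: "m<n" and inv: "ALL p<m. EX c<k. ints s' 58 (int p) = int c & (ALL u:nodes d pl p. lb u<k --> c = lb u)"
  and v: "ints s' 31 0 = int m" and fr: "frame (For 31 0 0 LABELPT) s s'"
 have r': "ready d pl s'" by (rule ready_frame[OF r fr]) auto
 have lb': "lbrel lb s'" by (rule lbrel_cong[OF lb(2)]) (use frameD[OF fr] in simp)
 have eq': "ALL u:nodes d pl m. ALL v:nodes d pl m. lb u = lb v" using eq m by blast
 show "wp K I LABELPT s' (%s'. ALL p<Suc m. EX c<k. ints s' 58 (int p) = int c & (ALL u:nodes d pl p. lb u<k --> c = lb u))"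
 proof (rule wp_mono[OF LABELPT_wp[OF r' pl dv kB lb' eq' v m]])
  fix s2 assume 2: "(EX c<k. ints s2 58 (int m) = int c & (ALL u:nodes d pl m. lb u<k --> c = lb u)) &
   (ALL i. i ~= int m --> ints s2 58 i = ints s' 58 i)"
  show "ALL p<Suc m. EX c<k. ints s2 58 (int p) = int c & (ALL u:nodes d pl p. lb u<k --> c = lb u)"
  proof (intro allI impI)
   fix p assume p: "p<Suc m"
   show "EX c<k. ints s2 58 (int p) = int c & (ALL u:nodes d pl p. lb u<k --> c = lb u)"
   proof (cases "p = m")
    case True
    thus ?thesis using 2 by simp
   next
    case False
    hence "ints s2 58 (int p) = ints s' 58 (int p)" "p<m" using 2 p by auto
    thus ?thesis using inv by simp
   qed
  qed
 qed
next
 fix s' :: state assume "ALL p<n. EX c<k. ints s' 58 (int p) = int c & (ALL u:nodes d pl p. lb u<k --> c = lb u)"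
 then obtain L where L: "ALL p<n. L p<k & ints s' 58 (int p) = int (L p) & (ALL u:nodes d pl p. lb u<k --> L p = lb u)" by metis
 \<comment> \<open>After all points are visited \<open>lb\<close> is constant along links, hence on
   components; together with \<open>good_lb\<close> this gives the equivalence in
   \<open>labelling\<close>.\<close>
 have sym: "lb u = lb v" if "(u, v) : (links d pl)\<^sup>*" for u v using that
 proof (induction rule: rtrancl_induct)
  case (step y w)
  then obtain p where "p<n" "y : nodes d pl p" "w : nodes d pl p" by (auto simp: links_def)
  thus ?case using eq step.IH by metis
 qed simp
 have "labelling d pl L" unfolding labelling_def
 proof (intro exI[of _ lb] conjI allI)
  show "(lb u = lb v) = ((u, v) : (links d pl)\<^sup>*)" for u v using sym lb(1) unfolding good_lb_def by blast
  show "lb u<=u" for u using lb(1) unfolding good_lb_def by blast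
  show "p<n --> (ALL u:nodes d pl p. lb u<k --> L p = lb u)" for p using L by blast
 qed
 thus "EX L. labrel L s' & (ALL p<n. L p<k) & labelling d pl L" using L by (auto simp: labrel_def)
qed (use r in "auto simp: ready_def consts_ok_def")

definition bits :: "state => bool list" where
 "bits s = map (%i. 0<ints s 10 (int i)) [0..<B]"

lemma DECODE_wp:
 assumes c: "consts_ok s" and kB: "k<=B"
 shows "wp K I DECODE s (%s'. (EX L. labrel L s' & candidate (bits s) L) & (0<ints s' 17 0 <-> ovf (snd (core (bits s)))) &
   (nice --> ~ 0<ints s' 17 0))"
proof -
 let ?Q = "%s'. (EX L. labrel L s' & candidate (bits s) L) & (0<ints s' 17 0 <-> ovf (snd (core (bits s)))) &
   (nice --> ~ 0<ints s' 17 0)"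
 let ?s0 = "iupd 17 0 0 (iupd 11 0 0 s)"
 have t0: "tp ?s0 = bits s" "tape_ok ?s0" "consts_ok ?s0" using c by (auto simp: tp_def bits_def tape_ok_def iupd_other)
 have "wp K I (SCALE;; TURNS;; ASSIGN;; UNIONS;; LABEL) ?s0 ?Q"
 proof (rule wp_step[OF SCALE_wp[OF t0(3,2)]])
  fix s1 assume s1: "consts_ok s1 & tape_ok s1 & scale (tp ?s0) = (reals s1 3 0, reals s1 4 0, tp s1)" and fr1: "frame SCALE ?s0 s1"
  let ?dl = "reals s1 3 0" and ?lm = "reals s1 4 0"
  let ?d = "turns ?dl ?lm (tp s1)"
  have core: "core (bits s) = (?dl, ?d)" using s1 t0 by (simp add: core_def)
  have 17: "~ 0<ints s1 17 0" using frameD[OF fr1] by simp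
  have len: "length (tp s1)<=B" by (simp add: tp_def)
  show "wp K I (TURNS;; ASSIGN;; UNIONS;; LABEL) s1 ?Q"
  proof (rule wp_step[OF TURNS_wp[OF _ _ refl refl 17 len]])
   show "consts_ok s1" "tape_ok s1" using s1 by auto
   fix s2 assume "rel ?dl ?lm ?d s2 & dinv ?d"
   hence r2: "rel ?dl ?lm ?d s2" and dv: "dinv ?d" by auto
   let ?pl = "assign ?dl ?d"
   show "wp K I (ASSIGN;; UNIONS;; LABEL) s2 ?Q"
   proof (rule wp_step[OF ASSIGN_wp[OF r2 dv]])
    fix s3 assume s3: "plrel ?pl s3 & pl_ok ?d ?pl & (EX t. rel ?dl ?lm (?d(|tape := t|)) s3)"
    hence pl: "pl_ok ?d ?pl" and r3: "ready ?d ?pl s3" and 17: "0<ints s3 17 0 <-> ovf ?d" by (auto simp: ready_def rel_def)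
    show "wp K I (UNIONS;; LABEL) s3 ?Q"
    proof (rule wp_step[OF UNIONS_wp[OF r3 pl dv kB]])
    fix s4 assume "EX lb. good_lb ?d ?pl lb & lbrel lb s4 & (ALL p<n. ALL u:nodes ?d ?pl p. ALL v:nodes ?d ?pl p. lb u = lb v)"
    and fr4: "frame UNIONS s3 s4"
    then obtain lb where lb: "good_lb ?d ?pl lb" "lbrel lb s4" "ALL p<n. ALL u:nodes ?d ?pl p. ALL v:nodes ?d ?pl p. lb u = lb v" by blast
    have r4: "ready ?d ?pl s4" by (rule ready_frame[OF r3 fr4]) auto
    show "wp K I LABEL s4 ?Q"
    proof (rule wp_conseq[OF LABEL_wp[OF r4 pl dv kB lb]])
    fix s5 assume "EX L. labrel L s5 & (ALL p<n. L p<k) & labelling ?d ?pl L" and fr5: "frame LABEL s4 s5"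
    hence "EX L. labrel L s5 & candidate (bits s) L" by (auto simp: candidate_def core)
    moreover have "ints s5 17 0 = ints s3 17 0" using frameD[OF fr5] frameD[OF fr4] by simp
    ultimately show "?Q s5" using 17 dv core by (auto simp: dinv_def)
    qed
    qed
   qed
  qed
 qed
 thus ?thesis unfolding DECODE_def by simp
qed

end

section \<open>Evaluating labellings and running through all advice strings\<close>

section \<open>The program: trying all advice strings\<close>

text \<open>
  Integer arrays: 1 the best labelling so far, 59 a validity flag, 61 a cluster, 62 the answer of
  the validation, 64 whether some labelling was kept, 65 whether some trial overflowed, 68 a
  carry.  Real arrays: 13 an upper bound on the cost, 14 a distance, 15 the bound kept.
\<close>

definition FAR :: prog where
 "FAR = For 31 0 0 (If (BAnd (ILess I0 (IGet 61 (iv 31))) (RLess (rv 14) (RDist (iv 32) (iv 31))))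
   (setr 14 (RDist (iv 32) (iv 31))) PSkip)"

definition DIAM :: prog where
 "DIAM = setr 14 (rnum 0);; FAR;; setr 12 (RDivide (rv 14) (rv 1));;
   For 63 8 0 (MINPT;; If (BNot (ILess (iv 32) I0)) (FAR;; DROPBALL) PSkip);;
   MINPT;; If (BNot (ILess (iv 32) I0)) (seti 17 I1) PSkip"

definition EVALC :: prog where
 "EVALC = FILL 61 (ieq (IGet 58 (iv 31)) (iv 60));; FILL 30 (ieq (IGet 58 (iv 31)) (iv 60));; MINPT;;
   If (BNot (ILess (iv 32) I0))
    (PCall 62 61;; If (ieq (iv 62) I0) (seti 59 I0) PSkip;;
    DIAM;; setr 13 (RPlus (rv 13) (RPlus (rv 14) (rv 12)))) PSkip"

definition EVAL :: prog where
 "EVAL = seti 59 I1;; setr 13 (rnum 0);; For 60 0 1 EVALC"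

definition KEEP :: prog where
 "KEEP = If (BAnd (pos 59) (bor (BNot (pos 64)) (RLess (rv 13) (rv 15))))
   (seti 64 I1;; setr 15 (rv 13);; For 31 0 0 (PISet 1 (iv 31) (IGet 58 (iv 31)))) PSkip"

definition INCR :: prog where
 "INCR = seti 68 I1;; For 66 3 0 (If (pos 68) (If (ILess I0 (IGet 10 (iv 66)))
   (PISet 10 (iv 66) I0) (PISet 10 (iv 66) I1;; seti 68 I0)) PSkip)"

definition TRIAL :: prog where
 "TRIAL = DECODE;; EVAL;; If (pos 17) (seti 65 I1) PSkip;; KEEP;; INCR"

definition ROUND :: prog where
 "ROUND = seti 65 I0;; seti 64 I0;; For 66 3 0 (PISet 10 (iv 66) I0);; For 67 6 0 TRIAL"

lemma [simp]: "piw FAR = {31}" "prw FAR = {14}" by (auto simp: FAR_def)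
lemma [simp]: "piw DIAM = {17,30,31,32,63}" "prw DIAM = {12,14}" by (auto simp: DIAM_def)
lemma [simp]: "piw EVALC = {17,30,31,32,59,61,62,63}" "prw EVALC = {12,13,14}" by (auto simp: EVALC_def)
lemma [simp]: "piw EVAL = {17,30,31,32,59,60,61,62,63}" "prw EVAL = {12,13,14}" by (auto simp: EVAL_def)
lemma [simp]: "piw KEEP = {1,31,64}" "prw KEEP = {15}" by (auto simp: KEEP_def)
lemma [simp]: "piw INCR = {10,66,68}" "prw INCR = {}" by (auto simp: INCR_def)
lemma [simp]: "piw TRIAL = piw DECODE \<union> {1,10,59,60,61,62,63,64,65,66,68}" "prw TRIAL = {3,4,5,6,7,8,9,10,12,13,14,15}" by (auto simp: TRIAL_def)
lemma [simp]: "piw ROUND = piw DECODE \<union> {1,10,59,60,61,62,63,64,65,66,67,68}"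
  "prw ROUND = {3,4,5,6,7,8,9,10,12,13,14,15}" by (auto simp: ROUND_def)

definition digits :: "nat => nat => bool list" where
 "digits m w = map (%i. odd (w div 2 ^ i)) [0..<m]"

lemma digits_surj: "EX w<2 ^ length bs. bs = digits (length bs) w"
proof (induction bs)
 case (Cons b bs)
 then obtain w where w: "w<2 ^ length bs" "bs = digits (length bs) w" by blast
 let ?w = "2*w + of_bool b"
 have a1: "?w<2 ^ length (b # bs)" using w(1) by (cases b) auto
 have a2: "digits (length (b # bs)) ?w = b # map (%i. odd (?w div 2 ^ Suc i)) [0..<length bs]" unfolding digits_def by (simp del: upt_Suc add: upt_conv_Cons map_Suc_upt[symmetric] o_def)
 have a3: "?w div 2 ^ Suc i = w div 2 ^ i" for i
 proof -
  have "?w div 2 ^ Suc i = ?w div 2 div 2 ^ i" by (simp add: div_mult2_eq)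
  thus ?thesis by simp
 qed
 have "b # bs = digits (length (b # bs)) ?w" unfolding a2 a3 using w(2) by (simp add: digits_def)
 thus ?case using a1 by blast
qed (auto simp: digits_def)

text \<open>The carry rule: the carry passes digit \<open>m\<close> iff it arrives there and the
  digit of the successor is even.\<close>

lemma Suc_mod_pow: "Suc w mod 2 ^ Suc m = 0 <-> Suc w mod 2 ^ m = 0 & even (Suc w div 2 ^ m)" using dvd_def mod_0_imp_dvd mod_eq_0_iff_dvd mult.commute dvd_mult_left power_Suc2 by auto

context decoder
begin

text \<open>The counterpart of \<open>nice\<close> for diameter estimates: \<open>2 ^ (g*q)\<close>
  greedy centres suffice at the finer mesh \<open>R/th\<close>.\<close>

definition wide :: bool where
 "wide <-> (ALL W y R. W<={..<n} & y : W & (ALL p:W. dd y p <= R) --> net W (R/th) (2 ^ (g*q)) = {})"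

definition cls :: "(nat => nat) => nat => nat set" where
 "cls L l = {p. p<n & L p = l}"

definition diams :: "nat => (nat => nat) => (nat => real) => bool" where
 "diams m L D <-> (ALL l<m. 0<=D l & (ALL x:cls L l. ALL y:cls L l. dd x y<=D l))"

lemma net_near:
 assumes "p : W" "p<n" "net W R T = {}"
 shows "EX t<T. net W R t ~= {} & dd (Min (net W R t)) p <= R"
proof -
 let ?N = "net W R"
 have p0: "p : ?N 0" using assms by simp
 have "EX t<T. p : ?N t & p ~: ?N (Suc t)"
 proof (rule ccontr)
  assume "~ ?thesis"
  hence "p : ?N t" if "t<=T" for t using that p0 by (induction t) (auto simp del: net.simps)
  thus False using assms(3) by blast
 qed
 then obtain t where t: "t<T" "p : ?N t" "p ~: ?N (Suc t)" by blast
 hence "p : ballp (Min (?N t)) R" by (auto split: if_splits)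
 thus ?thesis using t by (auto simp: ballp_def intro!: exI[of _ t])
qed

end

context machine
begin

lemma FILL_vals:
 assumes "ints s 0 0 = int n" "A ~= 31" "A ~= 0"
  and b: "!!j s'. j<n ==> ints s' 31 0 = int j ==> frame (FILL A b) s s' ==> bval I s' b = h j"
 shows "wp K I (FILL A b) s (%s'. ALL p<n. ints s' A (int p) = (if h p then 1 else 0))" unfolding FILL_def
proof (rule wp_For[where N = n and Inv = "%j s'. ALL p<j. ints s' A (int p) = (if h p then 1 else 0)"])
 fix j s' assume j: "j<n" and inv: "ALL p<j. ints s' A (int p) = (if h p then 1 else 0)" and v: "ints s' 31 0 = int j"
  and fr: "frame (For 31 0 0 (If b (PISet A (iv 31) I1) (PISet A (iv 31) I0))) s s'"
 have "bval I s' b = h j" using b[OF j v] fr by (simp add: FILL_def)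
 thus "wp K I (If b (PISet A (iv 31) I1) (PISet A (iv 31) I0)) s'
   (%s'. ALL p<Suc j. ints s' A (int p) = (if h p then 1 else 0))" using inv v by (auto simp: less_Suc_eq)
qed (use assms in "auto simp: iupd_other")

lemma FAR_wp:
 assumes n0: "ints s 0 0 = int n" and c: "ints s 32 0 = int c"
 shows "wp K I FAR s (%s'. (ALL p:pts 61 s. dd c p<=reals s' 14 0) & reals s 14 0<=reals s' 14 0 &
   (reals s' 14 0 = reals s 14 0 | (EX p:pts 61 s. reals s' 14 0 = dd c p)))" unfolding FAR_def
proof (rule wp_For[where N = n and Inv = "%m s'. (ALL p:pts 61 s. p<m --> dd c p<=reals s' 14 0) & reals s 14 0<=reals s' 14 0 &
   (reals s' 14 0 = reals s 14 0 | (EX p:pts 61 s. reals s' 14 0 = dd c p))"])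
 let ?p = "If (BAnd (ILess I0 (IGet 61 (iv 31))) (RLess (rv 14) (RDist (iv 32) (iv 31)))) (setr 14 (RDist (iv 32) (iv 31))) PSkip"
 fix m :: nat and s' assume m: "m<n" and inv: "(ALL p:pts 61 s. p<m --> dd c p<=reals s' 14 0) & reals s 14 0<=reals s' 14 0 &
   (reals s' 14 0 = reals s 14 0 | (EX p:pts 61 s. reals s' 14 0 = dd c p))" and v: "ints s' 31 0 = int m"
   and fr: "frame (For 31 0 0 ?p) s s'"
 have b: "0<ints s' 61 (int m) <-> m : pts 61 s" "ints s' 32 0 = int c" using m c frameD[OF fr] by (auto simp: pts_def)
 show "wp K I ?p s' (%s'. (ALL p:pts 61 s. p<Suc m --> dd c p<=reals s' 14 0) & reals s 14 0<=reals s' 14 0 &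
   (reals s' 14 0 = reals s 14 0 | (EX p:pts 61 s. reals s' 14 0 = dd c p)))" using inv less_Suc_eq b v dI by force
qed (use n0 in "auto simp: pts_def")

text \<open>Let \<open>R\<close> be the largest distance from the least point of \<open>C\<close>,
  and \<open>m\<close> the largest distance seen from it and from the centres of a greedy net of
  mesh \<open>R/th\<close>. Both \<open>m\<close> and \<open>R\<close> are distances within
  \<open>C\<close>, so \<open>m + R/th\<close> exceeds the diameter by at most the factor
  \<open>1 + 1/th\<close>. If the net is exhausted, every point has a centre within
  \<open>R/th\<close>, so \<open>m + R/th\<close> is also an upper bound.\<close>

lemma DIAM_wp:
 assumes met: "Metric_space {..<n} dd" and s: "consts_ok s" and C: "C ~= {}" "pts 30 s = C" "pts 61 s = C" and M: "ints s 32 0 = int (Min C)"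
 shows "wp K I DIAM s (%s'. (0<ints s 17 0 --> 0<ints s' 17 0) & (wide --> (0<ints s' 17 0 <-> 0<ints s 17 0)) &
   0<=reals s' 14 0+reals s' 12 0 &
   (~ 0<ints s' 17 0 --> (ALL x:C. ALL y:C. dd x y<=reals s' 14 0+reals s' 12 0)) &
   (ALL D. (ALL x:C. ALL y:C. dd x y<=D) --> reals s' 14 0+reals s' 12 0<=(1+1/th)*D))"
proof -
 let ?Q = "%s'. (0<ints s 17 0 --> 0<ints s' 17 0) & (wide --> (0<ints s' 17 0 <-> 0<ints s 17 0)) &
   0<=reals s' 14 0+reals s' 12 0 &
   (~ 0<ints s' 17 0 --> (ALL x:C. ALL y:C. dd x y<=reals s' 14 0+reals s' 12 0)) &
   (ALL D. (ALL x:C. ALL y:C. dd x y<=D) --> reals s' 14 0+reals s' 12 0<=(1+1/th)*D)"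
 have fin: "finite C" and Cn: "C<={..<n}" using C(2) by (auto simp: pts_def)
 have MC: "Min C : C" using C fin by simp
 have n0: "ints s 0 0 = int n" using s by (simp add: consts_ok_def)
 have self: "dd x x = 0" if "x : C" for x using that Cn met by (simp add: Metric_space.zero subset_iff)
 have nn: "0<=dd x y" for x y using met by (simp add: Metric_space.nonneg)
 have tri: "dd x w<=dd x y+dd y w" if "x : C" "y : C" "w : C" for x y w using that Cn met by (simp add: Metric_space.triangle subset_iff)
 have sym: "dd x y = dd y x" for x y using met by (simp add: Metric_space.commute)
 define att where "att v <-> (EX x:C. EX y:C. v = dd x y)" for v
 have att0: "att 0" unfolding att_def using MC self[OF MC] by metis
 let ?body = "MINPT;; If (BNot (ILess (iv 32) I0)) (FAR;; DROPBALL) PSkip"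
 let ?end = "MINPT;; If (BNot (ILess (iv 32) I0)) (seti 17 I1) PSkip"
 let ?s0 = "rupd 14 0 0 s"
 have "wp K I (FAR;; setr 12 (RDivide (rv 14) (rv 1));; For 63 8 0 ?body;; ?end) ?s0 ?Q"
 proof (rule wp_step[OF FAR_wp[where c = "Min C"]])
  show "ints ?s0 0 0 = int n" "ints ?s0 32 0 = int (Min C)" using n0 M by auto
  fix s1 assume 1: "(ALL p:pts 61 ?s0. dd (Min C) p<=reals s1 14 0) & reals ?s0 14 0<=reals s1 14 0 &
   (reals s1 14 0 = reals ?s0 14 0 | (EX p:pts 61 ?s0. reals s1 14 0 = dd (Min C) p))" and fr1: "frame FAR ?s0 s1"
  let ?R = "reals s1 14 0" and ?h = "reals s1 14 0/th"
  have far1: "ALL p:C. dd (Min C) p<=?R" using 1 C(3) by simp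
  have "?R = 0 | (EX p:C. ?R = dd (Min C) p)" using 1 C(3) by simp
  hence attR: "att ?R"
  proof
   assume "EX p:C. ?R = dd (Min C) p"
   thus ?thesis unfolding att_def using MC by blast
  qed (use att0 in simp)
  have c1: "consts_ok s1" by (rule consts_ok_frame[OF _ fr1]) (use s in auto)
  let ?s1 = "rupd 12 0 ?h s1"
  let ?net = "net C ?h"
  let ?Inv = "%t s'. consts_ok s' & pts 30 s' = ?net t & pts 61 s' = C & reals s' 12 0 = ?h & ints s' 17 0 = ints s 17 0 &
    att (reals s' 14 0) & (ALL t'<t. ?net t' ~= {} --> (ALL p:C. dd (Min (?net t')) p<=reals s' 14 0))"
  have p1: "pts 30 s1 = C" "pts 61 s1 = C" using pts_cong[of s1 30 s] pts_cong[of s1 61 s] C frameD[OF fr1] by auto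
  have inv0: "?Inv 0 ?s1" using c1 p1 attR frameD[OF fr1] by simp
  have netC: "?net t<=C" for t by (rule net_sub)
  have loop: "wp K I (For 63 8 0 ?body) ?s1 (?Inv (2 ^ (g*q)))"
  proof (rule wp_For[where N = "2 ^ (g*q)" and Inv = ?Inv])
   fix t s' assume t: "t<2 ^ (g*q)" and inv: "?Inv t s'"
   have n0': "ints s' 0 0 = int n" using inv by (simp add: consts_ok_def)
   show "wp K I ?body s' (?Inv (Suc t))"
   proof (rule wp_step[OF MINPT_wp[OF n0']])
    fix s2 assume m2: "ints s2 32 0 = (if pts 30 s' = {} then -1 else int (Min (pts 30 s')))" and fr2: "frame MINPT s' s2"
    have c2: "consts_ok s2" by (rule consts_ok_frame[OF _ fr2]) (use inv in auto)
    have p2: "pts 30 s2 = ?net t" "pts 61 s2 = C" using pts_cong[of s2 30 s'] pts_cong[of s2 61 s'] inv frameD[OF fr2] by auto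
    have k2: "reals s2 12 0 = ?h" "ints s2 17 0 = ints s 17 0" "reals s2 14 0 = reals s' 14 0" "ints s2 0 0 = int n" using inv frameD[OF fr2] c2 by (auto simp: consts_ok_def)
    show "wp K I (If (BNot (ILess (iv 32) I0)) (FAR;; DROPBALL) PSkip) s2 (?Inv (Suc t))"
    proof (cases "?net t = {}")
    case True
    have "?Inv (Suc t) s2" using True c2 p2 k2 inv by (auto simp: less_Suc_eq)
    thus ?thesis using True m2 inv by simp
    next
    case False
    let ?y = "Min (?net t)"
    have y: "?y : C" using netC[of t] False fin by (metis Min_in finite_subset subsetD)
    have m2': "ints s2 32 0 = int ?y" using m2 False inv by simp
    have "wp K I (FAR;; DROPBALL) s2 (?Inv (Suc t))"
    proof (rule wp_step[OF FAR_wp[OF k2(4) m2']])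
    fix s3 assume 3: "(ALL p:pts 61 s2. dd ?y p<=reals s3 14 0) & reals s2 14 0<=reals s3 14 0 &
    (reals s3 14 0 = reals s2 14 0 | (EX p:pts 61 s2. reals s3 14 0 = dd ?y p))" and fr3: "frame FAR s2 s3"
    have c3: "consts_ok s3" by (rule consts_ok_frame[OF c2 fr3]) auto
    have p3: "pts 30 s3 = ?net t" "pts 61 s3 = C" using pts_cong[of s3 30 s2] pts_cong[of s3 61 s2] p2 frameD[OF fr3] by auto
    have k3: "reals s3 12 0 = ?h" "ints s3 17 0 = ints s 17 0" "ints s3 0 0 = int n" "ints s3 32 0 = int ?y" using k2 m2' frameD[OF fr3] by auto
    have "reals s3 14 0 = reals s' 14 0 | (EX p:C. reals s3 14 0 = dd ?y p)" using 3 p2 k2 by simp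
    hence a3: "att (reals s3 14 0)"
    proof
    assume "EX p:C. reals s3 14 0 = dd ?y p"
    thus ?thesis unfolding att_def using y by blast
    qed (use inv in simp)
    have f3: "ALL p:C. dd ?y p<=reals s3 14 0" using 3 p2 by simp
    have g3: "ALL p:C. dd (Min (?net t')) p<=reals s3 14 0" if "t'<Suc t" "?net t' ~= {}" for t'
    proof (cases "t' = t")
    case False
    hence "t'<t" using that by simp
    hence "ALL p:C. dd (Min (?net t')) p<=reals s' 14 0" using inv that by blast
    moreover have "reals s' 14 0<=reals s3 14 0" using 3 k2 by simp
    ultimately show ?thesis by force
    qed (use f3 in simp)
    show "wp K I DROPBALL s3 (?Inv (Suc t))"
    proof (rule wp_conseq[OF DROPBALL_wp[OF k3(3,4)]])
    fix s4 assume 4: "pts 30 s4 = pts 30 s3 - ballp ?y (reals s3 12 0)" and fr4: "frame DROPBALL s3 s4"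
    have "consts_ok s4" by (rule consts_ok_frame[OF c3 fr4]) auto
    moreover have "pts 61 s4 = C" using pts_cong[of s4 61 s3] p3 frameD[OF fr4] by simp
    moreover have "pts 30 s4 = ?net (Suc t)" using 4 False p3 k3 by simp
    moreover have "reals s4 = reals s3" "ints s4 17 = ints s3 17" using frameD[OF fr4] by auto
    ultimately show "?Inv (Suc t) s4" using k3 a3 g3 by simp
    qed
    qed
    thus ?thesis using m2' by simp
    qed
   qed
  next
   show "ints ?s1 8 0 = int (2 ^ (g*q))" using c1 by (simp add: consts_ok_def)
   show "?Inv t (iupd 63 0 x s')" if "?Inv t s'" for t s' x using that by simp
  qed (use inv0 in auto)
  have "wp K I (For 63 8 0 ?body;; ?end) ?s1 ?Q"
  proof (rule wp_step[OF loop])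
   fix s2 assume inv: "?Inv (2 ^ (g*q)) s2"
   have n2: "ints s2 0 0 = int n" using inv by (simp add: consts_ok_def)
   show "wp K I ?end s2 ?Q"
   proof (rule wp_step[OF MINPT_wp[OF n2]])
    fix s3 assume m3: "ints s3 32 0 = (if pts 30 s2 = {} then -1 else int (Min (pts 30 s2)))" and fr3: "frame MINPT s2 s3"
    have k3: "reals s3 = reals s2" "ints s3 17 = ints s2 17" using frameD[OF fr3] by auto
    let ?m = "reals s2 14 0"
    have i: "att ?m" "reals s2 12 0 = ?h" "ints s2 17 0 = ints s 17 0" "pts 30 s2 = ?net (2 ^ (g*q))"
    "!!t'. t'<2 ^ (g*q) ==> ?net t' ~= {} ==> (ALL p:C. dd (Min (?net t')) p<=?m)" using inv by auto
    have up: "?m+?h<=(1+1/th)*D" if D: "ALL x:C. ALL y:C. dd x y<=D" for D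
    proof -
    have "?m<=D" "?R<=D" using i(1) attR D unfolding att_def by auto
    moreover from this have "?h<=D/th" by (intro divide_right_mono) auto
    ultimately show ?thesis by (simp add: algebra_simps)
    qed
    have pos: "0<=?m+?h" using i(1) attR nn unfolding att_def by auto
    have wd: "?net (2 ^ (g*q)) = {}" if wide using that[unfolded wide_def, rule_format, of C "Min C" ?R] Cn MC far1 by simp
    have low: "dd x y<=?m+?h" if e: "?net (2 ^ (g*q)) = {}" and xy: "x : C" "y : C" for x y
    proof -
    obtain t where t: "t<2 ^ (g*q)" "?net t ~= {}" "dd (Min (?net t)) x<=?h" using net_near[OF xy(1) _ e] xy Cn by auto
    let ?w = "Min (?net t)"
    have w: "?w : C" using netC[of t] t(2) fin by (metis Min_in finite_subset subsetD)
    have "dd ?w y<=?m" using i(5)[OF t(1,2)] xy by blast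
    thus ?thesis using tri[OF xy(1) w xy(2)] t(3) sym[of x ?w] by linarith
    qed
    show "wp K I (If (BNot (ILess (iv 32) I0)) (seti 17 I1) PSkip) s3 ?Q" using k3 i up pos low m3 wd by auto
   qed
  qed
  moreover have "reals s1 1 0 = th" using c1 by (simp add: consts_ok_def)
  ultimately show "wp K I (setr 12 (RDivide (rv 14) (rv 1));; For 63 8 0 ?body;; ?end) s1 ?Q" unfolding wp_Sq[of _ _ "setr 12 (RDivide (rv 14) (rv 1))"] by (simp only: wp_PRSet ival.simps rval.simps)
 qed
 thus ?thesis unfolding DIAM_def wp_Sq[of _ _ "setr 14 (rnum 0)"] by (simp only: wp_PRSet ival.simps rval.simps of_int_0)
qed

definition answers :: "(nat set => bool) => bool" where
 "answers okc <-> (ALL C. C ~= {} --> C<={..<n} --> (EX t v. K C t v & (v ~= 0 <-> okc C)))"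

definition valid :: "(nat set => bool) => nat => (nat => nat) => bool" where
 "valid okc m L <-> (ALL l<m. cls L l ~= {} --> okc (cls L l))"

text \<open>The computed value dominates the true diameters only if nothing overflowed; that it is
  not much larger than any admissible bound holds in every case.\<close>

definition evaluated :: "(nat set => bool) => (nat => nat) => nat => bool => state => bool" where
 "evaluated okc L m ov s' <-> (ov --> 0<ints s' 17 0) & (wide --> (0<ints s' 17 0 <-> ov)) &
   (0<ints s' 59 0 <-> valid okc m L) &
   (~ 0<ints s' 17 0 --> (EX D. diams m L D & reals s' 13 0 = sum D {..<m})) &
   (ALL D. diams m L D --> reals s' 13 0<=(1+1/th) * sum D {..<m})"

lemma EVALC_wp:
 assumes met: "Metric_space {..<n} dd" and Kok: "answers okc"
  and c: "consts_ok s" and L: "labrel L s" and ev: "evaluated okc L m ov s" and m: "ints s 60 0 = int m"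
 shows "wp K I EVALC s (evaluated okc L (Suc m) ov)"
proof -
 let ?b = "ieq (IGet 58 (iv 31)) (iv 60)"
 let ?C = "cls L m"
 let ?Q = "evaluated okc L (Suc m) ov"
 let ?rest = "If (BNot (ILess (iv 32) I0))
    (PCall 62 61;; If (ieq (iv 62) I0) (seti 59 I0) PSkip;;
    DIAM;; setr 13 (RPlus (rv 13) (RPlus (rv 14) (rv 12)))) PSkip"
 have n0: "ints s 0 0 = int n" using c by (simp add: consts_ok_def)
 have d_mono: "diams m L D" if "diams (Suc m) L D" for D using that by (simp add: diams_def)
 show ?thesis unfolding EVALC_def
 proof (rule wp_step[OF FILL_vals[OF n0, where h = "%p. L p = m"]])
  show "bval I s' ?b = (L j = m)" if "j<n" "ints s' 31 0 = int j" "frame (FILL 61 ?b) s s'" for j s' using that(1,2) frameD[OF that(3)] L m by (auto simp: labrel_def)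
 next
  fix s1 assume 1: "ALL p<n. ints s1 61 (int p) = (if L p = m then 1 else 0)" and fr1: "frame (FILL 61 ?b) s s1"
  note f1 = frameD[OF fr1]
  have n1: "ints s1 0 0 = int n" using n0 f1 by simp
  show "wp K I (FILL 30 ?b;; MINPT;; ?rest) s1 ?Q"
  proof (rule wp_step[OF FILL_wp[OF n1, where h = "%p. L p = m"]])
   show "bval I s' ?b = (L j = m)" if "j<n" "ints s' 31 0 = int j" "frame (FILL 30 ?b) s1 s'" for j s' using that(1,2) frameD[OF that(3)] f1 L m by (auto simp: labrel_def)
  next
   fix s2 assume 2: "pts 30 s2 = {p. p<n & L p = m}" and fr2: "frame (FILL 30 ?b) s1 s2"
   note f2 = frameD[OF fr2]
   have n2: "ints s2 0 0 = int n" using n1 f2 by simp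
   show "wp K I (MINPT;; ?rest) s2 ?Q"
   proof (rule wp_step[OF MINPT_wp[OF n2]])
    fix s3 assume 3: "ints s3 32 0 = (if pts 30 s2 = {} then -1 else int (Min (pts 30 s2)))" and fr3: "frame MINPT s2 s3"
    note f3 = frameD[OF fr3]
    have e: "ints s3 17 = ints s 17" "ints s3 59 = ints s 59" "reals s3 13 = reals s 13" using f1 f2 f3 by auto
    have c1: "consts_ok s1" by (rule consts_ok_frame[OF c fr1]) auto
    have c2: "consts_ok s2" by (rule consts_ok_frame[OF c1 fr2]) auto
    have c3: "consts_ok s3" by (rule consts_ok_frame[OF c2 fr3]) auto
    have C30: "pts 30 s3 = ?C" "pts 30 s2 = ?C" using 2 pts_cong[of s3 30 s2] f3 by (auto simp: cls_def)
    have 61: "ints s3 61 = ints s1 61" using f2 f3 by simp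
    have C61: "pts 61 s3 = ?C" using 1 61 by (auto simp: pts_def cls_def split: if_splits)
    have mk: "marked I s3 61 = ?C" using 1 61 by (auto simp: marked_def points_def nI cls_def split: if_splits)
    have ev3: "evaluated okc L m ov s3" using ev e by (simp add: evaluated_def)
    show "wp K I ?rest s3 ?Q"
    proof (cases "?C = {}")
    case True
    have "valid okc (Suc m) L = valid okc m L" using True by (auto simp: valid_def less_Suc_eq)
    moreover have "EX D. diams (Suc m) L D & reals s3 13 0 = sum D {..<Suc m}" if "~ 0<ints s3 17 0"
    proof -
    obtain D where D: "diams m L D" "reals s3 13 0 = sum D {..<m}" using ev3 \<open>~ 0<ints s3 17 0\<close> unfolding evaluated_def by blast
    have "diams (Suc m) L (D(m := 0))" using D(1) True by (auto simp: diams_def less_Suc_eq)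
    moreover have "sum (D(m := 0)) {..<Suc m} = sum D {..<m}" by simp
    ultimately show ?thesis using D(2) by metis
    qed
    moreover have "reals s3 13 0<=(1+1/th) * sum D {..<Suc m}" if "diams (Suc m) L D" for D
    proof -
    have "reals s3 13 0<=(1+1/th) * sum D {..<m}" using ev3 d_mono[OF that] by (simp add: evaluated_def)
    also have "...<=(1+1/th) * sum D {..<Suc m}" using that by (intro mult_left_mono) (auto simp: diams_def)
    finally show ?thesis .
    qed
    ultimately have "?Q s3" using ev3 unfolding evaluated_def by blast
    thus ?thesis using True 3 C30 by simp
    next
    case False
    have "?C<={..<n}" by (auto simp: cls_def)
    then obtain t v where v: "K ?C t v" "v ~= 0 <-> okc ?C" using Kok False unfolding answers_def by blast
    let ?s4 = "if v = 0 then iupd 59 0 0 (iupd 62 0 v s3) else iupd 62 0 v s3"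
    have c4: "consts_ok ?s4" using c3 by simp
    have p4: "pts 30 ?s4 = ?C" "pts 61 ?s4 = ?C" "ints ?s4 32 0 = int (Min ?C)" using C30 C61 3 False by auto
    have e4: "ints ?s4 17 = ints s3 17" "reals ?s4 = reals s3" "0<ints ?s4 59 0 <-> 0<ints s3 59 0 & okc ?C"  using v(2) by (auto simp: iupd_other)
    have "wp K I (DIAM;; setr 13 (RPlus (rv 13) (RPlus (rv 14) (rv 12)))) ?s4 ?Q"
    proof (rule wp_step[OF DIAM_wp[OF met c4 False p4]])
    fix s5 assume 5: "(0<ints ?s4 17 0 --> 0<ints s5 17 0) & (wide --> (0<ints s5 17 0 <-> 0<ints ?s4 17 0)) &
    0<=reals s5 14 0+reals s5 12 0 &
    (~ 0<ints s5 17 0 --> (ALL x:?C. ALL y:?C. dd x y<=reals s5 14 0+reals s5 12 0)) &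
    (ALL D. (ALL x:?C. ALL y:?C. dd x y<=D) --> reals s5 14 0+reals s5 12 0<=(1+1/th)*D)" and fr5: "frame DIAM ?s4 s5"
    let ?e = "reals s5 14 0+reals s5 12 0"
    have e5: "ints s5 59 = ints ?s4 59" "reals s5 13 = reals s3 13" using frameD[OF fr5] e4 by auto
    have "valid okc (Suc m) L <-> valid okc m L & okc ?C" using False by (auto simp: valid_def less_Suc_eq)
    hence vd: "0<ints s5 59 0 <-> valid okc (Suc m) L" using e4(3) e5(1) ev3 by (simp add: evaluated_def)
    have low: "EX D. diams (Suc m) L D & reals s3 13 0+?e = sum D {..<Suc m}" if o: "~ 0<ints s5 17 0"
    proof -
    have "~ 0<ints s3 17 0" using 5 o e4 by auto
    then obtain D where D: "diams m L D" "reals s3 13 0 = sum D {..<m}" using ev3 unfolding evaluated_def by blast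
    have "diams (Suc m) L (D(m := ?e))" using D(1) 5 o by (auto simp: diams_def less_Suc_eq)
    moreover have "sum (D(m := ?e)) {..<Suc m} = sum D {..<m}+?e" by simp
    ultimately show ?thesis using D(2) by metis
    qed
    have up: "reals s3 13 0+?e<=(1+1/th) * sum D {..<Suc m}" if "diams (Suc m) L D" for D
    proof -
    have "reals s3 13 0<=(1+1/th) * sum D {..<m}" using ev3 d_mono[OF that] by (simp add: evaluated_def)
    moreover have "?e<=(1+1/th)*D m" using 5 that by (auto simp: diams_def)
    ultimately show ?thesis by (simp add: distrib_left)
    qed
    have "?Q (rupd 13 0 (reals s3 13 0+?e) s5)" using vd low up 5 e4 ev3 unfolding evaluated_def by auto
    thus "wp K I (setr 13 (RPlus (rv 13) (RPlus (rv 14) (rv 12)))) s5 ?Q" using e5 by simp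
    qed
    moreover have "wp K I (PCall 62 61;; If (ieq (iv 62) I0) (seti 59 I0) PSkip;; X) s3 ?Q" if "wp K I X ?s4 ?Q" for X unfolding wp_Sq wp_PCall mk by (intro exI[of _ t] exI[of _ v] conjI v(1)) (use that in "auto split: if_splits")
    ultimately have "wp K I (PCall 62 61;; If (ieq (iv 62) I0) (seti 59 I0) PSkip;;
    DIAM;; setr 13 (RPlus (rv 13) (RPlus (rv 14) (rv 12)))) s3 ?Q" by blast
    moreover have "bval I s3 (BNot (ILess (iv 32) I0))" using 3 False C30 by simp
    ultimately show ?thesis unfolding wp_If by (simp only: if_True)
    qed
   qed
  qed auto
 qed auto
qed

lemma EVAL_wp:
 assumes met: "Metric_space {..<n} dd" and Kok: "answers okc"
  and c: "consts_ok s" and L: "labrel L s"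
 shows "wp K I EVAL s (evaluated okc L k (0<ints s 17 0))"
proof -
 let ?s = "rupd 13 0 0 (iupd 59 0 1 s)"
 have "wp K I (For 60 0 1 EVALC) ?s (evaluated okc L k (0<ints s 17 0))"
 proof (rule wp_For[where N = k and Inv = "%m s'. evaluated okc L m (0<ints s 17 0) s'"])
  show "evaluated okc L 0 (0<ints s 17 0) ?s" by (auto simp: evaluated_def valid_def diams_def)
  fix m s' assume inv: "evaluated okc L m (0<ints s 17 0) s'" and v: "ints s' 60 0 = int m" and fr: "frame (For 60 0 1 EVALC) ?s s'"
  have "consts_ok s'" by (rule consts_ok_frame[OF _ fr]) (use c in auto)
  moreover have "labrel L s'" using L frameD[OF fr] by (simp add: labrel_def)
  ultimately show "wp K I EVALC s' (evaluated okc L (Suc m) (0<ints s 17 0))" by (rule EVALC_wp[OF met Kok _ _ inv v])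
 next
  show "evaluated okc L m (0<ints s 17 0) (iupd 60 0 x s')" if "evaluated okc L m (0<ints s 17 0) s'" for m s' x using that by (simp add: evaluated_def)
 qed (use c in "auto simp: consts_ok_def")
 thus ?thesis by (simp add: EVAL_def)
qed

definition kept :: "(nat set => bool) => state => bool" where
 "kept okc s <-> (0<ints s 64 0 --> (EX L D. (ALL p<n. ints s 1 (int p) = int (L p) & L p<k) & valid okc k L & diams k L D &
   reals s 15 0 = sum D {..<k}))"

text \<open>\<open>e\<close> is the estimated cost of the candidate decoded from \<open>bs\<close>.
  The kept value can only decrease later, so the last clause persists.\<close>

definition tried :: "(nat set => bool) => bool list => state => bool" where
 "tried okc bs s <-> ~ ovf (snd (core bs)) & (EX L e. candidate bs L &
   (ALL D. diams k L D --> e<=(1+1/th) * sum D {..<k}) & (valid okc k L --> 0<ints s 64 0 & reals s 15 0<=e))"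

lemma KEEP_wp:
 assumes c: "consts_ok s" and L: "labrel L s" "ALL p<n. L p<k" and v: "0<ints s 59 0 <-> valid okc k L"
  and D: "diams k L D" "reals s 13 0 = sum D {..<k}" and kp: "kept okc s"
 shows "wp K I KEEP s (%s'. kept okc s' & (valid okc k L --> 0<ints s' 64 0 & reals s' 15 0<=reals s 13 0) &
   (0<ints s 64 0 --> 0<ints s' 64 0 & reals s' 15 0<=reals s 15 0))"
proof -
 let ?Q = "%s'. kept okc s' & (valid okc k L --> 0<ints s' 64 0 & reals s' 15 0<=reals s 13 0) &
   (0<ints s 64 0 --> 0<ints s' 64 0 & reals s' 15 0<=reals s 15 0)"
 let ?b = "BAnd (pos 59) (bor (BNot (pos 64)) (RLess (rv 13) (rv 15)))"
 show ?thesis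
 proof (cases "bval I s ?b")
  case False
  hence Q: "?Q s" using kp v by auto
  show ?thesis unfolding KEEP_def wp_If if_not_P[OF False] wp_PSkip by (rule Q)
 next
  case True
  let ?s = "rupd 15 0 (reals s 13 0) (iupd 64 0 1 s)"
  let ?p = "For 31 0 0 (PISet 1 (iv 31) (IGet 58 (iv 31)))"
  have "wp K I ?p ?s ?Q"
  proof (rule wp_For[where N = n and Inv = "%m s'. ALL p<m. ints s' 1 (int p) = int (L p)"])
   fix m s' assume m: "m<n" and inv: "ALL p<m. ints s' 1 (int p) = int (L p)" and v: "ints s' 31 0 = int m" and fr: "frame ?p ?s s'"
   have "ints s' 58 (int m) = int (L m)" using L(1) m frameD[OF fr] by (simp add: labrel_def)
   thus "wp K I (PISet 1 (iv 31) (IGet 58 (iv 31))) s' (%s'. ALL p<Suc m. ints s' 1 (int p) = int (L p))" using inv v by (auto simp: less_Suc_eq)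
  next
   fix s' assume inv: "ALL p<n. ints s' 1 (int p) = int (L p)" and fr: "frame ?p ?s s'"
   have e: "ints s' 64 0 = 1" "reals s' 15 0 = reals s 13 0" using frameD[OF fr] by auto
   have "valid okc k L" using True v by auto
   hence "kept okc s'" unfolding kept_def using inv L(2) D e by auto
   thus "?Q s'" using True e by auto
  qed (use c in "auto simp: consts_ok_def")
  thus ?thesis unfolding KEEP_def wp_If using True by simp
 qed
qed

definition adv :: "nat => state => bool" where
 "adv w s <-> bits s = digits B w"

lemma adv_iff: "adv w s <-> (ALL i<B. 0<ints s 10 (int i) <-> odd (w div 2 ^ i))" by (auto simp: adv_def bits_def digits_def)

text \<open>\<open>Suc w mod 2 ^ m = 0\<close> says that the lowest \<open>m\<close> digits of
  \<open>w\<close> are all ones, that is, the carry is still alive at digit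
  \<open>m\<close>.\<close>

lemma INCR_wp:
 assumes c: "consts_ok s" and w: "adv w s"
 shows "wp K I INCR s (adv (Suc w))"
proof -
 let ?Inv = "%m s'. (ALL i<B. 0<ints s' 10 (int i) <-> odd ((if i<m then Suc w else w) div 2 ^ i)) &
   (0<ints s' 68 0 <-> Suc w mod 2 ^ m = 0)"
 let ?p = "If (pos 68) (If (ILess I0 (IGet 10 (iv 66))) (PISet 10 (iv 66) I0) (PISet 10 (iv 66) I1;; seti 68 I0)) PSkip"
 have "wp K I (For 66 3 0 ?p) (iupd 68 0 1 s) (adv (Suc w))"
 proof (rule wp_For[where N = B and Inv = ?Inv])
  fix m :: nat and s' :: state assume m: "m<B" and inv: "?Inv m s'" and v: "ints s' 66 0 = int m"
  have bm: "0<ints s' 10 (int m) <-> odd (w div 2 ^ m)" using inv m by simp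
  show "wp K I ?p s' (?Inv (Suc m))"
  proof (cases "Suc w mod 2 ^ m = 0")
   case True
   hence d: "Suc w div 2 ^ m = Suc (w div 2 ^ m)" by (simp add: div_Suc)
   have car: "Suc w mod 2 ^ Suc m = 0 <-> odd (w div 2 ^ m)" unfolding Suc_mod_pow d using True by simp
   show ?thesis
   proof (cases "odd (w div 2 ^ m)")
    case o: True
    have "?Inv (Suc m) (iupd 10 (int m) 0 s')" using inv d o car by auto
    thus ?thesis using inv True bm o v by (simp del: power_Suc)
   next
    case e: False
    have "?Inv (Suc m) (iupd 68 0 0 (iupd 10 (int m) 1 s'))" using inv d e car by simp
    thus ?thesis using inv True bm e v by (simp del: power_Suc)
   qed
  next
   case False
   hence d: "Suc w div 2 ^ m = w div 2 ^ m" by (simp add: div_Suc)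
   have car: "Suc w mod 2 ^ Suc m ~= 0" unfolding Suc_mod_pow using False by simp
   have "?Inv (Suc m) s'"
   proof (intro conjI allI impI)
    show "(0<ints s' 10 (int i)) = odd ((if i<Suc m then Suc w else w) div 2 ^ i)" if "i<B" for i using that inv d by (cases "i = m") auto
    show "(0<ints s' 68 0) = (Suc w mod 2 ^ Suc m = 0)" using inv False car by simp
   qed
   thus ?thesis using inv False by (simp del: power_Suc)
  qed
 next
  show "?Inv 0 (iupd 68 0 1 s)" using w by (simp add: adv_iff iupd_other)
  show "adv (Suc w) s'" if "?Inv B s'" for s' using that by (simp add: adv_iff)
 qed (use c in "auto simp: consts_ok_def")
 thus ?thesis by (simp add: INCR_def)
qed

lemma tried_mono:
 assumes "tried okc bs s" "0<ints s 64 0 --> 0<ints s' 64 0 & reals s' 15 0<=reals s 15 0"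
 shows "tried okc bs s'" using assms unfolding tried_def by (meson order_trans)

text \<open>A single overflow discards the whole round, so from then on nothing is claimed about the
  labelling kept.\<close>

definition sofar :: "(nat set => bool) => nat => state => bool" where
 "sofar okc w s <-> adv w s & (nice & wide --> ~ 0<ints s 65 0) &
   (~ 0<ints s 65 0 --> (ALL w'<w. tried okc (digits B w') s) & kept okc s)"

lemma TRIAL_wp:
 assumes met: "Metric_space {..<n} dd" and Kok: "answers okc"
  and c: "consts_ok s" and kB: "k<=B" and sf: "sofar okc w s"
 shows "wp K I TRIAL s (sofar okc (Suc w))" unfolding TRIAL_def
proof (rule wp_step[OF DECODE_wp[OF c kB]])
 let ?bs = "digits B w"
 have bs: "bits s = ?bs" using sf by (simp add: sofar_def adv_def)
 fix s1 assume "(EX L. labrel L s1 & candidate (bits s) L) & (0<ints s1 17 0 <-> ovf (snd (core (bits s)))) & (nice --> ~ 0<ints s1 17 0)"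
  and fr1: "frame DECODE s s1"
 then obtain L where L: "labrel L s1" "candidate ?bs L" and o1: "0<ints s1 17 0 <-> ovf (snd (core ?bs))" "nice --> ~ 0<ints s1 17 0" unfolding bs by blast
 have c1: "consts_ok s1" by (rule consts_ok_frame[OF c fr1]) auto
 have Lk: "ALL p<n. L p<k" using L(2) by (simp add: candidate_def)
 show "wp K I (EVAL;; If (pos 17) (seti 65 I1) PSkip;; KEEP;; INCR) s1 (sofar okc (Suc w))"
 proof (rule wp_step[OF EVAL_wp[OF met Kok c1 L(1)]])
  fix s2 assume ev: "evaluated okc L k (0<ints s1 17 0) s2" and fr2: "frame EVAL s1 s2"
  have c2: "consts_ok s2" by (rule consts_ok_frame[OF c1 fr2]) auto
  let ?s3 = "if 0<ints s2 17 0 then iupd 65 0 1 s2 else s2"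
  have c3: "consts_ok ?s3" using c2 by simp
  have L3: "labrel L ?s3" using L(1) frameD[OF fr2] by (auto simp: labrel_def)
  have adv3: "adv w ?s3" using sf frameD[OF fr1] frameD[OF fr2] by (auto simp: sofar_def adv_iff)
  have 64: "ints ?s3 64 = ints s 64" "reals ?s3 15 = reals s 15" "ints ?s3 1 = ints s 1" "ints s2 65 = ints s 65" using frameD[OF fr1] frameD[OF fr2] by (auto simp: iupd_other)
  have 65: "0<ints ?s3 65 0 <-> 0<ints s2 17 0 | 0<ints s 65 0" using 64 by auto
  have nw: "nice & wide --> ~ 0<ints ?s3 65 0" using sf ev o1 unfolding 65 sofar_def evaluated_def by blast
  have incr: "wp K I INCR s4 (sofar okc (Suc w))"
   if "consts_ok s4" "adv w s4" "ints s4 65 0 = ints ?s3 65 0" "~ 0<ints ?s3 65 0 --> (ALL w'<Suc w. tried okc (digits B w') s4) & kept okc s4" for s4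
  proof (rule wp_conseq[OF INCR_wp[OF that(1,2)]])
   fix s5 assume "adv (Suc w) s5" and fr: "frame INCR s4 s5"
   moreover have "ints s5 64 = ints s4 64" "reals s5 15 = reals s4 15" "ints s5 1 = ints s4 1" "ints s5 65 = ints s4 65" using frameD[OF fr] by auto
   ultimately show "sofar okc (Suc w) s5" using that nw by (auto simp: sofar_def tried_def kept_def)
  qed
  have keep: "wp K I (KEEP;; INCR) ?s3 (sofar okc (Suc w))"
  proof (cases "0<ints ?s3 65 0")
   \<comment> \<open>The round is already spoiled; it only has to terminate and leave the advice
     counter intact.\<close>
   case True
   let ?b = "BAnd (pos 59) (bor (BNot (pos 64)) (RLess (rv 13) (rv 15)))"
   let ?p = "For 31 0 0 (PISet 1 (iv 31) (IGet 58 (iv 31)))"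
   have n3: "ints ?s3 0 0 = int n" using c3 by (simp add: consts_ok_def)
   have lp: "ints (s' :: state) 0 0 = int n ==> wp K I ?p s' (%_. True)" for s' by (rule wp_For[where N = n and Inv = "%_ _. True"]) auto
   have "wp K I KEEP ?s3 (%_. True)" unfolding KEEP_def wp_If using n3 lp by auto
   thus ?thesis
   proof (rule wp_step)
    fix s4 assume fr: "frame KEEP ?s3 s4"
    have "consts_ok s4" by (rule consts_ok_frame[OF c3 fr]) auto
    moreover have "adv w s4" using adv3 frameD[OF fr] by (simp add: adv_iff)
    moreover have "ints s4 65 0 = ints ?s3 65 0" using frameD[OF fr] by simp
    ultimately show "wp K I INCR s4 (sofar okc (Suc w))" using True by (intro incr) auto
   qed
  next
   case False
   hence o2: "~ 0<ints s2 17 0" "~ 0<ints s 65 0" using 65 by auto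
   have e3: "?s3 = s2" using o2 by simp
   obtain D where D: "diams k L D" "reals s2 13 0 = sum D {..<k}" using ev o2 unfolding evaluated_def by blast
   have kp: "kept okc s2" using sf o2 64 unfolding e3 sofar_def kept_def by simp
   have v: "0<ints s2 59 0 <-> valid okc k L" using ev by (simp add: evaluated_def)
   have tr: "ALL w'<w. tried okc (digits B w') s2" using sf o2 64 unfolding e3 sofar_def tried_def by simp
   have no: "~ ovf (snd (core ?bs))" using ev o1 o2 by (auto simp: evaluated_def)
   show ?thesis unfolding e3
   proof (rule wp_step[OF KEEP_wp[OF c2 _ Lk v D kp]])
    show "labrel L s2" using L3 e3 by simp
    fix s4 assume 4: "kept okc s4 & (valid okc k L --> 0<ints s4 64 0 & reals s4 15 0<=reals s2 13 0) &
    (0<ints s2 64 0 --> 0<ints s4 64 0 & reals s4 15 0<=reals s2 15 0)" and fr: "frame KEEP s2 s4"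
    have "tried okc ?bs s4" unfolding tried_def using no L(2) ev 4 by (auto simp: evaluated_def)
    moreover have "ALL w'<w. tried okc (digits B w') s4" using tr 4 tried_mono by blast
    ultimately have "ALL w'<Suc w. tried okc (digits B w') s4" by (auto simp: less_Suc_eq)
    moreover have "consts_ok s4" by (rule consts_ok_frame[OF c2 fr]) auto
    moreover have "adv w s4" using adv3 frameD[OF fr] unfolding e3 by (simp add: adv_iff)
    moreover have "ints s4 65 0 = ints ?s3 65 0" using frameD[OF fr] e3 by simp
    ultimately show "wp K I INCR s4 (sofar okc (Suc w))" using 4 by (intro incr) auto
   qed
  qed
  have "wp K I (If (pos 17) (seti 65 I1) PSkip;; X) s2 (sofar okc (Suc w)) = wp K I X ?s3 (sofar okc (Suc w))" for X by simp
  thus "wp K I (If (pos 17) (seti 65 I1) PSkip;; KEEP;; INCR) s2 (sofar okc (Suc w))" using keep by blast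
 qed
qed

theorem ROUND_wp:
 assumes met: "Metric_space {..<n} dd" and Kok: "answers okc"
  and c: "consts_ok s" and kB: "k<=B"
 shows "wp K I ROUND s (%s'. (nice & wide --> ~ 0<ints s' 65 0) &
   (~ 0<ints s' 65 0 --> (ALL bs. length bs = B --> tried okc bs s') & kept okc s'))"
proof -
 let ?Q = "%s'. (nice & wide --> ~ 0<ints s' 65 0) &
   (~ 0<ints s' 65 0 --> (ALL bs. length bs = B --> tried okc bs s') & kept okc s')"
 let ?s = "iupd 64 0 0 (iupd 65 0 0 s)"
 let ?p = "For 66 3 0 (PISet 10 (iv 66) I0)"
 have clear: "wp K I ?p ?s (%s'. ALL i<B. ints s' 10 (int i) = 0)" by (rule wp_For[where N = B and Inv = "%m s'. ALL i<m. ints s' 10 (int i) = 0"])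
   (use c in "auto simp: consts_ok_def less_Suc_eq iupd_other")
 have "wp K I (?p;; For 67 6 0 TRIAL) ?s ?Q"
 proof (rule wp_step[OF clear])
  fix s1 assume a: "ALL i<B. ints s1 10 (int i) = 0" and fr1: "frame ?p ?s s1"
  have c1: "consts_ok s1" by (rule consts_ok_frame[OF _ fr1]) (use c in auto)
  show "wp K I (For 67 6 0 TRIAL) s1 ?Q"
  proof (rule wp_For[where N = "2 ^ B" and Inv = "%w s'. sofar okc w s'"])
   show "sofar okc 0 s1" using a frameD[OF fr1] by (auto simp: sofar_def adv_iff kept_def)
   fix w s' assume "sofar okc w s'" and fr: "frame (For 67 6 0 TRIAL) s1 s'"
   moreover have "consts_ok s'" by (rule consts_ok_frame[OF c1 fr]) auto
   ultimately show "wp K I TRIAL s' (sofar okc (Suc w))" using TRIAL_wp[OF met Kok] kB by blast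
  next
   show "sofar okc w (iupd 67 0 x s')" if "sofar okc w s'" for w s' x using that by (simp add: sofar_def adv_iff tried_def kept_def iupd_other)
  next
   fix s' assume sf: "sofar okc (2 ^ B) s'"
   have "tried okc bs s'" if "length bs = B" "~ 0<ints s' 65 0" for bs using digits_surj[of bs] sf that unfolding sofar_def by auto
   thus "?Q s'" using sf by (auto simp: sofar_def)
  qed (use c1 in "auto simp: consts_ok_def")
 qed
 thus ?thesis by (simp add: ROUND_def)
qed

end

section \<open>Doubling dimension: attainment, packing, and sizes of greedy nets\<close>

section \<open>Doubling dimension\<close>

definition halving :: "'a set => ('a => 'a => real) => real => bool" where
 "halving M d m <-> (ALL x:M. ALL r>0. EX S. S<=M & finite S & real (card S)<=2 powr m &
    Metric_space.mcball M d x r<=(UN y:S. Metric_space.mcball M d y (r/2)))"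

lemma doubling_dim_halving: "doubling_dim M d = Inf {m. m > 0 & halving M d m}" by (simp add: doubling_dim_def halving_def)

text \<open>Finiteness of the space provides a closest pair for the lower bound and a nonempty set
  of admissible exponents, and covering numbers are integers, so the infimum is attained.\<close>

lemma doubling_dim_works:
 assumes met: "Metric_space M d" and fin: "finite M" and two: "2<=card M"
 shows "1<=doubling_dim M d" and "halving M d (doubling_dim M d)"
proof -
 interpret Metric_space M d by (rule met)
 let ?D = "{m. m > 0 & halving M d m}"
 \<comment> \<open>For a closest pair \<open>x\<close>, \<open>y\<close>, a ball of radius
   \<open>d x y / 2\<close> contains only its centre. The ball of radius \<open>d x y\<close> around
   \<open>x\<close> contains both points, so covering it takes two such balls.\<close>
 have ge1: "1<=m" if "m : ?D" for m
 proof -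
  let ?S = "{d x y | x y. x : M & y : M & x ~= y}"
  have "?S<=(%(x, y). d x y) ` (M \<times> M)" by auto
  hence finS: "finite ?S" by (rule finite_subset) (use fin in auto)
  obtain x0 y0 where "x0 : M" "y0 : M" "x0 ~= y0" using two fin by (metis card_le_Suc0_iff_eq not_less_eq_eq numeral_2_eq_2)
  hence "?S ~= {}" by blast
  hence "Min ?S : ?S" using finS by (rule Min_in[rotated])
  then obtain x y where xy: "x : M" "y : M" "x ~= y" "d x y = Min ?S" by auto
  have min: "d x y<=d u v" if "u : M" "v : M" "u ~= v" for u v unfolding xy(4) using finS that by (intro Min_le) auto
  have hm: "halving M d m" using that by simp
  have pos: "0<d x y" by (rule mdist_pos_less) (use xy in auto)
  obtain S where S: "S<=M" "finite S" "real (card S)<=2 powr m" "mcball x (d x y)<=(UN z:S. mcball z (d x y/2))" using hm[unfolded halving_def, rule_format, OF xy(1) pos] by (elim exE conjE) (rule that)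
  have "x : mcball x (d x y)" "y : mcball x (d x y)" using xy pos by auto
  then obtain u v where uv: "u : S" "v : S" "x : mcball u (d x y/2)" "y : mcball v (d x y/2)" using S(4) by blast
  have near: "w = p" if "p : M" "p : mcball w (d x y/2)" for w p
  proof (rule ccontr)
   assume "w ~= p"
   moreover have "w : M" "d w p<=d x y/2" using that(2) by auto
   ultimately have "d x y<=d x y/2" using min[of w p] that(1) by linarith
   thus False using pos by simp
  qed
  have "u = x" "v = y" using near uv xy by blast+
  hence "{x, y}<=S" using uv by auto
  hence "card {x, y}<=card S" using S(2) by (intro card_mono)
  hence "2 powr 1<=2 powr m" using xy(3) S(3) by simp
  thus ?thesis using powr_le_cancel_iff[of 2 1 m] by simp
 qed
 have cM: "real (card M)<=2 powr real (card M)" using of_nat_less_two_power[of "card M", where ?'a = real] by (simp add: powr_realpow less_imp_le)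
 have "EX S. S<=M & finite S & real (card S)<=2 powr real (card M) & mcball x r<=(UN y:S. mcball y (r/2))"
  if "x : M" "r > 0" for x r
 proof -
  have "mcball x r<=(UN y:M. mcball y (r/2))"
  proof
   fix p assume "p : mcball x r"
   hence p: "p : M" by auto
   hence "p : mcball p (r/2)" using that(2) by auto
   thus "p : (UN y:M. mcball y (r/2))" using p by blast
  qed
  thus ?thesis using fin cM by blast
 qed
 hence ne: "real (card M) : ?D" using two unfolding halving_def by auto
 have bdd: "bdd_below ?D" by (rule bdd_belowI[of _ 0]) auto
 show d1: "1<=doubling_dim M d" unfolding doubling_dim_halving
 proof (rule cInf_greatest)
  show "?D ~= {}" using ne by blast
 qed (rule ge1)
 show "halving M d (doubling_dim M d)" unfolding halving_def
 proof (intro ballI allI impI)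
  fix x r assume x: "x : M" and r: "(0::real)<r"
  let ?Q = "%N. EX S. S<=M & finite S & card S = N & mcball x r<=(UN y:S. mcball y (r/2))"
  have ex: "EX N. ?Q N" using ne x r unfolding halving_def by blast
  define N where "N = (LEAST N. ?Q N)"
  have QN: "?Q N" unfolding N_def by (rule LeastI_ex[OF ex])
  have le: "real N<=2 powr m" if "m : ?D" for m
  proof -
   have hm: "halving M d m" using that by simp
   obtain S where S: "S<=M" "finite S" "real (card S)<=2 powr m" "mcball x r<=(UN y:S. mcball y (r/2))" using hm[unfolded halving_def, rule_format, OF x r] by (elim exE conjE) (rule that)
   hence "N<=card S" unfolding N_def by (intro Least_le) blast
   thus ?thesis using S(3) by linarith
  qed
  \<comment> \<open>The least size \<open>N\<close> of a cover does not depend on the exponent and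
    is at most \<open>2 powr m\<close> for every admissible \<open>m\<close>, hence also for the
    infimum.\<close>
  have "real N<=2 powr doubling_dim M d"
  proof (rule ccontr)
   assume "~ ?thesis"
   hence lt: "2 powr doubling_dim M d<real N" by simp
   hence N0: "0<real N" using powr_gt_zero[of 2 "doubling_dim M d"] by (metis less_trans zero_neq_numeral)
   hence "doubling_dim M d<log 2 (real N)" using lt by (simp add: less_log_iff)
   then obtain m where m: "m : ?D" "m<log 2 (real N)" unfolding doubling_dim_halving using cInf_lessD[of ?D] ne by blast
   hence "2 powr m<real N" using N0 by (simp add: less_log_iff)
   thus False using le[OF m(1)] by simp
  qed
  thus "EX S. S<=M & finite S & real (card S)<=2 powr doubling_dim M d & mcball x r<=(UN y:S. mcball y (r/2))" using QN by auto
 qed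
qed

lemma halving_iterate:
 assumes met: "Metric_space M d" and h: "halving M d m" and x: "x : M" and R: "0 < R"
 shows "EX S. S<=M & finite S & real (card S)<=(2 powr m) ^ j &
   Metric_space.mcball M d x R<=(UN y:S. Metric_space.mcball M d y (R/2 ^ j))"
proof (induction j)
 case 0
 thus ?case using x by (intro exI[of _ "{x}"]) auto
next
 case (Suc j)
 interpret Metric_space M d by (rule met)
 obtain S where S: "S<=M" "finite S" "real (card S)<=(2 powr m) ^ j" "mcball x R<=(UN y:S. mcball y (R/2 ^ j))" using Suc.IH by blast
 have "ALL y:S. EX T. T<=M & finite T & real (card T)<=2 powr m & mcball y (R/2 ^ j)<=(UN w:T. mcball w (R/2 ^ Suc j))"
 proof
  fix y assume "y : S"
  hence y: "y : M" "0 < R/2 ^ j" using S R by auto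
  have e: "R/2 ^ j/2 = R/2 ^ Suc j" by simp
  show "EX T. T<=M & finite T & real (card T)<=2 powr m & mcball y (R/2 ^ j)<=(UN w:T. mcball w (R/2 ^ Suc j))" using h[unfolded halving_def, rule_format, OF y] unfolding e .
 qed
 then obtain T where T: "!!y. y : S ==> T y<=M & finite (T y) & real (card (T y))<=2 powr m &
   mcball y (R/2 ^ j)<=(UN w:T y. mcball w (R/2 ^ Suc j))" by metis
 have "real (card (UN y:S. T y))<=real (SUM y:S. card (T y))" using card_UN_le[OF S(2)] by (simp only: of_nat_le_iff)
 also have "... = (SUM y:S. real (card (T y)))" by simp
 also have "...<=real (card S)*2 powr m" using T by (intro sum_bounded_above) auto
 also have "...<=(2 powr m) ^ j*2 powr m" using S(3) by (intro mult_right_mono) auto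
 finally have "real (card (UN y:S. T y))<=(2 powr m) ^ Suc j" by (simp add: mult.commute)
 moreover have "mcball x R<=(UN y:(UN y:S. T y). mcball y (R/2 ^ Suc j))"
 proof
  fix p assume "p : mcball x R"
  then obtain y where y: "y : S" "p : mcball y (R/2 ^ j)" using S(4) by blast
  hence "p : (UN w:T y. mcball w (R/2 ^ Suc j))" using T[OF y(1)] by blast
  thus "p : (UN y:(UN y:S. T y). mcball y (R/2 ^ Suc j))" using y(1) by blast
 qed
 moreover have "(UN y:S. T y)<=M" using T by blast
 moreover have "finite (UN y:S. T y)" using T S(2) by blast
 ultimately show ?case by blast
qed

text \<open>Cover the ball by \<open>(2 powr m)^j\<close> balls of radius \<open>R/2^j\<close>; each
  of them contains at most one point of \<open>Y\<close>.\<close>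

lemma packing:
 assumes met: "Metric_space M d" and h: "halving M d m" and x: "x : M" and R: "0 < R"
  and Y: "Y<=M" "finite Y" "ALL y:Y. d x y <= R" "ALL y:Y. ALL y':Y. y ~= y' --> 2*(R/2 ^ j)<d y y'"
 shows "real (card Y)<=(2 powr m) ^ j"
proof -
 interpret Metric_space M d by (rule met)
 obtain S where S: "S<=M" "finite S" "real (card S)<=(2 powr m) ^ j" "mcball x R<=(UN y:S. mcball y (R/2 ^ j))" using halving_iterate[OF met h x R, of j] by (elim exE conjE) (rule that)
 have "ALL y:Y. EX w:S. d w y <= R/2 ^ j"
 proof
  fix y assume "y : Y"
  hence "y : mcball x R" using x Y by auto
  from subsetD[OF S(4) this] show "EX w:S. d w y <= R/2 ^ j" by auto
 qed
 then obtain w where w: "!!y. y : Y ==> w y : S & d (w y) y <= R/2 ^ j" by metis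
 have "inj_on w Y"
 proof (rule inj_onI, rule ccontr)
  fix y y' assume y: "y : Y" "y' : Y" "w y = w y'" "y ~= y'"
  have "d y y'<=d y (w y)+d (w y) y'" by (rule triangle) (use y w S Y in auto)
  also have "... = d (w y) y+d (w y') y'" by (simp add: y(3) commute[of y])
  finally show False using w[OF y(1)] w[OF y(2)] Y(4) y by fastforce
 qed
 hence "card Y<=card S" using w S(2) by (metis card_inj_on_le image_subsetI)
 thus ?thesis using S(3) by linarith
qed

context decoder
begin

lemma net_Suc_sep: "net W R t ~= {} ==> p : net W R (Suc t) ==> p<n ==> R<dd (Min (net W R t)) p" by (auto simp: ballp_def)

lemma net_card:
 assumes met: "Metric_space {..<n} dd" and W: "W<={..<n}" and ne: "net W R T ~= {}" and R: "0 <= R"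
 shows "EX Y<=W. card Y = Suc T & (ALL y:Y. ALL y':Y. y ~= y' --> R<dd y y')"
proof -
 let ?N = "net W R"
 have ne: "?N t ~= {}" if "t<=T" for t using net_antimono[OF that, of W R] ne by blast
 have finW: "finite W" using W finite_subset by blast
 have m: "Min (?N t) : ?N t" if "t<=T" for t by (rule Min_in) (use ne[OF that] finW net_sub[of W R t] finite_subset in auto)
 have mW: "Min (?N t) : W" if "t<=T" for t using m[OF that] net_sub by blast
 have sep: "R<dd (Min (?N t)) (Min (?N t'))" if "t<t'" "t'<=T" for t t'
 proof (rule net_Suc_sep)
  show "?N t ~= {}" using ne that by simp
  have "?N t'<=?N (Suc t)" using that by (intro net_antimono) simp
  thus "Min (?N t') : ?N (Suc t)" using m[OF that(2)] by blast
  show "Min (?N t')<n" using mW[OF that(2)] W by auto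
 qed
 have self: "dd x x = 0" if "x<n" for x using met that by (simp add: Metric_space.zero)
 have sym: "dd x y = dd y x" for x y using met by (simp add: Metric_space.commute)
 let ?Y = "(%t. Min (?N t)) ` {..T}"
 have "inj_on (%t. Min (?N t)) {..T}"
 proof (rule inj_onI, rule ccontr)
  fix t t' assume t: "t : {..T}" "t' : {..T}" "Min (?N t) = Min (?N t')" "t ~= t'"
  then consider "t<t'" | "t'<t" by linarith
  thus False using sep[of t t'] sep[of t' t] t R self[of "Min (?N t)"] mW[of t] W by cases auto
 qed
 hence "card ?Y = Suc T" by (simp add: card_image)
 moreover have "R<dd y y'" if yy: "y : ?Y" "y' : ?Y" "y ~= y'" for y y'
 proof -
  obtain t t' where t: "t<=T" "t'<=T" "y = Min (?N t)" "y' = Min (?N t')" using yy by auto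
  then consider "t<t'" | "t'<t" using yy(3) by (metis linorder_neqE_nat)
  thus ?thesis using sep[of t t'] sep[of t' t] t sym[of y y'] by cases auto
 qed
 ultimately show ?thesis using mW by (intro exI[of _ ?Y]) auto
qed

text \<open>If \<open>T\<close> greedy steps left a point, there would be \<open>T + 1\<close>
  points of \<open>W\<close> more than \<open>2*(R/2^j)\<close> apart, too many for
  \<open>packing\<close>. For \<open>R = 0\<close> the set \<open>W\<close> is at most one
  point.\<close>

lemma net_empty:
 assumes met: "Metric_space {..<n} dd" and h: "halving {..<n} dd m" and W: "W<={..<n}"
  and x: "x<n" and far: "ALL p:W. dd x p <= R" and T: "(2 powr m) ^ j<=real T" "1<=T" and j: "1<=j"
 shows "net W (R/2 ^ (j - 1)) T = {}"
proof (rule ccontr)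
 assume ne: "net W (R/2 ^ (j - 1)) T ~= {}"
 then obtain p where p: "p : W" using net_sub by blast
 have nn: "0<=dd x y" for x y using met by (simp add: Metric_space.nonneg)
 have R0: "0 <= R" using far p nn[of x p] by force
 obtain Y where Y: "Y<=W" "card Y = Suc T" "ALL y:Y. ALL y':Y. y ~= y' --> R/2 ^ (j - 1)<dd y y'" using net_card[OF met W ne] R0 by auto
 have finY: "finite Y" using Y(2) by (metis card.infinite nat.distinct(1))
 show False
 proof (cases "R = 0")
  case True
  have "y = x" if "y : Y" for y
  proof -
   have "dd x y = 0" "y<n" using far Y(1) W that nn[of x y] True by force+
   thus ?thesis using met x by (metis Metric_space.zero lessThan_iff)
  qed
  hence "Y<={x}" by blast
  hence "card Y<=1" using card_mono[of "{x}" Y] by simp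
  thus False using Y(2) T(2) by simp
 next
  case False
  have e: "2*(R/2 ^ j) = R/2 ^ (j - 1)" using j by (cases j) auto
  have "real (card Y)<=(2 powr m) ^ j" by (rule packing[OF met h, of x R]) (use x False R0 Y W far finY e in auto)
  thus False using Y(2) T(1) by simp
 qed
qed

text \<open>Naming needs two halvings, \<open>(2 powr m)^2 <= 2^g\<close>. Diameter estimates need
  \<open>q + 1\<close> halvings, and \<open>m*(q+1) <= 2*m*q <= g*q\<close>.\<close>

lemma no_overflow:
 assumes met: "Metric_space {..<n} dd" and h: "halving {..<n} dd m" and g: "2*m<=real g" and m: "1<=m" and q: "1<=q"
 shows nice wide
proof -
 have 1: "(2 powr m) ^ 2<=real (2 ^ g)"
 proof -
  have "(2 powr m) ^ 2 = 2 powr (2*m)" by (simp add: power2_eq_square powr_add[symmetric])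
  also have "...<=2 powr real g" using g by simp
  finally show ?thesis by (simp add: powr_realpow)
 qed
 show nice unfolding nice_def
 proof (intro allI impI)
  fix c R assume c: "c<n"
  show "net (ballp c R) (R/2) (2 ^ g) = {}" using net_empty[OF met h, of "ballp c R" c R 2 "2 ^ g"] c 1 by (auto simp: ballp_def)
 qed
 have 2: "(2 powr m) ^ Suc q<=real (2 ^ (g*q))"
 proof -
  have "(2 powr m) ^ Suc q = 2 powr (m*real (Suc q))" by (subst powr_power) (auto simp: mult.commute simp del: of_nat_Suc power_Suc)
  also have "m*real (Suc q)<=m*(2*real q)" using q m by (intro mult_left_mono) auto
  also have "...<=real g*real q" using g mult_right_mono[of "2*m" "real g" "real q"] by (simp add: algebra_simps)
  finally show ?thesis by (simp add: powr_realpow[symmetric])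
 qed
 show wide unfolding wide_def
 proof (intro allI impI)
  fix W y R assume "W<={..<n} & y : W & (ALL p:W. dd y p <= R)"
  thus "net W (R/th) (2 ^ (g*q)) = {}" using net_empty[OF met h, of W y R "Suc q" "2 ^ (g*q)"] 2 by auto
 qed
qed

lemma scale_read:
 assumes "a<k" "b<k" "j<B"
 shows "EX bs. length bs = a+b+j+3 & (ALL rest. scale (bs @ rest) =
   (2 ^ j*(dd (z a) (z b)+2*r)/real k/th, 2 ^ j*(dd (z a) (z b)+2*r)/real k, rest))"
proof -
 let ?bs = "replicate a True @ False # replicate b True @ False # replicate j True @ [False]"
 have Sf: "(Suc ^^ m) 0 = m" for m by (induction m) auto
 have dbl: "((*) 2 ^^ m) v = 2 ^ m * v" for m and v :: real by (induction m) auto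
 have "scale (?bs @ rest) =
   (2 ^ j*(dd (z a) (z b)+2*r)/real k/th, 2 ^ j*(dd (z a) (z b)+2*r)/real k, rest)" for rest using gstep_unary[OF assms(1), of Suc 0 "replicate b True @ False # replicate j True @ False # rest"]
   gstep_unary[OF assms(2), of Suc 0 "replicate j True @ False # rest"]
   gstep_unary[OF assms(3), of "%E. E+E" "dd (z a) (z b)+2*r" rest] using assms unfolding scale_def by (simp add: Sf dbl)
 thus ?thesis by (intro exI[of _ ?bs]) simp
qed

end

section \<open>Feasible clusterings: coarsening, the penalised optimum, and the guess of its
  cost\<close>

section \<open>Feasible clusterings\<close>

text \<open>The classes of \<open>h\<close> are reached by merging two clusters with equal
  \<open>h\<close> at a time; each merge is feasible and reduces the number of clusters.\<close>

lemma merge_feasible: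
 assumes mg: "mergeable \<I> F" and I: "I : \<I>" and P: "feasible F I P"
 shows "feasible F I ((%v. \<Union>{C : P. h C = v}) ` h ` P)" using P
proof (induction "card P" arbitrary: P h rule: less_induct)
 case less
 have part: "partition_on (points I) P" using less(2) by (simp add: feasible_def clustering_def)
 have fin: "finite P" using part finite_UnionD[of P] by (simp add: partition_on_def points_def)
 show ?case
 proof (cases "inj_on h P")
  case True
  have "(%v. \<Union>{C : P. h C = v}) (h C) = C" if "C : P" for C
  proof -
   have "{C' : P. h C' = h C} = {C}" using that True by (auto simp: inj_on_def)
   thus ?thesis by simp
  qed
  hence "(%v. \<Union>{C : P. h C = v}) ` h ` P = P" unfolding image_image by simp
  thus ?thesis using less(2) by simp
 next
  case False
  then obtain C D where CD: "C : P" "D : P" "C ~= D" "h C = h D" by (auto simp: inj_on_def)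
  let ?P = "insert (C \<union> D) (P - {C, D})"
  have f: "feasible F I ?P" using mg I less(2) CD unfolding mergeable_def by blast
  have new: "C \<union> D ~: P - {C, D}"
  proof
   assume a: "C \<union> D : P - {C, D}"
   have "C ~= {}" using part CD by (auto simp: partition_on_def)
   then obtain x where "x : C" by blast
   hence ne: "C \<inter> (C \<union> D) ~= {}" by blast
   have x: "C ~= C \<union> D" "C \<union> D : P" using a by auto
   have "C \<inter> (C \<union> D) = {}" by (rule disjointD[OF partition_onD2[OF part] CD(1) x(2,1)])
   thus False using ne by blast
  qed
  have "card ?P = card (P - {C, D})+1" using new fin by simp
  also have "card (P - {C, D}) = card P - 2" using CD fin by (subst card_Diff_subset) auto
  also have "card P - 2+1<card P"
  proof -
   have "card {C, D}<=card P" using CD fin by (intro card_mono) auto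
   thus ?thesis using CD(3) by simp
  qed
  finally have lt: "card ?P<card P" .
  \<comment> \<open>The merged cluster inherits the value of its two parts, so the unions over the
    classes do not change.\<close>
  let ?h = "%E. if E = C \<union> D then h C else h E"
  have im: "?h ` ?P = h ` P"
  proof -
   have "?h ` ?P = insert (h C) (h ` (P - {C, D}))" using new by auto
   also have "... = h ` P" using CD by (auto simp: image_iff)
   finally show ?thesis .
  qed
  have U: "\<Union>{E : ?P. ?h E = v} = \<Union>{E : P. h E = v}" for v
  proof (cases "v = h C")
   case True
   have "{E : ?P. ?h E = v} = insert (C \<union> D) {E : P - {C, D}. h E = v}" using True new by auto
   moreover have "{E : P. h E = v} = insert C (insert D {E : P - {C, D}. h E = v})" using True CD by auto
   ultimately show ?thesis by auto
  next
   case False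
   have "{E : ?P. ?h E = v} = {E : P - {C, D}. h E = v}" using False new by auto
   moreover have "{E : P. h E = v} = {E : P - {C, D}. h E = v}" using False CD by auto
   ultimately show ?thesis by simp
  qed
  show ?thesis using less(1)[OF lt f, of ?h] unfolding im U .
 qed
qed

lemma coarse_feasible:
 assumes mg: "mergeable \<I> F" and I: "I : \<I>" and P: "feasible F I P" and L: "ALL C:P. EX c. ALL p:C. L p = c"
 shows "feasible F I ((%i. {j : points I. L j = L i}) ` points I)"
proof -
 have part: "partition_on (points I) P" using P by (simp add: feasible_def clustering_def)
 obtain h where h: "!!C p. C : P ==> p : C ==> L p = h C" using L by metis
 have U: "\<Union>{C : P. h C = v} = {j : points I. L j = v}" for v
 proof (intro set_eqI iffI)
  fix x assume "x : \<Union>{C : P. h C = v}"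
  then obtain C where C: "C : P" "h C = v" "x : C" by blast
  hence "x : points I" using part by (auto simp: partition_on_def)
  thus "x : {j : points I. L j = v}" using h[OF C(1,3)] C(2) by simp
 next
  fix x assume x: "x : {j : points I. L j = v}"
  then obtain C where C: "C : P" "x : C" using part by (auto simp: partition_on_def)
  thus "x : \<Union>{C : P. h C = v}" using h[OF C] x by auto
 qed
 have "L ` points I = h ` P"
 proof
  show "L ` points I<=h ` P" using part h by (fastforce simp: partition_on_def)
  show "h ` P<=L ` points I"
  proof
   fix v assume "v : h ` P"
   then obtain C where C: "C : P" "v = h C" by blast
   hence "C ~= {}" using part unfolding partition_on_def by auto
   then obtain p where "p : C" by blast
   hence "L p = v" "p : points I" using part C h[OF C(1)] by (auto simp: partition_on_def)
   thus "v : L ` points I" by blast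
  qed
 qed
 hence "(%i. {j : points I. L j = L i}) ` points I = (%v. \<Union>{C : P. h C = v}) ` h ` P" unfolding U by (metis (no_types) image_image)
 thus ?thesis using merge_feasible[OF mg I P] by simp
qed

lemma diam_facts:
 assumes "finite C" "C ~= {}"
 shows "x : C ==> y : C ==> d x y<=diam d C" and "EX x:C. EX y:C. diam d C = d x y"
  and "(!!x y. x : C ==> y : C ==> d x y<=b) ==> diam d C<=b"
proof -
 have e: "{d x y | x y. x : C & y : C} = (%(x, y). d x y) ` (C \<times> C)" by auto
 have fin: "finite {d x y | x y. x : C & y : C}" unfolding e using assms by simp
 have ne: "{d x y | x y. x : C & y : C} ~= {}" using assms by auto
 show "x : C ==> y : C ==> d x y<=diam d C" unfolding diam_def using fin by (intro Max_ge) auto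
 show ex: "EX x:C. EX y:C. diam d C = d x y" unfolding diam_def using Max_in[OF fin ne] by auto
 show "(!!x y. x : C ==> y : C ==> d x y<=b) ==> diam d C<=b" using ex by auto
qed

locale feasible_instance =
 fixes \<I> :: "inst set" and F :: "inst => nat set set => bool" and I :: inst
 assumes mg: "mergeable \<I> F" and II: "I : \<I>" and wfI: "wf_inst I" and exQ: "EX Q. feasible F I Q"
begin

abbreviation "n \<equiv> npts I"
abbreviation "k \<equiv> nclus I"
abbreviation "dd \<equiv> dst I"
abbreviation "dm \<equiv> diam (dst I)"

lemma met: "Metric_space {..<n} dd" and k1: "1<=k" and n1: "1<=n" using wfI by (auto simp: wf_inst_def points_def)

lemma fpart: "feasible F I P ==> partition_on {..<n} P" and fcard: "feasible F I P ==> card P<=k" by (auto simp: feasible_def clustering_def points_def)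

lemma fin: "partition_on {..<n} P ==> finite P" using finite_UnionD[of P] by (simp add: partition_on_def)

lemma cl_fin: "partition_on {..<n} P ==> C : P ==> finite C & C ~= {} & C<={..<n}" by (auto simp: partition_on_def intro: finite_subset[of _ "{..<n}"])

lemma dm0: "finite C ==> C ~= {} ==> 0<=dm C" using diam_facts(2)[of C dd] met by (auto simp: Metric_space.nonneg)

text \<open>The constant \<open>c\<close> is a penalty per cluster. It makes merging strictly
  attractive unless it really increases the diameters.\<close>

lemma minimiser: "EX P. feasible F I P & (ALL Q. feasible F I Q --> (SUM C:P. dm C+c)<=(SUM C:Q. dm C+c))"
proof -
 let ?\<Phi> = "%P. SUM C:P. dm C+c"
 have "{P. feasible F I P}<=Pow (Pow {..<n})" using fpart by (auto simp: partition_on_def)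
 hence f: "finite {P. feasible F I P}" by (rule finite_subset) simp
 hence "Min (?\<Phi> ` {P. feasible F I P}) : ?\<Phi> ` {P. feasible F I P}" using exQ by (intro Min_in) auto
 then obtain P where P: "feasible F I P" "?\<Phi> P = Min (?\<Phi> ` {P. feasible F I P})" by auto
 thus ?thesis using f by (intro exI[of _ P]) auto
qed

text \<open>Replacing the family \<open>A\<close> by its union is feasible by mergeability, so it
  cannot beat the minimum.\<close>

lemma merged_sum:
 assumes P: "feasible F I P" and min: "!!Q. feasible F I Q ==> (SUM C:P. dm C+c)<=(SUM C:Q. dm C+c)"
  and A: "A<=P" "A ~= {}"
 shows "(SUM C:A. dm C+c)<=dm (\<Union>A)+c"
proof -
 note part = fpart[OF P]
 have finP: "finite P" using fin[OF part] .
 obtain C0 where C0: "C0 : A" using A by blast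
 let ?h = "%C. if C : A then C0 else C"
 let ?Q = "(%v. \<Union>{C : P. ?h C = v}) ` ?h ` P"
 have Qf: "feasible F I ?Q" by (rule merge_feasible[OF mg II P])
 have hP: "?h ` P = insert C0 (P - A)" using A C0 by auto
 have h1: "\<Union>{C : P. ?h C = C0} = \<Union>A"
 proof -
  have "{C : P. ?h C = C0} = A" using A C0 by auto
  thus ?thesis by simp
 qed
 have h2: "\<Union>{C : P. ?h C = E} = E" if "E : P - A" for E
 proof -
  have "{C : P. ?h C = E} = {E}" using that C0 by auto
  thus ?thesis by simp
 qed
 have "(%v. \<Union>{C : P. ?h C = v}) ` (P - A) = (%v. v) ` (P - A)" by (rule image_cong[OF refl h2])
 hence Q: "?Q = insert (\<Union>A) (P - A)" unfolding hP image_insert h1 by (simp only: image_ident)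
 have "(SUM C:insert (\<Union>A) (P - A). dm C+c)<=(dm (\<Union>A)+c)+(SUM C:P - A. dm C+c)"
 proof (cases "\<Union>A : P - A")
  case True
  have "C0<=\<Union>A" "C0 ~= {}" using C0 A cl_fin[OF part] by auto
  hence "C0 \<inter> \<Union>A ~= {}" by blast
  moreover have "C0 \<inter> \<Union>A = {}" by (rule disjointD[OF partition_onD2[OF part]]) (use True C0 A in auto)
  ultimately show ?thesis by blast
 next
  case False
  thus ?thesis using finP by simp
 qed
 moreover have "(SUM C:P. dm C+c) = (SUM C:P - A. dm C+c)+(SUM C:A. dm C+c)" using finP A by (simp add: sum.subset_diff)
 ultimately show ?thesis using min[OF Qf] unfolding Q by simp
qed

text \<open>Let \<open>M\<close> be the largest diameter in \<open>Q\<close>, attained at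
  \<open>x\<close> and \<open>y\<close>, and let \<open>z a\<close>, \<open>z b\<close> be centres
  within \<open>r\<close> of them. Then \<open>e = dd (z a) (z b) + 2*r\<close> satisfies
  \<open>M <= e <= M + 4*r <= 5*M\<close>, while the cost is between \<open>M\<close> and
  \<open>k*M\<close>; doubling \<open>e\<close> at most \<open>k\<close> times reaches it.\<close>

lemma scale_exists:
 assumes Q: "feasible F I Q" and z: "ALL i<=k. z i<n" and r: "ALL p<n. EX i<k. dd (z i) p<=r" "ALL i<=k. ALL j<=k. i ~= j --> r<=dd (z i) (z j)"
 shows "EX a<k. EX b<k. EX j<=k. cost I Q<=2 ^ j*(dd (z a) (z b)+2*r) & 2 ^ j*(dd (z a) (z b)+2*r)<=5*cost I Q"
proof -
 note part = fpart[OF Q]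
 interpret Metric_space "{..<n}" dd by (rule met)
 have finQ: "finite Q" using fin[OF part] .
 have neQ: "Q ~= {}"
 proof
  assume "Q = {}"
  hence "{..<n} = {}" using part by (simp add: partition_on_def)
  moreover have "0 : {..<n}" using n1 by simp
  ultimately show False by simp
 qed
 have "Max (dm ` Q) : dm ` Q" using finQ neQ by (intro Max_in) auto
 then obtain C0 where C0: "C0 : Q" "dm C0 = Max (dm ` Q)" by auto
 let ?M = "dm C0"
 have M: "dm C<=?M" if "C : Q" for C unfolding C0(2) using finQ that by (intro Max_ge) auto
 have cost1: "?M<=cost I Q" unfolding cost_def using C0(1) finQ cl_fin[OF part] dm0 by (intro member_le_sum) auto
 have M0: "0<=?M" using dm0 cl_fin[OF part C0(1)] by blast
 have "cost I Q<=real (card Q)*?M" unfolding cost_def using M by (intro sum_bounded_above) auto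
 also have "...<=real k*?M" using fcard[OF Q] M0 by (intro mult_right_mono) auto
 finally have cost2: "cost I Q<=real k*?M" .
 obtain x y where xy: "x : C0" "y : C0" "?M = dd x y" using diam_facts(2)[of C0 dd] cl_fin[OF part C0(1)] by blast
 have xyn: "x<n" "y<n" using cl_fin[OF part C0(1)] xy by auto
 obtain a b where ab: "a<k" "dd (z a) x<=r" "b<k" "dd (z b) y<=r" using r(1) xyn by blast
 have zn: "z a<n" "z b<n" using z ab by auto
 let ?e = "dd (z a) (z b)+2*r"
 have e1: "?M<=?e" using triangle[of x "z a" y] triangle[of "z a" "z b" y] zn xyn xy ab commute[of x "z a"] by simp
 \<comment> \<open>Pigeonhole: two of the \<open>k + 1\<close> centres lie in one cluster, and they
   are at least \<open>r\<close> apart.\<close>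
 have "r<=?M"
 proof -
  have "ALL i. EX C. i<=k --> C : Q & z i : C"
  proof
   fix i show "EX C. i<=k --> C : Q & z i : C" using z part by (cases "i<=k") (auto simp: partition_on_def)
  qed
  then obtain c where c: "!!i. i<=k ==> c i : Q & z i : c i" by metis
  have "~ inj_on c {..k}"
  proof
   assume "inj_on c {..k}"
   hence "card {..k}<=card Q" using c finQ by (intro card_inj_on_le[of c]) auto
   thus False using fcard[OF Q] by simp
  qed
  then obtain i j where ij: "i<=k" "j<=k" "i ~= j" "c i = c j" by (auto simp: inj_on_def)
  have "r<=dd (z i) (z j)" using r(2) ij by blast
  also have "...<=dm (c i)" using diam_facts(1)[of "c i" "z i" "z j" dd] cl_fin[OF part, of "c i"] c[OF ij(1)] c[OF ij(2)] ij(4) by auto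
  also have "...<=?M" using M c[OF ij(1)] by blast
  finally show ?thesis .
 qed
 moreover have "?e<=?M+4*r" using triangle[of "z a" x "z b"] triangle[of x y "z b"] zn xyn xy ab commute[of y "z b"] by simp
 ultimately have e2: "?e<=5*?M" by simp
 have big: "cost I Q<=2 ^ k*?e"
 proof -
  have "real k*?M<=2 ^ k*?M" using M0 of_nat_less_two_power[of k, where ?'a = real] by (intro mult_right_mono) auto
  also have "...<=2 ^ k*?e" using e1 by simp
  finally show ?thesis using cost2 by simp
 qed
 \<comment> \<open>With the least such \<open>j\<close>, either \<open>j = 0\<close> and
   \<open>e <= 5*M\<close>, or the previous power is below the cost and one doubling overshoots by
   at most 2.\<close>
 define j where "j = (LEAST j. cost I Q<=2 ^ j*?e)"
 have j1: "cost I Q<=2 ^ j*?e" unfolding j_def by (rule LeastI[of _ k]) (rule big)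
 have j2: "j<=k" unfolding j_def by (rule Least_le) (rule big)
 have "2 ^ j*?e<=5*cost I Q"
 proof (cases j)
  case 0
  thus ?thesis using e2 cost1 by simp
 next
  case (Suc i)
  hence "~ cost I Q<=2 ^ i*?e" unfolding j_def by (metis lessI not_less_Least)
  thus ?thesis using Suc cost1 M0 by simp
 qed
 thus ?thesis using ab j1 j2 by blast
qed

text \<open>The penalty \<open>6*dl\<close> survives rounding: each rounded diameter gains at most
  \<open>dl\<close>. Summed over at most \<open>k\<close> clusters of the comparison clustering it
  costs \<open>6*k*dl = 6*E/2^q\<close>.\<close>

lemma target_guide:
 assumes q: "10<=q" and g: "1<=g" and E: "cost I Qs<=E" and Qs: "feasible F I Qs" and dl: "dl = E/real k/2 ^ q"
 shows "EX P DD tt. feasible F I P & guide n k g q (100*k*g*q) dd P DD dl (E/real k) tt &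
   sum DD P<=cost I Qs+6*E/2 ^ q"
proof -
 let ?th = "2 ^ q :: real"
 obtain P where P: "feasible F I P" and min: "!!Q. feasible F I Q ==> (SUM C:P. dm C+6*dl)<=(SUM C:Q. dm C+6*dl)" using minimiser by metis
 note part = fpart[OF P]
 have finP: "finite P" using fin[OF part] .
 have cl: "finite C" "C ~= {}" "C<={..<n}" if "C : P" for C using cl_fin[OF part that] by auto
 have dmC: "0<=dm C" if "C : P" for C using dm0 cl[OF that] by blast
 have cost0: "0<=cost I Qs" unfolding cost_def using cl_fin[OF fpart[OF Qs]] dm0 by (intro sum_nonneg) auto
 have E0: "0<=E" using E cost0 by simp
 have dl0: "0<=dl" unfolding dl using E0 by simp
 have th: "1024<=?th"
 proof -
  have "(2::real) ^ 10<=2 ^ q" using q by (rule power_increasing) simp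
  thus ?thesis by simp
 qed
 have kdl: "real k*dl = E/?th" unfolding dl using k1 by simp
 have \<Phi>: "(SUM C:P. dm C+6*dl)<=cost I Qs+6*E/?th"
 proof -
  have "(SUM C:P. dm C+6*dl)<=cost I Qs+real (card Qs)*(6*dl)" using min[OF Qs] by (simp add: cost_def sum.distrib)
  also have "...<=cost I Qs+real k*(6*dl)" using fcard[OF Qs] dl0 by (intro add_left_mono mult_right_mono) auto
  also have "... = cost I Qs+6*(real k*dl)" by simp
  finally show ?thesis unfolding kdl by simp
 qed
 define tt where "tt C = (if dl = 0 then 0 else nat \<lfloor>dm C/dl\<rfloor>)" for C
 define DD where "DD C = real (tt C+1)*dl" for C
 \<comment> \<open>If \<open>dl = 0\<close> then \<open>E = 0\<close>, so the minimum is 0 and every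
   diameter vanishes.\<close>
 have zero: "dm C = 0" if "dl = 0" "C : P" for C
 proof -
  have "E = 0" using that(1) dl k1 by simp
  hence "sum dm P<=0" using \<Phi> E that(1) by simp
  hence "sum dm P = 0" using sum_nonneg[of P dm] dmC by force
  thus ?thesis using sum_nonneg_eq_0_iff[OF finP, of dm] dmC that(2) by blast
 qed
 have tt: "real (tt C)*dl<=dm C" "dm C<=DD C" if "C : P" for C
 proof -
  show "real (tt C)*dl<=dm C"
  proof (cases "dl = 0")
   case False
   hence "real (tt C)<=dm C/dl" unfolding tt_def using dmC[OF that] dl0 by simp
   thus ?thesis using False dl0 by (simp add: field_simps)
  qed (use dmC that in simp)
  show "dm C<=DD C"
  proof (cases "dl = 0")
   case False
   have "dm C/dl<real (tt C)+1" unfolding tt_def using dmC[OF that] dl0 False by simp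
   thus ?thesis unfolding DD_def using False dl0 by (simp add: field_simps)
  qed (use zero that in "simp add: DD_def")
 qed
 have DD_le: "DD C<=dm C+dl" if "C : P" for C unfolding DD_def using tt(1)[OF that] by (simp add: algebra_simps)
 have merged: "(SUM C:A. dm C+6*dl)<=dm (\<Union>A)+6*dl" if "A<=P" "A ~= {}" for A by (rule merged_sum[OF P min that])
 have met': "Metric_space {..<n} dd" by (rule met)
 have nn: "0<=dd x y" and sym: "dd x y = dd y x" for x y using met by (auto simp: Metric_space.nonneg Metric_space.commute)
 have att: "EX x:\<Union>A. EX y:\<Union>A. dm (\<Union>A) = dd x y" if "A<=P" "A ~= {}" for A
 proof (rule diam_facts(2))
  show "finite (\<Union>A)" using finP cl that by (intro finite_Union) (auto intro: finite_subset)
  show "\<Union>A ~= {}" using cl that by fastforce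
 qed
 have lmdl: "E/real k = ?th*dl" unfolding dl by simp
 have "guide n k g q (100*k*g*q) dd P DD dl (E/real k) tt"
 proof (intro guide.intro target.intro guide_axioms.intro)
  show "Metric_space {..<n} dd" by (rule met)
  show "partition_on {..<n} P" by (rule part)
  show "10<=q" by (rule q)
  show "0<=dl" by (rule dl0)
  show "dd x y<=DD C" if "C : P" "x : C" "y : C" for C x y using diam_facts(1)[of C x y dd] cl[OF that(1)] that tt(2)[OF that(1)] by force
  show "dl<=DD C" if "C : P" for C unfolding DD_def using dl0 by (simp add: algebra_simps)
  show "DD C = 0" if "C : P" "dl = 0" for C using that by (simp add: DD_def)
  \<comment> \<open>Minimality gains \<open>6*dl\<close> per member of \<open>A\<close>, rounding
    takes back one \<open>dl\<close> each and the united cluster pays \<open>6*dl\<close>; the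
    balance \<open>5*card A - 6\<close> is positive from two members on.\<close>
  show "EX x:\<Union>A. EX y:\<Union>A. sum DD A<=dd x y" if A: "A<=P" "2<=card A" for A
  proof -
   have ne: "A ~= {}" using A by auto
   have "sum DD A<=(SUM C:A. dm C+dl)" using DD_le A by (intro sum_mono) auto
   also have "... = (SUM C:A. dm C+6*dl) - 5*real (card A)*dl" by (simp add: sum.distrib algebra_simps)
   also have "...<=dm (\<Union>A)+6*dl - 5*real (card A)*dl" using merged[OF A(1) ne] by simp
   also have "...<=dm (\<Union>A)"
   proof -
    have "6*dl<=(5*real (card A))*dl" using A(2) dl0 by (intro mult_right_mono) auto
    thus ?thesis by simp
   qed
   finally show ?thesis using att[OF A(1) ne] by force
  qed
  show "EX x:C. EX y:C'. DD C+DD C'+4*dl<=dd x y" if C: "C : P" "C' : P" "C ~= C'" for C C'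
  proof (cases "dl = 0")
   case True
   obtain x y where "x : C" "y : C'" using cl(2)[OF C(1)] cl(2)[OF C(2)] by blast
   thus ?thesis using True nn[of x y] by (intro bexI[of _ x] bexI[of _ y]) (auto simp: DD_def)
  next
   case False
   have "dm C+dm C'+6*dl<=dm (C \<union> C')" using merged[of "{C, C'}"] C by simp
   hence b: "DD C+DD C'+4*dl<=dm (C \<union> C')" using DD_le[OF C(1)] DD_le[OF C(2)] by simp
   obtain x y where xy: "x : C \<union> C'" "y : C \<union> C'" "dm (C \<union> C') = dd x y" using att[of "{C, C'}"] C by auto
   have pos: "0<dl" using False dl0 by simp
   \<comment> \<open>Two points of the same cluster are too close to realise the diameter of the
     union, so one lies in \<open>C\<close> and the other in \<open>C'\<close>.\<close>
   have no: "~ (x : D & y : D)" if "D = C | D = C'" for D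
   proof
    assume "x : D & y : D"
    hence "dd x y<=dm D" using diam_facts(1)[of D x y dd] cl C that by auto
    thus False using b xy(3) tt(2)[OF C(1)] tt(2)[OF C(2)] dmC[OF C(1)] dmC[OF C(2)] pos that by force
   qed
   hence "(x : C & y : C') | (y : C & x : C')" using xy by blast
   thus ?thesis using b xy bexI sym by metis
  qed
  show "E/real k = ?th*dl" by (rule lmdl)
  show "DD C = real (tt C+1)*dl" for C by (simp add: DD_def)
  show "card P<=k" by (rule fcard[OF P])
  show "1<=k" by (rule k1)
  show "1<=g" by (rule g)
  \<comment> \<open>A unary digit is worth \<open>th*dl = E/k\<close>, and the diameters sum to at
    most \<open>E + 6*E/th <= 3*E\<close>.\<close>
  show "(SUM C:P. tt C div 2 ^ q)<=3*k"
  proof (cases "dl = 0")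
   case False
   have pos: "0<dl" using False dl0 by simp
   have "real (tt C div 2 ^ q)*(?th*dl)<=dm C" if "C : P" for C
   proof -
    have "real (tt C div 2 ^ q)*?th<=real (tt C)"
    proof -
    have "tt C div 2 ^ q*2 ^ q<=tt C" by simp
    hence "real (tt C div 2 ^ q*2 ^ q)<=real (tt C)" by (simp only: of_nat_le_iff)
    thus ?thesis by simp
    qed
    hence "real (tt C div 2 ^ q)*?th*dl<=real (tt C)*dl" using dl0 by (rule mult_right_mono)
    thus ?thesis using tt(1)[OF that] by (simp add: mult.assoc)
   qed
   hence "(SUM C:P. real (tt C div 2 ^ q)*(?th*dl)) <= sum dm P" by (rule sum_mono)
   also have "sum dm P<=(SUM C:P. dm C+6*dl)" using dl0 by (intro sum_mono) simp
   also have "...<=E+6*E/?th" using \<Phi> E by simp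
   also have "...<=3*E"
   proof -
    have "6*E/?th<=6*E/6" using E0 th by (intro divide_left_mono) auto
    thus ?thesis using E0 by simp
   qed
   also have "3*E = real (3*k)*(?th*dl)" using kdl by (simp add: field_simps)
   finally have "real (SUM C:P. tt C div 2 ^ q)*(?th*dl)<=real (3*k)*(?th*dl)" by (simp add: sum_distrib_right)
   hence "real (SUM C:P. tt C div 2 ^ q)<=real (3*k)" using pos by (simp add: mult_le_cancel_right)
   thus ?thesis by (simp only: of_nat_le_iff)
  qed (simp add: tt_def)
  show "100*k*g*q<=100*k*g*q" by simp
 qed
 moreover have "sum DD P<=cost I Qs+6*E/?th"
 proof -
  have "sum DD P<=(SUM C:P. dm C+6*dl)" 
  proof (rule sum_mono)
   fix C assume "C : P"
   thus "DD C<=dm C+6*dl" using DD_le dl0 by force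
  qed
  thus ?thesis using \<Phi> by simp
 qed
 ultimately show ?thesis using P by blast
qed

end

section \<open>The complete program and its execution\<close>

section \<open>The main program\<close>

text \<open>
  Integer arrays 70--73 are loop variables and a farthest point; real array 11 holds the distances
  to the centres chosen so far.
\<close>

definition SETB :: prog where
 "SETB = seti 3 I0;; For 70 0 1 (For 71 5 0 (For 72 4 0 (seti 3 (IPlus (iv 3) (IConst 100)))))"

definition SETP :: prog where
 "SETP = seti 6 I1;; For 70 3 0 (seti 6 (IPlus (iv 6) (iv 6)));;
   seti 7 I1;; For 70 5 0 (seti 7 (IPlus (iv 7) (iv 7)));;
   seti 8 I1;; For 70 5 0 (For 71 4 0 (seti 8 (IPlus (iv 8) (iv 8))));;
   seti 9 (IPlus (iv 3) (iv 3))"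

definition FARTHEST :: prog where
 "FARTHEST = seti 73 I0;; setr 2 (RGet 11 I0);;
   For 31 0 0 (If (RLess (rv 2) (RGet 11 (iv 31))) (seti 73 (iv 31);; setr 2 (RGet 11 (iv 31))) PSkip)"

definition CLOSER :: prog where
 "CLOSER = For 31 0 0 (If (RLess (RDist (iv 73) (iv 31)) (RGet 11 (iv 31))) (PRSet 11 (iv 31) (RDist (iv 73) (iv 31))) PSkip)"

definition CENTRES :: prog where
 "CENTRES = PISet 15 I0 I0;; For 31 0 0 (PRSet 11 (iv 31) (RDist I0 (iv 31)));;
   For 71 0 1 (FARTHEST;; PISet 15 (IPlus (iv 71) I1) (iv 73);; CLOSER)"

definition QLOOP :: com where
 "QLOOP = Seq (ISet 4 I0 (IConst 10)) (Seq (RSet 1 I0 (ROfInt (IConst 1024)))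
   (Loop (RLess (RTimes (rv 1) (rv 0)) (ROfInt (IConst 1000)))
    (Seq (RSet 1 I0 (RPlus (rv 1) (rv 1))) (ISet 4 I0 (IPlus (iv 4) I1)))))"

definition ATTEMPT :: com where
 "ATTEMPT = Seq (ISet 5 I0 (IPlus (iv 5) I1)) (Seq (compile SETB) (Seq (compile SETP) (compile ROUND)))"

definition MAIN :: com where
 "MAIN = Cond (ILess (IGet 0 I0) (IConst 2)) Skip
   (Seq QLOOP (Seq (compile CENTRES) (Seq (ISet 5 I0 I0) (Seq (ISet 65 I0 I1)
    (Loop (ILess I0 (iv 65)) ATTEMPT)))))"

lemma [simp]: "piw SETB = {3,70,71,72}" "prw SETB = {}" by (auto simp: SETB_def)
lemma [simp]: "piw SETP = {6,7,8,9,70,71}" "prw SETP = {}" by (auto simp: SETP_def)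
lemma [simp]: "piw FARTHEST = {31,73}" "prw FARTHEST = {2}" by (auto simp: FARTHEST_def)
lemma [simp]: "piw CLOSER = {31}" "prw CLOSER = {11}" by (auto simp: CLOSER_def)
lemma [simp]: "piw CENTRES = {15,31,71,73}" "prw CENTRES = {2,11}" by (auto simp: CENTRES_def)

subsection \<open>Static properties\<close>

definition allowed :: "(nat \<times> int) set" where
 "allowed = {(0, 0), (0, 1), (3, 0), (4, 0), (5, 0), (6, 0), (7, 0), (8, 0), (9, 0)}"

text \<open>The syntactic conditions for the linear time bound: loop bounds are among a few constant
  cells, all of them at most \<open>H\<close> except the number of points.\<close>

definition static :: "prog => bool" where
 "static p <-> wf p & linear_prog p & bounds p<=allowed"

definition pstatic :: "prog => bool" where
 "pstatic p <-> wf p & pointfree p & bounds p<=allowed"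

lemma pointfree_linear: "pointfree p ==> linear_prog p" by (induction p) auto

lemma pstatic_static: "pstatic p ==> static p" by (simp add: pstatic_def static_def pointfree_linear)

lemma pstatic_simps [simp]:
 "pstatic PSkip" "pstatic (PISet a e1 e2)" "pstatic (PRSet a e1 f2)" "pstatic (p ;; r) = (pstatic p & pstatic r)"
 "pstatic (If b p r) = (pstatic p & pstatic r)"
 "pstatic (For v a i p) = (pstatic p & v ~: piw p & (a, i) ~= (0, 0) & (a, i) : allowed)" by (auto simp: pstatic_def)

lemma static_simps [simp]:
 "static PSkip" "static (PISet a e1 e2)" "static (PRSet a e1 f2)" "static (PCall x a)" "static (p ;; r) = (static p & static r)"
 "static (If b p r) = (static p & static r)"
 "static (For v a i p) = (if (a, i) = (0, 0) then pstatic p & v ~: piw p else static p & v ~: piw p & (a, i) : allowed)" by (auto simp: static_def pstatic_def allowed_def)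

lemma allowed_simps [simp]:
 "(0, 1) : allowed" "(3, 0) : allowed" "(4, 0) : allowed" "(5, 0) : allowed" "(6, 0) : allowed" "(7, 0) : allowed"
 "(8, 0) : allowed" "(9, 0) : allowed" by (auto simp: allowed_def)

lemma pstatic_READ: "pstatic READ" by (simp add: READ_def)
lemma pstatic_UNARY: "pstatic (UNARY a i p) <-> pstatic p & 14 ~: piw p & (a, i) ~= (0, 0) & (a, i) : allowed" by (auto simp: UNARY_def pstatic_READ)
lemma pstatic_READD: "pstatic READD" by (simp add: READD_def pstatic_READ pstatic_UNARY)
lemma pstatic_NUM: "pstatic NUM" by (simp add: NUM_def pstatic_READ)
lemma static_FILL: "31 ~= A ==> static (FILL A b)" "31 ~= A ==> static (KILL A b)" by (simp_all add: FILL_def KILL_def)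
lemma static_MINPT: "static MINPT" by (simp add: MINPT_def)
lemma static_DROPBALL: "static DROPBALL" by (simp add: DROPBALL_def static_FILL)
lemmas static_basic = pstatic_READ pstatic_UNARY pstatic_READD pstatic_NUM static_FILL static_MINPT static_DROPBALL
 pstatic_static[OF pstatic_READ] pstatic_static[OF pstatic_READD] pstatic_static[OF pstatic_NUM]
lemma static_NAME: "static NAME" by (simp add: NAME_def NETPICK_def static_basic)
lemma static_ITEM: "static ITEM" by (simp add: ITEM_def ANNOUNCE_def MARK_def WITNESS_def static_basic static_NAME)
lemma pstatic_COVERED: "pstatic COVERED" by (simp add: COVERED_def BLOCKED_def)
lemma static_TURNS: "static TURNS" by (simp add: TURNS_def TURN_def DISCOVER_def UNCOV_def LISTING_def static_ITEM pstatic_COVERED static_basic)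
lemma static_SCALE: "static SCALE" by (simp add: SCALE_def static_basic pstatic_static)
lemma static_ASSIGN: "static ASSIGN" by (simp add: ASSIGN_def ASTEP_def SSET_def SSTEP_def WSTEP_def RMV_def static_basic)
lemma static_UNIONS: "static UNIONS" by (simp add: UNIONS_def VISIT_def UNITE_def MERGE_def)
lemma static_LABEL: "static LABEL" by (simp add: LABEL_def LABELPT_def)
lemma static_DECODE: "static DECODE" by (simp add: DECODE_def static_SCALE static_TURNS static_ASSIGN static_UNIONS static_LABEL)
lemma static_EVAL: "static EVAL" by (simp add: EVAL_def EVALC_def DIAM_def FAR_def static_basic)
lemma static_ROUND: "static ROUND" by (simp add: ROUND_def TRIAL_def KEEP_def INCR_def static_DECODE static_EVAL)
lemma static_SETB: "static SETB" by (simp add: SETB_def)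
lemma static_SETP: "static SETP" by (simp add: SETP_def)
lemma static_CENTRES: "static CENTRES" by (simp add: CENTRES_def FARTHEST_def CLOSER_def)

subsection \<open>Bounded execution\<close>

definition runs :: "(nat set => nat => int => bool) => inst => com => state => nat => (state => bool) => bool" where
 "runs K I c s T Q <-> (EX t s'. exec K I c s t s' & t<=T & Q s')"

lemma runs_Seq:
 assumes "runs K I c s T Q1" "!!s1. Q1 s1 ==> runs K I c' s1 T' Q"
 shows "runs K I (Seq c c') s (T+T') Q" using assms unfolding runs_def by (meson add_mono exec.Seq)

lemma runs_mono: "runs K I c s T Q ==> T<=T' ==> (!!s'. Q s' ==> Q' s') ==> runs K I c s T' Q'" unfolding runs_def by (meson order_trans)

lemma runs_ISet: "Q (iupd a (ival I s e1) (ival I s e2) s) ==> runs K I (ISet a e1 e2) s (1+icost e1+icost e2) Q" unfolding runs_def by (meson exec.ISet order_refl)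

lemma runs_RSet: "Q (rupd a (ival I s e1) (rval I s e2) s) ==> runs K I (RSet a e1 e2) s (1+icost e1+rcost e2) Q" unfolding runs_def by (meson exec.RSet order_refl)

lemma runs_LoopF: "~ bval I s b ==> Q s ==> runs K I (Loop b c) s (1+bcost b) Q" unfolding runs_def by (meson exec.LoopF order_refl)

lemma runs_LoopT:
 assumes "bval I s b" "runs K I c s T Q1" "!!s1. Q1 s1 ==> runs K I (Loop b c) s1 T' Q"
 shows "runs K I (Loop b c) s (1+bcost b+T+T') Q" using assms runs_def exec.LoopT add_mono order_refl by fastforce

text \<open>Joins correctness and time: \<open>wp\<close> supplies a run, and every run obeys the
  syntactic bound.\<close>

lemma wp_runs:
 assumes wp: "wp K I p s Q" and st: "static p" and b: "!!a i. (a, i) : bounds p ==> a ~: piw p & ints s a i<=int (if (a, i) = (0, 0) then n else H)"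
  and H: "1<=H" "1<=n" and F: "!!C t v. K C t v ==> t<=Fb"
 shows "runs K I (compile p) s (sz p*H ^ dep p*(n+Fb)) (%s'. Q s' & frame p s s')"
proof -
 obtain t s' where e: "exec K I (compile p) s t s'" "Q s'" using wp unfolding wp_def by blast
 let ?W = "%x. if x = (0, 0) then n else H"
 have "t<=cost_of ?W Fb p" by (rule exec_time[OF e(1) _ _ F]) (use st b in "auto simp: static_def")
 also have "... <= sz p*H ^ dep p*(n+Fb)" by (rule cost_linear) (use st H in "auto simp: static_def")
 finally have "t <= sz p*H ^ dep p*(n+Fb)" .
 moreover have "frame p s s'" using exec_frame[OF e(1)] by (simp add: frame_def iw_compile rw_compile)
 ultimately show ?thesis unfolding runs_def using e by blast
qed

lemma wp_accum:
 assumes N: "ints s a i = int N" and v: "v ~: piw p" "a ~: piw p" "a ~= v" "v ~= x"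
  and body: "!!s'. frame (For v a i p) s s' ==> wp K I p s' (%s2. ints s2 x 0 = ints s' x 0+c)"
 shows "wp K I (For v a i p) s (%s'. ints s' x 0 = ints s x 0+int N*c)"
proof (rule wp_For[where N = N and Inv = "%j s'. ints s' x 0 = ints s x 0+int j*c", OF N v(1-3)])
 fix j s' assume "ints s' x 0 = ints s x 0+int j*c" and fr: "frame (For v a i p) s s'"
 thus "wp K I p s' (%s'. ints s' x 0 = ints s x 0+int (Suc j)*c)" by (intro wp_mono[OF body[OF fr]]) (simp add: algebra_simps)
qed (use v in auto)

lemma wp_pow:
 assumes N: "ints s a i = int N" and v: "v ~: piw p" "a ~: piw p" "a ~= v" "v ~= x"
  and body: "!!s'. frame (For v a i p) s s' ==> wp K I p s' (%s2. ints s2 x 0 = ints s' x 0*c)"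
 shows "wp K I (For v a i p) s (%s'. ints s' x 0 = ints s x 0*c ^ N)"
proof (rule wp_For[where N = N and Inv = "%j s'. ints s' x 0 = ints s x 0*c ^ j", OF N v(1-3)])
 fix j s' assume "ints s' x 0 = ints s x 0*c ^ j" and fr: "frame (For v a i p) s s'"
 thus "wp K I p s' (%s'. ints s' x 0 = ints s x 0*c ^ Suc j)" by (intro wp_mono[OF body[OF fr]]) (simp add: algebra_simps)
qed (use v in auto)

lemma SETB_wp:
 assumes "ints s 0 1 = int k" "ints s 5 0 = int g" "ints s 4 0 = int q"
 shows "wp K I SETB s (%s'. ints s' 3 0 = int (100*k*g*q))"
proof -
 let ?i = "For 72 4 0 (seti 3 (IPlus (iv 3) (IConst 100)))"
 have 1: "wp K I ?i s' (%s2. ints s2 3 0 = ints s' 3 0+int q*100)" if "ints s' 4 0 = int q" for s' by (rule wp_accum) (use that in auto)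
 have 2: "wp K I (For 71 5 0 ?i) s' (%s2. ints s2 3 0 = ints s' 3 0+int g*(int q*100))"
  if "ints s' 4 0 = int q" "ints s' 5 0 = int g" for s' by (rule wp_accum) (use that in "auto intro!: 1 dest!: frameD(1)[of _ _ _ 4]")
 have 3: "wp K I (For 70 0 1 (For 71 5 0 ?i)) s' (%s2. ints s2 3 0 = ints s' 3 0+int k*(int g*(int q*100)))"
  if "ints s' 4 0 = int q" "ints s' 5 0 = int g" "ints s' 0 1 = int k" for s'
 proof (rule wp_accum)
  fix s2 assume fr: "frame (For 70 0 1 (For 71 5 0 ?i)) s' s2"
  show "wp K I (For 71 5 0 ?i) s2 (%s3. ints s3 3 0 = ints s2 3 0+int g*(int q*100))" by (rule 2) (use that frameD(1)[OF fr, of 4] frameD(1)[OF fr, of 5] in auto)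
 qed (use that in auto)
 show ?thesis unfolding SETB_def wp_Sq wp_PISet by (rule wp_mono[OF 3]) (use assms in auto)
qed

lemma SETP_wp:
 assumes "ints s 3 0 = int B" "ints s 5 0 = int g" "ints s 4 0 = int q"
 shows "wp K I SETP s (%s'. ints s' 6 0 = int (2 ^ B) & ints s' 7 0 = int (2 ^ g) & ints s' 8 0 = int (2 ^ (g*q)) &
   ints s' 9 0 = int (2*B))"
proof -
 let ?Q = "%s'. ints s' 6 0 = int (2 ^ B) & ints s' 7 0 = int (2 ^ g) & ints s' 8 0 = int (2 ^ (g*q)) & ints s' 9 0 = int (2*B)"
 let ?l6 = "For 70 3 0 (seti 6 (IPlus (iv 6) (iv 6)))" and ?l7 = "For 70 5 0 (seti 7 (IPlus (iv 7) (iv 7)))"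
  and ?i8 = "For 71 4 0 (seti 8 (IPlus (iv 8) (iv 8)))"
 let ?l8 = "For 70 5 0 ?i8"
 have 6: "wp K I ?l6 s' (%s2. ints s2 6 0 = ints s' 6 0*2 ^ B)" if "ints s' 3 0 = int B" for s' by (rule wp_pow) (use that in auto)
 have 7: "wp K I ?l7 s' (%s2. ints s2 7 0 = ints s' 7 0*2 ^ g)" if "ints s' 5 0 = int g" for s' by (rule wp_pow) (use that in auto)
 have i8: "wp K I ?i8 s' (%s2. ints s2 8 0 = ints s' 8 0*2 ^ q)" if "ints s' 4 0 = int q" for s' by (rule wp_pow) (use that in auto)
 have 8: "wp K I ?l8 s' (%s2. ints s2 8 0 = ints s' 8 0*(2 ^ q) ^ g)" if "ints s' 5 0 = int g" "ints s' 4 0 = int q" for s'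
 proof (rule wp_pow)
  fix s2 assume fr: "frame ?l8 s' s2"
  show "wp K I ?i8 s2 (%s3. ints s3 8 0 = ints s2 8 0*2 ^ q)" by (rule i8) (use that frameD(1)[OF fr, of 4] in auto)
 qed (use that in auto)
 let ?s0 = "iupd 6 0 1 s"
 have "wp K I (?l6;; seti 7 I1;; ?l7;; seti 8 I1;; ?l8;; seti 9 (IPlus (iv 3) (iv 3))) ?s0 ?Q"
 proof (rule wp_step[OF 6])
  show "ints ?s0 3 0 = int B" using assms by simp
  fix s1 assume 1: "ints s1 6 0 = ints ?s0 6 0*2 ^ B" and fr1: "frame ?l6 ?s0 s1"
  have a1: "ints s1 3 0 = int B" "ints s1 5 0 = int g" "ints s1 4 0 = int q" "ints s1 6 0 = 2 ^ B" using assms 1 frameD(1)[OF fr1, of 3] frameD(1)[OF fr1, of 4] frameD(1)[OF fr1, of 5] by auto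
  let ?s1 = "iupd 7 0 1 s1"
  have "wp K I (?l7;; seti 8 I1;; ?l8;; seti 9 (IPlus (iv 3) (iv 3))) ?s1 ?Q"
  proof (rule wp_step[OF 7])
   show "ints ?s1 5 0 = int g" using a1 by simp
   fix s2 assume 2: "ints s2 7 0 = ints ?s1 7 0*2 ^ g" and fr2: "frame ?l7 ?s1 s2"
   have a2: "ints s2 3 0 = int B" "ints s2 5 0 = int g" "ints s2 4 0 = int q" "ints s2 6 0 = 2 ^ B" "ints s2 7 0 = 2 ^ g" using a1 2 frameD(1)[OF fr2, of 3] frameD(1)[OF fr2, of 4] frameD(1)[OF fr2, of 5] frameD(1)[OF fr2, of 6] by auto
   let ?s2 = "iupd 8 0 1 s2"
   have "wp K I (?l8;; seti 9 (IPlus (iv 3) (iv 3))) ?s2 ?Q"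
   proof (rule wp_step[OF 8])
    show "ints ?s2 5 0 = int g" "ints ?s2 4 0 = int q" using a2 by auto
    fix s3 assume 3: "ints s3 8 0 = ints ?s2 8 0*(2 ^ q) ^ g" and fr3: "frame ?l8 ?s2 s3"
    have a3: "ints s3 3 0 = int B" "ints s3 6 0 = 2 ^ B" "ints s3 7 0 = 2 ^ g" "ints s3 8 0 = 2 ^ (g*q)" using a2 3 frameD(1)[OF fr3, of 3] frameD(1)[OF fr3, of 6] frameD(1)[OF fr3, of 7] by (auto simp: power_mult[symmetric] mult.commute)
    thus "wp K I (seti 9 (IPlus (iv 3) (iv 3))) s3 ?Q" by simp
   qed
   thus "wp K I (seti 8 I1;; ?l8;; seti 9 (IPlus (iv 3) (iv 3))) s2 ?Q" unfolding wp_Sq[of _ _ "seti 8 I1"] by (simp only: wp_PISet ival.simps)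
  qed
  thus "wp K I (seti 7 I1;; ?l7;; seti 8 I1;; ?l8;; seti 9 (IPlus (iv 3) (iv 3))) s1 ?Q" unfolding wp_Sq[of _ _ "seti 7 I1"] by (simp only: wp_PISet ival.simps)
 qed
 thus ?thesis unfolding SETP_def wp_Sq[of _ _ "seti 6 I1"] by (simp only: wp_PISet ival.simps)
qed

subsection \<open>Initial centres\<close>

text \<open>The state of farthest-point traversal: the first \<open>m\<close> centres cover within
  \<open>r\<close>, and together with the next one they are pairwise at least \<open>r\<close>
  apart.\<close>

definition spread :: "nat => nat => (nat => nat => real) => (nat => nat) => real => bool" where
 "spread n m d z r <-> (ALL i<=m. z i<n) & (ALL p<n. EX i<m. d (z i) p<=r) & (ALL i<=m. ALL j<=m. i<j --> r<=d (z i) (z j))"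

lemma FARTHEST_wp:
 assumes n: "ints s 0 0 = int n" "1<=n"
 shows "wp K I FARTHEST s (%s'. EX b<n. ints s' 73 0 = int b & reals s' 2 0 = reals s 11 (int b) &
   (ALL p<n. reals s 11 (int p)<=reals s 11 (int b)))"
proof -
 let ?s = "rupd 2 0 (reals s 11 0) (iupd 73 0 0 s)"
 let ?p = "If (RLess (rv 2) (RGet 11 (iv 31))) (seti 73 (iv 31);; setr 2 (RGet 11 (iv 31))) PSkip"
 have "wp K I (For 31 0 0 ?p) ?s (%s'. EX b<n. ints s' 73 0 = int b & reals s' 2 0 = reals s 11 (int b) &
   (ALL p<n. reals s 11 (int p)<=reals s 11 (int b)))"
 proof (rule wp_For[where N = n and Inv = "%m s'. EX b<n. ints s' 73 0 = int b & reals s' 2 0 = reals s 11 (int b) &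
   (ALL p<m. reals s 11 (int p)<=reals s 11 (int b))"])
  fix m :: nat and s' :: state assume m: "m<n" and "EX b<n. ints s' 73 0 = int b & reals s' 2 0 = reals s 11 (int b) &
   (ALL p<m. reals s 11 (int p)<=reals s 11 (int b))" and v: "ints s' 31 0 = int m" and fr: "frame (For 31 0 0 ?p) ?s s'"
  then obtain b where b: "b<n" "ints s' 73 0 = int b" "reals s' 2 0 = reals s 11 (int b)" "ALL p<m. reals s 11 (int p)<=reals s 11 (int b)" by blast
  have e: "reals s' 11 = reals s 11" using frameD(2)[OF fr, of 11] by (simp add: rupd_def iupd_def)
  show "wp K I ?p s' (%s'. EX b<n. ints s' 73 0 = int b & reals s' 2 0 = reals s 11 (int b) &
   (ALL p<Suc m. reals s 11 (int p)<=reals s 11 (int b)))" using b less_Suc_eq e v m by auto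
 next
  show "EX b<n. ints ?s 73 0 = int b & reals ?s 2 0 = reals s 11 (int b) & (ALL p<0. reals s 11 (int p)<=reals s 11 (int b))" using n by (intro exI[of _ 0]) auto
 qed (use n in auto)
 thus ?thesis unfolding FARTHEST_def by simp
qed

lemma CLOSER_wp:
 assumes n: "ints s 0 0 = int n" and b: "ints s 73 0 = int b" and d: "dst I = dd"
 shows "wp K I CLOSER s (%s'. ALL p<n. reals s' 11 (int p) = min (reals s 11 (int p)) (dd b p))" unfolding CLOSER_def
proof (rule wp_For[where N = n and Inv = "%m s'. ALL p<n. reals s' 11 (int p) = (if p<m then min (reals s 11 (int p)) (dd b p) else reals s 11 (int p))"])
 let ?p = "If (RLess (RDist (iv 73) (iv 31)) (RGet 11 (iv 31))) (PRSet 11 (iv 31) (RDist (iv 73) (iv 31))) PSkip"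
 fix m :: nat and s' :: state assume m: "m<n" and inv: "ALL p<n. reals s' 11 (int p) = (if p<m then min (reals s 11 (int p)) (dd b p) else reals s 11 (int p))"
  and v: "ints s' 31 0 = int m" and fr: "frame (For 31 0 0 ?p) s s'"
 have 73: "ints s' 73 0 = int b" using b frameD(1)[OF fr, of 73] by simp
 have e: "reals s' 11 (int m) = reals s 11 (int m)" using inv m by simp
 let ?s2 = "if dd b m<reals s 11 (int m) then rupd 11 (int m) (dd b m) s' else s'"
 have "ALL p<n. reals ?s2 11 (int p) = (if p<Suc m then min (reals s 11 (int p)) (dd b p) else reals s 11 (int p))" using inv e min_def less_Suc_eq by simp
 thus "wp K I ?p s' (%s'. ALL p<n. reals s' 11 (int p) = (if p<Suc m then min (reals s 11 (int p)) (dd b p) else reals s 11 (int p)))" using v 73 e d by (cases "dd b m<reals s 11 (int m)") simp_all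
qed (use n in auto)

text \<open>Array 11 holds the distance to the nearest chosen centre. The farthest point becomes the
  next centre, and its distance is at once the covering radius of the old centres and a separation
  of all of them.\<close>

lemma CENTRES_wp:
 assumes n: "ints s 0 0 = int n" "1<=n" and k: "ints s 0 1 = int k" "1<=k" and d: "dst I = dd" and met: "Metric_space {..<n} dd"
 shows "wp K I CENTRES s (%s'. EX z. (ALL i<=k. ints s' 15 (int i) = int (z i)) & spread n k dd z (reals s' 2 0))"
proof -
 let ?Q = "%s'. EX z. (ALL i<=k. ints s' 15 (int i) = int (z i)) & spread n k dd z (reals s' 2 0)"
 let ?s = "iupd 15 0 0 s"
 let ?init = "For 31 0 0 (PRSet 11 (iv 31) (RDist I0 (iv 31)))"
 let ?step = "FARTHEST;; PISet 15 (IPlus (iv 71) I1) (iv 73);; CLOSER"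
 have sym: "dd x y = dd y x" for x y using met by (simp add: Metric_space.commute)
 have init: "wp K I ?init ?s (%s'. ALL p<n. reals s' 11 (int p) = dd 0 p)" by (rule wp_For[where N = n and Inv = "%m s'. ALL p<m. reals s' 11 (int p) = dd 0 p"]) (use n d in "auto simp: less_Suc_eq")
 let ?Inv = "%m s'. EX z. (ALL i<=m. ints s' 15 (int i) = int (z i)) & (ALL i<=m. z i<n) &
   (ALL p<n. (ALL i<=m. reals s' 11 (int p)<=dd (z i) p) & (EX i<=m. reals s' 11 (int p) = dd (z i) p)) &
   (0<m --> spread n m dd z (reals s' 2 0))"
 have "wp K I (?init;; For 71 0 1 ?step) ?s ?Q"
 proof (rule wp_step[OF init])
  fix s1 assume 1: "ALL p<n. reals s1 11 (int p) = dd 0 p" and fr1: "frame ?init ?s s1"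
  have e1: "ints s1 0 1 = int k" "ints s1 0 0 = int n" "ints s1 15 0 = 0" using frameD(1)[OF fr1, of 0] frameD(1)[OF fr1, of 15] n k by auto
  show "wp K I (For 71 0 1 ?step) s1 ?Q"
  proof (rule wp_For[where N = k and Inv = ?Inv])
   show "?Inv 0 s1" using 1 e1 n by (intro exI[of _ "%_. 0"]) auto
   show "?Inv m (iupd 71 0 x s')" if "?Inv m s'" for m s' x using that by simp
   show "?Q s'" if "?Inv k s'" for s' using that k by auto
   fix m s' assume m: "m<k" and "?Inv m s'" and v: "ints s' 71 0 = int m" and fr: "frame (For 71 0 1 ?step) s1 s'"
   then obtain z where z: "ALL i<=m. ints s' 15 (int i) = int (z i)" "ALL i<=m. z i<n"
    "ALL p<n. (ALL i<=m. reals s' 11 (int p)<=dd (z i) p) & (EX i<=m. reals s' 11 (int p) = dd (z i) p)"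
    "0<m --> spread n m dd z (reals s' 2 0)" by blast
   have n': "ints s' 0 0 = int n" using e1 frameD(1)[OF fr, of 0] by simp
   show "wp K I ?step s' (?Inv (Suc m))"
   proof (rule wp_step[OF FARTHEST_wp[OF n' n(2)]])
    fix s2 assume "EX b<n. ints s2 73 0 = int b & reals s2 2 0 = reals s' 11 (int b) & (ALL p<n. reals s' 11 (int p)<=reals s' 11 (int b))"
    and fr2: "frame FARTHEST s' s2"
    then obtain b where b: "b<n" "ints s2 73 0 = int b" "reals s2 2 0 = reals s' 11 (int b)" "ALL p<n. reals s' 11 (int p)<=reals s' 11 (int b)" by blast
    have e2: "ints s2 71 0 = int m" "reals s2 11 = reals s' 11" "ints s2 15 = ints s' 15" "ints s2 0 0 = int n" using frameD[OF fr2] v n' by auto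
    let ?s3 = "iupd 15 (int m+1) (int b) s2"
    let ?z = "z(Suc m := b)"
    have "wp K I CLOSER ?s3 (?Inv (Suc m))"
    proof (rule wp_conseq[OF CLOSER_wp[where n = n and b = b and dd = dd]])
    fix s4 assume 4: "ALL p<n. reals s4 11 (int p) = min (reals ?s3 11 (int p)) (dd b p)" and fr4: "frame CLOSER ?s3 s4"
    have e4: "ints s4 15 = ints ?s3 15" "reals s4 2 0 = reals s' 11 (int b)" using frameD[OF fr4] b by auto
    have M: "reals s4 11 (int p) = min (reals s' 11 (int p)) (dd b p)" if "p<n" for p using 4 that e2 by simp
    have a1: "ints s4 15 (int i) = int (?z i)" if "i<=Suc m" for i
    proof (cases "i = Suc m")
    case False
    thus ?thesis using that z(1) e4 e2 by auto
    qed (use e4 in auto)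
    have a2: "?z i<n" if "i<=Suc m" for i using that z(2) b(1) by (cases "i = Suc m") auto
    have a3: "reals s4 11 (int p)<=dd (?z i) p" if "p<n" "i<=Suc m" for p i
    proof (cases "i = Suc m")
    case False
    hence "reals s' 11 (int p)<=dd (z i) p" using z(3) that by simp
    thus ?thesis using M[OF that(1)] False by simp
    qed (use M that in auto)
    have a4: "EX i<=Suc m. reals s4 11 (int p) = dd (?z i) p" if "p<n" for p
    proof (cases "reals s' 11 (int p)<=dd b p")
    case True
    have "EX i<=m. reals s' 11 (int p) = dd (z i) p" using z(3) that by simp
    then obtain i where "i<=m" "reals s' 11 (int p) = dd (z i) p" by blast
    thus ?thesis using M[OF that] True by (intro exI[of _ i]) auto
    next
    case False
    thus ?thesis using M[OF that] by (intro exI[of _ "Suc m"]) auto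
    qed
    let ?r = "reals s' 11 (int b)"
    have "spread n (Suc m) dd ?z ?r" unfolding spread_def
    proof (intro conjI allI impI)
    fix p assume p: "p<n"
    obtain i where i: "i<=m" "reals s' 11 (int p) = dd (z i) p" using z(3) p by blast
    have "reals s' 11 (int p)<=?r" using b(4) p by blast
    hence "dd (?z i) p<=?r" using i by simp
    thus "EX i<Suc m. dd (?z i) p<=?r" using i by (intro exI[of _ i]) auto
    next
    fix i j assume ij: "i<=Suc m" "j<=Suc m" "i<j"
    show "?r<=dd (?z i) (?z j)"
    proof (cases "j = Suc m")
    case True
    hence "?r<=dd (z i) b" using z(3) b(1) ij by simp
    thus ?thesis using True ij by simp
    next
    case False
    hence jm: "j<=m" "0<m" using ij by auto
    hence sp: "spread n m dd z (reals s' 2 0)" using z(4) by blast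
    \<comment> \<open>For two old centres the old separation suffices: the new radius does not
      exceed the old one, because \<open>b\<close> is within the old radius of some old
      centre.\<close>
    then obtain l where l: "l<m" "dd (z l) b<=reals s' 2 0" using b(1) unfolding spread_def by blast
    have "?r<=dd (z l) b" using z(3) b(1) l by simp
    also have "...<=reals s' 2 0" by (rule l)
    also have "...<=dd (z i) (z j)" using sp jm ij unfolding spread_def by auto
    finally show ?thesis using jm ij by simp
    qed
    qed (use a2 in auto)
    thus "?Inv (Suc m) s4" using a1 a2 a3 a4 e4 by (intro exI[of _ ?z]) simp
    qed (use e2 b d in auto)
    thus "wp K I (PISet 15 (IPlus (iv 71) I1) (iv 73);; CLOSER) s2 (?Inv (Suc m))" using e2 b by simp
   qed
  qed (use e1 in auto)
 qed
 thus ?thesis unfolding CENTRES_def wp_Sq[of _ _ "PISet 15 I0 I0"] by (simp only: wp_PISet ival.simps)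
qed

subsection \<open>The precision\<close>

text \<open>\<open>q\<close> is the least exponent from 10 on with \<open>2^q*eps >= 1000\<close>.
  Minimality gives \<open>2^q < 2000/eps\<close> unless \<open>q = 10\<close>, so the precision is
  not overshot.\<close>

lemma QLOOP_runs:
 assumes e: "reals s 0 0 = eps" "0<eps"
 shows "EX q. 10<=q & 1000<=2 ^ q*eps & (q = 10 | 2 ^ q*eps<2000) &
  runs K I QLOOP s (16+22*q) (%s'. ints s' 4 0 = int q & reals s' 1 0 = 2 ^ q &
   (ALL a. a ~= 4 --> ints s' a = ints s a) & (ALL a. a ~= 1 --> reals s' a = reals s a))"
proof -
 let ?b = "RLess (RTimes (rv 1) (rv 0)) (ROfInt (IConst 1000))"
 let ?c = "Seq (RSet 1 I0 (RPlus (rv 1) (rv 1))) (ISet 4 I0 (IPlus (iv 4) I1))"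
 let ?P = "%q. 10<=q & 1000<=2 ^ q*eps"
 have ex: "EX q. ?P q"
 proof -
  obtain m where "1000/eps<2 ^ m" using real_arch_pow[of 2 "1000/eps"] by auto
  hence "1000<2 ^ m*eps" using e by (simp add: field_simps)
  also have "...<=2 ^ (10+m)*eps" using e by (intro mult_right_mono power_increasing) auto
  finally show ?thesis by (intro exI[of _ "10+m"]) auto
 qed
 define q where "q = (LEAST q. ?P q)"
 have q: "?P q" unfolding q_def by (rule LeastI_ex[OF ex])
 have less: "~ ?P m" if "m<q" for m using that not_less_Least unfolding q_def by blast
 have q2: "q = 10 | 2 ^ q*eps<2000"
 proof (cases "q = 10")
  case False
  then obtain m where m: "q = Suc m" "10<=m" using q by (cases q) auto
  hence "2 ^ m*eps<1000" using less[of m] by simp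
  thus ?thesis using m by (simp add: mult.commute)
 qed simp
 let ?same = "%s'. (ALL a. a ~= 4 --> ints s' a = ints s a) & (ALL a. a ~= 1 --> reals s' a = reals s a)"
 let ?R = "%s'. ints s' 4 0 = int q & reals s' 1 0 = 2 ^ q & ?same s'"
 have loop: "runs K I (Loop ?b ?c) s1 (9+22*(q - m)) ?R"
  if "ints s1 4 0 = int m" "reals s1 1 0 = 2 ^ m" "10<=m" "m<=q" "?same s1" for m s1 using that
 proof (induction "q - m" arbitrary: m s1)
  case 0
  hence m: "m = q" by simp
  have "~ bval I s1 ?b" using 0 m q e by simp
  from runs_LoopF[OF this, of ?R K ?c]
  have "runs K I (Loop ?b ?c) s1 (1+bcost ?b) ?R" using 0 m by blast
  thus ?case by (rule runs_mono) auto
 next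
  case (Suc l)
  hence mq: "m<q" by simp
  have b: "bval I s1 ?b" using less[OF mq] Suc e by simp
  let ?s2 = "iupd 4 0 (int (Suc m)) (rupd 1 0 (2 ^ Suc m) s1)"
  have c: "runs K I ?c s1 13 (%s'. s' = ?s2)"
  proof -
   have "exec K I ?c s1 ((1+icost I0+rcost (RPlus (rv 1) (rv 1)))+(1+icost I0+icost (IPlus (iv 4) I1)))
    (iupd 4 (ival I (rupd 1 (ival I s1 I0) (rval I s1 (RPlus (rv 1) (rv 1))) s1) I0)
    (ival I (rupd 1 (ival I s1 I0) (rval I s1 (RPlus (rv 1) (rv 1))) s1) (IPlus (iv 4) I1))
    (rupd 1 (ival I s1 I0) (rval I s1 (RPlus (rv 1) (rv 1))) s1))" by (rule exec.Seq[OF exec.RSet exec.ISet])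
   thus ?thesis using Suc unfolding runs_def by (auto simp: add.commute)
  qed
  have "runs K I (Loop ?b ?c) s1 (1+bcost ?b+13+(9+22*(q - Suc m))) ?R"
  proof (rule runs_LoopT[OF b c])
   fix s2 assume "s2 = ?s2"
   thus "runs K I (Loop ?b ?c) s2 (9+22*(q - Suc m)) ?R" using Suc by (intro Suc.hyps(1)) (auto simp: iupd_def rupd_def)
  qed
  moreover have "1+bcost ?b+13+(9+22*(q - Suc m)) = 9+22*(q - m)" using mq by simp
  ultimately show ?case by (simp only:)
 qed
 let ?s1 = "rupd 1 0 1024 (iupd 4 0 10 s)"
 have "runs K I QLOOP s ((1+icost I0+icost (IConst 10))+((1+icost I0+rcost (ROfInt (IConst 1024)))+(9+22*(q - 10))))
  ?R" unfolding QLOOP_def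
 proof (rule runs_Seq[OF runs_ISet[where Q = "%s1. s1 = iupd 4 0 10 s"]])
  fix s1 assume s1: "s1 = iupd 4 0 10 s"
  show "runs K I (Seq (RSet 1 I0 (ROfInt (IConst 1024))) (Loop ?b ?c)) s1
   ((1+icost I0+rcost (ROfInt (IConst 1024)))+(9+22*(q - 10))) ?R"
  proof (rule runs_Seq[OF runs_RSet[where Q = "%s2. s2 = ?s1"]])
   fix s2 assume "s2 = ?s1"
   thus "runs K I (Loop ?b ?c) s2 (9+22*(q - 10)) ?R" using q by (intro loop) (auto simp: iupd_def rupd_def)
  qed (simp add: s1)
 qed simp
 hence "runs K I QLOOP s (16+22*q) ?R" by (rule runs_mono) auto
 thus ?thesis using q q2 by blast
qed

subsection \<open>Increasing the dimension parameter\<close>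

definition finished :: "nat => nat => nat => (nat => nat => real) => (nat => nat) => real => (nat set => bool) => nat => state => bool" where
 "finished n k q dd z r okc g s <->
   (ALL bs. length bs = 100*k*g*q --> machine.tried n k g q (100*k*g*q) dd z r okc bs s) & machine.kept n k dd okc s"

definition prepared :: "nat => nat => nat => (nat => nat) => real => state => bool" where
 "prepared n k q z r s <-> ints s 0 0 = int n & ints s 0 1 = int k & ints s 4 0 = int q &
   (ALL i<=k. ints s 15 (int i) = int (z i)) & reals s 1 0 = 2 ^ q & reals s 2 0 = r"

definition attempt_sz :: nat where "attempt_sz = 6 + sz SETB + sz SETP + sz ROUND"
definition attempt_dep :: nat where "attempt_dep = max (dep SETB) (max (dep SETP) (dep ROUND))"

lemma two_mult_le_pow: "2*m<=2 ^ m" if "1<=m" for m :: nat using that by (induction m rule: dec_induct) auto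

lemma ATTEMPT_runs:
 assumes met: "Metric_space {..<n} dd" and I: "npts I = n" "dst I = dd" "1<=n" "1<=k" and q: "1<=q"
  and Kok: "machine.answers n K okc" and F: "!!C t v. K C t v ==> t<=Fb"
  and st: "prepared n k q z r s" "ints s 5 0 = int g" and H: "2 ^ (100*k*Suc g*q)<=H"
 shows "runs K I ATTEMPT s (attempt_sz*H ^ attempt_dep*(n+Fb)) (%s'. prepared n k q z r s' & ints s' 5 0 = int (Suc g) &
   (decoder.nice n (Suc g) dd & decoder.wide n (Suc g) q dd --> ~ 0<ints s' 65 0) &
   (~ 0<ints s' 65 0 --> finished n k q dd z r okc (Suc g) s'))"
proof -
 let ?t1 = "sz SETB*H ^ dep SETB*(n+Fb)" and ?t2 = "sz SETP*H ^ dep SETP*(n+Fb)" and ?t3 = "sz ROUND*H ^ dep ROUND*(n+Fb)"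
 let ?g = "Suc g"
 let ?B = "100*k*?g*q"
 interpret machine n k ?g q ?B dd z r K I by unfold_locales (use I in auto)
 have kg: "1*1<=k*?g" "1*1*1<=k*?g*q" "1*?g*1<=k*?g*q" "1*?g*q<=k*?g*q" "k*1*1<=k*?g*q" "1*1*q<=k*?g*q" using I q by (intro mult_le_mono; simp)+
 note kg = kg[unfolded mult_1_left mult_1_right]
 have e: "?B = 100*(k*?g*q)" by (simp only: mult.assoc)
 have "k*?g*q<=?B" unfolding e by simp
 hence B: "1<=?B" "?g<=?B" "?g*q<=?B" "k<=?B" "q<=?B" using kg order_trans by blast+
 have pw: "2 ^ x<=H" if "x<=?B" for x :: nat by (rule order_trans[OF power_increasing[OF that] H]) simp
 have twB: "2*?B<=H" using two_mult_le_pow[OF B(1)] H by linarith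
 have H1: "1<=H" "?B<=H" "?g<=H" "k<=H" "q<=H" using B twB by linarith+
 have H2: "2 ^ ?B<=H" "2 ^ ?g<=H" "2 ^ (?g*q)<=H" using pw B by blast+
 have P: "x*H ^ y<=x*H ^ attempt_dep" if "y<=attempt_dep" for x y using that H1(1) by (intro mult_left_mono power_increasing) auto
 have deps: "dep SETB<=attempt_dep" "dep SETP<=attempt_dep" "dep ROUND<=attempt_dep" by (auto simp: attempt_dep_def)
 let ?Q = "%s'. prepared n k q z r s' & ints s' 5 0 = int ?g & (nice & wide --> ~ 0<ints s' 65 0) &
   (~ 0<ints s' 65 0 --> finished n k q dd z r okc ?g s')"
 let ?s = "iupd 5 0 (int ?g) s"
 have p0: "prepared n k q z r ?s" using st by (simp add: prepared_def)
 have "runs K I ATTEMPT s ((1+icost I0+icost (IPlus (iv 5) I1))+(?t1 +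
   (?t2+?t3))) ?Q" unfolding ATTEMPT_def
 proof (rule runs_Seq[OF runs_ISet[where Q = "%s1. s1 = ?s"]])
  fix s1 assume s1: "s1 = ?s"
  have r1: "runs K I (compile SETB) s1 (?t1) (%s'. ints s' 3 0 = int ?B & frame SETB s1 s')"
  proof (rule wp_runs[OF SETB_wp static_SETB _ H1(1) I(3) F])
   fix a i assume "(a, i) : bounds SETB"
   thus "a ~: piw SETB & ints s1 a i<=int (if (a, i) = (0, 0) then n else H)" using st H1 unfolding s1 by (auto simp: SETB_def prepared_def)
  qed (use st in "simp_all add: s1 prepared_def")
  show "runs K I (Seq (compile SETB) (Seq (compile SETP) (compile ROUND))) s1 (?t1 +
    (?t2+?t3)) ?Q"
  proof (rule runs_Seq[OF r1])
   fix s2 assume 2: "ints s2 3 0 = int ?B & frame SETB s1 s2"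
   hence fr2: "frame SETB s1 s2" by blast
   have p2: "prepared n k q z r s2 & ints s2 5 0 = int ?g" using p0 frameD(1)[OF fr2, of 0] frameD(1)[OF fr2, of 4] frameD(1)[OF fr2, of 5] frameD(1)[OF fr2, of 15]
    frameD(2)[OF fr2, of 1] frameD(2)[OF fr2, of 2] unfolding s1 by (simp add: prepared_def)
   have r2: "runs K I (compile SETP) s2 (?t2) (%s'. (ints s' 6 0 = int (2 ^ ?B) &
    ints s' 7 0 = int (2 ^ ?g) & ints s' 8 0 = int (2 ^ (?g*q)) & ints s' 9 0 = int (2*?B)) & frame SETP s2 s')"
   proof (rule wp_runs[OF SETP_wp static_SETP _ H1(1) I(3) F])
    fix a i assume "(a, i) : bounds SETP"
    hence "(a, i) : {(3, 0), (4, 0), (5, 0)}" by (auto simp: SETP_def)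
    moreover have "ints s2 3 0<=int H" "ints s2 4 0<=int H" "ints s2 5 0<=int H" using 2 p2 H1 by (simp_all only: prepared_def of_nat_le_iff)
    ultimately show "a ~: piw SETP & ints s2 a i<=int (if (a, i) = (0, 0) then n else H)" by auto
   qed (use 2 p2 in "simp_all add: prepared_def")
   show "runs K I (Seq (compile SETP) (compile ROUND)) s2 (?t2+?t3) ?Q"
   proof (rule runs_Seq[OF r2])
    fix s3 assume 3: "(ints s3 6 0 = int (2 ^ ?B) &
    ints s3 7 0 = int (2 ^ ?g) & ints s3 8 0 = int (2 ^ (?g*q)) & ints s3 9 0 = int (2*?B)) & frame SETP s2 s3"
    hence fr3: "frame SETP s2 s3" by blast
    have p3: "prepared n k q z r s3 & ints s3 5 0 = int ?g & ints s3 3 0 = int ?B" using p2 2 frameD(1)[OF fr3, of 0] frameD(1)[OF fr3, of 3] frameD(1)[OF fr3, of 4] frameD(1)[OF fr3, of 5] frameD(1)[OF fr3, of 15]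
    frameD(2)[OF fr3, of 1] frameD(2)[OF fr3, of 2] by (simp add: prepared_def)
    have c3: "consts_ok s3" using p3 3 unfolding consts_ok_def prepared_def by blast
    have "runs K I (compile ROUND) s3 (?t3) (%s'. ((nice & wide --> ~ 0<ints s' 65 0) &
    (~ 0<ints s' 65 0 --> (ALL bs. length bs = ?B --> tried okc bs s') & kept okc s')) & frame ROUND s3 s')"
    proof (rule wp_runs[OF ROUND_wp[OF met Kok c3 B(4)] static_ROUND _ H1(1) I(3) F])
    fix a i assume "(a, i) : bounds ROUND"
    hence ai: "(a, i) : allowed" using static_ROUND by (auto simp: static_def)
    have "ints s3 0 0<=int n" "ints s3 0 1<=int H" "ints s3 3 0<=int H" "ints s3 4 0<=int H" "ints s3 5 0<=int H"
    "ints s3 6 0<=int H" "ints s3 7 0<=int H" "ints s3 8 0<=int H" "ints s3 9 0<=int H" using c3 H1 H2 twB unfolding consts_ok_def by (simp_all only: of_nat_le_iff order_refl)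
    hence "ints s3 a i<=int (if (a, i) = (0, 0) then n else H)" using ai by (auto simp: allowed_def)
    moreover have "a : {0,3,4,5,6,7,8,9}" using ai by (auto simp: allowed_def)
    hence "a ~: piw ROUND" by (elim insertE emptyE) simp_all
    ultimately show "a ~: piw ROUND & ints s3 a i<=int (if (a, i) = (0, 0) then n else H)" by blast
    qed
    thus "runs K I (compile ROUND) s3 (?t3) ?Q"
    proof (rule runs_mono)
    fix s4 assume 4: "((nice & wide --> ~ 0<ints s4 65 0) &
    (~ 0<ints s4 65 0 --> (ALL bs. length bs = ?B --> tried okc bs s4) & kept okc s4)) & frame ROUND s3 s4"
    hence fr4: "frame ROUND s3 s4" by blast
    have "prepared n k q z r s4 & ints s4 5 0 = int ?g" using p3 frameD(1)[OF fr4, of 0] frameD(1)[OF fr4, of 4] frameD(1)[OF fr4, of 5] frameD(1)[OF fr4, of 15]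
    frameD(2)[OF fr4, of 1] frameD(2)[OF fr4, of 2] by (simp add: prepared_def)
    thus "?Q s4" using 4 unfolding finished_def by blast
    qed simp
   qed
  qed
 qed (use st in "simp add: prepared_def add.commute")
 thus ?thesis
 proof (rule runs_mono)
  let ?X = "H ^ attempt_dep*(n+Fb)"
  have "1*1<=?X" using H1(1) I(3) by (intro mult_le_mono) auto
  hence "6*1<=6*?X" by (intro mult_le_mono) auto
  moreover have "sz p*H ^ dep p*(n+Fb) <= sz p*?X" if "dep p<=attempt_dep" for p using P[OF that, of "sz p"] by (simp only: mult.assoc[symmetric] mult_right_mono[OF _ zero_le])
  from this[OF deps(1)] this[OF deps(2)] this[OF deps(3)] calculation
  have "6+(?t1+(?t2+?t3))
   <=6*?X+(sz SETB*?X+(sz SETP*?X + sz ROUND*?X))" by linarith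
  thus "(1+icost I0+icost (IPlus (iv 5) I1))+(?t1 +
   (?t2+?t3))<=attempt_sz*H ^ attempt_dep*(n+Fb)" unfolding attempt_sz_def by (simp add: algebra_simps)
 qed
qed

text \<open>The dimension is unknown to the program, so \<open>g\<close> grows until a round shows
  no overflow. At the latest this happens at \<open>G\<close>, where greedy nets are always
  exhausted, and every round costs at most what round \<open>G\<close> would.\<close>

lemma LOOP_runs:
 assumes met: "Metric_space {..<n} dd" and I: "npts I = n" "dst I = dd" "1<=n" "1<=k" and q: "1<=q"
  and Kok: "machine.answers n K okc" and F: "!!C t v. K C t v ==> t<=Fb"
  and G: "decoder.nice n G dd" "decoder.wide n G q dd"
  and st: "prepared n k q z r s" "ints s 5 0 = int g" "g<=G" "0<ints s 65 0 ==> g<G"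
  "~ 0<ints s 65 0 ==> 1<=g & finished n k q dd z r okc g s"
 shows "runs K I (Loop (ILess I0 (iv 65)) ATTEMPT) s
   (5+(G - g)*(5+attempt_sz*(2 ^ (100*k*G*q)) ^ attempt_dep*(n+Fb)))
   (%s'. EX g. 1<=g & g<=G & finished n k q dd z r okc g s')" using st
proof (induction "G - g" arbitrary: g s rule: less_induct)
 case less
 let ?b = "ILess I0 (iv 65)"
 let ?Q = "%s'. EX g. 1<=g & g<=G & finished n k q dd z r okc g s'"
 let ?T = "attempt_sz*(2 ^ (100*k*G*q)) ^ attempt_dep*(n+Fb)"
 show ?case
 proof (cases "0<ints s 65 0")
  case False
  have nb: "~ bval I s ?b" using False by simp
  have "?Q s" using less.prems(5)[OF False] less.prems(3) by blast
  from runs_LoopF[where Q = ?Q, OF nb this, of K ATTEMPT] show ?thesis by (rule runs_mono) auto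
 next
  case True
  have gG: "g<G" using less.prems(4)[OF True] .
  have b: "bval I s ?b" using True by simp
  have H: "(2::nat) ^ (100*k*Suc g*q)<=2 ^ (100*k*G*q)"
  proof (rule power_increasing)
   show "100*k*Suc g*q<=100*k*G*q" using gG by (intro mult_le_mono) auto
  qed simp
  note A = ATTEMPT_runs[OF met I q Kok F less.prems(1,2) H]
  have "runs K I (Loop ?b ATTEMPT) s (1+bcost ?b+?T+(5+(G - Suc g)*(5+?T))) ?Q"
  proof (rule runs_LoopT[OF b A])
   fix s1 assume 1: "prepared n k q z r s1 & ints s1 5 0 = int (Suc g) &
    (decoder.nice n (Suc g) dd & decoder.wide n (Suc g) q dd --> ~ 0<ints s1 65 0) &
    (~ 0<ints s1 65 0 --> finished n k q dd z r okc (Suc g) s1)"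
   show "runs K I (Loop ?b ATTEMPT) s1 (5+(G - Suc g)*(5+?T)) ?Q"
   proof (rule less.hyps)
    show "Suc g<G" if "0<ints s1 65 0"
    proof -
    have "Suc g ~= G" using that 1 G by auto
    thus ?thesis using gG by simp
    qed
   qed (use 1 gG in auto)
  qed
  moreover have "1+bcost ?b+?T+(5+(G - Suc g)*(5+?T)) = 5+(G - g)*(5+?T)"
  proof -
   have "G - g = Suc (G - Suc g)" using gG by simp
   thus ?thesis by simp
  qed
  ultimately show ?thesis by (simp only:)
 qed
qed

definition main_sz :: nat where "main_sz = 100 + sz CENTRES+attempt_sz"
definition main_dep :: nat where "main_dep = Suc (max (dep CENTRES) attempt_dep)"

lemma MAIN_runs:
 assumes met: "Metric_space {..<n} dd" and I: "npts I = n" "dst I = dd" "nclus I = k" "2<=n" "1<=k"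
  and Kok: "machine.answers n K okc" and F: "!!C t v. K C t v ==> t<=Fb"
  and h: "halving {..<n} dd m" "1<=m" "2*m<=real G" and eps: "0<eps"
 shows "EX q. 10<=q & 1000<=2 ^ q*eps & (q = 10 | 2 ^ q*eps<2000) &
   runs K I MAIN (main_init I eps) (main_sz*(2 ^ (100*k*G*q)) ^ main_dep*(n+Fb))
   (%s'. EX g z r. 1<=g & spread n k dd z r & finished n k q dd z r okc g s')"
proof -
 let ?s = "main_init I eps"
 have s: "ints ?s 0 0 = int n" "ints ?s 0 1 = int k" "reals ?s 0 0 = eps" using I by (simp_all add: main_init_def)
 obtain q where q: "10<=q" "1000<=2 ^ q*eps" "q = 10 | 2 ^ q*eps<2000"
  and rq: "runs K I QLOOP ?s (16+22*q) (%s'. ints s' 4 0 = int q & reals s' 1 0 = 2 ^ q &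
   (ALL a. a ~= 4 --> ints s' a = ints ?s a) & (ALL a. a ~= 1 --> reals s' a = reals ?s a))" using QLOOP_runs[OF s(3) eps, of K I] by (elim exE conjE) (rule that)
 have q1: "1<=q" and n1: "1<=n" using q(1) I(4) by linarith+
 have G1: "1<=G" using h(2,3) by (cases G) auto
 have nw: "decoder.nice n G dd" "decoder.wide n G q dd" using decoder.no_overflow[OF met h(1,3,2) q1] .
 let ?H = "2 ^ (100*k*G*q) :: nat"
 let ?T = "attempt_sz*?H ^ attempt_dep*(n+Fb)"
 let ?U = "(1+icost I0+icost I0)+((1+icost I0+icost I1)+(5+(G - 0)*(5+?T)))"
 let ?C = "sz CENTRES*?H ^ dep CENTRES*(n+Fb)"
 let ?Q = "%s'. EX g z r. 1<=g & spread n k dd z r & finished n k q dd z r okc g s'"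
 let ?loop = "Loop (ILess I0 (iv 65)) ATTEMPT"
 let ?rest = "Seq (ISet 5 I0 I0) (Seq (ISet 65 I0 I1) ?loop)"
 have kGq: "k*1*1<=k*G*q" "1*G*1<=k*G*q" "1*1*q<=k*G*q" using I(5) G1 q1 by (intro mult_le_mono; simp)+
 have BH: "100*k*G*q<=?H" by (rule less_imp_le[OF less_exp])
 hence H: "k<=?H" "G<=?H" "q<=?H" using kGq by linarith+
 have H1: "1<=?H" by simp
 have "runs K I (Seq QLOOP (Seq (compile CENTRES) (?rest))) ?s
  ((16+22*q)+(?C+(?U))) ?Q"
 proof (rule runs_Seq[OF rq])
  fix s1 :: state assume 1: "ints s1 4 0 = int q & reals s1 1 0 = 2 ^ q &
   (ALL a. a ~= 4 --> ints s1 a = ints ?s a) & (ALL a. a ~= 1 --> reals s1 a = reals ?s a)"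
  have e1: "ints s1 0 0 = int n" "ints s1 0 1 = int k" using 1 s by simp_all
  have r1: "runs K I (compile CENTRES) s1 ?C (%s'. (EX z. (ALL i<=k. ints s' 15 (int i) = int (z i)) & spread n k dd z (reals s' 2 0)) & frame CENTRES s1 s')"
  proof (rule wp_runs[OF CENTRES_wp[OF e1(1) n1 e1(2) I(5,2) met] static_CENTRES _ H1 n1 F])
   fix a i assume "(a, i) : bounds CENTRES"
   hence "(a, i) : {(0, 0), (0, 1)}" by (auto simp: CENTRES_def FARTHEST_def CLOSER_def)
   moreover have "ints s1 0 1<=int ?H" using e1 H(1) by (simp only: of_nat_le_iff)
   ultimately show "a ~: piw CENTRES & ints s1 a i<=int (if (a, i) = (0, 0) then n else ?H)" using e1 by auto
  qed
  show "runs K I (Seq (compile CENTRES) (?rest)) s1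
    (?C+(?U)) ?Q"
  proof (rule runs_Seq[OF r1])
   fix s2 assume 2: "(EX z. (ALL i<=k. ints s2 15 (int i) = int (z i)) & spread n k dd z (reals s2 2 0)) & frame CENTRES s1 s2"
   then obtain z where z: "ALL i<=k. ints s2 15 (int i) = int (z i)" "spread n k dd z (reals s2 2 0)" by blast
   have fr: "frame CENTRES s1 s2" using 2 by blast
   let ?r = "reals s2 2 0"
   have p2: "prepared n k q z ?r s2" unfolding prepared_def using e1 1 z frameD(1)[OF fr, of 0] frameD(1)[OF fr, of 4] frameD(2)[OF fr, of 1] by simp
   let ?s4 = "iupd 65 0 1 (iupd 5 0 0 s2)"
   have r4: "runs K I ?loop ?s4 (5+(G - 0)*(5+?T)) ?Q"
   proof (rule runs_mono[OF LOOP_runs[OF met I(1,2) n1 I(5) q1 Kok F nw, where z = z and r = ?r and g = 0]])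
    show "prepared n k q z ?r ?s4" using p2 by (simp add: prepared_def)
   qed (use z G1 in auto)
   show "runs K I (?rest) s2
    (?U) ?Q"
   proof (rule runs_Seq[OF runs_ISet[where Q = "%s3. s3 = iupd 5 0 0 s2"]])
    fix s3 assume s3: "s3 = iupd 5 0 0 s2"
    show "runs K I (Seq (ISet 65 I0 I1) ?loop) s3 ((1+icost I0+icost I1)+(5+(G - 0)*(5+?T))) ?Q"
    proof (rule runs_Seq[OF runs_ISet[where Q = "%s4. s4 = ?s4"]])
    show "runs K I ?loop s4 (5+(G - 0)*(5+?T)) ?Q" if "s4 = ?s4" for s4 using r4 unfolding that .
    qed (simp add: s3)
   qed simp
  qed
 qed
 then obtain t s' where e: "exec K I (Seq QLOOP (Seq (compile CENTRES) (?rest))) ?s t s'"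
  and t: "t<=(16+22*q)+(?C+(?U))"
  and Q: "?Q s'" unfolding runs_def by blast
 have nb: "~ bval I ?s (ILess (IGet 0 I0) (IConst 2))" using s I(4) by simp
 have ex: "exec K I MAIN ?s (1+bcost (ILess (IGet 0 I0) (IConst 2))+t) s'" unfolding MAIN_def by (rule exec.CondF[OF nb e])
 let ?X = "?H ^ main_dep*(n+Fb)"
 have HX: "?H<=?X"
 proof -
  have "?H ^ 1*1<=?H ^ main_dep*(n+Fb)" using H1 n1 unfolding main_dep_def by (intro mult_le_mono power_increasing) auto
  thus ?thesis by simp
 qed
 have C: "?C <= sz CENTRES*?X" unfolding mult.assoc main_dep_def using H1 by (intro mult_left_mono mult_right_mono power_increasing) auto
 \<comment> \<open>The number of rounds is at most \<open>G <= H\<close>, which costs one further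
   factor \<open>H\<close>; this is the \<open>Suc\<close> in \<open>main_dep\<close>.\<close>
 have T: "G*?T<=attempt_sz*?X"
 proof -
  have "G*?T<=?H*?T" using H(2) by (intro mult_right_mono) auto
  also have "... = attempt_sz*(?H ^ Suc attempt_dep*(n+Fb))" by (simp add: algebra_simps)
  also have "...<=attempt_sz*?X" unfolding main_dep_def using H1 by (intro mult_left_mono mult_right_mono power_increasing) auto
  finally show ?thesis .
 qed
 have "1+bcost (ILess (IGet 0 I0) (IConst 2))+t<=32+22*q+?C+(5*G+G*?T)" using t by (simp add: algebra_simps)
 also have "...<=59*?H + sz CENTRES*?X+attempt_sz*?X" using C T H H1 by linarith
 also have "...<=100*?X + sz CENTRES*?X+attempt_sz*?X" using HX by simp
 also have "... = main_sz*?H ^ main_dep*(n+Fb)" by (simp add: main_sz_def algebra_simps)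
 finally have "runs K I MAIN ?s (main_sz*?H ^ main_dep*(n+Fb)) ?Q" unfolding runs_def using ex Q by blast
 thus ?thesis using q by blast
qed

section \<open>Correctness of a round without overflow\<close>

section \<open>Correctness\<close>

text \<open>With \<open>x = 1/th\<close> the product is \<open>1 + 145*x\<close> plus terms of
  higher order, which are small because \<open>x <= 1/1024\<close>; and
  \<open>1000*x <= eps\<close>.\<close>

lemma precision_bound:
 assumes "1024<=(th :: real)" "1000<=th*eps"
 shows "(1+1/th)*((1+114/th)*(1+30/th))<=1+eps"
proof -
 define x where "x = 1/th"
 have x: "0<=x" "x<=1/1024" "1000*x<=eps" using assms by (auto simp: x_def field_simps)
 have xx: "x*x<=x*(1/1024)" using x by (intro mult_left_mono) auto
 have "x*x<=x" using x xx by linarith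
 hence xxx: "x*(x*x)<=x*x" using x(1) by (rule mult_left_mono)
 have "(1+x)*((1+114*x)*(1+30*x)) = 1+145*x+3564*(x*x)+3420*(x*(x*x))" by (simp add: algebra_simps)
 also have "...<=1+eps" using x xx xxx by linarith
 finally show ?thesis by (simp add: x_def)
qed

context feasible_instance
begin

text \<open>For any feasible \<open>Q\<close> the honest string for its target was among those
  tried. Its labelling is constant on target clusters, hence feasible, and its estimate is at most
  \<open>(1+eps)*cost I Q\<close> and bounds the kept value. The kept labelling is valid, and since
  no net overflowed its cost is at most the kept value.\<close>

lemma finished_approx:
 assumes cw: "clusterwise \<I> F ok" and sp: "spread n k dd z r" and q: "10<=q" "1000<=2 ^ q*eps" and g: "1<=g"
  and fin: "finished n k q dd z r (ok I) g s"
 shows "approx_solution F I eps (output_clustering I s)"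
proof -
 let ?B = "100*k*g*q"
 let ?th = "2 ^ q :: real"
 interpret machine n k g q ?B dd z r "%_ _ _. True" I by unfold_locales (use n1 k1 in auto)
 have pts: "points I = {..<n}" by (simp add: points_def)
 have kgq: "k<=k*g*q" "1<=k*g*q"
 proof -
  have "k*1*1<=k*g*q" "1*1*1<=k*g*q" using k1 g q by (intro mult_le_mono; simp)+
  thus "k<=k*g*q" "1<=k*g*q" by simp_all
 qed
 have B: "?B = 100*(k*g*q)" by (simp only: mult.assoc)
 have th: "1024<=?th"
 proof -
  have "(2::real) ^ 10<=2 ^ q" using q(1) by (rule power_increasing) simp
  thus ?thesis by simp
 qed
 have z: "ALL i<=k. z i<n" "ALL p<n. EX i<k. dd (z i) p<=r" using sp by (auto simp: spread_def)
 have zz: "ALL i<=k. ALL j<=k. i ~= j --> r<=dd (z i) (z j)"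
 proof (intro allI impI)
  fix i j assume "i<=k" "j<=k" "i ~= j"
  then consider "i<j" | "j<i" by linarith
  thus "r<=dd (z i) (z j)"
  proof cases
   case 1
   thus ?thesis using sp \<open>j<=k\<close> \<open>i<=k\<close> unfolding spread_def by blast
  next
   case 2
   hence "r<=dd (z j) (z i)" using sp \<open>j<=k\<close> \<open>i<=k\<close> unfolding spread_def by blast
   thus ?thesis by (simp only: Metric_space.commute[OF met, of "z i" "z j"])
  qed
 qed
 have tr: "!!bs. length bs = ?B ==> tried (ok I) bs s" and kp: "kept (ok I) s" using fin unfolding finished_def by auto
 have best: "0<ints s 64 0 & reals s 15 0<=(1+eps)*cost I Q" if Q: "feasible F I Q" for Q
 proof -
  obtain a b j where abj: "a<k" "b<k" "j<=k" "cost I Q<=2 ^ j*(dd (z a) (z b)+2*r)" "2 ^ j*(dd (z a) (z b)+2*r)<=5*cost I Q" using scale_exists[OF Q z zz] by blast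
  define E where "E = 2 ^ j*(dd (z a) (z b)+2*r)"
  have E: "cost I Q<=E" "E<=5*cost I Q" using abj by (simp_all add: E_def)
  obtain P DD tt where P: "feasible F I P" and gd: "guide n k g q ?B dd P DD (E/real k/?th) (E/real k) tt"
   and DD: "sum DD P<=cost I Q+6*E/?th" using target_guide[OF q(1) g E(1) Q refl] by blast
  let ?adv = "%d. ovf d | (ALL L. labelling d (assign (E/real k/?th) d) L -->
    (ALL l:P. EX c. ALL p:l. L p = c) & (EX D. (ALL p<n. ALL p'<n. L p = L p' --> dd p p'<=D (L p)) & (ALL v. 0<=D v) &
    (ALL K. finite K --> sum D K<=(1+114/?th) * sum DD P)))"
  obtain bs2 where l2: "length bs2<=36*(k*g*q)"
   and adv: "ALL rest. ?adv (turns (E/real k/?th) (E/real k) (bs2 @ rest))" using guide.advice[OF gd] by (elim exE conjE) (rule that)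
  have "j<?B" unfolding B using abj(3) kgq by linarith
  from scale_read[OF abj(1,2) this] obtain bs1 where l1: "length bs1 = a+b+j+3"
   and sc: "!!rest. scale (bs1 @ rest) = (E/real k/?th, E/real k, rest)" unfolding E_def by blast
  \<comment> \<open>Honest advice may be shorter than \<open>B\<close>; the decoder ignores what
    follows it.\<close>
  let ?pad = "replicate (?B - length bs1 - length bs2) False"
  let ?d = "turns (E/real k/?th) (E/real k) (bs2 @ ?pad)"
  have "length bs1+length bs2<=?B" unfolding B l1 using l2 abj kgq by linarith
  hence "tried (ok I) (bs1 @ bs2 @ ?pad) s" by (intro tr) simp
  moreover have core: "core (bs1 @ bs2 @ ?pad) = (E/real k/?th, ?d)" unfolding core_def sc by simp
  ultimately obtain L e where nov: "~ ovf ?d" and cand: "candidate (bs1 @ bs2 @ ?pad) L"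
   and e: "ALL D. diams k L D --> e<=(1+1/?th) * sum D {..<k}" and v: "valid (ok I) k L --> 0<ints s 64 0 & reals s 15 0<=e" unfolding tried_def by auto
  have Lk: "ALL p<n. L p<k" and lab: "labelling ?d (assign (E/real k/?th) ?d) L" using cand unfolding candidate_def core by auto
  have "(ALL l:P. EX c. ALL p:l. L p = c) & (EX D. (ALL p<n. ALL p'<n. L p = L p' --> dd p p'<=D (L p)) & (ALL v. 0<=D v) &
    (ALL K. finite K --> sum D K<=(1+114/?th) * sum DD P))" using spec[OF adv, of ?pad] nov lab by blast
  then obtain D where const: "ALL l:P. EX c. ALL p:l. L p = c" and D: "ALL p<n. ALL p'<n. L p = L p' --> dd p p'<=D (L p)" "ALL v. 0<=D v"
   "sum D {..<k}<=(1+114/?th) * sum DD P" by blast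
  let ?O = "(%i. {j : points I. L j = L i}) ` points I"
  have O: "feasible F I ?O" by (rule coarse_feasible[OF mg II P const])
  hence okO: "ALL C:?O. ok I C" using cw II unfolding clusterwise_def feasible_def by blast
  have val: "valid (ok I) k L" unfolding valid_def
  proof (intro allI impI)
   fix l assume "cls L l ~= {}"
   then obtain p where p: "p<n" "L p = l" by (auto simp: cls_def)
   hence "cls L l = {j : points I. L j = L p}" by (auto simp: cls_def pts)
   hence "cls L l : ?O" using p pts by blast
   thus "ok I (cls L l)" using okO by blast
  qed
  have "diams k L D" using D(1,2) unfolding diams_def cls_def by (metis (mono_tags, lifting) mem_Collect_eq)
  hence "e<=(1+1/?th) * sum D {..<k}" using e by blast
  also have "...<=(1+1/?th)*((1+114/?th) * sum DD P)" using D(3) by (intro mult_left_mono) auto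
  also have "...<=(1+1/?th)*((1+114/?th)*((1+30/?th)*cost I Q))"
  proof (intro mult_left_mono)
   have "6*E/?th<=6*(5*cost I Q)/?th" using E(2) by (intro divide_right_mono) auto
   thus "sum DD P<=(1+30/?th)*cost I Q" using DD by (simp add: algebra_simps)
  qed auto
  also have "... = (1+1/?th)*((1+114/?th)*(1+30/?th))*cost I Q" by (simp only: mult.assoc)
  also have "...<=(1+eps)*cost I Q"
  proof (rule mult_right_mono[OF precision_bound[OF th q(2)]])
   show "0<=cost I Q" unfolding cost_def using cl_fin[OF fpart[OF Q]] dm0 by (intro sum_nonneg) auto
  qed
  finally show ?thesis using v val by force
 qed
 obtain Q0 where "feasible F I Q0" using exQ by blast
 hence "0<ints s 64 0" using best by blast
 then obtain L D where L: "ALL p<n. ints s 1 (int p) = int (L p) & L p<k" and val: "valid (ok I) k L" and D: "diams k L D"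
  and r15: "reals s 15 0 = sum D {..<k}" using kp unfolding kept_def by blast
 let ?V = "L ` {..<n}"
 have O: "output_clustering I s = cls L ` ?V"
 proof -
  have "{j : points I. ints s 1 (int j) = ints s 1 (int i)} = cls L (L i)" if "i<n" for i using L that by (auto simp: cls_def pts)
  thus ?thesis unfolding output_clustering_def pts image_image by (intro image_cong) auto
 qed
 have inj: "inj_on (cls L) ?V"
 proof (rule inj_onI)
  fix u v assume "u : ?V" "cls L u = cls L v"
  then obtain p where p: "p : cls L u" "p : cls L v" by (auto simp: cls_def)
  thus "u = v" by (simp add: cls_def)
 qed
 have V: "?V<={..<k}" using L by auto
 have part: "partition_on {..<n} (cls L ` ?V)" unfolding partition_on_def disjoint_def by (auto simp: cls_def)
 have "card (cls L ` ?V)<=k" unfolding card_image[OF inj] using card_mono[OF _ V] by simp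
 hence cl: "clustering I (cls L ` ?V)" using part by (simp add: clustering_def pts)
 have "ALL C:cls L ` ?V. ok I C"
 proof
  fix C assume "C : cls L ` ?V"
  then obtain p where p: "p<n" "C = cls L (L p)" by auto
  hence "L p<k" "cls L (L p) ~= {}" using L by (auto simp: cls_def)
  thus "ok I C" using val p(2) unfolding valid_def by blast
 qed
 hence feas: "feasible F I (cls L ` ?V)" using cl cw II unfolding feasible_def clusterwise_def by blast
 have "cost I (cls L ` ?V) = (SUM v:?V. dm (cls L v))" unfolding cost_def by (rule sum.reindex_cong[OF inj]) auto
 also have "...<=(SUM v:?V. D v)"
 proof (rule sum_mono)
  fix v assume v: "v : ?V"
  hence ne: "cls L v ~= {}" "v<k" using V by (auto simp: cls_def)
  show "dm (cls L v)<=D v" by (rule diam_facts(3)) (use ne D in "auto simp: cls_def diams_def")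
 qed
 also have "... <= sum D {..<k}" using V D by (intro sum_mono2) (auto simp: diams_def)
 finally have "cost I (cls L ` ?V)<=reals s 15 0" using r15 by simp
 thus ?thesis unfolding O approx_solution_def using feas best by force
qed

end

section \<open>The running time, and the absorption of constants into the exponent\<close>

section \<open>The running time\<close>

text \<open>\<open>300 = 100*3\<close>, because the advice length has the factor 100 and
  \<open>G <= 3*d\<close>. The term \<open>2*main_sz\<close> turns a constant factor into an
  exponent of \<open>2048/eps >= 2\<close>.\<close>

definition main_exp :: real where "main_exp = real (2*main_sz+300*main_dep)"

text \<open>Passing the indicator vector already costs \<open>n\<close> steps, so terms linear in
  \<open>n\<close> are dominated by \<open>f n\<close>.\<close>

lemma validates_ge:
 assumes V: "validates V \<I> ok f" and I: "I : \<I>" and n: "1<=npts I"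
 shows "npts I<=f (npts I)"
proof -
 have 0: "{0} ~= {} & {0}<=points I" using n by (simp add: points_def)
 obtain t v where "proc_answers V I {0} t v" "t<=f (npts I)" using V[unfolded validates_def, rule_format, OF I 0] by (elim exE conjE) (rule that)
 thus ?thesis by (auto simp: proc_answers_def)
qed

lemma MAIN_within:
 assumes mg: "mergeable \<I> F" and cw: "clusterwise \<I> F ok" and V: "validates V \<I> ok f" and II: "I : \<I>"
  and wfI: "wf_inst I" and n: "2<=npts I" and eps: "0<eps" "eps<1"
 shows "approximates_within MAIN V F I eps
   ((2048/eps) powr (main_exp*(real (nclus I)*doubling_dim (points I) (dst I)))*real (f (npts I)))"
proof -
 let ?n = "npts I" and ?k = "nclus I" and ?dd = "dst I"
 let ?d = "doubling_dim (points I) ?dd"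
 have pts: "points I = {..<?n}" by (simp add: points_def)
 have met: "Metric_space {..<?n} ?dd" and k1: "1<=?k" using wfI by (simp_all add: wf_inst_def points_def)
 have d: "1<=?d" "halving {..<?n} ?dd ?d" using doubling_dim_works[OF met] n unfolding pts by auto
 have n1: "1<=?n" using n by simp
 interpret machine ?n ?k 0 0 0 ?dd "%_. 0" 0 "%_ _ _. True" I by unfold_locales (use n1 k1 in auto)
 \<comment> \<open>Calls are restricted to nonempty clusters, for which \<open>validates\<close>
   bounds the time; \<open>exec_mono\<close> later returns to \<open>proc_answers\<close>.\<close>
 define K where "K C t v <-> C ~= {} & C<=points I & proc_answers V I C t v & t<=f ?n & (v ~= 0 <-> ok I C)" for C t v
 have "machine.answers ?n K (ok I)" unfolding machine.answers_def[OF machine_axioms] K_def using V[unfolded validates_def, rule_format, OF II] unfolding pts by blast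
 \<comment> \<open>The least integer that rules out overflow; it is at most \<open>3*d\<close>
   because \<open>d >= 1\<close>.\<close>
 define G where "G = nat \<lceil>2*?d\<rceil>"
 have G: "2*?d<=real G" "real G<=3*?d" unfolding G_def using d(1) by linarith+
 have F: "t<=f ?n" if "K C t v" for C t v using that by (simp add: K_def)
 have nf: "?n<=f ?n" by (rule validates_ge[OF V II n1])
 have "EX q. 10<=q & 1000<=2 ^ q*eps & (q = 10 | 2 ^ q*eps<2000) &
   runs K I MAIN (main_init I eps) (main_sz*(2 ^ (100*?k*G*q)) ^ main_dep*(?n+f ?n))
   (%s'. EX g z r. 1<=g & spread ?n ?k ?dd z r & finished ?n ?k q ?dd z r (ok I) g s')" by (rule MAIN_runs[OF met refl refl refl n k1 \<open>machine.answers ?n K (ok I)\<close> _ d(2,1) G(1) eps(1)]) (rule F)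
 then obtain q where q: "10<=q" "1000<=2 ^ q*eps" "q = 10 | 2 ^ q*eps<2000"
  and R: "runs K I MAIN (main_init I eps) (main_sz*(2 ^ (100*?k*G*q)) ^ main_dep*(?n+f ?n))
   (%s'. EX g z r. 1<=g & spread ?n ?k ?dd z r & finished ?n ?k q ?dd z r (ok I) g s')" by (elim exE conjE) (rule that)
 obtain t s where e: "exec K I MAIN (main_init I eps) t s" and t: "t<=main_sz*(2 ^ (100*?k*G*q)) ^ main_dep*(?n+f ?n)"
  and post: "EX g z r. 1<=g & spread ?n ?k ?dd z r & finished ?n ?k q ?dd z r (ok I) g s" using R unfolding runs_def by blast
 have e': "exec (proc_answers V I) I MAIN (main_init I eps) t s" by (rule exec_mono[OF e]) (simp add: K_def)
 have approx: "approx_solution F I eps (output_clustering I s)" if Q: "EX Q. feasible F I Q"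
 proof -
  interpret feasible_instance \<I> F I by unfold_locales (use mg II wfI Q in auto)
  obtain g z r where "1<=g" "spread ?n ?k ?dd z r" "finished ?n ?k q ?dd z r (ok I) g s" using post by blast
  thus ?thesis using finished_approx[OF cw _ q(1,2)] by blast
 qed
 let ?Y = "2048/eps" and ?x = "real ?k*?d"
 have Y: "2<=?Y" "1<=?Y" using eps by (simp_all add: field_simps)
 have x: "1<=?x" using k1 d(1) mult_mono[of 1 "real ?k" 1 ?d] by simp
 have qY: "2 ^ q<=?Y" using q(3) eps by (auto simp: field_simps)
 have 1: "real ((2 ^ (100*?k*G*q)) ^ main_dep)<=?Y powr (real (300*main_dep)*?x)"
 proof -
  have "real ((2 ^ (100*?k*G*q)) ^ main_dep) = (2 ^ q) ^ (100*?k*G*main_dep)" by (simp add: power_mult[symmetric] mult.commute mult.left_commute)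
  also have "...<=?Y ^ (100*?k*G*main_dep)" using qY by (intro power_mono) auto
  also have "... = ?Y powr real (100*?k*G*main_dep)" by (rule powr_realpow[symmetric]) (use Y in linarith)
  also have "...<=?Y powr (real (300*main_dep)*?x)"
  proof (rule powr_mono[OF _ Y(2)])
   have "real (100*?k*G*main_dep) = real (100*main_dep)*real ?k*real G" by simp
   also have "...<=real (100*main_dep)*real ?k*(3*?d)" using G(2) by (intro mult_left_mono) auto
   finally show "real (100*?k*G*main_dep)<=real (300*main_dep)*?x" by (simp add: algebra_simps)
  qed
  finally show ?thesis .
 qed
 have 2: "real (2*main_sz)<=?Y powr (real (2*main_sz)*?x)"
 proof -
  have "real (2*main_sz)<=2 ^ (2*main_sz)" by (rule less_imp_le[OF of_nat_less_two_power])
  also have "...<=?Y ^ (2*main_sz)" using Y by (intro power_mono) auto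
  also have "... = ?Y powr real (2*main_sz)" by (rule powr_realpow[symmetric]) (use Y in linarith)
  also have "...<=?Y powr (real (2*main_sz)*?x)" by (rule powr_mono[OF _ Y(2)]) (use x mult_left_mono[of 1 ?x "real (2*main_sz)"] in simp)
  finally show ?thesis .
 qed
 have "real t<=real main_sz*real ((2 ^ (100*?k*G*q)) ^ main_dep)*real (?n+f ?n)" using t unfolding of_nat_mult[symmetric] of_nat_le_iff .
 also have "...<=real main_sz*?Y powr (real (300*main_dep)*?x)*(2*real (f ?n))" using 1 nf by (intro mult_mono) auto
 also have "... = real (2*main_sz)*?Y powr (real (300*main_dep)*?x)*real (f ?n)" by simp
 also have "...<=?Y powr (real (2*main_sz)*?x)*?Y powr (real (300*main_dep)*?x)*real (f ?n)" using 2 by (intro mult_right_mono) auto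
 also have "... = ?Y powr (main_exp*?x)*real (f ?n)" by (simp add: main_exp_def powr_add[symmetric] algebra_simps)
 finally show ?thesis unfolding approximates_within_def using e' approx by blast
qed

text \<open>With one point the program stops at once. All labels are 0, and the resulting clustering
  is the only one there is.\<close>

lemma MAIN_single:
 assumes wfI: "wf_inst I" and n: "npts I = 1"
 shows "approximates_within MAIN V F I eps 6"
proof -
 let ?s = "main_init I eps"
 have b: "bval I ?s (ILess (IGet 0 I0) (IConst 2))" using n by (simp add: main_init_def)
 have e: "exec (proc_answers V I) I MAIN ?s (1+bcost (ILess (IGet 0 I0) (IConst 2))+1) ?s" unfolding MAIN_def by (rule exec.CondT[OF b exec.Skip])
 have "1+bcost (ILess (IGet 0 I0) (IConst 2))+1 = 6" by simp
 hence e: "exec (proc_answers V I) I MAIN ?s 6 ?s" using e by (simp only:)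
 have pts: "points I = {0}" using n by (auto simp: points_def)
 have O: "output_clustering I ?s = {{0}}" unfolding output_clustering_def pts by (auto simp: main_init_def)
 have single: "Q = {{0}}" if "feasible F I Q" for Q
 proof -
  have Q: "\<Union>Q = {0}" "{} ~: Q" using that unfolding feasible_def clustering_def partition_on_def pts by auto
  have "C = {0}" if "C : Q" for C
  proof -
   have "C<={0}" "C ~= {}" using Q that by auto
   thus ?thesis by blast
  qed
  moreover have "Q ~= {}" using Q by auto
  ultimately show ?thesis by blast
 qed
 have c0: "cost I {{0}} = 0"
 proof -
  have "Metric_space {0} (dst I)" using wfI pts by (simp add: wf_inst_def)
  hence "dst I 0 0 = 0" by (simp add: Metric_space.zero)
  thus ?thesis by (simp add: cost_def diam_def)
 qed
 have "approx_solution F I eps (output_clustering I ?s)" if ex: "EX Q. feasible F I Q"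
 proof -
  obtain Q where "feasible F I Q" using ex by blast
  hence "feasible F I {{0}}" using single by metis
  thus ?thesis unfolding approx_solution_def O using single c0 by fastforce
 qed
 thus ?thesis unfolding approximates_within_def using e by (intro exI[of _ 6] exI[of _ ?s]) simp
qed

lemma approximates_within_mono:
 assumes "approximates_within A V F I eps T" "T<=T'"
 shows "approximates_within A V F I eps T'" using assms unfolding approximates_within_def by (meson order_trans)

text \<open>For \<open>eps <= eps0\<close> one has
  \<open>2048/eps <= (1/eps)^(1 + ln 2048/ln (1/eps0))\<close>. The constant thus moves into the
  exponent, which is why the factor depends on \<open>eps0\<close>; \<open>eps0 < 1\<close> keeps
  the logarithm positive.\<close>

lemma time_bound_ge:
 assumes eps: "0<eps" "eps<=eps0" "eps0<1" and I: "1<=npts I" and v: "0 <= v" and a: "0<=a" "c = (1+ln 2048/ln (1/eps0))*a"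
  and d: "0<=doubling_dim (points I) (dst I)"
 shows "(2048/eps) powr (a*(real (nclus I)*doubling_dim (points I) (dst I))) * v<=time_bound c eps I v"
proof -
 let ?x = "real (nclus I)*doubling_dim (points I) (dst I)"
 let ?\<gamma> = "1+ln 2048/ln (1/eps0)"
 have l0: "0<ln (1/eps0)" using eps by (intro ln_gt_zero) (simp add: field_simps)
 have l1: "ln (1/eps0)<=ln (1/eps)" using eps by (subst ln_le_cancel_iff) (auto simp: field_simps)
 have "0<=ln (2048 :: real)" by simp
 hence c0: "0<=c" unfolding a(2) using l0 a(1) by (intro mult_nonneg_nonneg add_nonneg_nonneg divide_nonneg_pos) auto
 have "ln (2048/eps) = ln 2048+ln (1/eps)" using eps by (simp add: ln_div)
 also have "...<=?\<gamma>*ln (1/eps)"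
 proof -
  have "ln 2048 = ln 2048/ln (1/eps0)*ln (1/eps0)" using l0 by simp
  also have "...<=ln 2048/ln (1/eps0)*ln (1/eps)" using l0 l1 by (intro mult_left_mono divide_nonneg_pos) auto
  finally have "ln 2048<=ln 2048/ln (1/eps0)*ln (1/eps)" .
  thus ?thesis by (simp only: distrib_right mult_1_left)
 qed
 finally have l: "ln (2048/eps)<=?\<gamma>*ln (1/eps)" .
 have x0: "0<=a*?x" using a d by (intro mult_nonneg_nonneg) auto
 have "(2048/eps) powr (a*?x) = exp (a*?x*ln (2048/eps))" using eps by (simp add: powr_def)
 also have "...<=exp (a*?x*(?\<gamma>*ln (1/eps)))" using mult_left_mono[OF l x0] by (subst exp_le_cancel_iff)
 also have "a*?x*(?\<gamma>*ln (1/eps)) = c*real (nclus I)*doubling_dim (points I) (dst I)*ln (1/eps)" unfolding a(2) by (simp only: mult_ac)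
 also have "exp ... = (1/eps) powr (c*real (nclus I)*doubling_dim (points I) (dst I))" using eps by (simp add: powr_def)
 finally have "(2048/eps) powr (a*?x) * v<=(1/eps) powr (c*real (nclus I)*doubling_dim (points I) (dst I)) * v" using v by (rule mult_right_mono)
 moreover have "0<=2 powr (c*doubling_dim (points I) (dst I))*real (npts I)*log 2 (real (npts I))" using I by (intro mult_nonneg_nonneg zero_le_log_cancel_iff[THEN iffD2]) auto
 moreover have "0<=c*real (nclus I) * v" using c0 v by simp
 ultimately show ?thesis by (simp add: time_bound_def Let_def)
qed

lemma time_bound_single:
 assumes "0<eps" "1<=npts I" "1<=nclus I" "1 <= v" "6<=c"
 shows "6<=time_bound c eps I v"
proof -
 have "6*1*1<=c*real (nclus I) * v" using assms by (intro mult_mono) auto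
 moreover have "0<=2 powr (c*doubling_dim (points I) (dst I))*real (npts I)*log 2 (real (npts I))" using assms by (intro mult_nonneg_nonneg zero_le_log_cancel_iff[THEN iffD2]) auto
 ultimately show ?thesis using assms by (simp add: time_bound_def Let_def add_nonneg_nonneg le_add_same_cancel2 add_increasing)
qed

section \<open>Balanced clusters: validation, mergeability, and the final time bounds\<close>

section \<open>Balanced clusters\<close>

definition COUNT :: prog where
 "COUNT = For 2 0 0 (If (ILess I0 (IGet 1 (iv 2)))
   (If (ILess (IData (iv 2)) (IConst 2)) (seti 3 (IPlus (iv 3) I1)) (seti 4 (IPlus (iv 4) I1))) PSkip)"

definition COMPARE :: prog where
 "COMPARE = seti 0 I1;;
   If (RLess (RDivide (ROfInt (iv 4)) (ROfInt (iv 3))) (RData I0)) (seti 0 I0) PSkip;;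
   If (RLess (RDivide (ROfInt (iv 3)) (ROfInt (iv 4))) (RData I0)) (seti 0 I0) PSkip"

definition CHECK :: com where "CHECK = Seq (compile COUNT) (compile COMPARE)"

definition check_sz :: nat where "check_sz = 1 + sz COUNT + sz COMPARE"

lemma card_less_Suc_of_bool: "card {i. i<Suc m & P i} = card {i. i<m & P i} + of_bool (P m)"
proof (cases "P m")
 case True
 hence "{i. i<Suc m & P i} = insert m {i. i<m & P i}" by (auto simp: less_Suc_eq)
 thus ?thesis using True by simp
next
 case False
 hence "{i. i<Suc m & P i} = {i. i<m & P i}" by (auto simp: less_Suc_eq)
 thus ?thesis using False by simp
qed

lemma COUNT_wp:
 assumes col: "ALL i<n. idata I i : {1,2}" and s: "ints s 0 0 = int n" "!!i. ints s 1 (int i) = (if i : C then 1 else 0)"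
  "ints s 3 0 = 0" "ints s 4 0 = 0"
 shows "wp K I COUNT s (%s'. ints s' 3 0 = int (card {i. i<n & i : C & idata I i = 1}) &
   ints s' 4 0 = int (card {i. i<n & i : C & idata I i = 2}))" unfolding COUNT_def
proof (rule wp_For[where N = n and Inv = "%m s'. ints s' 3 0 = int (card {i. i<m & i : C & idata I i = 1}) &
   ints s' 4 0 = int (card {i. i<m & i : C & idata I i = 2})"])
 let ?p = "If (ILess I0 (IGet 1 (iv 2)))
   (If (ILess (IData (iv 2)) (IConst 2)) (seti 3 (IPlus (iv 3) I1)) (seti 4 (IPlus (iv 4) I1))) PSkip"
 fix m :: nat and s' :: state assume m: "m<n" and inv: "ints s' 3 0 = int (card {i. i<m & i : C & idata I i = 1}) &
   ints s' 4 0 = int (card {i. i<m & i : C & idata I i = 2})" and v: "ints s' 2 0 = int m" and fr: "frame (For 2 0 0 ?p) s s'"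
 have 1: "ints s' 1 (int m) = (if m : C then 1 else 0)" using frameD(1)[OF fr, of 1] s(2) by simp
 have "idata I m = 1 | idata I m = 2" using col m by blast
 thus "wp K I ?p s' (%s'. ints s' 3 0 = int (card {i. i<Suc m & i : C & idata I i = 1}) &
   ints s' 4 0 = int (card {i. i<Suc m & i : C & idata I i = 2}))" unfolding card_less_Suc_of_bool using inv v 1 by (cases "m : C") auto
qed (use s in auto)

text \<open>Colours are 1 or 2, so one comparison with 2 classifies a point. Machine and definition
  share the convention \<open>x / 0 = 0\<close>, so missing colours need no special
  treatment.\<close>

lemma CHECK_validates: "validates CHECK fair_insts balanced (%n. check_sz*n)" unfolding validates_def
proof (intro ballI allI impI, elim conjE)
 fix I C assume I: "I : fair_insts" and C: "C ~= {}" "C<=points I"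
 let ?K = "%_ _ _. False" and ?s = "proc_init I C" and ?n = "npts I"
 have n1: "1<=?n" and col: "ALL i<?n. idata I i : {1,2}" using I by (auto simp: fair_insts_def wf_inst_def points_def)
 let ?c = "%j. {i. i<?n & i : C & idata I i = j}"
 have c: "?c j = C \<inter> colour_class I j" for j using C(2) by (auto simp: colour_class_def points_def)
 have r1: "runs ?K I (compile COUNT) ?s (sz COUNT*1 ^ dep COUNT*(?n+0))
  (%s'. (ints s' 3 0 = int (card (?c 1)) & ints s' 4 0 = int (card (?c 2))) & frame COUNT ?s s')"
 proof (rule wp_runs[OF COUNT_wp[OF col] _ _ order_refl n1])
  fix a i assume "(a, i) : bounds COUNT"
  thus "a ~: piw COUNT & ints ?s a i<=int (if (a, i) = (0, 0) then ?n else 1)" by (auto simp: COUNT_def proc_init_def)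
 qed (auto simp: proc_init_def COUNT_def)
 have r2: "runs ?K I (compile COMPARE) s1 (sz COMPARE*1 ^ dep COMPARE*(?n+0)) (%s'. ints s' 0 0 ~= 0 <-> balanced I C)"
  if "(ints s1 3 0 = int (card (?c 1)) & ints s1 4 0 = int (card (?c 2))) & frame COUNT ?s s1" for s1
 proof -
  have w: "wp ?K I COMPARE s1 (%s'. ints s' 0 0 ~= 0 <-> balanced I C)" using that unfolding COMPARE_def balanced_def Let_def c by auto
  have "runs ?K I (compile COMPARE) s1 (sz COMPARE*1 ^ dep COMPARE*(?n+0)) (%s'. (ints s' 0 0 ~= 0 <-> balanced I C) & frame COMPARE s1 s')" by (rule wp_runs[OF w _ _ order_refl n1]) (auto simp: COMPARE_def)
  thus ?thesis by (rule runs_mono) auto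
 qed
 have "runs ?K I CHECK ?s (sz COUNT*1 ^ dep COUNT*(?n+0) + sz COMPARE*1 ^ dep COMPARE*(?n+0)) (%s'. ints s' 0 0 ~= 0 <-> balanced I C)" unfolding CHECK_def by (rule runs_Seq[OF r1 r2])
 then obtain t s' where "exec ?K I CHECK ?s t s'" "t <= sz COUNT*?n + sz COMPARE*?n" "ints s' 0 0 ~= 0 <-> balanced I C" unfolding runs_def by auto
 thus "EX t v. proc_answers CHECK I C t v & t<=check_sz*?n & (v ~= 0 <-> balanced I C)" unfolding proc_answers_def check_sz_def by (intro exI[of _ "?n+t"] exI[of _ "ints s' 0 0"]) (auto simp: algebra_simps)
qed

lemma fair_clusterwise: "clusterwise fair_insts fair balanced" by (simp add: clusterwise_def fair_def)

lemma merge_clustering: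
 assumes P: "clustering I P" and CD: "C : P" "D : P" "C ~= D"
 shows "clustering I (insert (C \<union> D) (P - {C, D}))"
proof -
 have p: "\<Union>P = points I" "{} ~: P" "!!A B. A : P ==> B : P ==> A ~= B ==> A \<inter> B = {}" and card: "card P<=nclus I" using P unfolding clustering_def partition_on_def disjoint_def by auto
 have fin: "finite P" using finite_UnionD[of P] p(1) by (simp add: points_def)
 have "\<Union>(insert (C \<union> D) (P - {C, D})) = points I" using p(1) CD by auto
 moreover have "{} ~: insert (C \<union> D) (P - {C, D})" using p(2) CD by auto
 moreover have "disjoint (insert (C \<union> D) (P - {C, D}))" unfolding disjoint_def
 proof (intro ballI impI)
  have "(C \<union> D) \<inter> B = {}" if "B : P - {C, D}" for B using p(3)[of C B] p(3)[of D B] CD that by blast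
  thus "A \<inter> B = {}" if "A : insert (C \<union> D) (P - {C, D})" "B : insert (C \<union> D) (P - {C, D})" "A ~= B" for A B using that p(3)[of A B] by blast
 qed
 moreover have "card (insert (C \<union> D) (P - {C, D}))<=nclus I"
 proof -
  have "card (insert (C \<union> D) (P - {C, D}))<=Suc (card (P - {C, D}))" using fin by (simp add: card_insert_if)
  also have "card (P - {C, D}) = card P - 2" using CD fin by (subst card_Diff_subset) auto
  also have "Suc (card P - 2)<=card P"
  proof -
   have "card {C, D}<=card P" using CD fin by (intro card_mono) auto
   thus ?thesis using CD(3) by simp
  qed
  finally show ?thesis using card by simp
 qed
 ultimately show ?thesis by (simp add: clustering_def partition_on_def)
qed

text \<open>A mediant of two ratios is at least the smaller of them. A positive
  \<open>\<beta>\<close> excludes zero denominators, because the ratio would then be 0.\<close>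

lemma ratio_add:
 fixes a b c d \<beta> :: real
 assumes "\<beta><=a/b" "\<beta><=c/d" "0<\<beta>" "0<=b" "0<=d"
 shows "\<beta><=(a+c)/(b+d)"
proof -
 have "b ~= 0" "d ~= 0" using assms by auto
 hence "0<b" "0<d" using assms by simp_all
 thus ?thesis using assms by (simp add: le_divide_eq algebra_simps)
qed

text \<open>For \<open>b = 0\<close> every cluster is balanced; otherwise both colour ratios of a
  disjoint union are mediants.\<close>

lemma balanced_union:
 assumes b: "0<=rdata I 0" and C: "balanced I C" "finite C" and D: "balanced I D" "finite D" and dis: "C \<inter> D = {}"
 shows "balanced I (C \<union> D)"
proof (cases "rdata I 0 = 0")
 case True
 thus ?thesis by (simp add: balanced_def Let_def)
next
 case False
 have e: "card ((C \<union> D) \<inter> X) = card (C \<inter> X)+card (D \<inter> X)" for X using C D dis by (subst card_Un_disjoint[symmetric]) (auto intro: arg_cong[of _ _ card])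
 show ?thesis using False b C(1) D(1) unfolding balanced_def Let_def e by (auto intro: ratio_add)
qed

lemma fair_mergeable: "mergeable fair_insts fair" unfolding mergeable_def
proof (intro ballI allI impI)
 fix I P C D assume I: "I : fair_insts" and P: "feasible fair I P" and CD: "C : P" "D : P" "C ~= D"
 have cl: "clustering I P" and bal: "ALL C:P. balanced I C" using P by (auto simp: feasible_def fair_def)
 have U: "\<Union>P = points I" and dis: "C \<inter> D = {}" using cl CD unfolding clustering_def partition_on_def disjoint_def by auto
 have "C<={..<npts I}" "D<={..<npts I}" using U CD by (auto simp: points_def)
 hence fin: "finite C" "finite D" by (auto intro: finite_subset)
 have "balanced I (C \<union> D)" by (rule balanced_union) (use I bal CD fin dis in "auto simp: fair_insts_def")
 thus "feasible fair I (insert (C \<union> D) (P - {C, D}))" using merge_clustering[OF cl CD] bal by (auto simp: feasible_def fair_def)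
qed

definition factor :: "real => real => real" where "factor eps0 a = (1+ln 2048/ln (1/eps0))*a"

lemma main_exp_ge: "100<=main_exp" by (simp add: main_exp_def main_sz_def)

lemma factor_ge:
 assumes "0<eps0" "eps0<1" "100<=a"
 shows "6<=factor eps0 a"
proof -
 have "0<ln (1/eps0)" using assms by (intro ln_gt_zero) (simp add: field_simps)
 hence "0<=ln 2048/ln (1/eps0)" by (intro divide_nonneg_pos) auto
 hence "1*6<=(1+ln 2048/ln (1/eps0))*a" using assms by (intro mult_mono) auto
 thus ?thesis by (simp add: factor_def)
qed

lemma doubling_dim_ge: "wf_inst I ==> 2<=npts I ==> 1<=doubling_dim (points I) (dst I)" using doubling_dim_works[of "points I" "dst I"] by (simp add: wf_inst_def points_def)

lemma MAIN_time:
 assumes eps0: "0<eps0" "eps0<1" and mg: "mergeable \<I> F" and cw: "clusterwise \<I> F ok" and V: "validates V \<I> ok f"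
  and I: "I : \<I>" "wf_inst I" and eps: "0<eps" "eps<=eps0"
 shows "approximates_within MAIN V F I eps (time_bound (factor eps0 main_exp) eps I (real (f (npts I))))"
proof -
 have nk: "1<=npts I" "1<=nclus I" using I by (simp_all add: wf_inst_def)
 show ?thesis
 proof (cases "npts I = 1")
  case True
  have "1<=f (npts I)" using validates_ge[OF V I(1) nk(1)] nk by simp
  thus ?thesis using time_bound_single[OF eps(1) nk _ factor_ge[OF eps0 main_exp_ge], of "real (f (npts I))"] by (intro approximates_within_mono[OF MAIN_single[OF I(2) True]]) simp
 next
  case False
  hence n2: "2<=npts I" using nk by simp
  show ?thesis by (rule approximates_within_mono[OF MAIN_within[OF mg cw V I n2 eps(1)] time_bound_ge[OF eps eps0(2) nk(1) _ _ factor_def]])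
    (use eps0 eps main_exp_ge doubling_dim_ge[OF I(2) n2] in auto)
 qed
qed

text \<open>The validator takes \<open>check_sz*n\<close> steps, and its constant
  \<open>check_sz\<close> is absorbed into the exponent just as \<open>main_sz\<close> was.\<close>

lemma MAIN_fair_time:
 assumes eps0: "0<eps0" "eps0<1" and I: "I : fair_insts" and eps: "0<eps" "eps<=eps0"
 shows "approximates_within MAIN CHECK fair I eps (time_bound (factor eps0 (main_exp+real check_sz)) eps I (real (npts I)))"
proof -
 let ?a = "main_exp+real check_sz"
 let ?T = "time_bound (factor eps0 ?a) eps I (real (npts I))"
 have wf: "wf_inst I" using I by (simp add: fair_insts_def)
 hence nk: "1<=npts I" "1<=nclus I" by (simp_all add: wf_inst_def)
 have a: "100<=?a" using main_exp_ge by simp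
 show ?thesis
 proof (cases "npts I = 1")
  case True
  thus ?thesis using time_bound_single[OF eps(1) nk _ factor_ge[OF eps0 a], of "real (npts I)"] by (intro approximates_within_mono[OF MAIN_single[OF wf True]]) simp
 next
  case False
  hence n2: "2<=npts I" using nk by simp
  let ?x = "real (nclus I)*doubling_dim (points I) (dst I)" and ?Y = "2048/eps"
  have eps1: "eps<1" using eps eps0 by linarith
  have Y: "2<=?Y" "1<=?Y" using eps eps1 by (simp_all add: field_simps)
  have x: "1<=?x" using nk(2) doubling_dim_ge[OF wf n2] mult_mono[of 1 "real (nclus I)" 1 "doubling_dim (points I) (dst I)"] by simp
  have "real check_sz<=2 ^ check_sz" by (rule less_imp_le[OF of_nat_less_two_power])
  also have "...<=?Y ^ check_sz" using Y by (intro power_mono) auto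
  also have "... = ?Y powr real check_sz" by (rule powr_realpow[symmetric]) (use Y in linarith)
  also have "...<=?Y powr (real check_sz*?x)" by (rule powr_mono[OF _ Y(2)]) (use x mult_left_mono[of 1 ?x "real check_sz"] in simp)
  finally have "?Y powr (main_exp*?x)*(real check_sz*real (npts I))<=?Y powr (main_exp*?x)*(?Y powr (real check_sz*?x)*real (npts I))" by (intro mult_left_mono mult_right_mono) auto
  also have "... = ?Y powr (?a*?x)*real (npts I)" by (simp add: powr_add distrib_right)
  also have "...<=?T" by (rule time_bound_ge[OF eps eps0(2) nk(1) _ _ factor_def]) (use a doubling_dim_ge[OF wf n2] in auto)
  finally have T: "?Y powr (main_exp*?x)*real (check_sz*npts I)<=?T" by simp
  show ?thesis by (rule approximates_within_mono[OF MAIN_within[OF fair_mergeable fair_clusterwise CHECK_validates I wf n2 eps(1) eps1] T])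
 qed
qed

theorem mainTheorem14:
  shows "(\<exists>A :: com. \<forall>\<epsilon>0 :: real. 0 < \<epsilon>0 \<and> \<epsilon>0 < 1 \<longrightarrow> (\<exists>c :: real. c > 0 \<and>
           (\<forall>(\<I> :: inst set) (F :: inst \<Rightarrow> nat set set \<Rightarrow> bool)
              (ok :: inst \<Rightarrow> nat set \<Rightarrow> bool) (V :: com) (f :: nat \<Rightarrow> nat).
              (\<forall>I\<in>\<I>. wf_inst I) \<and> mergeable \<I> F \<and> clusterwise \<I> F ok \<and> validates V \<I> ok f \<longrightarrow>
              (\<forall>I\<in>\<I>. \<forall>\<epsilon> :: real. 0 < \<epsilon> \<and> \<epsilon> \<le> \<epsilon>0 \<longrightarrow>
                 approximates_within A V F I \<epsilon> (time_bound c \<epsilon> I (real (f (npts I)))))))) \<and>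
         (\<exists>A V :: com. \<forall>\<epsilon>0 :: real. 0 < \<epsilon>0 \<and> \<epsilon>0 < 1 \<longrightarrow> (\<exists>c :: real. c > 0 \<and>
           (\<forall>I\<in>fair_insts. \<forall>\<epsilon> :: real. 0 < \<epsilon> \<and> \<epsilon> \<le> \<epsilon>0 \<longrightarrow>
              approximates_within A V fair I \<epsilon> (time_bound c \<epsilon> I (real (npts I))))))"
proof (rule conjI, goal_cases)
 case 1
 show ?case
 proof (rule exI[of _ MAIN], intro allI impI, goal_cases)
  case (1 eps0)
  hence e: "0<eps0" "eps0<1" by auto
  show ?case
  proof (intro exI[of _ "factor eps0 main_exp"] conjI allI impI ballI, goal_cases)
   case 1
   show ?case using factor_ge[OF e main_exp_ge] by simp
  next
   case (2 \<I> F ok V f I eps)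
   thus ?case by (intro MAIN_time[OF e, of \<I> F ok]) auto
  qed
 qed
next
 case 2
 show ?case
 proof (rule exI[of _ MAIN], rule exI[of _ CHECK], intro allI impI, goal_cases)
  case (1 eps0)
  hence e: "0<eps0" "eps0<1" by auto
  show ?case
  proof (intro exI[of _ "factor eps0 (main_exp+real check_sz)"] conjI allI impI ballI, goal_cases)
   case 1
   show ?case using factor_ge[OF e, of "main_exp+real check_sz"] main_exp_ge by simp
  next
   case (2 I eps)
   thus ?case by (intro MAIN_fair_time[OF e]) auto
  qed
 qed
qed

end
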